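(* Let $A$ be a recursively enumerable set of integers. Then there is a finitely presentable group $G$ which is $A$-torsion-free and contains an embedded copy of every countably generated recursively presentable $A$-torsion-free group.
   Context: A countably generated recursive presentation $\langle X \mid R\rangle$ is a group presentation where $X$ is a recursively enumerated set of generators and $R$ is a recursive enumeration of relators. A group is countably generated recursively presentable if it is isomorphic to the group presented by such a presentation. For a group $G$ and set of integers $A$, $G$ is $A$-torsion-free if there is no $g \neq e$ in $G$ with $g^{n} = e$ for some $n \in A$. *)

theory Defs
  imports "HOL-Algebra.Group" "HOL-Library.Nat_Bijection"
begin

datatype recf = Zero | Succ | Proj nat | Comp recf "recf list"
  | PrimRec recf recf | Minimise recf

inductive eval_recf :: "recf \<Rightarrow> nat list \<Rightarrow> nat \<Rightarrow> bool" where
  zero: "eval_recf Zero xs 0"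
| succ: "eval_recf Succ (x # xs) (Suc x)"
| proj: "i < length xs \<Longrightarrow> eval_recf (Proj i) xs (xs ! i)"
| comp: "list_all2 (\<lambda>g y. eval_recf g xs y) gs ys \<Longrightarrow> eval_recf f ys z
         \<Longrightarrow> eval_recf (Comp f gs) xs z"
| pr0: "eval_recf f xs y \<Longrightarrow> eval_recf (PrimRec f g) (0 # xs) y"
| prS: "eval_recf (PrimRec f g) (n # xs) y \<Longrightarrow> eval_recf g (n # y # xs) z
         \<Longrightarrow> eval_recf (PrimRec f g) (Suc n # xs) z"
| mn: "eval_recf f (n # xs) 0 \<Longrightarrow> (\<forall>m<n. \<exists>v. eval_recf f (m # xs) v \<and> 0 < v)
         \<Longrightarrow> eval_recf (Minimise f) xs n"
monos list.rel_mono

definition re_nat :: "nat set \<Rightarrow> bool" where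
  "re_nat S \<longleftrightarrow> (\<exists>f. S = {n. \<exists>v. eval_recf f [n] v})"

definition re_int :: "int set \<Rightarrow> bool" where
  "re_int A \<longleftrightarrow> re_nat (int_encode ` A)"

text \<open>Generators are natural numbers; a letter is a generator with a flag (True = inverse).\<close>
type_synonym word = "(nat \<times> bool) list"

definition words_on :: "nat set \<Rightarrow> word set" where
  "words_on X = {w. \<forall>l\<in>set w. fst l \<in> X}"

definition word_code :: "word \<Rightarrow> nat" where
  "word_code w = list_encode (map (\<lambda>(x, b). prod_encode (x, if b then 1 else 0)) w)"

definition re_words :: "word set \<Rightarrow> bool" where
  "re_words R \<longleftrightarrow> re_nat (word_code ` R)"

inductive pres_eq :: "nat set \<Rightarrow> word set \<Rightarrow> word \<Rightarrow> word \<Rightarrow> bool" for X R where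
  refl: "w \<in> words_on X \<Longrightarrow> pres_eq X R w w"
| sym: "pres_eq X R u v \<Longrightarrow> pres_eq X R v u"
| trans: "pres_eq X R u v \<Longrightarrow> pres_eq X R v w \<Longrightarrow> pres_eq X R u w"
| cancel: "u \<in> words_on X \<Longrightarrow> v \<in> words_on X \<Longrightarrow> x \<in> X
           \<Longrightarrow> pres_eq X R (u @ [(x, b), (x, \<not> b)] @ v) (u @ v)"
| rel: "u \<in> words_on X \<Longrightarrow> v \<in> words_on X \<Longrightarrow> r \<in> R
           \<Longrightarrow> pres_eq X R (u @ r @ v) (u @ v)"

definition pres_class :: "nat set \<Rightarrow> word set \<Rightarrow> word \<Rightarrow> word set" where
  "pres_class X R w = {v. pres_eq X R w v}"

definition pres_group :: "nat set \<Rightarrow> word set \<Rightarrow> word set monoid" where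
  "pres_group X R = \<lparr> carrier = pres_class X R ` words_on X,
     mult = (\<lambda>A B. pres_class X R ((SOME a. a \<in> A) @ (SOME b. b \<in> B))),
     one = pres_class X R [] \<rparr>"

definition rec_presentation :: "nat set \<Rightarrow> word set \<Rightarrow> bool" where
  "rec_presentation X R \<longleftrightarrow> re_nat X \<and> R \<subseteq> words_on X \<and> re_words R"

definition fin_presentation :: "nat set \<Rightarrow> word set \<Rightarrow> bool" where
  "fin_presentation X R \<longleftrightarrow> finite X \<and> finite R \<and> R \<subseteq> words_on X"

definition torsion_free_wrt :: "int set \<Rightarrow> ('a, 'b) monoid_scheme \<Rightarrow> bool" where
  "torsion_free_wrt A G \<longleftrightarrow>
     (\<forall>g\<in>carrier G. \<forall>n\<in>A. g [^]\<^bsub>G\<^esub> n = \<one>\<^bsub>G\<^esub> \<longrightarrow> g = \<one>\<^bsub>G\<^esub>)"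

end

theory Submission
  imports Defs "HOL-Algebra.Elementary_Groups"
begin

text \<open>Call a subgroup \<open>H\<close> of \<open>G\<close> benign if \<open>G\<close> embeds into a finitely presented torsion-free group
  in which \<open>H\<close> is cut out by a finitely generated subgroup, and call a set \<open>P\<close> of elements of \<open>G\<close> benign if
  the conjugates \<open>g\<inverse> t g\<close> with \<open>g \<in> P\<close> generate a benign subgroup of the free product of \<open>G\<close> with
  \<open>\<langle>t\<rangle>\<close>.  HNN extensions show that benign sets are closed under Boolean combinations without negation,
  projections, substitution of group terms, generated subgroups and equivalence closures.  Encoding
  computations as chains of a deterministic step relation, one finds that all recursively enumerable
  relations on the integers are benign, and so are the kernels of recursive presentations.  The rope
  trick turns a countable group with benign kernel into a subgroup of a finitely presented group, and as
  only HNN extensions and products with torsion-free groups are used, no new torsion orders appear.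

  Every recursively presented \<open>A\<close>-torsion-free group therefore lies in a finitely presented one.  The
  latter are enumerated by the codes \<open>e\<close> of finite sets of relators of the form \<open>x\<^sub>i x\<^sub>j = x\<^sub>k\<close>; the
  group on generators \<open>x\<^sub>e\<^sub>,\<^sub>i\<close> with all these relators, divided by the least normal
  subgroup closed under \<open>n\<close>-th roots for \<open>n \<in> A\<close>, is recursively presented, \<open>A\<close>-torsion-free and contains
  all of them, and embedding it once more gives the universal group.  If \<open>0 \<in> A\<close>, only the trivial
  group is \<open>A\<close>-torsion-free.\<close>

section \<open>HNN extensions\<close>

text \<open>A relation has to be stored in a subgroup. The conjugates of \<open>t\<close> serve for
  this because they are a free basis: distinct sets span distinct subgroups, and spans intersect in
  the span of the intersection. Every step made inside a generated subgroup can be undone there, so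
  iteration only yields equivalence closures; with deterministic steps towards a terminal state, a
  zigzag already contains a forward path. Relators of the form \<open>x y = z\<close> turn a finite
  presentation into a finite set of triples, hence into one number. The obstacle for the universal
  group is that A-torsion-freeness is not visible in the code of a finite presentation. All finite
  presentations are therefore used at once and the closure under roots repairs the bad ones; a
  homomorphism into an A-torsion-free group kills this closure, so the good ones survive intact. The
  rope trick needs a quotient of a finitely presented group, while a recursive presentation may have
  infinitely many generators; a group on three generators is put in between.\<close>

lemma (in group) inv_mult_cancel [simp]:
  assumes "x \<in> carrier G" "y \<in> carrier G"
  shows "x \<otimes> (inv x \<otimes> y) = y" "inv x \<otimes> (x \<otimes> y) = y"
  using assms by (simp_all add: m_assoc[symmetric])

text \<open>The induction proves more: right multiplication by \<open>x\<close> preserves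
  \<open>P\<close> on the whole generated subgroup. In this form the product case is a composition
  of two steps.\<close>

lemma (in group) generate_right_induct:
  assumes S: "S \<subseteq> carrier G" and x: "x \<in> generate G S"
    and one: "P \<one>"
    and step: "\<And>x s. x \<in> generate G S \<Longrightarrow> P x \<Longrightarrow> s \<in> S \<Longrightarrow> P (x \<otimes> s) \<and> P (x \<otimes> inv s)"
  shows "P x"
proof -
  note inc = generate_in_carrier[OF S]
  have "\<forall>y\<in>generate G S. P y \<longrightarrow> P (y \<otimes> x)" using x
  proof (induct x rule: generate.induct)
    case one then show ?case using inc by simp
  next
    case (incl h) then show ?case using step by blast
  next
    case (inv h) then show ?case using step by blast
  next
    case (eng h1 h2)
    show ?case
    proof (intro ballI impI)
      fix y assume y: "y \<in> generate G S" "P y"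
      have "P (y \<otimes> h1 \<otimes> h2)" using eng y generate.eng[OF y(1) eng(1)] by blast
      then show "P (y \<otimes> (h1 \<otimes> h2))" using inc eng(1,3) y(1) by (simp add: m_assoc)
    qed
  qed
  then have "P (\<one> \<otimes> x)" using one generate.one by blast
  then show ?thesis using inc x by simp
qed

section \<open>Normal forms and the multiplication of an HNN extension\<close>

definition hnn_dom :: "'a set \<Rightarrow> ('a \<Rightarrow> 'a) \<Rightarrow> bool \<Rightarrow> 'a set" where
  "hnn_dom A \<phi> b = (if b then A else \<phi> ` A)"

definition hnn_map :: "'a set \<Rightarrow> ('a \<Rightarrow> 'a) \<Rightarrow> bool \<Rightarrow> 'a \<Rightarrow> 'a" where
  "hnn_map A \<phi> b = (if b then \<phi> else inv_into A \<phi>)"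

text \<open>The choice is made from the left coset of \<open>g\<close> as a set, so it depends on
  the coset only. The subgroup itself is represented by the identity.\<close>

definition hnn_rep :: "('a, 'c) monoid_scheme \<Rightarrow> 'a set \<Rightarrow> ('a \<Rightarrow> 'a) \<Rightarrow> bool \<Rightarrow> 'a \<Rightarrow> 'a" where
  "hnn_rep G A \<phi> b g = (if g \<in> hnn_dom A \<phi> b then \<one>\<^bsub>G\<^esub>
     else SOME r. \<exists>a\<in>hnn_dom A \<phi> b. r = g \<otimes>\<^bsub>G\<^esub> a)"

text \<open>The pair \<open>(xs, g)\<close> stands for the product of the letters \<open>r t\<^sup>\<plusminus>\<^sup>1\<close> coded in \<open>xs\<close>, the last
  letter first, followed by \<open>g\<close>; \<open>True\<close> codes the stable letter \<open>t\<close> and \<open>False\<close> its inverse, and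
  \<open>hnn_dom b\<close> is the subgroup that can be moved from the left to the right of the letter \<open>b\<close>.\<close>

fun hnn_nf :: "('a, 'c) monoid_scheme \<Rightarrow> 'a set \<Rightarrow> ('a \<Rightarrow> 'a) \<Rightarrow> ('a \<times> bool) list \<Rightarrow> bool" where
  "hnn_nf G A \<phi> [] = True"
| "hnn_nf G A \<phi> ((r, b) # xs) = (r \<in> carrier G \<and> hnn_rep G A \<phi> b r = r \<and> hnn_nf G A \<phi> xs \<and>
     (r = \<one>\<^bsub>G\<^esub> \<longrightarrow> (\<forall>r' ys. xs \<noteq> (r', \<not> b) # ys)))"

definition hnn_push :: "('a, 'c) monoid_scheme \<Rightarrow> 'a set \<Rightarrow> ('a \<Rightarrow> 'a) \<Rightarrow> bool \<Rightarrow> ('a \<times> bool) list \<times> 'a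
    \<Rightarrow> ('a \<times> bool) list \<times> 'a" where
  "hnn_push G A \<phi> b p = ((hnn_rep G A \<phi> b (snd p), b) # fst p,
     hnn_map A \<phi> b (inv\<^bsub>G\<^esub> (hnn_rep G A \<phi> b (snd p)) \<otimes>\<^bsub>G\<^esub> snd p))"

text \<open>Right multiplication by a stable letter on normal forms. In the first case the base
  element moves across the new letter, which then cancels against the last one.\<close>

definition hnn_letter :: "('a, 'c) monoid_scheme \<Rightarrow> 'a set \<Rightarrow> ('a \<Rightarrow> 'a) \<Rightarrow> bool \<Rightarrow> ('a \<times> bool) list \<times> 'a
    \<Rightarrow> ('a \<times> bool) list \<times> 'a" where
  "hnn_letter G A \<phi> b p = (if fst p \<noteq> [] \<and> snd (hd (fst p)) = (\<not> b) \<and> snd p \<in> hnn_dom A \<phi> b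
     then (tl (fst p), fst (hd (fst p)) \<otimes>\<^bsub>G\<^esub> hnn_map A \<phi> b (snd p))
     else hnn_push G A \<phi> b p)"

definition hnn_base :: "('a, 'c) monoid_scheme \<Rightarrow> 'a \<Rightarrow> ('a \<times> bool) list \<times> 'a
    \<Rightarrow> ('a \<times> bool) list \<times> 'a" where
  "hnn_base G g p = (fst p, snd p \<otimes>\<^bsub>G\<^esub> g)"

definition hnn_run :: "('a, 'c) monoid_scheme \<Rightarrow> 'a set \<Rightarrow> ('a \<Rightarrow> 'a) \<Rightarrow> ('a \<times> bool) list \<times> 'a
    \<Rightarrow> ('a \<times> bool) list \<Rightarrow> ('a \<times> bool) list \<times> 'a" where
  "hnn_run G A \<phi> u xs = foldr (\<lambda>(r, b) v. hnn_letter G A \<phi> b (hnn_base G r v)) xs u"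

text \<open>The product lets the normal form of \<open>v\<close> act on \<open>u\<close> from the
  right, letter by letter (van der Waerden's method). Associativity then follows from left
  multiplications commuting with these actions, without any confluence argument for words.\<close>

definition HNN :: "('a, 'c) monoid_scheme \<Rightarrow> 'a set \<Rightarrow> ('a \<Rightarrow> 'a) \<Rightarrow> (('a \<times> bool) list \<times> 'a) monoid" where
  "HNN G A \<phi> = \<lparr>carrier = {p. hnn_nf G A \<phi> (fst p) \<and> snd p \<in> carrier G},
     mult = (\<lambda>u v. hnn_base G (snd v) (hnn_run G A \<phi> u (fst v))), one = ([], \<one>\<^bsub>G\<^esub>)\<rparr>"

abbreviation hnn_incl :: "'a \<Rightarrow> ('a \<times> bool) list \<times> 'a" where
  "hnn_incl g \<equiv> ([], g)"

definition hnn_t :: "('a, 'c) monoid_scheme \<Rightarrow> bool \<Rightarrow> ('a \<times> bool) list \<times> 'a" where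
  "hnn_t G b = ([(\<one>\<^bsub>G\<^esub>, b)], \<one>\<^bsub>G\<^esub>)"

text \<open>The convention for the stable letter \<open>t\<close> is
  \<open>a t = t (\<phi> a)\<close> for \<open>a\<close> in \<open>A\<close>.\<close>

locale hnn = group G for G (structure) +
  fixes A and \<phi> :: "'a \<Rightarrow> 'a"
  assumes sub_A: "subgroup A G"
    and phi_closed: "\<And>x. x \<in> A \<Longrightarrow> \<phi> x \<in> carrier G"
    and phi_mult: "\<And>x y. x \<in> A \<Longrightarrow> y \<in> A \<Longrightarrow> \<phi> (x \<otimes> y) = \<phi> x \<otimes> \<phi> y"
    and phi_inj: "inj_on \<phi> A"
begin

abbreviation "D \<equiv> hnn_dom A \<phi>"
abbreviation "F \<equiv> hnn_map A \<phi>"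
abbreviation "rep \<equiv> hnn_rep G A \<phi>"
abbreviation "nf \<equiv> hnn_nf G A \<phi>"
abbreviation "push \<equiv> hnn_push G A \<phi>"
abbreviation "lt \<equiv> hnn_letter G A \<phi>"
abbreviation "bs \<equiv> hnn_base G"
abbreviation "run \<equiv> hnn_run G A \<phi>"
abbreviation "K \<equiv> HNN G A \<phi>"
abbreviation "t \<equiv> hnn_t G"

lemma phi_hom: "\<phi> \<in> hom (G\<lparr>carrier := A\<rparr>) G"
  using phi_closed phi_mult by (auto simp: hom_def)

lemma sub_D: "subgroup (D b) G"
proof -
  interpret h: group_hom "G\<lparr>carrier := A\<rparr>" G \<phi>
    by (simp add: group_hom_def group_hom_axioms_def phi_hom sub_A subgroup_imp_group is_group)
  show ?thesis using h.img_is_subgroup sub_A by (simp add: hnn_dom_def)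
qed

lemma D_carrier: "a \<in> D b \<Longrightarrow> a \<in> carrier G"
  using subgroup.subset[OF sub_D] by blast

lemma F_closed: "a \<in> D b \<Longrightarrow> F b a \<in> D (\<not> b)"
  by (auto simp: hnn_dom_def hnn_map_def inv_into_into)

lemma F_F: "a \<in> D b \<Longrightarrow> F (\<not> b) (F b a) = a"
  by (auto simp: hnn_dom_def hnn_map_def phi_inj)

lemma F_mult: "a \<in> D b \<Longrightarrow> a' \<in> D b \<Longrightarrow> F b (a \<otimes> a') = F b a \<otimes> F b a'"
proof (cases b)
  case True then show "a \<in> D b \<Longrightarrow> a' \<in> D b \<Longrightarrow> F b (a \<otimes> a') = F b a \<otimes> F b a'"
    by (simp add: hnn_dom_def hnn_map_def phi_mult)
next
  case False
  assume a: "a \<in> D b" "a' \<in> D b"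
  with False obtain x y where xy: "x \<in> A" "y \<in> A" "a = \<phi> x" "a' = \<phi> y" by (auto simp: hnn_dom_def)
  have "\<phi> x \<otimes> \<phi> y = \<phi> (x \<otimes> y)" "x \<otimes> y \<in> A" using xy phi_mult sub_A by (auto simp: subgroup.m_closed)
  with False xy show ?thesis by (simp add: hnn_map_def phi_inj)
qed

lemma F_carrier: "a \<in> D b \<Longrightarrow> F b a \<in> carrier G"
  using F_closed D_carrier by blast

lemma one_D: "\<one> \<in> D b" by (rule subgroup.one_closed[OF sub_D])

lemma F_one: "F b \<one> = \<one>"
proof -
  have "F b (\<one> \<otimes> \<one>) = F b \<one> \<otimes> F b \<one>" by (rule F_mult) (rule one_D)+
  then show ?thesis using F_carrier[OF one_D] by simp
qed

lemma rep_coset: assumes "g \<in> carrier G" shows "\<exists>a\<in>D b. rep b g = g \<otimes> a"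
proof (cases "g \<in> D b")
  case True then show ?thesis using subgroup.m_inv_closed[OF sub_D] assms
    by (intro bexI[of _ "inv g"]) (auto simp: hnn_rep_def)
next
  case False
  have "\<exists>r. \<exists>a\<in>D b. r = g \<otimes> a" using one_D by blast
  from someI_ex[OF this] False show ?thesis by (simp add: hnn_rep_def)
qed

lemma rep_carrier: "g \<in> carrier G \<Longrightarrow> rep b g \<in> carrier G"
  using rep_coset[of g b] D_carrier by fastforce

lemma rep_rest: assumes "g \<in> carrier G" shows "inv (rep b g) \<otimes> g \<in> D b"
proof -
  obtain a where "a \<in> D b" "rep b g = g \<otimes> a" using rep_coset[OF assms] by blast
  moreover from this have "inv (g \<otimes> a) \<otimes> g = inv a"
    using assms D_carrier by (simp add: inv_mult_group m_assoc)
  ultimately show ?thesis using subgroup.m_inv_closed[OF sub_D] by simp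
qed

lemma rep_split: "g \<in> carrier G \<Longrightarrow> rep b g \<otimes> (inv (rep b g) \<otimes> g) = g"
  using rep_carrier by (simp add: m_assoc[symmetric])

lemma D_mult_iff: assumes "g \<in> carrier G" "a \<in> D b" shows "g \<otimes> a \<in> D b \<longleftrightarrow> g \<in> D b"
proof
  assume "g \<otimes> a \<in> D b"
  then have "g \<otimes> a \<otimes> inv a \<in> D b" using assms subgroup.m_closed[OF sub_D] subgroup.m_inv_closed[OF sub_D] by blast
  then show "g \<in> D b" using assms D_carrier by (simp add: m_assoc)
qed (use assms subgroup.m_closed[OF sub_D] in blast)

lemma rep_mult: assumes "g \<in> carrier G" "a \<in> D b" shows "rep b (g \<otimes> a) = rep b g"
proof -
  have "(\<exists>c\<in>D b. r = g \<otimes> a \<otimes> c) \<longleftrightarrow> (\<exists>c\<in>D b. r = g \<otimes> c)" for r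
  proof
    assume "\<exists>c\<in>D b. r = g \<otimes> a \<otimes> c"
    then show "\<exists>c\<in>D b. r = g \<otimes> c" using assms D_carrier subgroup.m_closed[OF sub_D, of a b] m_assoc by metis
  next
    assume "\<exists>c\<in>D b. r = g \<otimes> c"
    then obtain c where c: "c \<in> D b" "r = g \<otimes> c" by blast
    have "r = g \<otimes> a \<otimes> (inv a \<otimes> c)" using c assms D_carrier by (simp add: m_assoc)
    moreover have "inv a \<otimes> c \<in> D b" using c assms subgroup.m_closed[OF sub_D] subgroup.m_inv_closed[OF sub_D] by blast
    ultimately show "\<exists>c\<in>D b. r = g \<otimes> a \<otimes> c" by blast
  qed
  then show ?thesis using D_mult_iff[OF assms] by (simp add: hnn_rep_def)
qed

lemma rep_rep: assumes "g \<in> carrier G" shows "rep b (rep b g) = rep b g"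
  using rep_coset[OF assms, of b] rep_mult[OF assms] by metis

lemma rep_eq_one: assumes "g \<in> carrier G" shows "rep b g = \<one> \<longleftrightarrow> g \<in> D b"
proof
  assume "rep b g = \<one>"
  then show "g \<in> D b" using rep_rest[OF assms, of b] assms by simp
qed (simp add: hnn_rep_def)

definition \<Omega> where "\<Omega> = {p. nf (fst p) \<and> snd p \<in> carrier G}"

lemma base_Omega: "p \<in> \<Omega> \<Longrightarrow> g \<in> carrier G \<Longrightarrow> bs g p \<in> \<Omega>"
  by (simp add: \<Omega>_def hnn_base_def)

lemma letter_cases:
  assumes "p \<in> \<Omega>"
  obtains (pop) r ys g where "p = ((r, \<not> b) # ys, g)" "g \<in> D b" "lt b p = (ys, r \<otimes> F b g)"
      "r \<in> carrier G" "rep (\<not> b) r = r" "nf ys" "r = \<one> \<longrightarrow> (\<forall>r' zs. ys \<noteq> (r', b) # zs)"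
  | (push) xs g r a where "p = (xs, g)" "r = rep b g" "a = inv r \<otimes> g" "g = r \<otimes> a" "a \<in> D b" "r \<in> carrier G"
      "lt b p = ((r, b) # xs, F b a)" "nf ((r, b) # xs)" "nf xs" "g \<in> carrier G"
proof -
  obtain xs g where p: "p = (xs, g)" by fastforce
  have g: "g \<in> carrier G" and nf: "nf xs" using assms p by (auto simp: \<Omega>_def)
  show ?thesis
  proof (cases "\<exists>r ys. xs = (r, \<not> b) # ys \<and> g \<in> D b")
    case True
    then obtain r ys where xs: "xs = (r, \<not> b) # ys" "g \<in> D b" by blast
    show ?thesis using pop[of r ys g] xs nf p by (simp add: hnn_letter_def)
  next
    case False
    then have "lt b p = push b p" using p by (cases xs) (auto simp: hnn_letter_def)
    moreover have "nf ((rep b g, b) # xs)" using False nf g rep_carrier rep_rep rep_eq_one by auto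
    ultimately show ?thesis using push[of xs g "rep b g" "inv (rep b g) \<otimes> g"] p g nf rep_split rep_rest rep_carrier
      by (simp add: hnn_push_def)
  qed
qed

lemma letter_Omega: assumes "p \<in> \<Omega>" shows "lt b p \<in> \<Omega>"
  using assms
proof (cases rule: letter_cases[of p b])
  case (push xs g r a)
  show ?thesis using push(5,8) F_carrier unfolding push(7) by (simp add: \<Omega>_def)
qed (simp add: \<Omega>_def F_carrier)

text \<open>After a cancellation, the inverse letter has to be pushed back. It could cancel against
  \<open>ys\<close> instead only if \<open>r\<close> were in the subgroup, hence equal to the
  identity, and this is what the last condition of the normal form excludes.\<close>

lemma letter_inverse: assumes "p \<in> \<Omega>" shows "lt (\<not> b) (lt b p) = p"
  using assms
proof (cases rule: letter_cases[of p b])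
  case (pop r ys g)
  have F: "F b g \<in> D (\<not> b)" using pop F_closed by blast
  have "rep (\<not> b) (r \<otimes> F b g) = r" using F pop rep_mult by simp
  moreover have "r \<otimes> F b g \<in> D (\<not> b) \<Longrightarrow> r = \<one>"
    using rep_eq_one[of r "\<not> b"] D_mult_iff[OF pop(4) F] pop by simp
  moreover have "inv r \<otimes> (r \<otimes> F b g) = F b g" using pop F_carrier by (simp add: m_assoc[symmetric])
  ultimately show ?thesis using pop F_F[of g b]
    by (cases ys) (auto simp: hnn_letter_def hnn_push_def)
next
  case (push xs g r a)
  have "lt (\<not> b) ((r, b) # xs, F b a) = (xs, r \<otimes> a)"
    using push(5) F_closed[of a b] F_F[of a b] by (simp add: hnn_letter_def)
  then show ?thesis using push(1,4,7) by simp
qed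

text \<open>Multiplying by \<open>a\<close> changes neither the coset of the base element nor its
  membership in the subgroup, so both sides take the same branch and \<open>a\<close> comes out as
  \<open>F b a\<close>. This is the defining relation as a statement about actions.\<close>

lemma letter_slide: assumes "p \<in> \<Omega>" "a \<in> D b" shows "lt b (bs a p) = bs (F b a) (lt b p)"
proof -
  obtain xs g where p: "p = (xs, g)" by fastforce
  have g: "g \<in> carrier G" and nf: "nf xs" using assms p by (auto simp: \<Omega>_def)
  have a: "a \<in> carrier G" using assms D_carrier by blast
  show ?thesis
  proof (cases "\<exists>r ys. xs = (r, \<not> b) # ys \<and> g \<in> D b")
    case True
    then obtain r ys where xs: "xs = (r, \<not> b) # ys" "g \<in> D b" by blast
    have "r \<in> carrier G" using nf xs by simp
    then show ?thesis using xs p g a assms D_mult_iff[of g a b] F_mult F_carrier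
      by (simp add: hnn_letter_def hnn_base_def m_assoc)
  next
    case False
    have "inv (rep b g) \<otimes> (g \<otimes> a) = (inv (rep b g) \<otimes> g) \<otimes> a" using g a rep_carrier by (simp add: m_assoc)
    then have "push b (bs a p) = bs (F b a) (push b p)"
      using p g a assms rep_mult F_mult rep_rest by (simp add: hnn_push_def hnn_base_def)
    moreover have "lt b p = push b p" using p False by (cases xs) (auto simp: hnn_letter_def)
    moreover have "lt b (bs a p) = push b (bs a p)"
      using p False D_mult_iff[OF g assms(2)] by (cases xs) (auto simp: hnn_letter_def hnn_base_def)
    ultimately show ?thesis by simp
  qed
qed

lemma base_base: "p \<in> \<Omega> \<Longrightarrow> g \<in> carrier G \<Longrightarrow> h \<in> carrier G \<Longrightarrow> bs h (bs g p) = bs (g \<otimes> h) p"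
  by (simp add: hnn_base_def \<Omega>_def m_assoc)

lemma run_Nil [simp]: "run u [] = u" by (simp add: hnn_run_def)

lemma run_Cons [simp]: "run u ((r, b) # xs) = lt b (bs r (run u xs))" by (simp add: hnn_run_def)

lemma run_Omega: "u \<in> \<Omega> \<Longrightarrow> nf xs \<Longrightarrow> run u xs \<in> \<Omega>"
proof (induct xs)
  case (Cons x xs) then show ?case using base_Omega letter_Omega by (cases x) simp
qed simp

lemma carrier_K: "carrier K = \<Omega>" by (simp add: HNN_def \<Omega>_def)

lemma mult_K: "u \<otimes>\<^bsub>K\<^esub> v = bs (snd v) (run u (fst v))" by (simp add: HNN_def)

lemma one_K: "\<one>\<^bsub>K\<^esub> = ([], \<one>)" by (simp add: HNN_def)

lemma incl_Omega [simp]: "([], g) \<in> \<Omega> \<longleftrightarrow> g \<in> carrier G" by (simp add: \<Omega>_def)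

lemma t_Omega: "t b \<in> \<Omega>" by (simp add: \<Omega>_def hnn_t_def hnn_rep_def one_D)

lemma mult_incl: "u \<otimes>\<^bsub>K\<^esub> ([], g) = bs g u" by (simp add: mult_K)

lemma base_one: "w \<in> \<Omega> \<Longrightarrow> bs \<one> w = w"
  by (cases w) (simp add: hnn_base_def \<Omega>_def)

lemma mult_t: assumes "u \<in> \<Omega>" shows "u \<otimes>\<^bsub>K\<^esub> t b = lt b u"
proof -
  have "u \<otimes>\<^bsub>K\<^esub> t b = bs \<one> (lt b (bs \<one> u))" by (simp add: mult_K hnn_t_def)
  then show ?thesis by (simp only: base_one[OF assms] base_one[OF letter_Omega[OF assms]])
qed

lemma mult_closed: "u \<in> \<Omega> \<Longrightarrow> v \<in> \<Omega> \<Longrightarrow> u \<otimes>\<^bsub>K\<^esub> v \<in> \<Omega>"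
  unfolding mult_K by (rule base_Omega[OF run_Omega]) (auto simp: \<Omega>_def)

lemma mult_base: "u \<in> \<Omega> \<Longrightarrow> v \<in> \<Omega> \<Longrightarrow> g \<in> carrier G \<Longrightarrow> u \<otimes>\<^bsub>K\<^esub> bs g v = bs g (u \<otimes>\<^bsub>K\<^esub> v)"
proof -
  assume a: "u \<in> \<Omega>" "v \<in> \<Omega>" "g \<in> carrier G"
  then have "run u (fst v) \<in> \<Omega>" "snd v \<in> carrier G" using run_Omega by (auto simp: \<Omega>_def)
  then show ?thesis using base_base[of "run u (fst v)" "snd v" g] a by (simp add: mult_K hnn_base_def)
qed

text \<open>If the letter cancels in \<open>v\<close>, the inverse letters cancel in the product as
  well by \<open>letter_inverse\<close>; if it is pushed, the rest of the base element is carried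
  across by \<open>letter_slide\<close>. Associativity rests on this step.\<close>

lemma mult_letter: assumes u: "u \<in> \<Omega>" and v: "v \<in> \<Omega>" shows "u \<otimes>\<^bsub>K\<^esub> lt b v = lt b (u \<otimes>\<^bsub>K\<^esub> v)"
  using v
proof (cases rule: letter_cases[of v b])
  case (pop r ys g)
  let ?M = "run u ys"
  have M: "?M \<in> \<Omega>" "bs r ?M \<in> \<Omega>" using u pop run_Omega base_Omega by auto
  have "lt b (u \<otimes>\<^bsub>K\<^esub> v) = lt b (bs g (lt (\<not> b) (bs r ?M)))" using pop by (simp add: mult_K)
  also have "\<dots> = bs (F b g) (bs r ?M)"
    using letter_slide[OF letter_Omega[OF M(2)] pop(2)] letter_inverse[OF M(2), of "\<not> b"] by simp
  also have "\<dots> = bs (r \<otimes> F b g) ?M" using base_base[OF M(1)] pop F_carrier by blast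
  finally show ?thesis using pop by (simp add: mult_K)
next
  case (push xs g r a)
  let ?M = "run u xs"
  have M: "?M \<in> \<Omega>" "bs r ?M \<in> \<Omega>" using u push(6,9) run_Omega base_Omega by auto
  have "lt b (u \<otimes>\<^bsub>K\<^esub> v) = lt b (bs g ?M)" unfolding push(1) by (simp add: mult_K)
  also have "\<dots> = lt b (bs a (bs r ?M))"
    unfolding push(4) by (simp only: base_base[OF M(1) push(6) D_carrier[OF push(5)]])
  also have "\<dots> = bs (F b a) (lt b (bs r ?M))" using letter_slide[OF M(2)] push(5) by blast
  finally show ?thesis unfolding push(7) by (simp add: mult_K)
qed

text \<open>Building a normal form letter by letter never cancels: an entry lying in the subgroup is
  the identity, and then no inverse letter precedes it. Hence the right actions reach every element
  from the identity.\<close>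

lemma Omega_induct:
  assumes "p \<in> \<Omega>" "P ([], \<one>)"
    and base: "\<And>p g. p \<in> \<Omega> \<Longrightarrow> P p \<Longrightarrow> g \<in> carrier G \<Longrightarrow> P (bs g p)"
    and letter: "\<And>p b. p \<in> \<Omega> \<Longrightarrow> P p \<Longrightarrow> P (lt b p)"
  shows "P p"
proof -
  have st: "nf xs \<Longrightarrow> P (xs, \<one>)" for xs
  proof (induct xs)
    case (Cons x xs)
    obtain r b where x: "x = (r, b)" by fastforce
    have r: "r \<in> carrier G" "rep b r = r" "nf xs" "(xs, \<one>) \<in> \<Omega>" using Cons x by (auto simp: \<Omega>_def)
    have d: "r \<in> D b \<Longrightarrow> r = \<one>" using rep_eq_one[OF r(1), of b] r(2) by simp
    have "P (lt b (bs r (xs, \<one>)))" using Cons r x by (intro letter base base_Omega) auto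
    moreover have "lt b (bs r (xs, \<one>)) = (x # xs, \<one>)"
      using Cons(2) x r d F_one by (cases xs) (auto simp: hnn_letter_def hnn_push_def hnn_base_def)
    ultimately show ?case by simp
  qed (simp add: assms)
  have "P (bs (snd p) (fst p, \<one>))" using assms(1) by (intro base st) (auto simp: \<Omega>_def)
  then show ?thesis using assms(1) by (simp add: hnn_base_def \<Omega>_def)
qed

lemma one_mult: "p \<in> \<Omega> \<Longrightarrow> ([], \<one>) \<otimes>\<^bsub>K\<^esub> p = p"
proof (rule Omega_induct[of p "\<lambda>p. ([], \<one>) \<otimes>\<^bsub>K\<^esub> p = p"])
  show "([], \<one>) \<otimes>\<^bsub>K\<^esub> ([], \<one>) = ([], \<one>)" by (simp add: mult_incl hnn_base_def)
qed (simp_all add: mult_base mult_letter)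

lemma assoc_K: assumes "u \<in> \<Omega>" "v \<in> \<Omega>" "w \<in> \<Omega>" shows "u \<otimes>\<^bsub>K\<^esub> v \<otimes>\<^bsub>K\<^esub> w = u \<otimes>\<^bsub>K\<^esub> (v \<otimes>\<^bsub>K\<^esub> w)"
proof (rule Omega_induct[of w "\<lambda>w. u \<otimes>\<^bsub>K\<^esub> v \<otimes>\<^bsub>K\<^esub> w = u \<otimes>\<^bsub>K\<^esub> (v \<otimes>\<^bsub>K\<^esub> w)"])
  show "u \<otimes>\<^bsub>K\<^esub> v \<otimes>\<^bsub>K\<^esub> ([], \<one>) = u \<otimes>\<^bsub>K\<^esub> (v \<otimes>\<^bsub>K\<^esub> ([], \<one>))"
    by (simp only: mult_incl base_one assms mult_closed)
qed (simp_all add: assms mult_base mult_letter mult_closed)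

lemma monoid_K: "monoid K"
  by (rule monoidI) (simp_all add: carrier_K mult_closed assoc_K one_mult one_K mult_incl base_one)

lemma base_Units: "g \<in> carrier G \<Longrightarrow> ([], g) \<in> Units K"
  by (auto simp: Units_def carrier_K one_K mult_incl hnn_base_def intro!: bexI[of _ "([], inv g)"])

lemma letter_one: "lt b ([], \<one>) = t b"
  by (simp add: hnn_letter_def hnn_push_def hnn_t_def hnn_rep_def one_D F_one)

lemma t_t: "t b \<otimes>\<^bsub>K\<^esub> t (\<not> b) = \<one>\<^bsub>K\<^esub>"
  using letter_inverse[of "([], \<one>)" b] t_Omega by (simp add: mult_t one_K letter_one)

lemma t_Units: "t b \<in> Units K"
  using t_t[of b] t_t[of "\<not> b"] t_Omega by (auto simp: Units_def carrier_K intro!: bexI[of _ "t (\<not> b)"])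

lemma group_K: "group K"
proof -
  interpret K: monoid K by (rule monoid_K)
  have "p \<in> Units K" if "p \<in> \<Omega>" for p
  proof (rule Omega_induct[OF that, of "\<lambda>p. p \<in> Units K"])
    show "([], \<one>) \<in> Units K" by (rule base_Units) simp
    show "\<And>p g. p \<in> \<Omega> \<Longrightarrow> p \<in> Units K \<Longrightarrow> g \<in> carrier G \<Longrightarrow> bs g p \<in> Units K"
      using K.Units_m_closed base_Units mult_incl by metis
    show "\<And>p b. p \<in> \<Omega> \<Longrightarrow> p \<in> Units K \<Longrightarrow> lt b p \<in> Units K"
      using K.Units_m_closed t_Units mult_t by metis
  qed
  then show ?thesis by unfold_locales (auto simp: carrier_K)
qed

sublocale K: group K by (rule group_K)

lemma incl_hom: "hnn_incl \<in> hom G K"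
  by (simp add: hom_def carrier_K mult_incl hnn_base_def)

lemma incl_mult: "([], g) \<otimes>\<^bsub>K\<^esub> ([], h) = ([], g \<otimes> h)"
  by (simp add: mult_incl hnn_base_def)

lemma incl_inv: "g \<in> carrier G \<Longrightarrow> inv\<^bsub>K\<^esub> ([], g) = ([], inv g)"
  by (rule K.inv_equality) (simp_all add: incl_mult one_K carrier_K)

lemma t_inv: "inv\<^bsub>K\<^esub> (t b) = t (\<not> b)"
  using t_t[of "\<not> b"] t_Omega by (intro K.inv_equality) (simp_all add: carrier_K)

lemma t_slide: "a \<in> D b \<Longrightarrow> ([], a) \<otimes>\<^bsub>K\<^esub> t b = t b \<otimes>\<^bsub>K\<^esub> ([], F b a)"
  using letter_slide[of "([], \<one>)" a b] by (simp add: mult_t mult_incl D_carrier letter_one hnn_base_def)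

lemma K_generated: "generate K (hnn_incl ` carrier G \<union> {t True}) = carrier K" (is "?L = _")
proof -
  have inc: "hnn_incl ` carrier G \<union> {t True} \<subseteq> carrier K" using t_Omega by (auto simp: carrier_K)
  have tb: "t b \<in> ?L" for b
    using generate.incl[of "t True" _ K] generate.inv[of "t True" _ K] t_inv[of True] by (cases b) auto
  have "p \<in> ?L" if "p \<in> \<Omega>" for p
  proof (rule Omega_induct[OF that, of "\<lambda>p. p \<in> ?L"])
    show "([], \<one>) \<in> ?L" using generate.one[of K] by (simp add: one_K)
    show "\<And>p g. p \<in> \<Omega> \<Longrightarrow> p \<in> ?L \<Longrightarrow> g \<in> carrier G \<Longrightarrow> bs g p \<in> ?L"
      by (subst mult_incl[symmetric]) (auto intro: generate.eng generate.incl)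
    show "\<And>p b. p \<in> \<Omega> \<Longrightarrow> p \<in> ?L \<Longrightarrow> lt b p \<in> ?L"
      using generate.eng tb mult_t by metis
  qed
  then show ?thesis using K.generate_incl[OF inc] carrier_K by blast
qed

lemma K_generated_by: assumes "generate G S = carrier G" "S \<subseteq> carrier G"
  shows "generate K (hnn_incl ` S \<union> {t True}) = carrier K"
proof -
  interpret i: group_hom G K hnn_incl
    by (simp add: group_hom_def group_hom_axioms_def incl_hom is_group group_K)
  have S: "hnn_incl ` S \<union> {t True} \<subseteq> carrier K" using t_Omega assms by (auto simp: carrier_K)
  have "hnn_incl ` carrier G = generate K (hnn_incl ` S)" using i.generate_img[OF assms(2)] assms(1) by simp
  also have "\<dots> \<subseteq> generate K (hnn_incl ` S \<union> {t True})" by (rule K.mono_generate) blast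
  finally have "generate K (hnn_incl ` carrier G \<union> {t True}) \<subseteq> generate K (hnn_incl ` S \<union> {t True})"
    using K.generate_is_subgroup[OF S] by (intro K.generate_subgroup_incl) (auto intro: generate.incl)
  then show ?thesis using K_generated K.generate_incl[OF S] by auto
qed

text \<open>The homomorphism evaluates a normal form in \<open>M\<close>. It respects the right
  actions of base elements and letters, and \<open>Omega_induct\<close> turns this into
  multiplicativity.\<close>

lemma universal:
  fixes M (structure)
  assumes "group M" and h: "h \<in> hom G M" and \<tau>: "\<tau> \<in> carrier M"
    and slide: "\<And>a. a \<in> A \<Longrightarrow> h a \<otimes>\<^bsub>M\<^esub> \<tau> = \<tau> \<otimes>\<^bsub>M\<^esub> h (\<phi> a)"
  shows "\<exists>k\<in>hom K M. (\<forall>g\<in>carrier G. k ([], g) = h g) \<and> k (t True) = \<tau>"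
proof -
  interpret M: group M by fact
  interpret h: group_hom G M h by (simp add: group_hom_def group_hom_axioms_def h is_group \<open>group M\<close>)
  define tt where "tt b = (if b then \<tau> else inv\<^bsub>M\<^esub> \<tau>)" for b
  have tt: "tt b \<in> carrier M" "tt b \<otimes>\<^bsub>M\<^esub> tt (\<not> b) = \<one>\<^bsub>M\<^esub>" for b using \<tau> by (auto simp: tt_def)
  have sl: "h a \<otimes>\<^bsub>M\<^esub> tt b = tt b \<otimes>\<^bsub>M\<^esub> h (F b a)" if aD: "a \<in> D b" for a b
  proof (cases b)
    case True then show ?thesis using slide aD by (simp add: tt_def hnn_map_def hnn_dom_def)
  next
    case False
    then obtain x where x: "x \<in> A" "a = \<phi> x" "F b a = x"
      using aD phi_inj by (auto simp: hnn_dom_def hnn_map_def)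
    have c: "h x \<in> carrier M" "h a \<in> carrier M" using x phi_closed subgroup.subset[OF sub_A] by auto
    have "tt b \<otimes>\<^bsub>M\<^esub> h (F b a) = inv\<^bsub>M\<^esub> \<tau> \<otimes>\<^bsub>M\<^esub> (h x \<otimes>\<^bsub>M\<^esub> \<tau>) \<otimes>\<^bsub>M\<^esub> inv\<^bsub>M\<^esub> \<tau>"
      using x c \<tau> False by (simp add: tt_def M.m_assoc)
    also have "\<dots> = h a \<otimes>\<^bsub>M\<^esub> tt b" using slide[OF x(1)] x c \<tau> False by (simp add: tt_def M.m_assoc[symmetric])
    finally show ?thesis by simp
  qed
  define el where "el xs = foldr (\<lambda>(r, b) v. v \<otimes>\<^bsub>M\<^esub> h r \<otimes>\<^bsub>M\<^esub> tt b) xs \<one>\<^bsub>M\<^esub>" for xs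
  define ev where "ev p = el (fst p) \<otimes>\<^bsub>M\<^esub> h (snd p)" for p
  have el: "nf xs \<Longrightarrow> el xs \<in> carrier M" for xs
    by (induct xs) (auto simp: el_def tt)
  have ev_closed: "p \<in> \<Omega> \<Longrightarrow> ev p \<in> carrier M" for p by (auto simp: ev_def el \<Omega>_def)
  have ev_base: "ev (bs g p) = ev p \<otimes>\<^bsub>M\<^esub> h g" if "p \<in> \<Omega>" "g \<in> carrier G" for p g
    using that by (simp add: ev_def hnn_base_def \<Omega>_def el M.m_assoc)
  have ev_letter: "ev (lt b p) = ev p \<otimes>\<^bsub>M\<^esub> tt b" if "p \<in> \<Omega>" for p b
    using that
  proof (cases rule: letter_cases[of p b])
    case (pop r ys g)
    have c: "el ys \<in> carrier M" "h r \<in> carrier M" "h (F b g) \<in> carrier M" "h g \<in> carrier M"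
      using el pop F_carrier D_carrier by auto
    have "ev p \<otimes>\<^bsub>M\<^esub> tt b = el ys \<otimes>\<^bsub>M\<^esub> h r \<otimes>\<^bsub>M\<^esub> tt (\<not> b) \<otimes>\<^bsub>M\<^esub> (h g \<otimes>\<^bsub>M\<^esub> tt b)"
      using pop c tt by (simp add: ev_def el_def M.m_assoc)
    also have "\<dots> = el ys \<otimes>\<^bsub>M\<^esub> h r \<otimes>\<^bsub>M\<^esub> (tt (\<not> b) \<otimes>\<^bsub>M\<^esub> tt b) \<otimes>\<^bsub>M\<^esub> h (F b g)"
      using c tt(1) sl[OF pop(2)] by (simp add: M.m_assoc)
    also have "\<dots> = ev (lt b p)" using tt(2)[of "\<not> b"] c pop F_carrier by (simp add: ev_def M.m_assoc)
    finally show ?thesis by simp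
  next
    case (push xs g r a)
    have c: "el xs \<in> carrier M" "h r \<in> carrier M" "h a \<in> carrier M" "h (F b a) \<in> carrier M"
      using el push(5,6,9) F_carrier D_carrier by auto
    have "ev (lt b p) = el xs \<otimes>\<^bsub>M\<^esub> h r \<otimes>\<^bsub>M\<^esub> (tt b \<otimes>\<^bsub>M\<^esub> h (F b a))" using c tt unfolding push(7) by (simp add: ev_def el_def M.m_assoc)
    also have "\<dots> = el xs \<otimes>\<^bsub>M\<^esub> h r \<otimes>\<^bsub>M\<^esub> (h a \<otimes>\<^bsub>M\<^esub> tt b)" using sl push(5) by simp
    also have "\<dots> = el xs \<otimes>\<^bsub>M\<^esub> h (r \<otimes> a) \<otimes>\<^bsub>M\<^esub> tt b" using c tt push(5,6) D_carrier by (simp add: M.m_assoc)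
    also have "\<dots> = ev p \<otimes>\<^bsub>M\<^esub> tt b" unfolding push(1) push(4)[symmetric] by (simp add: ev_def)
    finally show ?thesis .
  qed
  have ev_mult: "ev (u \<otimes>\<^bsub>K\<^esub> v) = ev u \<otimes>\<^bsub>M\<^esub> ev v" if "u \<in> \<Omega>" "v \<in> \<Omega>" for u v
    using \<open>v \<in> \<Omega>\<close>
  proof (rule Omega_induct[of v "\<lambda>v. ev (u \<otimes>\<^bsub>K\<^esub> v) = ev u \<otimes>\<^bsub>M\<^esub> ev v"])
    have "u \<otimes>\<^bsub>K\<^esub> ([], \<one>) = u" using K.r_one[of u] that by (simp add: carrier_K one_K)
    then show "ev (u \<otimes>\<^bsub>K\<^esub> ([], \<one>)) = ev u \<otimes>\<^bsub>M\<^esub> ev ([], \<one>)"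
      using ev_closed[OF that(1)] by (simp add: ev_def el_def)
  qed (use that ev_closed tt in \<open>simp_all add: mult_base ev_base mult_letter ev_letter mult_closed M.m_assoc\<close>)
  have "ev \<in> hom K M" using ev_closed ev_mult by (auto simp: hom_def carrier_K)
  moreover have "ev ([], g) = h g" if "g \<in> carrier G" for g using that by (simp add: ev_def el_def)
  moreover have "ev (t True) = \<tau>" using \<tau> by (simp add: ev_def el_def hnn_t_def tt_def)
  ultimately show ?thesis by blast
qed


section \<open>Words with stable letters and Britton's lemma\<close>

definition wstep where "wstep p x = bs (snd x) (lt (fst x) p)"

text \<open>The value of \<open>g t\<^sub>1 h\<^sub>1 t\<^sub>2 h\<^sub>2 ...\<close>. Unlike in a
  normal form, each base element follows its letter and is arbitrary.\<close>

definition wd where "wd g ws = foldl wstep ([], g) ws"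

text \<open>Two adjacent inverse letters such that the base element between them can be moved across
  the second one, so that they cancel.\<close>

definition pinch :: "bool \<times> 'a \<Rightarrow> bool \<times> 'a \<Rightarrow> bool" where
  "pinch x y \<longleftrightarrow> fst y = (\<not> fst x) \<and> snd x \<in> D (fst y)"

fun red where
  "red [] = True"
| "red [x] = True"
| "red (x # y # ws) = (\<not> pinch x y \<and> red (y # ws))"

abbreviation "wfw ws \<equiv> snd ` set ws \<subseteq> carrier G"

lemma wstep_Omega: "p \<in> \<Omega> \<Longrightarrow> snd x \<in> carrier G \<Longrightarrow> wstep p x \<in> \<Omega>"
  by (simp add: wstep_def base_Omega letter_Omega)

lemma foldl_Omega: "p \<in> \<Omega> \<Longrightarrow> wfw ws \<Longrightarrow> foldl wstep p ws \<in> \<Omega>"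
  by (induct ws arbitrary: p) (auto simp: wstep_Omega)

lemma wd_Omega: "g \<in> carrier G \<Longrightarrow> wfw ws \<Longrightarrow> wd g ws \<in> \<Omega>"
  by (simp add: wd_def foldl_Omega)

lemma wd_Nil [simp]: "wd g [] = ([], g)" by (simp add: wd_def)

lemma wd_snoc: "wd g (ws @ [x]) = wstep (wd g ws) x" by (simp add: wd_def)

lemma mult_foldl: "u \<in> \<Omega> \<Longrightarrow> p \<in> \<Omega> \<Longrightarrow> wfw ws \<Longrightarrow> u \<otimes>\<^bsub>K\<^esub> foldl wstep p ws = foldl wstep (u \<otimes>\<^bsub>K\<^esub> p) ws"
proof (induct ws arbitrary: p)
  case (Cons x ws)
  then show ?case using wstep_Omega[of p x] letter_Omega[of p "fst x"]
    by (simp add: wstep_def mult_base mult_letter mult_closed)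
qed simp

lemma base_wd_snoc: "g \<in> carrier G \<Longrightarrow> wfw ws \<Longrightarrow> h \<in> carrier G \<Longrightarrow> k \<in> carrier G \<Longrightarrow>
   bs k (wd g (ws @ [(b, h)])) = wd g (ws @ [(b, h \<otimes> k)])"
  using wd_Omega letter_Omega by (simp add: wd_snoc wstep_def base_base)

lemma push_length: "length (fst (push b p)) = Suc (length (fst p))" by (simp add: hnn_push_def)

lemma D_mult_iff': "a \<in> D b \<Longrightarrow> g \<in> carrier G \<Longrightarrow> a \<otimes> g \<in> D b \<longleftrightarrow> g \<in> D b"
proof
  assume a: "a \<in> D b" "g \<in> carrier G" "a \<otimes> g \<in> D b"
  then have "inv a \<otimes> (a \<otimes> g) \<in> D b" using subgroup.m_closed[OF sub_D] subgroup.m_inv_closed[OF sub_D] by blast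
  then show "g \<in> D b" using a D_carrier by simp
qed (use subgroup.m_closed[OF sub_D] in blast)

text \<open>After a push the trailing element is a member of the associated subgroup times the entry
  of the word, so the next letter cancels only if the word has a pinch there. A reduced word
  therefore pushes all of its letters.\<close>

lemma red_length:
  assumes "p \<in> \<Omega>" "red (x # ws)" "wfw (x # ws)" "lt (fst x) p = push (fst x) p"
  shows "length (fst (foldl wstep p (x # ws))) = length (fst p) + length (x # ws)"
  using assms
proof (induct ws arbitrary: p x)
  case Nil then show ?case by (simp add: wstep_def hnn_base_def push_length)
next
  case (Cons y ws)
  obtain b g where x: "x = (b, g)" by fastforce
  let ?q = "wstep p x" and ?c = "inv (rep b (snd p)) \<otimes> snd p"
  have g: "g \<in> carrier G" "snd p \<in> carrier G" using Cons.prems x by (auto simp: \<Omega>_def)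
  have q: "?q \<in> \<Omega>" using Cons.prems by (intro wstep_Omega) auto
  have fq: "fst ?q = (rep b (snd p), b) # fst p" "snd ?q = F b ?c \<otimes> g"
    using Cons.prems(4) x by (simp_all add: wstep_def hnn_base_def hnn_push_def)
  have "F b ?c \<in> D (\<not> b)" using rep_rest[OF g(2)] F_closed by blast
  then have "snd ?q \<in> D (\<not> b) \<longleftrightarrow> g \<in> D (\<not> b)" using fq D_mult_iff' g by simp
  then have "lt (fst y) ?q = push (fst y) ?q"
    using fq Cons.prems(2) x by (auto simp: hnn_letter_def pinch_def)
  then have "length (fst (foldl wstep ?q (y # ws))) = length (fst ?q) + length (y # ws)"
    using Cons.prems q by (intro Cons.hyps) auto
  then show ?case using fq by simp
qed

text \<open>Britton's lemma, read off from the number of letters in the normal form.\<close>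

lemma britton:
  assumes "g \<in> carrier G" "wfw ws" "fst (wd g ws) = []" "red ws" shows "ws = []"
proof (cases ws)
  case (Cons x vs)
  have "lt (fst x) ([], g) = push (fst x) ([], g)" by (simp add: hnn_letter_def)
  then show ?thesis using red_length[of "([], g)" x vs] assms Cons by (simp add: wd_def)
qed

lemma not_red: "\<not> red ws \<Longrightarrow> \<exists>us x y vs. ws = us @ x # y # vs \<and> pinch x y"
proof (induct ws rule: red.induct)
  case (3 x y ws)
  show ?case
  proof (cases "pinch x y")
    case True then show ?thesis by (metis append_Nil)
  next
    case False
    then obtain us x' y' vs where "y # ws = us @ x' # y' # vs \<and> pinch x' y'" using 3 by auto
    then show ?thesis by (metis append_Cons)
  qed
qed auto

lemma red_append: "red (us @ vs) \<longleftrightarrow> red us \<and> red vs \<and> (us \<noteq> [] \<longrightarrow> vs \<noteq> [] \<longrightarrow> \<not> pinch (last us) (hd vs))"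
proof (induct us rule: red.induct)
  case (2 x) then show ?case by (cases vs) auto
qed auto

lemma foldl_pinch:
  assumes "p \<in> \<Omega>" "pinch x y" "snd x \<in> carrier G" "snd y \<in> carrier G"
  shows "foldl wstep p (x # y # vs) = foldl wstep (bs (F (fst y) (snd x) \<otimes> snd y) p) vs"
proof -
  have xy: "fst y = (\<not> fst x)" "snd x \<in> D (fst y)" using assms by (auto simp: pinch_def)
  have "wstep (wstep p x) y = bs (snd y) (bs (F (fst y) (snd x)) (lt (\<not> fst x) (lt (fst x) p)))"
    using letter_slide[OF letter_Omega[OF assms(1)] xy(2)] by (simp add: wstep_def xy(1))
  also have "\<dots> = bs (F (fst y) (snd x) \<otimes> snd y) p"
    using assms letter_inverse base_base F_carrier[OF xy(2)] by simp
  finally show ?thesis by simp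
qed

lemma wd_pinch_first:
  assumes "g \<in> carrier G" "wfw (x # y # vs)" "pinch x y"
  shows "wd g (x # y # vs) = wd (g \<otimes> (F (fst y) (snd x) \<otimes> snd y)) vs"
  using foldl_pinch[of "([], g)" x y vs] assms by (simp add: wd_def hnn_base_def)

lemma wd_pinch_later:
  assumes "g \<in> carrier G" "wfw (us @ (c, k) # x # y # vs)" "pinch x y"
  shows "wd g (us @ (c, k) # x # y # vs) = wd g (us @ (c, k \<otimes> (F (fst y) (snd x) \<otimes> snd y)) # vs)"
proof -
  have F: "F (fst y) (snd x) \<in> carrier G" using assms F_carrier by (auto simp: pinch_def)
  have "wd g (us @ (c, k) # x # y # vs) = foldl wstep (wd g (us @ [(c, k)])) (x # y # vs)" by (simp add: wd_def)
  also have "\<dots> = foldl wstep (bs (F (fst y) (snd x) \<otimes> snd y) (wd g (us @ [(c, k)]))) vs"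
    using assms by (intro foldl_pinch wd_Omega) auto
  also have "\<dots> = foldl wstep (wd g (us @ [(c, k \<otimes> (F (fst y) (snd x) \<otimes> snd y))])) vs"
    using assms F by (subst base_wd_snoc) auto
  finally show ?thesis by (simp add: wd_def)
qed

text \<open>Removing a pinch replaces its base element by the image under the associated map. A
  subgroup closed under these maps thus contains all entries of the shorter word.\<close>

lemma wd_shorten:
  assumes "subgroup H G" and H: "\<And>b a. a \<in> H \<Longrightarrow> a \<in> D b \<Longrightarrow> F b a \<in> H"
    and g: "g \<in> H" "snd ` set ws \<subseteq> H" and nr: "\<not> red ws"
  shows "\<exists>g' ws'. g' \<in> H \<and> snd ` set ws' \<subseteq> H \<and> length ws' < length ws \<and> wd g ws = wd g' ws'"
proof -
  interpret H: subgroup H G by fact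
  obtain us x y vs where ws: "ws = us @ x # y # vs" and p: "pinch x y" using not_red[OF nr] by blast
  have F: "F (fst y) (snd x) \<in> H" using H p g ws by (auto simp: pinch_def)
  show ?thesis
  proof (cases us rule: rev_cases)
    case Nil
    have "wd g ws = wd (g \<otimes> (F (fst y) (snd x) \<otimes> snd y)) vs"
      using ws Nil g p H.subset wd_pinch_first[of g x y vs] by auto
    moreover have "g \<otimes> (F (fst y) (snd x) \<otimes> snd y) \<in> H" using F g ws by auto
    ultimately show ?thesis using g ws by (intro exI[of _ "g \<otimes> (F (fst y) (snd x) \<otimes> snd y)"] exI[of _ vs]) auto
  next
    case (snoc us' z)
    obtain c k where z: "z = (c, k)" by fastforce
    have "wd g ws = wd g (us' @ (c, k \<otimes> (F (fst y) (snd x) \<otimes> snd y)) # vs)"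
      using ws snoc z g p H.subset wd_pinch_later[of g us' c k x y vs] by auto
    moreover have "k \<otimes> (F (fst y) (snd x) \<otimes> snd y) \<in> H" using F g ws snoc z by auto
    ultimately show ?thesis using g ws snoc z
      by (intro exI[of _ g] exI[of _ "us' @ (c, k \<otimes> (F (fst y) (snd x) \<otimes> snd y)) # vs"]) auto
  qed
qed

text \<open>By Britton's lemma a word with value in the base has a pinch as long as it has letters,
  and removing pinches keeps the entries in \<open>H\<close>. So adjoining \<open>t\<close> to an
  invariant subgroup adds nothing to it inside \<open>G\<close>.\<close>

lemma wd_base:
  assumes "subgroup H G" and H: "\<And>b a. a \<in> H \<Longrightarrow> a \<in> D b \<Longrightarrow> F b a \<in> H"
    and "g \<in> H" "snd ` set ws \<subseteq> H" "wd g ws = ([], a)"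
  shows "a \<in> H"
  using assms(3-)
proof (induct "length ws" arbitrary: g ws rule: less_induct)
  case less
  have c: "H \<subseteq> carrier G" using assms(1) subgroup.subset by blast
  show ?case
  proof (cases "red ws")
    case True
    then have "ws = []" using britton[of g ws] less.prems c by auto
    then show ?thesis using less.prems by simp
  next
    case False
    then obtain g' ws' where w: "g' \<in> H" "snd ` set ws' \<subseteq> H" "length ws' < length ws" "wd g ws = wd g' ws'"
      using wd_shorten[OF assms(1) H less.prems(1,2)] by blast
    show ?thesis by (rule less.hyps[OF w(3,1,2)]) (use less.prems w(4) in simp)
  qed
qed

lemma base_wd: assumes "subgroup H G" "g \<in> H" "snd ` set ws \<subseteq> H" "k \<in> H"
  shows "\<exists>g' ws'. g' \<in> H \<and> snd ` set ws' \<subseteq> H \<and> length ws' = length ws \<and> bs k (wd g ws) = wd g' ws'"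
proof -
  interpret H: subgroup H G by fact
  show ?thesis
  proof (cases ws rule: rev_cases)
    case Nil then show ?thesis using assms by (auto simp: hnn_base_def intro!: exI[of _ "g \<otimes> k"])
  next
    case (snoc us z)
    obtain c h where "z = (c, h)" by fastforce
    then show ?thesis using snoc assms H.subset base_wd_snoc[of g us h k c]
      by (intro exI[of _ g] exI[of _ "us @ [(c, h \<otimes> k)]"]) auto
  qed
qed

lemma generate_wd:
  assumes "subgroup H G" "p \<in> generate K (hnn_incl ` H \<union> {t True})"
  shows "\<exists>g ws. g \<in> H \<and> snd ` set ws \<subseteq> H \<and> p = wd g ws"
proof -
  interpret H: subgroup H G by fact
  have S: "hnn_incl ` H \<union> {t True} \<subseteq> carrier K" using H.subset t_Omega by (auto simp: carrier_K)
  show ?thesis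
  proof (rule K.generate_right_induct[OF S assms(2)])
    show "\<exists>g ws. g \<in> H \<and> snd ` set ws \<subseteq> H \<and> \<one>\<^bsub>K\<^esub> = wd g ws"
      by (intro exI[of _ \<one>] exI[of _ "[]"]) (simp add: one_K)
  next
    fix x s assume x: "x \<in> generate K (hnn_incl ` H \<union> {t True})"
      and "\<exists>g ws. g \<in> H \<and> snd ` set ws \<subseteq> H \<and> x = wd g ws" and s: "s \<in> hnn_incl ` H \<union> {t True}"
    then obtain g ws where gw: "g \<in> H" "snd ` set ws \<subseteq> H" "x = wd g ws" by blast
    have xO: "x \<in> \<Omega>" using x K.generate_incl[OF S] carrier_K by blast
    have base: "\<exists>g ws. g \<in> H \<and> snd ` set ws \<subseteq> H \<and> x \<otimes>\<^bsub>K\<^esub> ([], k) = wd g ws" if "k \<in> H" for k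
      using base_wd[OF assms(1) gw(1,2) that] gw(3) by (auto simp: mult_incl)
    have tb: "x \<otimes>\<^bsub>K\<^esub> t b = wd g (ws @ [(b, \<one>)])" for b
      using xO gw by (simp add: mult_t wd_snoc wstep_def base_one letter_Omega)
    have t: "\<exists>g ws. g \<in> H \<and> snd ` set ws \<subseteq> H \<and> x \<otimes>\<^bsub>K\<^esub> t b = wd g ws" for b
      using tb[of b] gw by (intro exI[of _ g] exI[of _ "ws @ [(b, \<one>)]"]) auto
    show "(\<exists>g ws. g \<in> H \<and> snd ` set ws \<subseteq> H \<and> x \<otimes>\<^bsub>K\<^esub> s = wd g ws) \<and>
          (\<exists>g ws. g \<in> H \<and> snd ` set ws \<subseteq> H \<and> x \<otimes>\<^bsub>K\<^esub> inv\<^bsub>K\<^esub> s = wd g ws)"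
    proof (cases "s = t True")
      case True then show ?thesis using t t_inv[of True] by simp
    next
      case False
      then obtain k where "k \<in> H" "s = ([], k)" using s by blast
      then show ?thesis using base[of k] base[of "inv k"] incl_inv[of k] H.subset by auto
    qed
  qed
qed

theorem invariance:
  assumes "subgroup H G" "\<And>b a. a \<in> H \<Longrightarrow> a \<in> D b \<Longrightarrow> F b a \<in> H"
    and "([], g) \<in> generate K (hnn_incl ` H \<union> {t True})"
  shows "g \<in> H"
  using generate_wd[OF assms(1,3)] wd_base[OF assms(1,2)] by metis

lemma carrier_wd: assumes "p \<in> carrier K" shows "\<exists>g ws. g \<in> carrier G \<and> wfw ws \<and> p = wd g ws"
  using assms generate_wd[OF subgroup_self, of p] K_generated by simp

lemma incl_pow: "g \<in> carrier G \<Longrightarrow> ([], g) [^]\<^bsub>K\<^esub> (n::nat) = ([], g [^] n)"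
  by (induct n) (simp_all add: one_K incl_mult)

lemma wd_append: "wfw us \<Longrightarrow> wfw vs \<Longrightarrow> wd \<one> (us @ vs) = wd \<one> us \<otimes>\<^bsub>K\<^esub> wd \<one> vs"
  using mult_foldl[of "wd \<one> us" "([], \<one>)" vs] wd_Omega[of \<one> us]
  by (simp add: wd_def mult_incl base_one)

lemma wd_power: "wfw vs \<Longrightarrow> wd \<one> vs [^]\<^bsub>K\<^esub> (n::nat) = wd \<one> (concat (replicate n vs))"
proof (induct n)
  case (Suc n)
  have "set (concat (replicate n vs)) \<subseteq> set vs" by (induct n) auto
  then have "wfw (concat (replicate n vs))" using Suc.prems by blast
  then have "wd \<one> (concat (replicate n vs) @ vs) = wd \<one> vs [^]\<^bsub>K\<^esub> Suc n" using Suc by (subst wd_append) auto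
  moreover have "concat (replicate n vs) @ vs = concat (replicate (Suc n) vs)"
    by (induct n) auto
  ultimately show ?case by simp
qed (simp add: one_K)

lemma red_power: "red vs \<Longrightarrow> \<not> pinch (last vs) (hd vs) \<Longrightarrow> red (concat (replicate n vs))"
proof (induct n)
  case (Suc n)
  then show ?case by (cases n) (auto simp: red_append)
qed simp

lemma conj_pow: assumes "group M" "p \<in> carrier M" "q \<in> carrier M"
  shows "(inv\<^bsub>M\<^esub> q \<otimes>\<^bsub>M\<^esub> p \<otimes>\<^bsub>M\<^esub> q) [^]\<^bsub>M\<^esub> (n::nat) = inv\<^bsub>M\<^esub> q \<otimes>\<^bsub>M\<^esub> p [^]\<^bsub>M\<^esub> n \<otimes>\<^bsub>M\<^esub> q"
proof -
  interpret M: group M by fact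
  show ?thesis using assms by (induct n) (simp_all add: M.m_assoc)
qed

text \<open>An element with trivial \<open>n\<close>-th power is conjugate to a shorter one, because a cyclically
  reduced word has reduced powers.\<close>

lemma torsion:
  assumes G: "\<And>g. g \<in> carrier G \<Longrightarrow> g [^] n = \<one> \<Longrightarrow> g = \<one>" and n: "(n::nat) > 0"
    and "p \<in> carrier K" "p [^]\<^bsub>K\<^esub> n = \<one>\<^bsub>K\<^esub>"
  shows "p = \<one>\<^bsub>K\<^esub>"
proof -
  have conj: "p = \<one>\<^bsub>K\<^esub>" if "p \<in> carrier K" "q \<in> carrier K" "inv\<^bsub>K\<^esub> q \<otimes>\<^bsub>K\<^esub> p \<otimes>\<^bsub>K\<^esub> q = \<one>\<^bsub>K\<^esub>" for p q
  proof -
    have "q \<otimes>\<^bsub>K\<^esub> (inv\<^bsub>K\<^esub> q \<otimes>\<^bsub>K\<^esub> p \<otimes>\<^bsub>K\<^esub> q) \<otimes>\<^bsub>K\<^esub> inv\<^bsub>K\<^esub> q = p" using that(1,2) by (simp add: K.m_assoc)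
    then show ?thesis using that by simp
  qed
  have "wd g ws = \<one>\<^bsub>K\<^esub>" if "g \<in> carrier G" "wfw ws" "wd g ws [^]\<^bsub>K\<^esub> n = \<one>\<^bsub>K\<^esub>" for g ws
    using that
  proof (induct "length ws" arbitrary: g ws rule: less_induct)
    case less
    let ?p = "wd g ws"
    have pc: "?p \<in> carrier K" using less.prems by (simp add: carrier_K wd_Omega)
    have IH: "?p = \<one>\<^bsub>K\<^esub>" if "q \<in> carrier K" "inv\<^bsub>K\<^esub> q \<otimes>\<^bsub>K\<^esub> ?p \<otimes>\<^bsub>K\<^esub> q = wd h vs" "h \<in> carrier G" "wfw vs"
      "length vs < length ws" for q h vs
    proof (rule conj[OF pc that(1)])
      have "wd h vs [^]\<^bsub>K\<^esub> n = \<one>\<^bsub>K\<^esub>" unfolding that(2)[symmetric] conj_pow[OF group_K pc that(1)]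
        using less.prems that(1) by simp
      then show "inv\<^bsub>K\<^esub> q \<otimes>\<^bsub>K\<^esub> ?p \<otimes>\<^bsub>K\<^esub> q = \<one>\<^bsub>K\<^esub>" using less.hyps that by simp
    qed
    show ?case
    proof (cases ws rule: rev_cases)
      case Nil
      then have "g [^] n = \<one>" using less.prems by (simp add: incl_pow one_K)
      then show ?thesis using G[OF less.prems(1)] Nil by (simp add: one_K)
    next
      case (snoc us z)
      obtain b k where z: "z = (b, k)" by fastforce
      \<comment> \<open>Conjugation by \<open>g\<close> moves the leading base element to the end,
        so that the word can be treated as a cyclic one.\<close>
      define vs where "vs = us @ [(b, k \<otimes> g)]"
      have vs: "wfw vs" "length vs = length ws" "vs \<noteq> []" using snoc z less.prems by (auto simp: vs_def)
      have gK: "([], g) \<in> carrier K" using less.prems by (simp add: carrier_K)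
      have "([], g) \<otimes>\<^bsub>K\<^esub> wd \<one> ws = ?p"
        using less.prems mult_foldl[of "([], g)" "([], \<one>)" ws] by (simp add: wd_def incl_mult)
      then have "inv\<^bsub>K\<^esub> ([], g) \<otimes>\<^bsub>K\<^esub> ?p = wd \<one> ws"
        using K.inv_mult_cancel(2)[OF gK, of "wd \<one> ws"] less.prems by (auto simp: carrier_K wd_Omega)
      then have q: "inv\<^bsub>K\<^esub> ([], g) \<otimes>\<^bsub>K\<^esub> ?p \<otimes>\<^bsub>K\<^esub> ([], g) = wd \<one> vs"
        using less.prems snoc z base_wd_snoc[of \<one> us k g b] by (simp add: mult_incl vs_def)
      have vp: "wd \<one> (concat (replicate n vs)) = ([], \<one>)"
        unfolding wd_power[OF vs(1), symmetric] q[symmetric] conj_pow[OF group_K pc gK]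
        using less.prems(3) K.l_inv[OF gK] gK by (simp add: one_K[symmetric])
      have nn: "concat (replicate n vs) \<noteq> []" using vs n by (cases n) auto
      have nr: "\<not> red (concat (replicate n vs))"
      proof -
        have "set (concat (replicate n vs)) \<subseteq> set vs" by (induct n) auto
        then have "wfw (concat (replicate n vs))" using vs(1) by blast
        then show ?thesis using britton[of \<one> "concat (replicate n vs)"] nn unfolding vp by fastforce
      qed
      show ?thesis
      proof (cases "red vs")
        case False
        have "\<exists>g' ws'. g' \<in> carrier G \<and> wfw ws' \<and> length ws' < length vs \<and> wd \<one> vs = wd g' ws'"
          by (rule wd_shorten[OF subgroup_self _ one_closed vs(1) False]) (rule F_carrier)
        then obtain g' ws' where "g' \<in> carrier G" "wfw ws'" "length ws' < length vs" "wd \<one> vs = wd g' ws'"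
          by blast
        then show ?thesis using IH[OF gK] q vs by simp
      next
        case True
        \<comment> \<open>If the word is reduced and its power is not, the pinch sits at the seam
          between two copies; conjugation by the first letter then cancels two letters.\<close>
        then have p: "pinch (last vs) (hd vs)" using red_power nr by blast
        obtain c h ms where vs2: "vs = (c, h) # ms" using vs(3) by (cases vs) auto
        have lv: "last vs = (b, k \<otimes> g)" by (simp add: vs_def)
        have cb: "c = (\<not> b)" "k \<otimes> g \<in> D c" using p lv vs2 by (auto simp: pinch_def)
        then obtain us' where us: "us = (c, h) # us'" using vs2 by (cases us) (auto simp: vs_def)
        have w: "h \<in> carrier G" "wfw us'" "k \<otimes> g \<in> carrier G" using vs us by (auto simp: vs_def)
        let ?m = "wd h us'"
        have m: "?m \<in> \<Omega>" using w wd_Omega by blast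
        have "wd \<one> vs = t c \<otimes>\<^bsub>K\<^esub> wd h (us' @ [(b, k \<otimes> g)])"
          using w mult_foldl[of "t c" "([], h)" "us' @ [(b, k \<otimes> g)]"] t_Omega
          by (simp add: vs_def us wd_def wstep_def mult_incl letter_one)
        also have "\<dots> = t c \<otimes>\<^bsub>K\<^esub> (?m \<otimes>\<^bsub>K\<^esub> t b \<otimes>\<^bsub>K\<^esub> ([], k \<otimes> g))"
          using m by (simp add: wd_snoc wstep_def mult_t mult_incl)
        finally have e: "wd \<one> vs \<otimes>\<^bsub>K\<^esub> t c = t c \<otimes>\<^bsub>K\<^esub> (?m \<otimes>\<^bsub>K\<^esub> t b \<otimes>\<^bsub>K\<^esub> (([], k \<otimes> g) \<otimes>\<^bsub>K\<^esub> t c))"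
          using m t_Omega w by (simp add: K.m_assoc carrier_K mult_closed)
        have "\<dots> = t c \<otimes>\<^bsub>K\<^esub> (?m \<otimes>\<^bsub>K\<^esub> (t b \<otimes>\<^bsub>K\<^esub> t c) \<otimes>\<^bsub>K\<^esub> ([], F c (k \<otimes> g)))"
          unfolding t_slide[OF cb(2)] using m t_Omega F_carrier[OF cb(2)] by (simp add: K.m_assoc carrier_K mult_closed)
        also have "\<dots> = t c \<otimes>\<^bsub>K\<^esub> bs (F c (k \<otimes> g)) ?m"
          using cb(1) m by (simp add: t_t mult_incl K.r_one[unfolded carrier_K])
        finally have e2: "inv\<^bsub>K\<^esub> t c \<otimes>\<^bsub>K\<^esub> (wd \<one> vs \<otimes>\<^bsub>K\<^esub> t c) = bs (F c (k \<otimes> g)) ?m"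
          unfolding e using K.inv_mult_cancel(2) t_Omega base_Omega[OF m F_carrier[OF cb(2)]] by (simp add: carrier_K)
        obtain g' ws' where gw: "g' \<in> carrier G" "wfw ws'" "length ws' = length us'" "bs (F c (k \<otimes> g)) ?m = wd g' ws'"
          using base_wd[OF subgroup_self w(1,2) F_carrier[OF cb(2)]] by blast
        have tK: "t c \<in> carrier K" using t_Omega by (simp add: carrier_K)
        have "inv\<^bsub>K\<^esub> (([], g) \<otimes>\<^bsub>K\<^esub> t c) \<otimes>\<^bsub>K\<^esub> ?p \<otimes>\<^bsub>K\<^esub> (([], g) \<otimes>\<^bsub>K\<^esub> t c)
            = inv\<^bsub>K\<^esub> t c \<otimes>\<^bsub>K\<^esub> (inv\<^bsub>K\<^esub> ([], g) \<otimes>\<^bsub>K\<^esub> ?p \<otimes>\<^bsub>K\<^esub> ([], g) \<otimes>\<^bsub>K\<^esub> t c)"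
          using gK tK pc by (simp add: K.inv_mult_group K.m_assoc)
        also have "\<dots> = wd g' ws'" unfolding q e2 gw(4) ..
        finally show ?thesis using IH[of "([], g) \<otimes>\<^bsub>K\<^esub> t c" g' ws'] gK tK gw vs(2) vs2 us
          by (simp add: vs_def)
      qed
    qed
  qed
  then show ?thesis using carrier_wd[OF assms(3)] assms(4) by auto
qed

section \<open>Stable letters that commute with a subgroup\<close>

lemma F_id: assumes "\<And>a. a \<in> A \<Longrightarrow> \<phi> a = a" shows "D b = A" "a \<in> A \<Longrightarrow> F b a = a"
proof -
  have *: "\<phi> ` A = A" using assms by simp
  then show "D b = A" by (simp add: hnn_dom_def)
  show "a \<in> A \<Longrightarrow> F b a = a" using inv_into_f_f[OF phi_inj, of a] assms by (simp add: hnn_map_def)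
qed

abbreviation cj where "cj g \<equiv> t False \<otimes>\<^bsub>K\<^esub> ([], g) \<otimes>\<^bsub>K\<^esub> t True"

lemma cj_wd: "g \<in> carrier G \<Longrightarrow> cj g = wd \<one> [(False, g), (True, \<one>)]"
  using t_Omega by (simp add: wd_def wstep_def mult_t mult_incl letter_one base_one letter_Omega base_Omega)

lemma cj_base: assumes "g \<in> carrier G" "cj g = ([], h)" shows "g \<in> A"
proof -
  have "\<not> red [(False, g), (True, \<one>)]"
    using britton[of \<one> "[(False, g), (True, \<one>)]"] assms by (auto simp: cj_wd)
  then show ?thesis by (simp add: pinch_def hnn_dom_def)
qed

lemma cj_A: assumes "a \<in> A" "\<phi> a = a" shows "cj a = ([], a)"
proof -
  have "a \<in> D True" using assms by (simp add: hnn_dom_def)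
  then have a: "a \<in> D True" "a \<in> carrier G" using D_carrier by auto
  have "cj a = t False \<otimes>\<^bsub>K\<^esub> (t True \<otimes>\<^bsub>K\<^esub> ([], F True a))"
    using t_slide[OF a(1)] a t_Omega by (simp add: K.m_assoc carrier_K)
  also have "\<dots> = ([], F True a)"
    using t_t[of False] a t_Omega assms K.m_assoc[of "t False" "t True" "([], F True a)"] K.l_one[of "([], a)"]
    by (simp add: carrier_K hnn_map_def)
  finally show ?thesis using assms by (simp add: hnn_map_def)
qed

text \<open>The elements in question alternate between \<open>t\<close>-conjugates of elements of
  \<open>P\<close> and elements of \<open>C\<close>. By Britton's lemma such a word with value in
  the base has a pinch: either a conjugated entry is in \<open>A\<close>, commutes with
  \<open>t\<close> and is absorbed into \<open>C\<close>, or an entry from \<open>C\<close> between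
  two conjugates is in \<open>A\<close>, hence in \<open>P\<close>, and merges its two
  neighbours.\<close>

lemma join_base:
  assumes id: "\<And>a. a \<in> A \<Longrightarrow> \<phi> a = a"
    and P: "subgroup P G" and C: "subgroup C G" and AP: "A \<inter> P \<subseteq> C" and CA: "C \<inter> A \<subseteq> P"
    and g: "([], g) \<in> generate K (cj ` P \<union> hnn_incl ` C)"
  shows "g \<in> C"
proof -
  interpret P: subgroup P G by fact
  interpret C: subgroup C G by fact
  have F: "D b = A" "a \<in> A \<Longrightarrow> F b a = a" for a b using F_id id by blast+
  \<comment> \<open>The pair \<open>(x, c)\<close> stands for \<open>t^-1 x t c\<close>.\<close>
  define W where "W ps = concat (map (\<lambda>(x, c). [(False, x), (True, c)]) ps)" for ps :: "('a \<times> 'a) list"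
  have W: "W [] = []" "W (p # ps) = (False, fst p) # (True, snd p) # W ps" "W (ps @ qs) = W ps @ W qs" for p ps qs
    by (auto simp: W_def split: prod.split)
  have Wwf: "set ps \<subseteq> P \<times> C \<Longrightarrow> wfw (W ps)" for ps
    using P.subset C.subset by (induct ps) (auto simp: W)
  have S: "cj ` P \<union> hnn_incl ` C \<subseteq> carrier K"
    using P.subset C.subset t_Omega by (auto simp: carrier_K mult_closed)
  have ext: "\<exists>c' ps'. c' \<in> C \<and> set ps' \<subseteq> P \<times> C \<and> bs k (wd c (W ps)) = wd c' (W ps')"
    if "c \<in> C" "set ps \<subseteq> P \<times> C" "k \<in> C" for c ps k
  proof (cases ps rule: rev_cases)
    case Nil then show ?thesis using that by (auto simp: W hnn_base_def intro!: exI[of _ "c \<otimes> k"] exI[of _ "[]"])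
  next
    case (snoc qs z)
    obtain x d where z: "z = (x, d)" by fastforce
    have "bs k (wd c (W ps)) = wd c (W (qs @ [(x, d \<otimes> k)]))"
      using snoc z that Wwf[of qs] P.subset C.subset base_wd_snoc[of c "W qs @ [(False, x)]" d k True]
      by (auto simp: W)
    then show ?thesis using that snoc z by (intro exI[of _ c] exI[of _ "qs @ [(x, d \<otimes> k)]"]) auto
  qed
  have gen: "\<exists>c ps. c \<in> C \<and> set ps \<subseteq> P \<times> C \<and> ([], g) = wd c (W ps)"
  proof (rule K.generate_right_induct[OF S g])
    show "\<exists>c ps. c \<in> C \<and> set ps \<subseteq> P \<times> C \<and> \<one>\<^bsub>K\<^esub> = wd c (W ps)"
      by (intro exI[of _ \<one>] exI[of _ "[]"]) (simp add: one_K W)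
  next
    fix x s assume x: "x \<in> generate K (cj ` P \<union> hnn_incl ` C)"
      and "\<exists>c ps. c \<in> C \<and> set ps \<subseteq> P \<times> C \<and> x = wd c (W ps)" and s: "s \<in> cj ` P \<union> hnn_incl ` C"
    then obtain c ps where gw: "c \<in> C" "set ps \<subseteq> P \<times> C" "x = wd c (W ps)" by blast
    have xO: "x \<in> \<Omega>" using x K.generate_incl[OF S] carrier_K by blast
    have base: "\<exists>g ps. g \<in> C \<and> set ps \<subseteq> P \<times> C \<and> x \<otimes>\<^bsub>K\<^esub> ([], k) = wd g (W ps)" if "k \<in> C" for k
      using ext[OF gw(1,2) that] gw(3) by (auto simp: mult_incl)
    have cj: "\<exists>g ps. g \<in> C \<and> set ps \<subseteq> P \<times> C \<and> x \<otimes>\<^bsub>K\<^esub> cj k = wd g (W ps)" if "k \<in> P" for k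
    proof -
      have k: "k \<in> carrier G" using that P.subset by blast
      have "x \<otimes>\<^bsub>K\<^esub> cj k = foldl wstep x [(False, k), (True, \<one>)]"
        unfolding cj_wd[OF k] wd_def using k mult_foldl[OF xO, of "([], \<one>)" "[(False, k), (True, \<one>)]"]
        by (simp only: mult_incl base_one[OF xO]) simp
      then have "x \<otimes>\<^bsub>K\<^esub> cj k = wd c (W (ps @ [(k, \<one>)]))" unfolding gw(3) by (simp add: W wd_def)
      then show ?thesis using gw that by (intro exI[of _ c] exI[of _ "ps @ [(k, \<one>)]"]) auto
    qed
    have ic: "inv\<^bsub>K\<^esub> (cj k) = cj (inv k)" if "k \<in> P" for k
    proof -
      have k: "k \<in> carrier G" "([], k) \<in> carrier K" "t True \<in> carrier K" "t False \<in> carrier K"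
        using that P.subset t_Omega by (auto simp: carrier_K)
      then show ?thesis using t_inv[of True] t_inv[of False] incl_inv[of k] K.inv_closed[OF k(2)]
        by (simp add: K.inv_mult_group K.m_assoc)
    qed
    show "(\<exists>c ps. c \<in> C \<and> set ps \<subseteq> P \<times> C \<and> x \<otimes>\<^bsub>K\<^esub> s = wd c (W ps)) \<and>
          (\<exists>c ps. c \<in> C \<and> set ps \<subseteq> P \<times> C \<and> x \<otimes>\<^bsub>K\<^esub> inv\<^bsub>K\<^esub> s = wd c (W ps))"
    proof (cases "s \<in> cj ` P")
      case True then show ?thesis using cj ic by auto
    next
      case False
      then obtain k where "k \<in> C" "s = ([], k)" using s by blast
      then show ?thesis using base[of k] base[of "inv k"] incl_inv[of k] C.subset by auto
    qed
  qed
  have nred: "(\<exists>qs x c rs. ps = qs @ (x, c) # rs \<and> x \<in> A) \<or>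
      (\<exists>qs x c y d rs. ps = qs @ (x, c) # (y, d) # rs \<and> c \<in> A)" if "\<not> red (W ps)" for ps
    using that
  proof (induct ps)
    case (Cons p ps)
    show ?case
    proof (cases "fst p \<in> A \<or> (snd p \<in> A \<and> ps \<noteq> [])")
      case True then show ?thesis by (metis append_Nil neq_Nil_conv prod.collapse)
    next
      case False
      then have "\<not> red (W ps)" using Cons.prems
        by (cases ps) (auto simp: W pinch_def F)
      then show ?thesis using Cons.hyps by (metis append_Cons)
    qed
  qed (simp add: W)
  have "g \<in> C" if "c \<in> C" "set ps \<subseteq> P \<times> C" "([], g) = wd c (W ps)" for c ps
    using that
  proof (induct "length ps" arbitrary: c ps rule: less_induct)
    case less
    have c: "c \<in> carrier G" using less.prems by simp
    show ?case
    proof (cases "red (W ps)")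
      case True
      have "W ps = []" using britton[OF c Wwf[OF less.prems(2)] _ True] less.prems(3) by (metis fst_conv)
      then show ?thesis using less.prems by simp
    next
      case False
      consider (1) qs x d rs where "ps = qs @ (x, d) # rs" "x \<in> A"
        | (2) qs x d y e rs where "ps = qs @ (x, d) # (y, e) # rs" "d \<in> A"
        using nred[OF False] by blast
      then show ?thesis
      proof cases
        case 1
        have x: "x \<in> P" "d \<in> C" "x \<in> C" "set rs \<subseteq> P \<times> C" using 1 less.prems AP by auto
        have pin: "pinch (False, x) (True, d)" using 1 by (simp add: pinch_def F)
        show ?thesis
        proof (cases qs rule: rev_cases)
          case Nil
          have "wd c (W ps) = wd (c \<otimes> (x \<otimes> d)) (W rs)"
            using wd_pinch_first[OF c _ pin, of "W rs"] Wwf[of rs] x F(2)[OF 1(2)] 1 Nil by (simp add: W)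
          then show ?thesis using less.prems x 1 Nil by (intro less.hyps[of rs "c \<otimes> (x \<otimes> d)"]) auto
        next
          case (snoc qs' z)
          obtain y e where z: "z = (y, e)" by fastforce
          have y: "y \<in> P" "e \<in> C" "set qs' \<subseteq> P \<times> C" using 1 snoc z less.prems by auto
          have wfs: "wfw ((W qs' @ [(False, y)]) @ (True, e) # (False, x) # (True, d) # W rs)"
            using Wwf[of rs] Wwf[of qs'] x y by (simp add: image_Un subset_iff)
          have "wd c (W ps) = wd c (W (qs' @ (y, e \<otimes> (x \<otimes> d)) # rs))"
            using wd_pinch_later[OF c wfs pin] F(2)[OF 1(2)] 1 snoc z by (simp add: W)
          then show ?thesis using less.prems x y 1 snoc z
            by (intro less.hyps[of "qs' @ (y, e \<otimes> (x \<otimes> d)) # rs" c]) auto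
        qed
      next
        case 2
        have x: "x \<in> P" "d \<in> C" "y \<in> P" "e \<in> C" "d \<in> P" "set rs \<subseteq> P \<times> C" "set qs \<subseteq> P \<times> C"
          using 2 less.prems CA by auto
        have pin: "pinch (True, d) (False, y)" using 2 by (simp add: pinch_def F)
        have wfs: "wfw (W qs @ (False, x) # (True, d) # (False, y) # (True, e) # W rs)"
          using Wwf[of rs] Wwf[of qs] x by (simp add: image_Un subset_iff)
        have "wd c (W ps) = wd c (W (qs @ (x \<otimes> (d \<otimes> y), e) # rs))"
          using wd_pinch_later[OF c wfs pin] F(2)[OF 2(2)] 2(1) by (simp add: W)
        then show ?thesis using less.prems x 2
          by (intro less.hyps[of "qs @ (x \<otimes> (d \<otimes> y), e) # rs" c]) auto
      qed
    qed
  qed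
  then show ?thesis using gen by blast
qed

end

section \<open>Finite presentations without words\<close>

lemma group_homI: "group G \<Longrightarrow> group H \<Longrightarrow> h \<in> hom G H \<Longrightarrow> group_hom G H h"
  by (simp add: group_hom_def group_hom_axioms_def)

lemma hom_eq_generate:
  assumes "group K" "group M" "h \<in> hom K M" "k \<in> hom K M" "S \<subseteq> carrier K" "\<And>x. x \<in> S \<Longrightarrow> h x = k x"
    and "x \<in> generate K S"
  shows "h x = k x"
proof -
  interpret h: group_hom K M h by (rule group_homI[OF assms(1-3)])
  interpret k: group_hom K M k by (rule group_homI[OF assms(1,2,4)])
  show ?thesis using assms(7)
  proof (induct rule: generate.induct)
    case (eng x y)
    then have "x \<in> carrier K" "y \<in> carrier K" using h.G.generate_incl[OF assms(5)] by auto
    then show ?case by (simp only: h.hom_mult k.hom_mult eng)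
  next
    case (inv x)
    then have "x \<in> carrier K" using assms(5) by blast
    then show ?case by (simp only: h.hom_inv k.hom_inv assms(6)[OF inv])
  next
    case (incl x) then show ?case by (rule assms(6))
  qed simp
qed

text \<open>An interpretation of the generators \<open>C\<close> in \<open>M\<close> that satisfies
  every relator \<open>x y = z\<close> of the multiplication table of \<open>C\<close>.\<close>

definition part_hom :: "('a, 'c) monoid_scheme \<Rightarrow> 'a set \<Rightarrow> ('b, 'd) monoid_scheme \<Rightarrow> ('a \<Rightarrow> 'b) \<Rightarrow> bool" where
  "part_hom K C M m \<longleftrightarrow> m \<in> C \<rightarrow> carrier M \<and>
     (\<forall>x\<in>C. \<forall>y\<in>C. x \<otimes>\<^bsub>K\<^esub> y \<in> C \<longrightarrow> m (x \<otimes>\<^bsub>K\<^esub> y) = m x \<otimes>\<^bsub>M\<^esub> m y)"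

text \<open>\<open>K\<close> is finitely presented by the products \<open>x y = z\<close> that hold inside the finite set \<open>C\<close>.  A
  definition cannot quantify over types, so the universal property is demanded only for groups on
  the carrier type of \<open>pres_group\<close>, which suffices by \<open>fp_on_presentation\<close>.\<close>

definition fp_on :: "('a, 'c) monoid_scheme \<Rightarrow> 'a set \<Rightarrow> bool" where
  "fp_on K C \<longleftrightarrow> finite C \<and> C \<subseteq> carrier K \<and> generate K C = carrier K \<and>
     (\<forall>(M :: word set monoid) m. group M \<longrightarrow> part_hom K C M m \<longrightarrow> (\<exists>h\<in>hom K M. \<forall>x\<in>C. h x = m x))"

definition torfree :: "nat \<Rightarrow> ('a, 'c) monoid_scheme \<Rightarrow> bool" where
  "torfree n K \<longleftrightarrow> (\<forall>g\<in>carrier K. g [^]\<^bsub>K\<^esub> n = \<one>\<^bsub>K\<^esub> \<longrightarrow> g = \<one>\<^bsub>K\<^esub>)"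

definition fpt :: "('a, 'c) monoid_scheme \<Rightarrow> bool" where
  "fpt K \<longleftrightarrow> group K \<and> (\<exists>C. fp_on K C) \<and> (\<forall>n>0. torfree n K)"

section \<open>Enlarging a multiplication table\<close>

lemma fp_onD: "fp_on K C \<Longrightarrow> group (M :: word set monoid) \<Longrightarrow> part_hom K C M m \<Longrightarrow>
    \<exists>h\<in>hom K M. \<forall>x\<in>C. h x = m x"
  unfolding fp_on_def by blast

lemma fpt_group: "fpt K \<Longrightarrow> group K" by (simp add: fpt_def)

lemma part_hom_mono: "part_hom K C' M m \<Longrightarrow> C \<subseteq> C' \<Longrightarrow> part_hom K C M m"
  unfolding part_hom_def by blast

lemma part_hom_mult: "part_hom K C M m \<Longrightarrow> x \<in> C \<Longrightarrow> y \<in> C \<Longrightarrow> x \<otimes>\<^bsub>K\<^esub> y \<in> C \<Longrightarrow>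
    m (x \<otimes>\<^bsub>K\<^esub> y) = m x \<otimes>\<^bsub>M\<^esub> m y"
  unfolding part_hom_def by blast

lemma part_hom_closed: "part_hom K C M m \<Longrightarrow> x \<in> C \<Longrightarrow> m x \<in> carrier M"
  unfolding part_hom_def by blast

lemma part_hom_comp:
  assumes "part_hom K' C' M m" "i \<in> hom K K'" "C \<subseteq> carrier K" "i ` C \<subseteq> C'"
  shows "part_hom K C M (m \<circ> i)"
  unfolding part_hom_def
proof (intro conjI ballI impI funcsetI)
  fix x y assume xy: "x \<in> C" "y \<in> C" "x \<otimes>\<^bsub>K\<^esub> y \<in> C"
  have "i (x \<otimes>\<^bsub>K\<^esub> y) = i x \<otimes>\<^bsub>K'\<^esub> i y" using xy assms(2,3) by (auto simp: hom_def)
  moreover have "i x \<in> C'" "i y \<in> C'" "i (x \<otimes>\<^bsub>K\<^esub> y) \<in> C'" using xy assms(4) by auto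
  ultimately show "(m \<circ> i) (x \<otimes>\<^bsub>K\<^esub> y) = (m \<circ> i) x \<otimes>\<^bsub>M\<^esub> (m \<circ> i) y"
    using part_hom_mult[OF assms(1), of "i x" "i y"] by simp
qed (use assms in \<open>auto simp: part_hom_def\<close>)

lemma part_hom_one:
  assumes "part_hom K C M m" "group M" "group K" "\<one>\<^bsub>K\<^esub> \<in> C"
  shows "m \<one>\<^bsub>K\<^esub> = \<one>\<^bsub>M\<^esub>"
proof -
  interpret K: group K by fact
  interpret M: group M by fact
  have c: "m \<one>\<^bsub>K\<^esub> \<in> carrier M" by (rule part_hom_closed[OF assms(1,4)])
  have "m \<one>\<^bsub>K\<^esub> \<otimes>\<^bsub>M\<^esub> m \<one>\<^bsub>K\<^esub> = m \<one>\<^bsub>K\<^esub>"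
    using part_hom_mult[OF assms(1,4,4)] assms(4) K.r_one[OF K.one_closed] by argo
  then show ?thesis using M.l_cancel_one[OF c c] by blast
qed

text \<open>A Tietze move: a new element may enter the table once its value under every
  interpretation is forced by the old ones.\<close>

lemma fp_insert:
  assumes "fp_on K C" "x \<in> carrier K" "group K"
    and "\<And>(M :: word set monoid) m h. group M \<Longrightarrow> part_hom K (insert x C) M m \<Longrightarrow> h \<in> hom K M \<Longrightarrow>
           \<forall>y\<in>C. h y = m y \<Longrightarrow> h x = m x"
  shows "fp_on K (insert x C)"
  unfolding fp_on_def
proof (intro conjI allI impI)
  interpret group K by fact
  show "generate K (insert x C) = carrier K"
    using mono_generate[of C "insert x C"] generate_incl[of "insert x C"] assms(1,2) by (auto simp: fp_on_def)
next
  fix M :: "word set monoid" and m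
  assume M: "group M" "part_hom K (insert x C) M m"
  then obtain h where h: "h \<in> hom K M" "\<forall>y\<in>C. h y = m y"
    using assms(1) part_hom_mono[of K "insert x C" M m C] unfolding fp_on_def by blast
  then show "\<exists>h\<in>hom K M. \<forall>y\<in>insert x C. h y = m y" using assms(4)[OF M h] by auto
qed (use assms in \<open>auto simp: fp_on_def\<close>)

lemma fp_insert_one: assumes "fp_on K C" "group K" shows "fp_on K (insert \<one>\<^bsub>K\<^esub> C)"
proof (rule fp_insert[OF assms(1) _ assms(2)])
  interpret group K by fact
  show "\<one>\<^bsub>K\<^esub> \<in> carrier K" by simp
  fix M :: "word set monoid" and m h
  assume a: "group M" "part_hom K (insert \<one>\<^bsub>K\<^esub> C) M m" "h \<in> hom K M"
  interpret M: group M by fact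
  have "m \<one>\<^bsub>K\<^esub> = \<one>\<^bsub>M\<^esub>" by (rule part_hom_one[OF a(2,1) assms(2)]) simp
  then show "h \<one>\<^bsub>K\<^esub> = m \<one>\<^bsub>K\<^esub>" using hom_one[OF a(3) is_group a(1)] by simp
qed

lemma part_hom_inv:
  assumes "part_hom K C M m" "group M" "group K" "x \<in> C" "\<one>\<^bsub>K\<^esub> \<in> C" "inv\<^bsub>K\<^esub> x \<in> C" "x \<in> carrier K"
  shows "m (inv\<^bsub>K\<^esub> x) = inv\<^bsub>M\<^esub> (m x)"
proof -
  interpret K: group K by fact
  interpret M: group M by fact
  have c: "m x \<in> carrier M" "m (inv\<^bsub>K\<^esub> x) \<in> carrier M" using part_hom_closed[OF assms(1)] assms(4,6) by auto
  have "m (inv\<^bsub>K\<^esub> x \<otimes>\<^bsub>K\<^esub> x) = m (inv\<^bsub>K\<^esub> x) \<otimes>\<^bsub>M\<^esub> m x"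
    by (rule part_hom_mult[OF assms(1)]) (use assms(4-6) K.l_inv[OF assms(7)] in auto)
  then have "m (inv\<^bsub>K\<^esub> x) \<otimes>\<^bsub>M\<^esub> m x = \<one>\<^bsub>M\<^esub>"
    using part_hom_one[OF assms(1-3,5)] K.l_inv[OF assms(7)] by simp
  then show ?thesis using M.inv_equality[OF _ c] by simp
qed

text \<open>The table grows along a derivation of \<open>x\<close> from the generators. Every
  intermediate product or inverse enters it, so that each new value is forced by entries already
  present; for an inverse the identity has to be there first.\<close>

lemma fp_enlarge:
  assumes "group K" "x \<in> generate K C0"
  shows "C0 \<subseteq> C \<Longrightarrow> fp_on K C \<Longrightarrow> \<exists>C'. C \<subseteq> C' \<and> x \<in> C' \<and> fp_on K C'"
  using assms(2)
proof (induct x arbitrary: C rule: generate.induct)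
  case one
  then show ?case using fp_insert_one[OF one(2) assms(1)] by blast
next
  case (incl h) then show ?case by blast
next
  case (inv h)
  interpret K: group K by fact
  let ?C = "insert \<one>\<^bsub>K\<^esub> C"
  have C: "fp_on K ?C" using fp_insert_one[OF inv(3) assms(1)] .
  have h: "h \<in> C" "h \<in> carrier K" using inv by (auto simp: fp_on_def)
  have "fp_on K (insert (inv\<^bsub>K\<^esub> h) ?C)"
  proof (rule fp_insert[OF C _ assms(1)])
    fix M :: "word set monoid" and m k
    assume a: "group M" "part_hom K (insert (inv\<^bsub>K\<^esub> h) ?C) M m" "k \<in> hom K M" "\<forall>y\<in>?C. k y = m y"
    then show "k (inv\<^bsub>K\<^esub> h) = m (inv\<^bsub>K\<^esub> h)"
      using part_hom_inv[OF a(2,1) assms(1), of h] h group_hom.hom_inv[OF group_homI[OF assms(1) a(1,3)] h(2)] by simp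
  qed (use h in simp)
  then show ?case by (intro exI[of _ "insert (inv\<^bsub>K\<^esub> h) ?C"]) auto
next
  case (eng x y)
  interpret K: group K by fact
  obtain C1 where C1: "C \<subseteq> C1" "x \<in> C1" "fp_on K C1" using eng(2)[OF eng(5,6)] by blast
  obtain C2 where C2: "C1 \<subseteq> C2" "y \<in> C2" "fp_on K C2" using eng(4)[of C1] eng(5) C1 by blast
  have xy: "x \<in> C2" "y \<in> C2" "x \<in> carrier K" "y \<in> carrier K" using C1 C2 by (auto simp: fp_on_def)
  have "fp_on K (insert (x \<otimes>\<^bsub>K\<^esub> y) C2)"
  proof (rule fp_insert[OF C2(3) _ assms(1)])
    fix M :: "word set monoid" and m k
    assume a: "group M" "part_hom K (insert (x \<otimes>\<^bsub>K\<^esub> y) C2) M m" "k \<in> hom K M" "\<forall>z\<in>C2. k z = m z"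
    then show "k (x \<otimes>\<^bsub>K\<^esub> y) = m (x \<otimes>\<^bsub>K\<^esub> y)" using xy by (auto simp: part_hom_def hom_def)
  qed (use xy in simp)
  then show ?case using C1(1) C2(1) by (intro exI[of _ "insert (x \<otimes>\<^bsub>K\<^esub> y) C2"]) auto
qed

lemma fp_enlarge_set:
  assumes "group K" "fp_on K C" "finite B" "B \<subseteq> carrier K"
  shows "\<exists>C'. C \<union> B \<subseteq> C' \<and> fp_on K C'"
  using assms(3,4)
proof (induct B rule: finite_induct)
  case empty then show ?case using assms by auto
next
  case (insert x B)
  then obtain C' where C': "C \<union> B \<subseteq> C'" "fp_on K C'" by auto
  have "x \<in> generate K C'" using C' insert by (auto simp: fp_on_def)
  then obtain C'' where "C' \<subseteq> C''" "x \<in> C''" "fp_on K C''" using fp_enlarge[OF assms(1) _ order_refl C'(2)] by blast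
  then show ?case using C' by blast
qed

lemma fp_obtain:
  assumes "fpt K" "finite B" "B \<subseteq> carrier K"
  obtains C where "B \<subseteq> C" "\<one>\<^bsub>K\<^esub> \<in> C" "fp_on K C"
proof -
  interpret group K using assms fpt_group by blast
  obtain C0 where "fp_on K C0" using assms by (auto simp: fpt_def)
  from fp_enlarge_set[OF is_group this, of "insert \<one>\<^bsub>K\<^esub> B"] assms show ?thesis using that by auto
qed

section \<open>Finite presentations of the integers, of direct products and of HNN
  extensions\<close>

lemma torfree_inj:
  assumes "torfree n M" "h \<in> hom K M" "inj_on h (carrier K)" "group K" "group M"
  shows "torfree n K"
  unfolding torfree_def
proof (intro ballI impI)
  interpret h: group_hom K M h by (rule group_homI[OF assms(4,5,2)])
  fix g assume g: "g \<in> carrier K" "g [^]\<^bsub>K\<^esub> n = \<one>\<^bsub>K\<^esub>"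
  then have "h g [^]\<^bsub>M\<^esub> n = \<one>\<^bsub>M\<^esub>" by (metis h.hom_nat_pow h.hom_one)
  then have "h g = \<one>\<^bsub>M\<^esub>" using assms(1) g by (simp add: torfree_def)
  then show "g = \<one>\<^bsub>K\<^esub>" using inj_onD[OF assms(3), of g "\<one>\<^bsub>K\<^esub>"] g by simp
qed

text \<open>The table on \<open>{1}\<close> contains no product, since 1 + 1 is not 1. It presents
  the free group of rank one.\<close>

lemma fpt_int: "fpt integer_group"
proof -
  interpret Z: group integer_group by simp
  have g: "generate integer_group {1} = carrier integer_group"
    using Z.generate_pow[of 1] by (auto intro: image_eqI)
  have "\<exists>h\<in>hom integer_group M. \<forall>x\<in>{1}. h x = m x"
    if "group M" "part_hom integer_group {1} M m" for M :: "word set monoid" and m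
  proof -
    interpret M: group M by fact
    have "m 1 \<in> carrier M" using that by (auto simp: part_hom_def)
    then show ?thesis using M.hom_integer_group_pow[of "m 1"] by (intro bexI[of _ "pow M (m 1)"]) auto
  qed
  then have "fp_on integer_group {1}" using g by (auto simp: fp_on_def)
  then show ?thesis by (auto simp: fpt_def torfree_def)
qed

lemma nat_pow_DirProd: "(x, y) [^]\<^bsub>G \<times>\<times> H\<^esub> (n::nat) = (x [^]\<^bsub>G\<^esub> n, y [^]\<^bsub>H\<^esub> n)"
  by (induct n) auto

lemma torfree_prod: "torfree n G \<Longrightarrow> torfree n H \<Longrightarrow> torfree n (G \<times>\<times> H)"
  by (auto simp: torfree_def nat_pow_DirProd)

text \<open>Commuting with \<open>a\<close> means that \<open>h\<close> agrees with its conjugate by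
  \<open>a\<close>, and homomorphisms that agree on generators agree on what these generate.\<close>

lemma comm_generate:
  assumes "group M" "a \<in> carrier M" "group K" "h \<in> hom K M" "S \<subseteq> carrier K"
    and "\<And>x. x \<in> S \<Longrightarrow> h x \<otimes>\<^bsub>M\<^esub> a = a \<otimes>\<^bsub>M\<^esub> h x" and "x \<in> generate K S"
  shows "h x \<otimes>\<^bsub>M\<^esub> a = a \<otimes>\<^bsub>M\<^esub> h x"
proof -
  interpret h: group_hom K M h by (rule group_homI[OF assms(3,1,4)])
  have "x \<in> generate K S \<Longrightarrow> h x = a \<otimes>\<^bsub>M\<^esub> h x \<otimes>\<^bsub>M\<^esub> inv\<^bsub>M\<^esub> a"
  proof (rule hom_eq_generate[OF assms(3,1,4) _ assms(5)])
    show "(\<lambda>x. a \<otimes>\<^bsub>M\<^esub> h x \<otimes>\<^bsub>M\<^esub> inv\<^bsub>M\<^esub> a) \<in> hom K M"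
      using assms(2) by (auto simp: hom_def h.H.m_assoc)
    fix x assume "x \<in> S"
    then have "h x \<in> carrier M" "h x \<otimes>\<^bsub>M\<^esub> a = a \<otimes>\<^bsub>M\<^esub> h x" using assms by auto
    then show "h x = a \<otimes>\<^bsub>M\<^esub> h x \<otimes>\<^bsub>M\<^esub> inv\<^bsub>M\<^esub> a" using assms(2) by (metis h.H.inv_solve_right h.H.m_closed)
  qed simp
  then show ?thesis using assms h.G.generate_incl[OF assms(5)]
    by (metis h.H.inv_solve_right h.H.m_closed h.hom_closed subsetD)
qed

lemma hom_prod_glue:
  assumes "group G" "group H" "group M" "h \<in> hom G M" "k \<in> hom H M" "S \<subseteq> carrier G" "T \<subseteq> carrier H"
    and "generate G S = carrier G" "generate H T = carrier H"
    and comm: "\<And>x y. x \<in> S \<Longrightarrow> y \<in> T \<Longrightarrow> h x \<otimes>\<^bsub>M\<^esub> k y = k y \<otimes>\<^bsub>M\<^esub> h x"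
  shows "(\<lambda>p. h (fst p) \<otimes>\<^bsub>M\<^esub> k (snd p)) \<in> hom (G \<times>\<times> H) M"
proof -
  interpret M: group M by fact
  have hk: "\<And>x. x \<in> carrier G \<Longrightarrow> h x \<in> carrier M" "\<And>x. x \<in> carrier H \<Longrightarrow> k x \<in> carrier M"
    using assms by (auto simp: hom_def)
  have 1: "h x \<otimes>\<^bsub>M\<^esub> k y = k y \<otimes>\<^bsub>M\<^esub> h x" if "x \<in> carrier G" "y \<in> T" for x y
    by (rule comm_generate[where h = h, OF assms(3) _ assms(1,4,6)]) (use that hk comm assms(7-9) in auto)
  have 2: "h x \<otimes>\<^bsub>M\<^esub> k y = k y \<otimes>\<^bsub>M\<^esub> h x" if "x \<in> carrier G" "y \<in> carrier H" for x y
  proof -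
    have "k y \<otimes>\<^bsub>M\<^esub> h x = h x \<otimes>\<^bsub>M\<^esub> k y"
      by (rule comm_generate[where h = k, OF assms(3) _ assms(2,5,7)]) (use that hk 1 assms(8,9) in auto)
    then show ?thesis by simp
  qed
  show ?thesis
  proof (rule homI)
    fix p q assume "p \<in> carrier (G \<times>\<times> H)" "q \<in> carrier (G \<times>\<times> H)"
    then obtain x y u v where pq: "p = (x, y)" "q = (u, v)" "x \<in> carrier G" "u \<in> carrier G" "y \<in> carrier H" "v \<in> carrier H"
      by (cases p, cases q) (simp add: DirProd_def)
    have "h x \<otimes>\<^bsub>M\<^esub> h u \<otimes>\<^bsub>M\<^esub> (k y \<otimes>\<^bsub>M\<^esub> k v) = h x \<otimes>\<^bsub>M\<^esub> (h u \<otimes>\<^bsub>M\<^esub> k y) \<otimes>\<^bsub>M\<^esub> k v" using pq hk by (simp add: M.m_assoc)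
    also have "\<dots> = h x \<otimes>\<^bsub>M\<^esub> k y \<otimes>\<^bsub>M\<^esub> (h u \<otimes>\<^bsub>M\<^esub> k v)" using 2[of u y] pq hk by (simp add: M.m_assoc)
    finally show "h (fst (p \<otimes>\<^bsub>G \<times>\<times> H\<^esub> q)) \<otimes>\<^bsub>M\<^esub> k (snd (p \<otimes>\<^bsub>G \<times>\<times> H\<^esub> q)) =
        h (fst p) \<otimes>\<^bsub>M\<^esub> k (snd p) \<otimes>\<^bsub>M\<^esub> (h (fst q) \<otimes>\<^bsub>M\<^esub> k (snd q))"
      using pq hom_mult[OF assms(4)] hom_mult[OF assms(5)] by simp
  qed (use hk in auto)
qed

text \<open>The identities in \<open>S\<close> and \<open>T\<close> make each factor available
  separately inside \<open>S \<times> T\<close>.\<close>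

lemma generate_prod:
  assumes "group G" "group H" "S \<subseteq> carrier G" "T \<subseteq> carrier H"
    and "\<one>\<^bsub>G\<^esub> \<in> S" "\<one>\<^bsub>H\<^esub> \<in> T"
  shows "generate (G \<times>\<times> H) (S \<times> T) = generate G S \<times> generate H T"
proof
  interpret G: group G by fact
  interpret H: group H by fact
  interpret P: group "G \<times>\<times> H" using assms DirProd_group by blast
  have sub: "subgroup (generate G S \<times> generate H T) (G \<times>\<times> H)"
    by (rule DirProd_subgroups[OF G.is_group G.generate_is_subgroup[OF assms(3)] H.is_group
          H.generate_is_subgroup[OF assms(4)]])
  show "generate (G \<times>\<times> H) (S \<times> T) \<subseteq> generate G S \<times> generate H T"
    by (rule P.generate_subgroup_incl[OF _ sub]) (auto intro: generate.incl)
  have l: "(\<lambda>x. (x, \<one>\<^bsub>H\<^esub>)) \<in> hom G (G \<times>\<times> H)" "(\<lambda>y. (\<one>\<^bsub>G\<^esub>, y)) \<in> hom H (G \<times>\<times> H)" by (auto simp: hom_def)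
  interpret l: group_hom G "G \<times>\<times> H" "\<lambda>x. (x, \<one>\<^bsub>H\<^esub>)" using l by (intro group_homI G.is_group P.is_group)
  interpret r: group_hom H "G \<times>\<times> H" "\<lambda>y. (\<one>\<^bsub>G\<^esub>, y)" using l by (intro group_homI H.is_group P.is_group)
  show "generate G S \<times> generate H T \<subseteq> generate (G \<times>\<times> H) (S \<times> T)"
  proof clarify
    fix x y assume xy: "x \<in> generate G S" "y \<in> generate H T"
    have "(x, \<one>\<^bsub>H\<^esub>) \<in> generate (G \<times>\<times> H) ((\<lambda>x. (x, \<one>\<^bsub>H\<^esub>)) ` S)" using l.generate_img[OF assms(3)] xy by blast
    moreover have "(\<one>\<^bsub>G\<^esub>, y) \<in> generate (G \<times>\<times> H) ((\<lambda>y. (\<one>\<^bsub>G\<^esub>, y)) ` T)" using r.generate_img[OF assms(4)] xy by blast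
    ultimately have "(x, \<one>\<^bsub>H\<^esub>) \<in> generate (G \<times>\<times> H) (S \<times> T)" "(\<one>\<^bsub>G\<^esub>, y) \<in> generate (G \<times>\<times> H) (S \<times> T)"
      using P.mono_generate[of "(\<lambda>x. (x, \<one>\<^bsub>H\<^esub>)) ` S" "S \<times> T"] P.mono_generate[of "(\<lambda>y. (\<one>\<^bsub>G\<^esub>, y)) ` T" "S \<times> T"] assms by auto
    from generate.eng[OF this] show "(x, y) \<in> generate (G \<times>\<times> H) (S \<times> T)"
      using G.generate_in_carrier[OF assms(3) xy(1)] H.generate_in_carrier[OF assms(4) xy(2)] by simp
  qed
qed

lemma fpt_prod: assumes "fpt G" "fpt H" shows "fpt (G \<times>\<times> H)"
proof -
  interpret G: group G using assms fpt_group by blast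
  interpret H: group H using assms fpt_group by blast
  have P: "group (G \<times>\<times> H)" by (simp add: DirProd_group G.is_group H.is_group)
  obtain C where C: "\<one>\<^bsub>G\<^esub> \<in> C" "fp_on G C" using fp_obtain[OF assms(1), of "{}"] by auto
  obtain B where B: "\<one>\<^bsub>H\<^esub> \<in> B" "fp_on H B" using fp_obtain[OF assms(2), of "{}"] by auto
  have c: "C \<subseteq> carrier G" "B \<subseteq> carrier H" "generate G C = carrier G" "generate H B = carrier H"
    using B C by (auto simp: fp_on_def)
  have "\<exists>h\<in>hom (G \<times>\<times> H) M. \<forall>p\<in>C \<times> B. h p = m p"
    if M: "group M" "part_hom (G \<times>\<times> H) (C \<times> B) M m" for M :: "word set monoid" and m
  proof -
    have m: "m (x \<otimes>\<^bsub>G\<^esub> u, y \<otimes>\<^bsub>H\<^esub> v) = m (x, y) \<otimes>\<^bsub>M\<^esub> m (u, v)"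
      if "x \<in> C" "u \<in> C" "y \<in> B" "v \<in> B" "x \<otimes>\<^bsub>G\<^esub> u \<in> C" "y \<otimes>\<^bsub>H\<^esub> v \<in> B" for x u y v
      using M(2) that unfolding part_hom_def by auto
    have "part_hom G C M (m \<circ> (\<lambda>x. (x, \<one>\<^bsub>H\<^esub>)))"
      by (rule part_hom_comp[OF M(2)]) (use B c in \<open>auto simp: hom_def\<close>)
    from fp_onD[OF C(2) M(1) this]
    obtain h where h: "h \<in> hom G M" "\<And>x. x \<in> C \<Longrightarrow> h x = m (x, \<one>\<^bsub>H\<^esub>)" by auto
    have "part_hom H B M (m \<circ> (\<lambda>x. (\<one>\<^bsub>G\<^esub>, x)))"
      by (rule part_hom_comp[OF M(2)]) (use C c in \<open>auto simp: hom_def\<close>)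
    from fp_onD[OF B(2) M(1) this]
    obtain k where k: "k \<in> hom H M" "\<And>x. x \<in> B \<Longrightarrow> k x = m (\<one>\<^bsub>G\<^esub>, x)" by auto
    \<comment> \<open>The pair \<open>(x, y)\<close> is in the table and factors in both orders,
      which forces the images of the two factors to commute.\<close>
    have xy: "m (x, \<one>\<^bsub>H\<^esub>) \<otimes>\<^bsub>M\<^esub> m (\<one>\<^bsub>G\<^esub>, y) = m (x, y)" "m (\<one>\<^bsub>G\<^esub>, y) \<otimes>\<^bsub>M\<^esub> m (x, \<one>\<^bsub>H\<^esub>) = m (x, y)"
      if "x \<in> C" "y \<in> B" for x y
      using m[of x "\<one>\<^bsub>G\<^esub>" "\<one>\<^bsub>H\<^esub>" y] m[of "\<one>\<^bsub>G\<^esub>" x y "\<one>\<^bsub>H\<^esub>"] that B C c by (auto simp: subset_iff)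
    have "(\<lambda>p. h (fst p) \<otimes>\<^bsub>M\<^esub> k (snd p)) \<in> hom (G \<times>\<times> H) M"
      by (rule hom_prod_glue[OF G.is_group H.is_group M(1) h(1) k(1) c]) (simp add: h k xy)
    then show ?thesis using h k xy by (intro bexI[of _ "\<lambda>p. h (fst p) \<otimes>\<^bsub>M\<^esub> k (snd p)"]) auto
  qed
  moreover have "generate (G \<times>\<times> H) (C \<times> B) = carrier (G \<times>\<times> H)"
    using generate_prod[OF G.is_group H.is_group c(1,2) C(1) B(1)] c by simp
  ultimately have "fp_on (G \<times>\<times> H) (C \<times> B)" using B C c unfolding fp_on_def by auto
  then show ?thesis using P assms by (auto simp: fpt_def intro: torfree_prod)
qed

text \<open>Both \<open>k\<close> and the conjugate of \<open>h\<close> by \<open>\<tau>\<close> are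
  homomorphisms on the generated subgroup, so the relations of a stable letter need checking on
  generators only.\<close>

lemma slide_generate:
  assumes "group M" "group G" "h \<in> hom G M" "\<tau> \<in> carrier M" "B \<subseteq> carrier G" "subgroup (generate G B) G"
    and k: "k \<in> hom (G\<lparr>carrier := generate G B\<rparr>) M"
    and "\<And>b. b \<in> B \<Longrightarrow> h b \<otimes>\<^bsub>M\<^esub> \<tau> = \<tau> \<otimes>\<^bsub>M\<^esub> k b" and "a \<in> generate G B"
  shows "h a \<otimes>\<^bsub>M\<^esub> \<tau> = \<tau> \<otimes>\<^bsub>M\<^esub> k a"
proof -
  interpret G: group G by fact
  interpret M: group M by fact
  let ?A = "G\<lparr>carrier := generate G B\<rparr>"
  have A: "group ?A" using assms G.subgroup_imp_group by blast
  have gB: "generate ?A B = generate G B" using G.generate_consistent[OF _ assms(6), of B] by (auto intro: generate.incl)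
  have Bc: "B \<subseteq> carrier ?A" by (auto intro: generate.incl)
  have inc: "generate G B \<subseteq> carrier G" using G.generate_incl assms by blast
  have hc: "\<And>x. x \<in> generate G B \<Longrightarrow> h x \<in> carrier M" "\<And>x. x \<in> generate G B \<Longrightarrow> k x \<in> carrier M"
    using assms(3) k inc by (auto simp: hom_def)
  have "inv\<^bsub>M\<^esub> \<tau> \<otimes>\<^bsub>M\<^esub> h a \<otimes>\<^bsub>M\<^esub> \<tau> = k a"
  proof (rule hom_eq_generate[OF A assms(1) _ k Bc, of "\<lambda>a. inv\<^bsub>M\<^esub> \<tau> \<otimes>\<^bsub>M\<^esub> h a \<otimes>\<^bsub>M\<^esub> \<tau>"])
    show "(\<lambda>a. inv\<^bsub>M\<^esub> \<tau> \<otimes>\<^bsub>M\<^esub> h a \<otimes>\<^bsub>M\<^esub> \<tau>) \<in> hom ?A M"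
      using hc assms(3,4) inc by (auto simp: hom_def M.m_assoc subset_iff)
    show "inv\<^bsub>M\<^esub> \<tau> \<otimes>\<^bsub>M\<^esub> h x \<otimes>\<^bsub>M\<^esub> \<tau> = k x" if "x \<in> B" for x
      using assms(8)[OF that] hc[of x] that assms(4) by (simp add: M.m_assoc generate.incl)
  qed (use assms gB in auto)
  then have "\<tau> \<otimes>\<^bsub>M\<^esub> k a = \<tau> \<otimes>\<^bsub>M\<^esub> (inv\<^bsub>M\<^esub> \<tau> \<otimes>\<^bsub>M\<^esub> (h a \<otimes>\<^bsub>M\<^esub> \<tau>))" using hc[OF assms(9)] assms(4) by (simp add: M.m_assoc)
  then show ?thesis using hc[OF assms(9)] assms(4) by simp
qed

lemma (in hnn) fpt_K:
  assumes "fpt G" "finite B" "B \<subseteq> carrier G" "A = generate G B"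
  shows "fpt K"
proof -
  have BA: "B \<subseteq> A" using assms by (auto intro: generate.incl)
  then have pB: "\<phi> ` B \<subseteq> carrier G" using phi_closed by auto
  obtain C where C: "B \<union> \<phi> ` B \<subseteq> C" "\<one> \<in> C" "fp_on G C"
    using fp_obtain[OF assms(1), of "B \<union> \<phi> ` B"] assms pB by auto
  have c: "C \<subseteq> carrier G" "generate G C = carrier G" "finite C" using C by (auto simp: fp_on_def)
  \<comment> \<open>The elements \<open>b t\<close> are in the table because they also factor as
    \<open>t (\<phi> b)\<close>; the two factorizations encode the relations of the extension.
    Finitely many suffice because \<open>B\<close> generates \<open>A\<close>.\<close>
  let ?C = "hnn_incl ` C \<union> {t True} \<union> (\<lambda>b. ([], b) \<otimes>\<^bsub>K\<^esub> t True) ` B"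
  have sub: "?C \<subseteq> carrier K" using c(1) assms(3) t_Omega by (auto simp: carrier_K mult_closed)
  have gen: "generate K ?C = carrier K"
    using K.mono_generate[of "hnn_incl ` C \<union> {t True}" ?C] K.generate_incl[OF sub] K_generated_by[OF c(2,1)] by blast
  have sl: "([], b) \<otimes>\<^bsub>K\<^esub> t True = t True \<otimes>\<^bsub>K\<^esub> ([], \<phi> b)" if "b \<in> A" for b
    using t_slide[of b True] that by (simp add: hnn_dom_def hnn_map_def)
  have "\<exists>h\<in>hom K M. \<forall>p\<in>?C. h p = m p"
    if M: "group M" "part_hom K ?C M m" for M :: "word set monoid" and m
  proof -
    have mm: "m (x \<otimes>\<^bsub>K\<^esub> y) = m x \<otimes>\<^bsub>M\<^esub> m y" if "x \<in> ?C" "y \<in> ?C" "x \<otimes>\<^bsub>K\<^esub> y \<in> ?C" for x y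
      using M(2) that unfolding part_hom_def by blast
    have mt: "m (t True) \<in> carrier M" using M(2) unfolding part_hom_def by blast
    have "part_hom G C M (m \<circ> hnn_incl)" by (rule part_hom_comp[OF M(2) incl_hom c(1)]) blast
    from fp_onD[OF C(3) M(1) this]
    obtain h where h: "h \<in> hom G M" "\<And>x. x \<in> C \<Longrightarrow> h x = m ([], x)" by auto
    interpret h: group_hom G M h using h M by (simp add: group_homI is_group)
    have ph: "(\<lambda>x. h (\<phi> x)) \<in> hom (G\<lparr>carrier := generate G B\<rparr>) M"
      using phi_mult phi_closed assms(4) by (auto simp: hom_def)
    have slide: "h a \<otimes>\<^bsub>M\<^esub> m (t True) = m (t True) \<otimes>\<^bsub>M\<^esub> h (\<phi> a)" if "a \<in> A" for a
    proof (rule slide_generate[OF M(1) is_group h(1) mt assms(3) _ ph])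
      fix b assume b: "b \<in> B"
      have bC: "b \<in> C" "\<phi> b \<in> C" "b \<in> A" using b C BA by auto
      have mem: "([], b) \<in> ?C" "([], \<phi> b) \<in> ?C" "t True \<in> ?C" "([], b) \<otimes>\<^bsub>K\<^esub> t True \<in> ?C"
        using b bC by blast+
      have "m (([], b) \<otimes>\<^bsub>K\<^esub> t True) = h b \<otimes>\<^bsub>M\<^esub> m (t True)"
        using mm[OF mem(1,3,4)] h(2)[OF bC(1)] by simp
      moreover have "m (([], b) \<otimes>\<^bsub>K\<^esub> t True) = m (t True) \<otimes>\<^bsub>M\<^esub> h (\<phi> b)"
        using mm[OF mem(3,2)] mem(4) unfolding sl[OF bC(3)] h(2)[OF bC(2)] by blast
      ultimately show "h b \<otimes>\<^bsub>M\<^esub> m (t True) = m (t True) \<otimes>\<^bsub>M\<^esub> h (\<phi> b)" by simp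
    qed (use that assms sub_A in auto)
    obtain k where k: "k \<in> hom K M" "\<And>g. g \<in> carrier G \<Longrightarrow> k ([], g) = h g" "k (t True) = m (t True)"
      using universal[OF M(1) h(1) mt slide] by blast
    have "k p = m p" if pC: "p \<in> ?C" for p
    proof -
      consider (1) x where "x \<in> C" "p = ([], x)" | (2) "p = t True" | (3) b where "b \<in> B" "p = ([], b) \<otimes>\<^bsub>K\<^esub> t True"
        using pC by blast
      then show ?thesis
      proof cases
        case 3
        have bK: "([], b) \<in> carrier K" "t True \<in> carrier K" "b \<in> carrier G" "b \<in> C"
          using 3(1) assms(3) C(1) t_Omega by (auto simp: carrier_K)
        have "k p = m ([], b) \<otimes>\<^bsub>M\<^esub> m (t True)" using 3 bK hom_mult[OF k(1)] k h by simp
        moreover have "m p = m ([], b) \<otimes>\<^bsub>M\<^esub> m (t True)"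
          unfolding 3(2) by (rule mm) (use 3 bK in blast)+
        ultimately show ?thesis by simp
      qed (use k h c in auto)
    qed
    then show ?thesis using k(1) by blast
  qed
  then have "fp_on K ?C" using sub gen c assms unfolding fp_on_def by auto
  moreover have "torfree n K" if "n > 0" for n
    using torsion[of n] that assms(1) unfolding fpt_def torfree_def by blast
  ultimately show ?thesis using group_K by (auto simp: fpt_def)
qed

lemma (in hnn) torfree_K: "torfree n G \<Longrightarrow> n > 0 \<Longrightarrow> torfree n K"
  using torsion[of n] unfolding torfree_def by blast

section \<open>The group of a presentation\<close>

definition weval :: "('a, 'c) monoid_scheme \<Rightarrow> (nat \<Rightarrow> 'a) \<Rightarrow> word \<Rightarrow> 'a" where
  "weval M f w = foldr (\<lambda>l v. (if snd l then inv\<^bsub>M\<^esub> (f (fst l)) else f (fst l)) \<otimes>\<^bsub>M\<^esub> v) w \<one>\<^bsub>M\<^esub>"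

lemma weval_Nil [simp]: "weval M f [] = \<one>\<^bsub>M\<^esub>" by (simp add: weval_def)

lemma weval_Cons [simp]: "weval M f (l # w) = (if snd l then inv\<^bsub>M\<^esub> (f (fst l)) else f (fst l)) \<otimes>\<^bsub>M\<^esub> weval M f w"
  by (simp add: weval_def)

lemma words_on_simps [simp]:
  "[] \<in> words_on X" "l # w \<in> words_on X \<longleftrightarrow> fst l \<in> X \<and> w \<in> words_on X"
  "u @ w \<in> words_on X \<longleftrightarrow> u \<in> words_on X \<and> w \<in> words_on X"
  by (auto simp: words_on_def)

lemma weval_closed: "group M \<Longrightarrow> f \<in> X \<rightarrow> carrier M \<Longrightarrow> w \<in> words_on X \<Longrightarrow> weval M f w \<in> carrier M"
proof (induct w)
  case Nil then show ?case by (simp add: group.is_monoid)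
next
  case (Cons l w)
  interpret group M by fact
  show ?case using Cons by (auto simp: Pi_iff)
qed

lemma weval_append:
  assumes "group M" "f \<in> X \<rightarrow> carrier M" "u \<in> words_on X" "w \<in> words_on X"
  shows "weval M f (u @ w) = weval M f u \<otimes>\<^bsub>M\<^esub> weval M f w"
  using assms(3)
proof (induct u)
  case Nil
  interpret group M by fact
  show ?case using weval_closed[OF assms(1,2,4)] by simp
next
  case (Cons l u)
  interpret group M by fact
  have "f (fst l) \<in> carrier M" using Cons(2) assms(2) by auto
  then show ?case using Cons weval_closed[OF assms(1,2,4)] weval_closed[OF assms(1,2)] by (simp add: m_assoc)
qed

lemma pres_eq_weval:
  assumes "pres_eq X R u v" "group M" "f \<in> X \<rightarrow> carrier M" "R \<subseteq> words_on X"
    "\<And>r. r \<in> R \<Longrightarrow> weval M f r = \<one>\<^bsub>M\<^esub>"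
  shows "weval M f u = weval M f v"
  using assms(1)
proof induct
  case (cancel u v x b)
  interpret group M by fact
  have "f x \<in> carrier M" "weval M f v \<in> carrier M" using cancel assms(3) weval_closed[OF assms(2,3)] by auto
  then show ?case using cancel by (simp add: weval_append[OF assms(2,3)])
next
  case (rel u v r)
  interpret group M by fact
  have "r \<in> words_on X" using rel assms(4) by blast
  then show ?case using rel weval_closed[OF assms(2,3)] by (simp add: weval_append[OF assms(2,3)] assms(5))
qed auto

lemma pres_eq_words: "pres_eq X R u v \<Longrightarrow> R \<subseteq> words_on X \<Longrightarrow> u \<in> words_on X \<and> v \<in> words_on X"
  by (induct rule: pres_eq.induct) auto

lemma pres_eq_ctxt:
  assumes "pres_eq X R u v" "p \<in> words_on X" "q \<in> words_on X"
  shows "pres_eq X R (p @ u @ q) (p @ v @ q)"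
  using assms(1)
proof induct
  case (refl w) then show ?case using assms by (intro pres_eq.refl) simp
next
  case (cancel u v x b)
  then show ?case using pres_eq.cancel[of "p @ u" X "v @ q" x R b] assms by simp
next
  case (rel u v r)
  then show ?case using pres_eq.rel[of "p @ u" X "v @ q" r R] assms by simp
qed (auto intro: pres_eq.sym pres_eq.trans)

locale presentation =
  fixes X :: "nat set" and R :: "word set"
  assumes R_words: "R \<subseteq> words_on X"
begin

abbreviation "P \<equiv> pres_group X R"
abbreviation "cls \<equiv> pres_class X R"

lemma cls_eq: "u \<in> words_on X \<Longrightarrow> cls u = cls v \<longleftrightarrow> pres_eq X R u v"
  unfolding pres_class_def using pres_eq.refl pres_eq.sym pres_eq.trans by blast

lemma carrier_P: "carrier P = cls ` words_on X" by (simp add: pres_group_def)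

lemma some_cls: assumes "u \<in> words_on X" shows "pres_eq X R u (SOME a. a \<in> cls u)"
proof -
  have "u \<in> cls u" using assms by (simp add: pres_class_def pres_eq.refl)
  then have "(SOME a. a \<in> cls u) \<in> cls u" by (rule someI)
  then show ?thesis by (simp add: pres_class_def)
qed

lemma mult_cls: assumes "u \<in> words_on X" "v \<in> words_on X" shows "cls u \<otimes>\<^bsub>P\<^esub> cls v = cls (u @ v)"
proof -
  let ?a = "SOME a. a \<in> cls u" and ?b = "SOME a. a \<in> cls v"
  have a: "pres_eq X R u ?a" "pres_eq X R v ?b" using assms some_cls by auto
  have w: "?a \<in> words_on X" "?b \<in> words_on X" using a pres_eq_words R_words by blast+
  have "pres_eq X R (u @ v) (?a @ v)" using pres_eq_ctxt[OF a(1), of "[]" v] assms by simp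
  moreover have "pres_eq X R (?a @ v) (?a @ ?b)" using pres_eq_ctxt[OF a(2), of ?a "[]"] w by simp
  ultimately have "pres_eq X R (u @ v) (?a @ ?b)" by (rule pres_eq.trans)
  then have "cls (u @ v) = cls (?a @ ?b)" using cls_eq[of "u @ v"] assms by simp
  then show ?thesis by (simp add: pres_group_def)
qed

lemma one_P: "\<one>\<^bsub>P\<^esub> = cls []" by (simp add: pres_group_def)

lemma cancel_cls: "x \<in> X \<Longrightarrow> w \<in> words_on X \<Longrightarrow> cls ((x, b) # (x, \<not> b) # w) = cls w"
  using pres_eq.cancel[of "[]" X w x R b] by (simp add: cls_eq)

lemma group_P: "group P"
proof (rule groupI)
  fix x assume "x \<in> carrier P"
  then obtain w where w: "w \<in> words_on X" "x = cls w" by (auto simp: carrier_P)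
  from w(1) have "\<exists>v\<in>words_on X. cls (v @ w) = cls []"
  proof (induct w)
    case Nil then show ?case by (auto intro: bexI[of _ "[]"])
  next
    case (Cons l w)
    then obtain v where v: "v \<in> words_on X" "cls (v @ w) = cls []" by auto
    have "pres_eq X R (v @ [(fst l, \<not> snd l), (fst l, \<not> \<not> snd l)] @ w) (v @ w)"
      by (rule pres_eq.cancel) (use Cons v in auto)
    then have "cls ((v @ [(fst l, \<not> snd l)]) @ l # w) = cls (v @ w)" using Cons v by (subst cls_eq) auto
    then show ?case using v Cons by (intro bexI[of _ "v @ [(fst l, \<not> snd l)]"]) auto
  qed
  then show "\<exists>y\<in>carrier P. y \<otimes>\<^bsub>P\<^esub> x = \<one>\<^bsub>P\<^esub>" using w by (auto simp: carrier_P mult_cls one_P)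
qed (auto simp: carrier_P mult_cls one_P)

sublocale P: group P by (rule group_P)

lemma inv_gen: "x \<in> X \<Longrightarrow> inv\<^bsub>P\<^esub> (cls [(x, False)]) = cls [(x, True)]"
  using cancel_cls[of x "[]" True] by (intro P.inv_equality) (auto simp: carrier_P mult_cls one_P)

lemma weval_cls: "w \<in> words_on X \<Longrightarrow> weval P (\<lambda>x. cls [(x, False)]) w = cls w"
proof (induct w)
  case (Cons l w)
  then show ?case using mult_cls[of "[l]" w] by (cases l) (auto simp: inv_gen)
qed (simp add: one_P)

lemma P_universal:
  assumes "group M" "f \<in> X \<rightarrow> carrier M" "\<And>r. r \<in> R \<Longrightarrow> weval M f r = \<one>\<^bsub>M\<^esub>"
  shows "\<exists>h\<in>hom P M. \<forall>w\<in>words_on X. h (cls w) = weval M f w"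
proof (intro bexI ballI)
  define h where "h A = weval M f (SOME a. a \<in> A)" for A
  show h: "h (cls w) = weval M f w" if "w \<in> words_on X" for w
    using pres_eq_weval[OF some_cls[OF that] assms(1,2) R_words assms(3)] by (simp add: h_def)
  show "h \<in> hom P M"
    using h weval_closed[OF assms(1,2)] by (auto simp: hom_def carrier_P mult_cls weval_append[OF assms(1,2)])
qed

lemma P_generated: "generate P ((\<lambda>x. cls [(x, False)]) ` X) = carrier P"
proof
  let ?S = "(\<lambda>x. cls [(x, False)]) ` X"
  show "generate P ?S \<subseteq> carrier P" by (rule P.generate_incl) (auto simp: carrier_P)
  have "cls w \<in> generate P ?S" if "w \<in> words_on X" for w using that
  proof (induct w)
    case Nil then show ?case using generate.one[of P ?S] by (simp add: one_P)
  next
    case (Cons l w)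
    have "cls [l] \<in> generate P ?S" using Cons generate.inv[of "cls [(fst l, False)]" ?S P]
      by (cases l; cases "snd l") (auto simp: inv_gen intro: generate.incl)
    then show ?case using Cons generate.eng[of "cls [l]" P ?S "cls w"] mult_cls[of "[l]" w] by simp
  qed
  then show "carrier P \<subseteq> generate P ?S" by (auto simp: carrier_P)
qed

end

text \<open>With \<open>R\<close> consisting of all products that hold inside \<open>C\<close>,
  sending \<open>C\<close> to the classes of the letters respects the table, and
  \<open>pres_group X R\<close> has the type for which \<open>fp_on\<close> grants an extension. The
  inverse comes from the universal property of the presentation.\<close>

lemma fp_on_presentation:
  fixes K :: "('a, 'c) monoid_scheme"
  assumes "group K" "fp_on K C"
  shows "\<exists>X R c h. fin_presentation X R \<and> c ` X = C \<and> h \<in> iso K (pres_group X R) \<and>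
     (\<forall>x\<in>X. h (c x) = pres_class X R [(x, False)]) \<and>
     (\<forall>r\<in>R. \<exists>i j k. r = [(i, False), (j, False), (k, True)] \<and> c i \<otimes>\<^bsub>K\<^esub> c j = c k)"
proof -
  interpret K: group K by fact
  have C: "finite C" "C \<subseteq> carrier K" "generate K C = carrier K" using assms(2) by (auto simp: fp_on_def)
  obtain c where c: "bij_betw c {..<card C} C" using ex_bij_betw_nat_finite[OF C(1)] by (auto simp: atLeast0LessThan)
  define X where "X = {..<card C}"
  have cX: "c ` X = C" "inj_on c X" using c by (auto simp: X_def bij_betw_def)
  define R where "R = {[(i, False), (j, False), (k, True)] | i j k. i \<in> X \<and> j \<in> X \<and> k \<in> X \<and> c i \<otimes>\<^bsub>K\<^esub> c j = c k}"
  have "R \<subseteq> (\<lambda>(i, j, k). [(i, False), (j, False), (k, True)]) ` (X \<times> X \<times> X)" by (auto simp: R_def image_iff)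
  then have "finite R" by (rule finite_subset) (simp add: X_def)
  then have fin: "fin_presentation X R" by (auto simp: fin_presentation_def X_def R_def)
  interpret presentation X R using fin by unfold_locales (simp add: fin_presentation_def)
  define m where "m y = cls [(the_inv_into X c y, False)]" for y
  have m: "m (c x) = cls [(x, False)]" if "x \<in> X" for x using that cX by (simp add: m_def the_inv_into_f_f)
  have "part_hom K C P m" unfolding part_hom_def cX(1)[symmetric]
  proof (intro conjI ballI impI)
    fix x y assume "x \<in> c ` X" "y \<in> c ` X" "x \<otimes>\<^bsub>K\<^esub> y \<in> c ` X"
    then obtain i j k where ijk: "i \<in> X" "j \<in> X" "k \<in> X" "x = c i" "y = c j" "c i \<otimes>\<^bsub>K\<^esub> c j = c k" by auto
    then have r: "[(i, False), (j, False), (k, True)] \<in> R" by (auto simp: R_def)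
    have "cls [(i, False), (j, False)] = cls ([(i, False), (j, False)] @ [(k, True), (k, \<not> True)] @ [])"
      using pres_eq.cancel[of "[(i, False), (j, False)]" X "[]" k R True] ijk by (subst eq_commute, subst cls_eq) auto
    also have "\<dots> = cls [(k, False)]" using pres_eq.rel[OF _ _ r, of "[]" X "[(k, False)]"] ijk by (subst cls_eq) auto
    finally show "m (x \<otimes>\<^bsub>K\<^esub> y) = m x \<otimes>\<^bsub>P\<^esub> m y" using ijk by (simp add: m mult_cls)
  qed (auto simp: m carrier_P)
  then obtain h where h: "h \<in> hom K P" "\<And>x. x \<in> X \<Longrightarrow> h (c x) = cls [(x, False)]"
    using fp_onD[OF assms(2) group_P] m cX(1) by fastforce
  have cK: "c \<in> X \<rightarrow> carrier K" using cX C by auto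
  have "weval K c r = \<one>\<^bsub>K\<^esub>" if "r \<in> R" for r
    using that cK by (auto simp: R_def Pi_iff) (metis K.m_assoc K.r_inv K.m_closed K.inv_closed)
  then obtain k where k: "k \<in> hom P K" "\<And>w. w \<in> words_on X \<Longrightarrow> k (cls w) = weval K c w"
    using P_universal[OF assms(1) cK] by blast
  have kh: "k (h y) = y" if "y \<in> carrier K" for y
  proof (rule hom_eq_generate[OF assms(1) assms(1), of "\<lambda>y. k (h y)" "\<lambda>y. y" C])
    show "(\<lambda>y. k (h y)) \<in> hom K K" using hom_compose[OF h(1) k(1)] by (simp add: comp_def)
    show "k (h x) = x" if "x \<in> C" for x using that cX(1) h(2) k(2) cK by (force simp: Pi_iff)
  qed (use that C in \<open>auto simp: hom_def\<close>)
  have hk: "h (k y) = y" if "y \<in> carrier P" for y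
  proof (rule hom_eq_generate[OF group_P group_P, of "\<lambda>y. h (k y)" "\<lambda>y. y" "(\<lambda>x. cls [(x, False)]) ` X"])
    show "(\<lambda>y. h (k y)) \<in> hom P P" using hom_compose[OF k(1) h(1)] by (simp add: comp_def)
    show "h (k x) = x" if "x \<in> (\<lambda>x. cls [(x, False)]) ` X" for x
      using that h(2) k(2) cK by (force simp: Pi_iff)
  qed (use that P_generated in \<open>auto simp: hom_def carrier_P\<close>)
  have "bij_betw h (carrier K) (carrier P)"
    by (rule bij_betw_byWitness[of _ k]) (use kh hk h k in \<open>auto simp: hom_def\<close>)
  then have "h \<in> iso K P" using h by (simp add: iso_def)
  then show ?thesis using fin cX h(2) by (intro exI[of _ X] exI[of _ R] exI[of _ c] exI[of _ h]) (auto simp: R_def)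
qed

lemma fpt_iso: assumes "fpt K" "h \<in> iso K K'" "group K'" shows "fpt K'"
proof -
  interpret K: group K using assms fpt_group by blast
  interpret K': group K' by fact
  have hh: "h \<in> hom K K'" "bij_betw h (carrier K) (carrier K')" using assms by (auto simp: iso_def)
  interpret h: group_hom K K' h by (rule group_homI[OF K.is_group K'.is_group hh(1)])
  obtain C where C: "fp_on K C" using assms by (auto simp: fpt_def)
  have c: "finite C" "C \<subseteq> carrier K" "generate K C = carrier K" using C by (auto simp: fp_on_def)
  define g where "g = inv_into (carrier K) h"
  have g: "g \<in> hom K' K" using K.iso_set_sym[OF assms(2)] by (simp add: iso_def g_def)
  have gh: "g (h x) = x" if "x \<in> carrier K" for x using that hh by (simp add: g_def bij_betw_def)
  have "\<exists>k\<in>hom K' M. \<forall>x\<in>h ` C. k x = m x" if M: "group M" "part_hom K' (h ` C) M m" for M :: "word set monoid" and m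
  proof -
    have "part_hom K C M (m \<circ> h)" by (rule part_hom_comp[OF M(2) hh(1) c(2)]) simp
    from fp_onD[OF C M(1) this] obtain k where k: "k \<in> hom K M" "\<forall>x\<in>C. k x = m (h x)" by auto
    have "k \<circ> g \<in> hom K' M" using hom_compose[OF g k(1)] .
    then show ?thesis using k(2) gh c(2) by (intro bexI[of _ "k \<circ> g"]) auto
  qed
  moreover have "generate K' (h ` C) = carrier K'" using h.generate_img[OF c(2)] c(3) hh(2) by (simp add: bij_betw_def)
  ultimately have "fp_on K' (h ` C)" using c by (auto simp: fp_on_def)
  moreover have "torfree n K'" if "n > 0" for n
  proof (rule torfree_inj[OF _ g _ K'.is_group K.is_group])
    show "torfree n K" using assms that by (simp add: fpt_def)
    show "inj_on g (carrier K')" using hh(2) by (simp add: g_def bij_betw_def inj_on_inv_into)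
  qed
  ultimately show ?thesis using K'.is_group by (auto simp: fpt_def)
qed

lemma fpt_pres:
  assumes "fpt K" shows "\<exists>(K' :: word set monoid) h. fpt K' \<and> h \<in> iso K K'"
proof -
  obtain C where C: "group K" "fp_on K C" using assms by (auto simp: fpt_def)
  then obtain X R h where *: "fin_presentation X R" "h \<in> iso K (pres_group X R)"
    using fp_on_presentation[OF C] by blast
  interpret presentation X R using * by unfold_locales (simp add: fin_presentation_def)
  show ?thesis using fpt_iso[OF assms *(2) group_P] *(2) by blast
qed

section \<open>Benign subgroups\<close>

text \<open>The overgroup ranges over a single type. Nothing is lost by this:
  \<open>fpt_pres\<close> moves any finitely presented torsion-free group to that type, and
  \<open>benignI\<close> accepts overgroups of every type.\<close>

definition benign :: "('a, 'c) monoid_scheme \<Rightarrow> 'a set \<Rightarrow> bool" where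
  "benign G H \<longleftrightarrow> H \<subseteq> carrier G \<and> (\<exists>(K :: word set monoid) \<iota> L. fpt K \<and> \<iota> \<in> hom G K \<and> inj_on \<iota> (carrier G) \<and>
     finite L \<and> L \<subseteq> carrier K \<and> (\<forall>g\<in>carrier G. g \<in> H \<longleftrightarrow> \<iota> g \<in> generate K L))"

lemma inj_hom_generate:
  assumes "group K" "group M" "h \<in> hom K M" "inj_on h (carrier K)" "L \<subseteq> carrier K" "x \<in> carrier K"
  shows "h x \<in> generate M (h ` L) \<longleftrightarrow> x \<in> generate K L"
proof -
  interpret h: group_hom K M h by (rule group_homI[OF assms(1-3)])
  show ?thesis using h.generate_img[OF assms(5)] inj_on_image_mem_iff[OF assms(4,6) h.G.generate_incl[OF assms(5)]]
    by simp
qed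

lemma benignI:
  assumes "group G" "fpt K" "\<iota> \<in> hom G K" "inj_on \<iota> (carrier G)" "finite L" "L \<subseteq> carrier K" "H \<subseteq> carrier G"
    "\<And>g. g \<in> carrier G \<Longrightarrow> g \<in> H \<longleftrightarrow> \<iota> g \<in> generate K L"
  shows "benign G H"
proof -
  obtain K' :: "word set monoid" and h where K': "fpt K'" "h \<in> iso K K'" using fpt_pres[OF assms(2)] by blast
  then have h: "h \<in> hom K K'" "inj_on h (carrier K)" by (auto simp: iso_def bij_betw_def)
  have "h \<circ> \<iota> \<in> hom G K'" using hom_compose[OF assms(3) h(1)] .
  moreover have "\<iota> ` carrier G \<subseteq> carrier K" using assms(3) by (auto simp: hom_def)
  then have "inj_on (h \<circ> \<iota>) (carrier G)" using assms(4) h(2) by (intro comp_inj_on) (auto intro: inj_on_subset)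
  moreover have "g \<in> H \<longleftrightarrow> (h \<circ> \<iota>) g \<in> generate K' (h ` L)" if "g \<in> carrier G" for g
    using inj_hom_generate[OF fpt_group[OF assms(2)] fpt_group[OF K'(1)] h assms(6), of "\<iota> g"] assms(3,8) that
    by (auto simp: hom_def)
  moreover have "h ` L \<subseteq> carrier K'" "finite (h ` L)" using h(1) assms(5,6) by (auto simp: hom_def)
  ultimately show ?thesis using K'(1) assms(7) unfolding benign_def
    by (intro conjI exI[of _ K'] exI[of _ "h \<circ> \<iota>"] exI[of _ "h ` L"]) auto
qed

lemma benignE:
  assumes "benign G H"
  obtains K :: "word set monoid" and \<iota> L where "fpt K" "\<iota> \<in> hom G K" "inj_on \<iota> (carrier G)" "finite L"
    "L \<subseteq> carrier K" "\<And>g. g \<in> carrier G \<Longrightarrow> g \<in> H \<longleftrightarrow> \<iota> g \<in> generate K L" "H \<subseteq> carrier G"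
proof -
  from assms[unfolded benign_def, THEN conjunct2] obtain K :: "word set monoid" and \<iota> L where
    "fpt K \<and> \<iota> \<in> hom G K \<and> inj_on \<iota> (carrier G) \<and> finite L \<and> L \<subseteq> carrier K \<and>
     (\<forall>g\<in>carrier G. g \<in> H \<longleftrightarrow> \<iota> g \<in> generate K L)" by (elim exE)
  moreover have "H \<subseteq> carrier G" using assms by (simp add: benign_def)
  ultimately show ?thesis by (intro that[of K \<iota> L]) simp_all
qed

lemma benign_subgroup: assumes "group G" "benign G H" shows "subgroup H G"
proof -
  obtain K :: "word set monoid" and \<iota> L where *: "fpt K" "\<iota> \<in> hom G K" "L \<subseteq> carrier K"
    "\<And>g. g \<in> carrier G \<Longrightarrow> g \<in> H \<longleftrightarrow> \<iota> g \<in> generate K L" "H \<subseteq> carrier G"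
    by (rule benignE[OF assms(2)]) blast
  interpret K: group K by (rule fpt_group[OF *(1)])
  interpret i: group_hom G K \<iota> by (rule group_homI[OF assms(1) K.is_group *(2)])
  interpret L: subgroup "generate K L" K by (rule K.generate_is_subgroup[OF *(3)])
  show ?thesis
  proof (rule i.G.subgroupI)
    show "H \<noteq> {}" using *(4)[of "\<one>\<^bsub>G\<^esub>"] by auto
    show "inv\<^bsub>G\<^esub> a \<in> H" if "a \<in> H" for a using *(4)[of a] *(4)[of "inv\<^bsub>G\<^esub> a"] *(5) that by auto
    show "a \<otimes>\<^bsub>G\<^esub> b \<in> H" if "a \<in> H" "b \<in> H" for a b
    proof -
      have "a \<in> carrier G" "b \<in> carrier G" using that *(5) by auto
      then show ?thesis using *(4)[of a] *(4)[of b] *(4)[of "a \<otimes>\<^bsub>G\<^esub> b"] that by simp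
    qed
  qed (rule *(5))
qed

lemma fpt_gens: assumes "fpt G" obtains C where "finite C" "C \<subseteq> carrier G" "generate G C = carrier G" "\<one>\<^bsub>G\<^esub> \<in> C"
proof -
  obtain C where "\<one>\<^bsub>G\<^esub> \<in> C" "fp_on G C" using fp_obtain[OF assms, of "{}"] by auto
  then show ?thesis by (intro that[of C]) (simp_all add: fp_on_def)
qed

section \<open>Finitely generated subgroups, restrictions and cylinders\<close>

lemma benign_fg:
  assumes "fpt G" "finite L" "L \<subseteq> carrier G" shows "benign G (generate G L)"
  using assms group.generate_incl[OF fpt_group[OF assms(1)] assms(3)]
  by (intro benignI[where \<iota> = "\<lambda>x. x" and K = G and L = L]) (auto simp: fpt_group hom_def)

lemma benign_hom_image:
  assumes "fpt G" "fpt M" "f \<in> hom G M" shows "benign M (f ` carrier G)"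
proof -
  obtain C where C: "finite C" "C \<subseteq> carrier G" "generate G C = carrier G" by (rule fpt_gens[OF assms(1)])
  interpret f: group_hom G M f by (rule group_homI[OF fpt_group[OF assms(1)] fpt_group[OF assms(2)] assms(3)])
  have "benign M (generate M (f ` C))" using C by (intro benign_fg assms) auto
  then show ?thesis using f.generate_img[OF C(2)] C(3) by simp
qed

lemma benign_restrict:
  assumes "group G" "group M" "f \<in> hom G M" "inj_on f (carrier G)" "benign M H"
  shows "benign G {g \<in> carrier G. f g \<in> H}"
proof -
  obtain K :: "word set monoid" and \<iota> L where *: "fpt K" "\<iota> \<in> hom M K" "inj_on \<iota> (carrier M)" "finite L"
    "L \<subseteq> carrier K" "\<And>g. g \<in> carrier M \<Longrightarrow> g \<in> H \<longleftrightarrow> \<iota> g \<in> generate K L" "H \<subseteq> carrier M"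
    by (rule benignE[OF assms(5)]) blast
  have f: "f ` carrier G \<subseteq> carrier M" using assms(3) by (auto simp: hom_def)
  show ?thesis
  proof (rule benignI[OF assms(1) *(1) hom_compose[OF assms(3) *(2)] _ *(4,5)])
    show "inj_on (\<iota> \<circ> f) (carrier G)" using comp_inj_on[OF assms(4) inj_on_subset[OF *(3) f]] .
    show "g \<in> {g \<in> carrier G. f g \<in> H} \<longleftrightarrow> (\<iota> \<circ> f) g \<in> generate K L" if "g \<in> carrier G" for g
      using *(6)[of "f g"] f that by auto
  qed auto
qed

lemma benign_times:
  assumes "group G" "fpt M" "benign G H" "finite C" "C \<subseteq> carrier M" "\<one>\<^bsub>M\<^esub> \<in> C"
  shows "benign (G \<times>\<times> M) (H \<times> generate M C)"
proof -
  obtain K :: "word set monoid" and \<iota> L where *: "fpt K" "\<iota> \<in> hom G K" "inj_on \<iota> (carrier G)" "finite L"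
    "L \<subseteq> carrier K" "\<And>g. g \<in> carrier G \<Longrightarrow> g \<in> H \<longleftrightarrow> \<iota> g \<in> generate K L" "H \<subseteq> carrier G"
    by (rule benignE[OF assms(3)]) blast
  interpret K: group K by (rule fpt_group[OF *(1)])
  interpret M: group M by (rule fpt_group[OF assms(2)])
  let ?L = "insert \<one>\<^bsub>K\<^esub> L"
  have L: "generate K ?L = generate K L"
  proof
    show "generate K ?L \<subseteq> generate K L"
      by (rule K.generate_subgroup_incl[OF _ K.generate_is_subgroup[OF *(5)]]) (auto intro: generate.one generate.incl)
    show "generate K L \<subseteq> generate K ?L" by (rule K.mono_generate) auto
  qed
  have g: "generate (K \<times>\<times> M) (?L \<times> C) = generate K L \<times> generate M C"
    using generate_prod[OF K.is_group M.is_group, of ?L C] *(5) assms(5,6) L by auto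
  show ?thesis
  proof (rule benignI[OF DirProd_group[OF assms(1) M.is_group] fpt_prod[OF *(1) assms(2)]])
    show "(\<lambda>p. (\<iota> (fst p), snd p)) \<in> hom (G \<times>\<times> M) (K \<times>\<times> M)" using *(2) by (auto simp: hom_def)
    show "inj_on (\<lambda>p. (\<iota> (fst p), snd p)) (carrier (G \<times>\<times> M))" using *(3) by (auto simp: inj_on_def)
    show "finite (?L \<times> C)" using *(4) assms(4) by auto
    show "?L \<times> C \<subseteq> carrier (K \<times>\<times> M)" using *(5) assms(5) by auto
    show "H \<times> generate M C \<subseteq> carrier (G \<times>\<times> M)" using *(7) M.generate_incl[OF assms(5)] by auto
    show "p \<in> H \<times> generate M C \<longleftrightarrow> (\<iota> (fst p), snd p) \<in> generate (K \<times>\<times> M) (?L \<times> C)"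
      if "p \<in> carrier (G \<times>\<times> M)" for p
      using that *(6)[of "fst p"] unfolding g by (cases p) auto
  qed
qed

lemma benign_cylinder: assumes "group G" "fpt M" "benign G H" shows "benign (G \<times>\<times> M) (H \<times> carrier M)"
proof -
  obtain C where C: "finite C" "C \<subseteq> carrier M" "generate M C = carrier M" "\<one>\<^bsub>M\<^esub> \<in> C" by (rule fpt_gens[OF assms(2)])
  show ?thesis using benign_times[OF assms C(1,2,4)] C(3) by simp
qed

lemma benign_cylinder': assumes "group G" "fpt M" "benign G H" shows "benign (M \<times>\<times> G) (carrier M \<times> H)"
proof -
  have s: "(\<lambda>p. (snd p, fst p)) \<in> hom (M \<times>\<times> G) (G \<times>\<times> M)" by (auto simp: hom_def)
  have H: "H \<subseteq> carrier G" using assms(3) by (auto simp: benign_def)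
  have g: "group (M \<times>\<times> G)" "group (G \<times>\<times> M)" using assms fpt_group DirProd_group by blast+
  have "benign (M \<times>\<times> G) {p \<in> carrier (M \<times>\<times> G). (snd p, fst p) \<in> H \<times> carrier M}"
    by (rule benign_restrict[OF g s _ benign_cylinder[OF assms]]) (auto simp: inj_on_def)
  moreover have "{p \<in> carrier (M \<times>\<times> G). (snd p, fst p) \<in> H \<times> carrier M} = carrier M \<times> H" using H by auto
  ultimately show ?thesis by simp
qed

section \<open>Intersections, joins, images and preimages\<close>

lemma hnn_id: assumes "group G" "subgroup A G" shows "hnn G A (\<lambda>x. x)"
  using assms subgroup.subset[OF assms(2)] by (auto simp: hnn_def hnn_axioms_def)

lemma (in hnn) cj_hom: "cj \<in> hom G K"
proof -
  have t: "t b \<in> carrier K" for b using t_Omega by (simp add: carrier_K)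
  have c: "([], g) \<in> carrier K" if "g \<in> carrier G" for g using that by (simp add: carrier_K)
  have "t True \<otimes>\<^bsub>K\<^esub> (t False \<otimes>\<^bsub>K\<^esub> x) = x" if "x \<in> carrier K" for x
    using t_t[of True] t that by (simp add: K.m_assoc[symmetric])
  then show ?thesis using t c by (auto simp: hom_def K.m_assoc incl_mult[symmetric])
qed

text \<open>The witnesses \<open>K1\<close> and \<open>K2\<close> are combined in an HNN extension
  of \<open>K1 \<times>\<times> K2\<close> whose stable letter conjugates the copy of
  \<open>G\<close> in the first factor to that in the second. The conjugate of \<open>K1\<close> and
  the factor \<open>K2\<close> then contain the same copy of \<open>G\<close>. The associated
  subgroup is finitely generated because \<open>G\<close> is.\<close>

lemma common_overgroup:
  assumes "fpt G" "benign G H1" "benign G H2"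
  shows "\<exists>(K :: word set monoid) \<iota> L1 L2. fpt K \<and> \<iota> \<in> hom G K \<and> inj_on \<iota> (carrier G) \<and> finite L1 \<and> finite L2 \<and>
    L1 \<subseteq> carrier K \<and> L2 \<subseteq> carrier K \<and>
    (\<forall>g\<in>carrier G. g \<in> H1 \<longleftrightarrow> \<iota> g \<in> generate K L1) \<and> (\<forall>g\<in>carrier G. g \<in> H2 \<longleftrightarrow> \<iota> g \<in> generate K L2)"
proof -
  obtain K1 :: "word set monoid" and i1 L1 where 1: "fpt K1" "i1 \<in> hom G K1" "inj_on i1 (carrier G)" "finite L1"
    "L1 \<subseteq> carrier K1" "\<And>g. g \<in> carrier G \<Longrightarrow> g \<in> H1 \<longleftrightarrow> i1 g \<in> generate K1 L1" "H1 \<subseteq> carrier G"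
    by (rule benignE[OF assms(2)]) blast
  obtain K2 :: "word set monoid" and i2 L2 where 2: "fpt K2" "i2 \<in> hom G K2" "inj_on i2 (carrier G)" "finite L2"
    "L2 \<subseteq> carrier K2" "\<And>g. g \<in> carrier G \<Longrightarrow> g \<in> H2 \<longleftrightarrow> i2 g \<in> generate K2 L2" "H2 \<subseteq> carrier G"
    by (rule benignE[OF assms(3)]) blast
  interpret G: group G by (rule fpt_group[OF assms(1)])
  interpret K1: group K1 by (rule fpt_group[OF 1(1)])
  interpret K2: group K2 by (rule fpt_group[OF 2(1)])
  interpret i1: group_hom G K1 i1 by (rule group_homI[OF G.is_group K1.is_group 1(2)])
  interpret i2: group_hom G K2 i2 by (rule group_homI[OF G.is_group K2.is_group 2(2)])
  let ?P = "K1 \<times>\<times> K2"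
  have P: "fpt ?P" by (rule fpt_prod[OF 1(1) 2(1)])
  interpret P: group ?P by (rule fpt_group[OF P])
  define a1 where "a1 g = (i1 g, \<one>\<^bsub>K2\<^esub>)" for g
  define a2 where "a2 g = (\<one>\<^bsub>K1\<^esub>, i2 g)" for g
  have ah: "a1 \<in> hom G ?P" "a2 \<in> hom G ?P" by (auto simp: hom_def a1_def a2_def)
  interpret a1: group_hom G ?P a1 by (rule group_homI[OF G.is_group P.is_group ah(1)])
  have ai: "inj_on a1 (carrier G)" "inj_on a2 (carrier G)" using 1(3) 2(3) by (auto simp: inj_on_def a1_def a2_def)
  define \<phi> where "\<phi> p = a2 (inv_into (carrier G) a1 p)" for p
  have phi: "\<phi> (a1 g) = a2 g" if "g \<in> carrier G" for g using that ai by (simp add: \<phi>_def)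
  interpret t: hnn ?P "a1 ` carrier G" \<phi>
  proof (rule hnn.intro[OF P.is_group hnn_axioms.intro])
    show "subgroup (a1 ` carrier G) ?P" by (rule a1.img_is_subgroup)
    show "\<phi> (x \<otimes>\<^bsub>?P\<^esub> y) = \<phi> x \<otimes>\<^bsub>?P\<^esub> \<phi> y" if xy: "x \<in> a1 ` carrier G" "y \<in> a1 ` carrier G" for x y
    proof -
      obtain g h where gh: "g \<in> carrier G" "h \<in> carrier G" "x = a1 g" "y = a1 h" using xy by blast
      have "x \<otimes>\<^bsub>?P\<^esub> y = a1 (g \<otimes>\<^bsub>G\<^esub> h)" using gh by (simp only: a1.hom_mult)
      then have "\<phi> (x \<otimes>\<^bsub>?P\<^esub> y) = a2 (g \<otimes>\<^bsub>G\<^esub> h)" using gh by (simp only: phi G.m_closed)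
      also have "\<dots> = a2 g \<otimes>\<^bsub>?P\<^esub> a2 h" by (rule hom_mult[OF ah(2) gh(1,2)])
      finally show ?thesis using gh by (simp only: phi)
    qed
    show "\<phi> x \<in> carrier ?P" if "x \<in> a1 ` carrier G" for x using that phi hom_in_carrier[OF ah(2)] by auto
    show "inj_on \<phi> (a1 ` carrier G)"
      by (rule inj_on_imageI) (use ai(2) phi in \<open>simp add: inj_on_def\<close>)
  qed
  obtain C where C: "finite C" "C \<subseteq> carrier G" "generate G C = carrier G" by (rule fpt_gens[OF assms(1)])
  have "a1 ` C \<subseteq> carrier ?P" using C(2) by (intro image_subsetI a1.hom_closed) blast
  moreover have "a1 ` carrier G = generate ?P (a1 ` C)" by (simp only: a1.generate_img[OF C(2)] C(3))
  ultimately have K: "fpt t.K"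
    using C(1) by (intro t.fpt_K[OF P, of "a1 ` C"]) simp_all
  have l1: "(\<lambda>x. (x, \<one>\<^bsub>K2\<^esub>)) \<in> hom K1 ?P" "(\<lambda>y. (\<one>\<^bsub>K1\<^esub>, y)) \<in> hom K2 ?P" by (auto simp: hom_def)
  define \<alpha> where "\<alpha> x = t.t False \<otimes>\<^bsub>t.K\<^esub> hnn_incl (x, \<one>\<^bsub>K2\<^esub>) \<otimes>\<^bsub>t.K\<^esub> t.t True" for x
  define \<beta> where "\<beta> y = (hnn_incl (\<one>\<^bsub>K1\<^esub>, y) :: ((word set \<times> word set) \<times> bool) list \<times> word set \<times> word set)" for y
  have \<alpha>: "\<alpha> \<in> hom K1 t.K" using hom_compose[OF l1(1) t.cj_hom] unfolding \<alpha>_def[abs_def] comp_def .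
  have \<beta>: "\<beta> \<in> hom K2 t.K" using hom_compose[OF l1(2) t.incl_hom] unfolding \<beta>_def[abs_def] comp_def .
  have b_inj: "inj_on \<beta> (carrier K2)" by (simp add: inj_on_def \<beta>_def)
  have a_inj: "inj_on \<alpha> (carrier K1)"
  proof (rule inj_onI)
    fix x y assume xy: "x \<in> carrier K1" "y \<in> carrier K1" "\<alpha> x = \<alpha> y"
    have c: "t.t b \<in> carrier t.K" "hnn_incl (x, \<one>\<^bsub>K2\<^esub>) \<in> carrier t.K" "hnn_incl (y, \<one>\<^bsub>K2\<^esub>) \<in> carrier t.K" for b
      using xy(1,2) t.t_Omega by (auto simp: t.carrier_K)
    then have "(hnn_incl (x, \<one>\<^bsub>K2\<^esub>) :: ((word set \<times> word set) \<times> bool) list \<times> word set \<times> word set) = hnn_incl (y, \<one>\<^bsub>K2\<^esub>)"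
      using xy(3) unfolding \<alpha>_def by simp
    then show "x = y" by simp
  qed
  have ab: "\<alpha> (i1 g) = \<beta> (i2 g)" if g: "g \<in> carrier G" for g
  proof -
    have D: "a1 g \<in> t.D True" using g by (simp add: hnn_dom_def)
    have "hnn_incl (a1 g) \<otimes>\<^bsub>t.K\<^esub> t.t True = t.t True \<otimes>\<^bsub>t.K\<^esub> hnn_incl (a2 g)"
      using t.t_slide[OF D] phi[OF g] by (simp add: hnn_map_def)
    moreover have "t.t b \<in> carrier t.K" "hnn_incl (a1 g) \<in> carrier t.K" "hnn_incl (a2 g) \<in> carrier t.K" for b
      using g t.t_Omega ah by (auto simp: t.carrier_K hom_def)
    ultimately have "t.t False \<otimes>\<^bsub>t.K\<^esub> hnn_incl (a1 g) \<otimes>\<^bsub>t.K\<^esub> t.t True = hnn_incl (a2 g)"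
      using t.t_t[of False] t.K.m_assoc[of "t.t False" "t.t True" "hnn_incl (a2 g)"] by (simp add: t.K.m_assoc)
    then show ?thesis by (simp add: \<alpha>_def \<beta>_def a1_def a2_def)
  qed
  obtain K :: "word set monoid" and h where K': "fpt K" "h \<in> iso t.K K" using fpt_pres[OF K] by blast
  have h: "h \<in> hom t.K K" "inj_on h (carrier t.K)" using K'(2) by (auto simp: iso_def bij_betw_def)
  have \<alpha>': "h \<circ> \<alpha> \<in> hom K1 K" and \<beta>': "h \<circ> \<beta> \<in> hom K2 K" using hom_compose \<alpha> \<beta> h(1) by blast+
  have \<alpha>i: "inj_on (h \<circ> \<alpha>) (carrier K1)" and \<beta>i: "inj_on (h \<circ> \<beta>) (carrier K2)"
    using a_inj b_inj h(2) \<alpha> \<beta> by (auto intro!: comp_inj_on elim!: inj_on_subset simp: hom_def)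
  note gK = fpt_group[OF K'(1)]
  show ?thesis
  proof (rule exI[of _ K], rule exI[of _ "(h \<circ> \<beta>) \<circ> i2"], rule exI[of _ "(h \<circ> \<alpha>) ` L1"],
      rule exI[of _ "(h \<circ> \<beta>) ` L2"], intro conjI ballI)
    show "(h \<circ> \<beta>) \<circ> i2 \<in> hom G K" using hom_compose 2(2) \<beta>' by blast
    have "i2 ` carrier G \<subseteq> carrier K2" by auto
    then show "inj_on ((h \<circ> \<beta>) \<circ> i2) (carrier G)" using comp_inj_on[OF 2(3)] inj_on_subset[OF \<beta>i] by blast
    have c: "(h \<circ> \<alpha>) ` L1 \<subseteq> carrier K" "(h \<circ> \<beta>) ` L2 \<subseteq> carrier K"
      using 1(5) 2(5) hom_in_carrier[OF \<alpha>'] hom_in_carrier[OF \<beta>'] by blast+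
    show "(h \<circ> \<alpha>) ` L1 \<subseteq> carrier K" by (rule c(1))
    show "(h \<circ> \<beta>) ` L2 \<subseteq> carrier K" by (rule c(2))
    show "g \<in> H1 \<longleftrightarrow> ((h \<circ> \<beta>) \<circ> i2) g \<in> generate K ((h \<circ> \<alpha>) ` L1)" if "g \<in> carrier G" for g
      using inj_hom_generate[OF K1.is_group gK \<alpha>' \<alpha>i 1(5), of "i1 g"] 1(6)[OF that] ab[OF that] that by simp
    show "g \<in> H2 \<longleftrightarrow> ((h \<circ> \<beta>) \<circ> i2) g \<in> generate K ((h \<circ> \<beta>) ` L2)" if "g \<in> carrier G" for g
      using inj_hom_generate[OF K2.is_group gK \<beta>' \<beta>i 2(5), of "i2 g"] 2(6)[OF that] that by simp
  qed (use 1 2 K' in auto)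
qed

text \<open>Stable letters \<open>p\<close> and \<open>q\<close> are adjoined that commute with the
  subgroups generated by \<open>L1\<close> and \<open>L2\<close>. The conjugate of \<open>G\<close>
  by \<open>p q\<close> meets \<open>G\<close> in the intersection, since a conjugate falls back
  into the base only for elements that commute with the letter. The conjugates of \<open>G\<close>
  by \<open>p\<close> and by \<open>q\<close> together generate a subgroup that meets
  \<open>G\<close> in the join.\<close>

lemma benign_int_join:
  assumes "fpt G" "benign G H1" "benign G H2"
  shows "benign G (H1 \<inter> H2)" "benign G (generate G (H1 \<union> H2))"
proof -
  obtain K :: "word set monoid" and i L1 L2 where K: "fpt K" and i: "i \<in> hom G K" "inj_on i (carrier G)"
    and L: "finite L1" "finite L2" "L1 \<subseteq> carrier K" "L2 \<subseteq> carrier K"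
    and H1: "\<And>g. g \<in> carrier G \<Longrightarrow> g \<in> H1 \<longleftrightarrow> i g \<in> generate K L1"
    and H2: "\<And>g. g \<in> carrier G \<Longrightarrow> g \<in> H2 \<longleftrightarrow> i g \<in> generate K L2"
    using common_overgroup[OF assms] by blast
  interpret G: group G by (rule fpt_group[OF assms(1)])
  interpret K: group K by (rule fpt_group[OF K])
  interpret i: group_hom G K i by (rule group_homI[OF G.is_group K.is_group i(1)])
  interpret p: hnn K "generate K L1" "\<lambda>x. x" by (rule hnn_id[OF K.is_group K.generate_is_subgroup[OF L(3)]])
  interpret pi: group_hom K p.K hnn_incl by (rule group_homI[OF K.is_group p.group_K p.incl_hom])
  let ?A2 = "hnn_incl ` generate K L2"
  have A2: "?A2 = generate p.K (hnn_incl ` L2)" using pi.generate_img[OF L(4)] by simp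
  have iL2: "hnn_incl ` L2 \<subseteq> carrier p.K" using L(4) by (auto simp: p.carrier_K)
  interpret q: hnn p.K ?A2 "\<lambda>x. x" unfolding A2 by (rule hnn_id[OF p.group_K p.K.generate_is_subgroup[OF iL2]])
  have pK: "fpt p.K" by (rule p.fpt_K[OF K L(1,3) HOL.refl])
  have qK: "fpt q.K" by (rule q.fpt_K[OF pK _ iL2 A2]) (simp add: L(2))
  obtain C where C: "finite C" "C \<subseteq> carrier G" "generate G C = carrier G" by (rule fpt_gens[OF assms(1)])
  define j where "j g = (hnn_incl (hnn_incl (i g)) :: (((word set \<times> bool) list \<times> word set) \<times> bool) list \<times> (word set \<times> bool) list \<times> word set)" for g
  have j: "j \<in> hom G q.K" using hom_compose[OF hom_compose[OF i(1) p.incl_hom] q.incl_hom] unfolding j_def[abs_def] comp_def .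
  have ji: "inj_on j (carrier G)" using i(2) by (auto simp: inj_on_def j_def)
  have HG: "H1 \<subseteq> carrier G" "H2 \<subseteq> carrier G" using assms by (auto simp: benign_def)
  define a where "a g = q.cj (p.cj (i g))" for g
  have a: "a \<in> hom G q.K" using hom_compose[OF hom_compose[OF i(1) p.cj_hom] q.cj_hom] unfolding a_def[abs_def] comp_def .
  define b where "b g = q.cj (hnn_incl (i g))" for g
  have b: "b \<in> hom G q.K" using hom_compose[OF hom_compose[OF i(1) p.incl_hom] q.cj_hom] unfolding b_def[abs_def] comp_def .
  define c where "c g = (hnn_incl (p.cj (i g)) :: ((((word set \<times> bool) list \<times> word set) \<times> bool) list \<times> (word set \<times> bool) list \<times> word set))" for g
  have c: "c \<in> hom G q.K" using hom_compose[OF hom_compose[OF i(1) p.cj_hom] q.incl_hom] unfolding c_def[abs_def] comp_def .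
  interpret a: group_hom G q.K a by (rule group_homI[OF G.is_group q.group_K a])
  interpret b: group_hom G q.K b by (rule group_homI[OF G.is_group q.group_K b])
  interpret c: group_hom G q.K c by (rule group_homI[OF G.is_group q.group_K c])
  interpret j: group_hom G q.K j by (rule group_homI[OF G.is_group q.group_K j])
  have cH1: "c g = j g" if "g \<in> H1" for g
    using p.cj_A[of "i g"] H1[of g] that HG by (auto simp: c_def j_def)
  have bH2: "b g = j g" if "g \<in> H2" for g
    using q.cj_A[of "hnn_incl (i g)"] H2[of g] that HG by (auto simp: b_def j_def)
  show "benign G (H1 \<inter> H2)"
  proof (rule benignI[OF G.is_group qK j ji, of "a ` C"])
    fix g assume g: "g \<in> carrier G"
    have gen: "generate q.K (a ` C) = a ` carrier G" using a.generate_img[OF C(2)] C(3) by simp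
    show "g \<in> H1 \<inter> H2 \<longleftrightarrow> j g \<in> generate q.K (a ` C)" unfolding gen
    proof
      assume "g \<in> H1 \<inter> H2"
      then have "p.cj (i g) = hnn_incl (i g)" "q.cj (hnn_incl (i g)) = j g"
        using p.cj_A[of "i g"] q.cj_A[of "hnn_incl (i g)"] H1 H2 g by (auto simp: j_def)
      then have "a g = j g" by (simp add: a_def)
      then show "j g \<in> a ` carrier G" using g by (metis imageI)
    next
      assume "j g \<in> a ` carrier G"
      then obtain g' where g': "g' \<in> carrier G" "j g = a g'" by blast
      have ig: "i g' \<in> carrier K" using g' by simp
      have "p.cj (i g') \<in> carrier p.K" using p.cj_hom ig by (auto simp: hom_def)
      moreover have "q.cj (p.cj (i g')) = hnn_incl (hnn_incl (i g))" using g'(2) by (simp add: a_def j_def)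
      ultimately have "p.cj (i g') \<in> ?A2" by (rule q.cj_base)
      then obtain y where y: "y \<in> generate K L2" "p.cj (i g') = hnn_incl y" by blast
      have "i g' \<in> generate K L1" using p.cj_base[OF ig y(2)] .
      moreover from this have "y = i g'" using p.cj_A[of "i g'"] y(2) by simp
      ultimately have "g' \<in> H1 \<inter> H2" using H1 H2 g' y by blast
      moreover have "a g' = j g'" using \<open>y = i g'\<close> y q.cj_A[of "hnn_incl y"] by (simp add: a_def j_def)
      then have "g = g'" using g'(2) inj_onD[OF ji, of g g'] g g' by simp
      ultimately show "g \<in> H1 \<inter> H2" by simp
    qed
  qed (use C HG in auto)
  let ?J = "generate G (H1 \<union> H2)"
  have HJ: "H1 \<union> H2 \<subseteq> carrier G" using HG by blast
  have Jc: "?J \<subseteq> carrier G" using G.generate_incl[OF HJ] .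
  have J: "subgroup (i ` ?J) K" by (rule i.subgroup_img_is_subgroup[OF G.generate_is_subgroup[OF HJ]])
  have P: "subgroup (i ` carrier G) K" by (rule i.img_is_subgroup)
  \<comment> \<open>The join is located in two stages: \<open>?C1\<close> is generated by the
    conjugate of \<open>G\<close> by \<open>p\<close> and by the join, and it meets the base in the
    join; adding the conjugate by \<open>q\<close> then contributes nothing new inside
    \<open>p.K\<close>.\<close>
  let ?C1 = "generate p.K (p.cj ` (i ` carrier G) \<union> hnn_incl ` (i ` ?J))"
  have c1: "p.cj ` (i ` carrier G) \<union> hnn_incl ` (i ` ?J) \<subseteq> carrier p.K"
    using p.cj_hom Jc by (auto simp: hom_def p.carrier_K)
  have 1: "y \<in> i ` ?J" if "hnn_incl y \<in> ?C1" for y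
  proof (rule p.join_base[OF HOL.refl P J _ _ that])
    show "generate K L1 \<inter> i ` carrier G \<subseteq> i ` ?J" using H1 by (auto intro!: imageI generate.incl)
    show "i ` ?J \<inter> generate K L1 \<subseteq> i ` carrier G" using Jc by blast
  qed
  have sC1: "subgroup ?C1 p.K" by (rule p.K.generate_is_subgroup[OF c1])
  have P2: "subgroup (hnn_incl ` i ` carrier G) p.K" by (rule pi.subgroup_img_is_subgroup[OF P])
  have 2: "y \<in> ?C1" if "hnn_incl y \<in> generate q.K (q.cj ` (hnn_incl ` i ` carrier G) \<union> hnn_incl ` ?C1)" for y
  proof (rule q.join_base[OF HOL.refl P2 sC1 _ _ that])
    show "?A2 \<inter> hnn_incl ` i ` carrier G \<subseteq> ?C1"
    proof clarify
      fix y g assume "i g \<in> generate K L2" "g \<in> carrier G"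
      then have "g \<in> ?J" using H2 by (auto intro: generate.incl)
      then show "hnn_incl (i g) \<in> ?C1" by (auto intro!: generate.incl)
    qed
    show "?C1 \<inter> ?A2 \<subseteq> hnn_incl ` i ` carrier G"
    proof
      fix x assume x: "x \<in> ?C1 \<inter> ?A2"
      then obtain y where y: "x = hnn_incl y" by blast
      then have "y \<in> i ` ?J" using 1[of y] x by simp
      then show "x \<in> hnn_incl ` i ` carrier G" unfolding y using Jc by blast
    qed
  qed
  show "benign G ?J"
  proof (rule benignI[OF G.is_group qK j ji, of "b ` C \<union> c ` C"])
    have bc: "b ` C \<union> c ` C \<subseteq> carrier q.K" using C by auto
    then show "b ` C \<union> c ` C \<subseteq> carrier q.K" .
    fix g assume g: "g \<in> carrier G"
    have gen: "b ` carrier G \<subseteq> generate q.K (b ` C \<union> c ` C)" "c ` carrier G \<subseteq> generate q.K (b ` C \<union> c ` C)"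
      unfolding C(3)[symmetric] b.generate_img[OF C(2), symmetric] c.generate_img[OF C(2), symmetric]
      by (rule q.K.mono_generate; blast)+
    show "g \<in> ?J \<longleftrightarrow> j g \<in> generate q.K (b ` C \<union> c ` C)"
    proof
      assume gJ: "g \<in> ?J"
      have "j ` (H1 \<union> H2) \<subseteq> b ` carrier G \<union> c ` carrier G"
      proof (rule image_subsetI)
        fix x assume x: "x \<in> H1 \<union> H2"
        show "j x \<in> b ` carrier G \<union> c ` carrier G"
        proof (cases "x \<in> H1")
          case True then show ?thesis unfolding cH1[OF True, symmetric] using HG by blast
        next
          case False
          then have "x \<in> H2" using x by blast
          then show ?thesis unfolding bH2[OF \<open>x \<in> H2\<close>, symmetric] using HG by blast
        qed
      qed
      then have "generate q.K (j ` (H1 \<union> H2)) \<subseteq> generate q.K (b ` C \<union> c ` C)"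
        using gen by (intro q.K.generate_subgroup_incl q.K.generate_is_subgroup bc) blast
      then show "j g \<in> generate q.K (b ` C \<union> c ` C)" using j.generate_img[OF HJ] gJ by blast
    next
      assume "j g \<in> generate q.K (b ` C \<union> c ` C)"
      moreover have "b ` C \<subseteq> q.cj ` (hnn_incl ` i ` carrier G)" "c ` C \<subseteq> hnn_incl ` ?C1"
        using C(2) by (auto simp: b_def c_def intro!: imageI generate.incl)
      then have "generate q.K (b ` C \<union> c ` C) \<subseteq> generate q.K (q.cj ` (hnn_incl ` i ` carrier G) \<union> hnn_incl ` ?C1)"
        by (intro q.K.mono_generate) blast
      ultimately have "i g \<in> i ` ?J" unfolding j_def by (intro 1 2) blast
      then show "g \<in> ?J" using inj_on_image_mem_iff[OF i(2) g Jc] by blast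
    qed
  qed (use C Jc in auto)
qed

text \<open>The graph of \<open>f\<close> over \<open>H\<close>, joined with the first factor,
  contains \<open>(1, f h)\<close> because \<open>(h, f h)\<close> can be multiplied by
  \<open>(inv h, 1)\<close>. Conversely the second coordinates of the join stay in the image of
  \<open>H\<close>.\<close>

lemma benign_image:
  assumes "fpt G" "fpt M" "f \<in> hom G M" "benign G H" shows "benign M (f ` H)"
proof -
  interpret G: group G by (rule fpt_group[OF assms(1)])
  interpret M: group M by (rule fpt_group[OF assms(2)])
  interpret f: group_hom G M f by (rule group_homI[OF G.is_group M.is_group assms(3)])
  let ?P = "G \<times>\<times> M"
  have P: "fpt ?P" by (rule fpt_prod[OF assms(1,2)])
  have H: "H \<subseteq> carrier G" "subgroup H G" using assms(4) benign_subgroup[OF G.is_group] by (auto simp: benign_def)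
  let ?\<Gamma> = "(\<lambda>x. (x, f x)) ` carrier G" and ?G = "(\<lambda>x. (x, \<one>\<^bsub>M\<^esub>)) ` carrier G"
  have \<Gamma>: "benign ?P ?\<Gamma>" "benign ?P ?G" by (rule benign_hom_image[OF assms(1) P]; auto simp: hom_def)+
  let ?X = "(H \<times> carrier M) \<inter> ?\<Gamma>"
  have X: "benign ?P (generate ?P (?X \<union> ?G))"
    by (intro benign_int_join P benign_cylinder G.is_group assms \<Gamma>)
  interpret P: group ?P by (rule fpt_group[OF P])
  have sub: "?X \<union> ?G \<subseteq> carrier ?P" using H by auto
  have "{m \<in> carrier M. (\<one>\<^bsub>G\<^esub>, m) \<in> generate ?P (?X \<union> ?G)} = f ` H"
  proof (intro equalityI subsetI)
    fix m assume m: "m \<in> {m \<in> carrier M. (\<one>\<^bsub>G\<^esub>, m) \<in> generate ?P (?X \<union> ?G)}"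
    have fH: "subgroup (f ` H) M" by (rule f.subgroup_img_is_subgroup[OF H(2)])
    have "generate ?P (?X \<union> ?G) \<subseteq> carrier G \<times> f ` H"
      by (rule P.generate_subgroup_incl[OF _ DirProd_subgroups[OF G.is_group G.subgroup_self M.is_group fH]])
        (use subgroup.one_closed[OF fH] in auto)
    then show "m \<in> f ` H" using m by blast
  next
    fix m assume "m \<in> f ` H"
    then obtain h where h: "h \<in> H" "h \<in> carrier G" "m = f h" using H by blast
    have "(h, f h) \<otimes>\<^bsub>?P\<^esub> (inv\<^bsub>G\<^esub> h, \<one>\<^bsub>M\<^esub>) \<in> generate ?P (?X \<union> ?G)"
      using h by (intro generate.eng generate.incl) auto
    then show "m \<in> {m \<in> carrier M. (\<one>\<^bsub>G\<^esub>, m) \<in> generate ?P (?X \<union> ?G)}" using h by simp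
  qed
  moreover have "benign M {m \<in> carrier M. (\<one>\<^bsub>G\<^esub>, m) \<in> generate ?P (?X \<union> ?G)}"
    by (rule benign_restrict[OF M.is_group P.is_group _ _ X]) (auto simp: hom_def inj_on_def)
  ultimately show ?thesis by simp
qed

text \<open>The preimage is the projection to \<open>G\<close> of the graph of \<open>f\<close>, cut
  down to \<open>H\<close> in the second coordinate.\<close>

lemma benign_vimage:
  assumes "fpt G" "fpt M" "f \<in> hom G M" "benign M H" shows "benign G {g \<in> carrier G. f g \<in> H}"
proof -
  interpret G: group G by (rule fpt_group[OF assms(1)])
  interpret M: group M by (rule fpt_group[OF assms(2)])
  interpret f: group_hom G M f by (rule group_homI[OF G.is_group M.is_group assms(3)])
  let ?P = "G \<times>\<times> M"
  have P: "fpt ?P" by (rule fpt_prod[OF assms(1,2)])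
  have \<Gamma>: "benign ?P ((\<lambda>x. (x, f x)) ` carrier G)" by (rule benign_hom_image[OF assms(1) P]) (auto simp: hom_def)
  have X: "benign ?P ((carrier G \<times> H) \<inter> (\<lambda>x. (x, f x)) ` carrier G)"
    by (intro benign_int_join P benign_cylinder' M.is_group assms \<Gamma>)
  have "fst \<in> hom ?P G" by (auto simp: hom_def)
  from benign_image[OF P assms(1) this X]
  have "benign G (fst ` ((carrier G \<times> H) \<inter> (\<lambda>x. (x, f x)) ` carrier G))" .
  moreover have "fst ` ((carrier G \<times> H) \<inter> (\<lambda>x. (x, f x)) ` carrier G) = {g \<in> carrier G. f g \<in> H}"
  proof (intro equalityI subsetI)
    fix x assume "x \<in> {g \<in> carrier G. f g \<in> H}"
    then have "(x, f x) \<in> (carrier G \<times> H) \<inter> (\<lambda>x. (x, f x)) ` carrier G" by auto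
    then show "x \<in> fst ` ((carrier G \<times> H) \<inter> (\<lambda>x. (x, f x)) ` carrier G)" by (metis fst_conv imageI)
  qed auto
  ultimately show ?thesis by simp
qed

section \<open>Benign sets\<close>

definition wreath :: "('p, 'c) monoid_scheme \<Rightarrow> ('a, 'd) monoid_scheme \<Rightarrow> (('a \<Rightarrow> 'p) \<times> 'a) monoid" where
  "wreath P G = \<lparr>carrier = (carrier G \<rightarrow>\<^sub>E carrier P) \<times> carrier G,
     mult = (\<lambda>a b. (\<lambda>u\<in>carrier G. fst a (snd b \<otimes>\<^bsub>G\<^esub> u) \<otimes>\<^bsub>P\<^esub> fst b u, snd a \<otimes>\<^bsub>G\<^esub> snd b)),
     one = (\<lambda>u\<in>carrier G. \<one>\<^bsub>P\<^esub>, \<one>\<^bsub>G\<^esub>)\<rparr>"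

lemma wreath_simps:
  "carrier (wreath P G) = (carrier G \<rightarrow>\<^sub>E carrier P) \<times> carrier G"
  "a \<otimes>\<^bsub>wreath P G\<^esub> b = (\<lambda>u\<in>carrier G. fst a (snd b \<otimes>\<^bsub>G\<^esub> u) \<otimes>\<^bsub>P\<^esub> fst b u, snd a \<otimes>\<^bsub>G\<^esub> snd b)"
  "\<one>\<^bsub>wreath P G\<^esub> = (\<lambda>u\<in>carrier G. \<one>\<^bsub>P\<^esub>, \<one>\<^bsub>G\<^esub>)"
  by (simp_all add: wreath_def)

lemma group_wreath: assumes "group P" "group G" shows "group (wreath P G)"
proof (rule groupI)
  interpret P: group P by fact
  interpret G: group G by fact
  let ?W = "wreath P G"
  show "\<one>\<^bsub>?W\<^esub> \<in> carrier ?W" by (simp add: wreath_simps restrict_PiE_iff)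
  fix a assume a: "a \<in> carrier ?W"
  have ac: "fst a u \<in> carrier P" "snd a \<in> carrier G" if "u \<in> carrier G" for u
    using a that by (auto simp: wreath_simps)
  have ga: "snd a \<in> carrier G" using a by (auto simp: wreath_simps)
  have ae: "fst a u = undefined" if "u \<notin> carrier G" for u
    using a that by (auto simp: wreath_simps intro: PiE_arb)
  show "\<one>\<^bsub>?W\<^esub> \<otimes>\<^bsub>?W\<^esub> a = a"
  proof (rule prod_eqI)
    show "fst (\<one>\<^bsub>?W\<^esub> \<otimes>\<^bsub>?W\<^esub> a) = fst a"
    proof
      show "fst (\<one>\<^bsub>?W\<^esub> \<otimes>\<^bsub>?W\<^esub> a) u = fst a u" for u
        by (cases "u \<in> carrier G") (simp_all add: wreath_simps ac ae)
    qed
  qed (simp add: wreath_simps ga)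
  let ?i = "(\<lambda>u\<in>carrier G. inv\<^bsub>P\<^esub> (fst a (inv\<^bsub>G\<^esub> (snd a) \<otimes>\<^bsub>G\<^esub> u)), inv\<^bsub>G\<^esub> (snd a))"
  have "?i \<in> carrier ?W" by (simp add: wreath_simps restrict_PiE_iff ac ga)
  moreover have "?i \<otimes>\<^bsub>?W\<^esub> a = \<one>\<^bsub>?W\<^esub>"
    by (simp add: wreath_simps ga) (rule restrict_ext, simp add: ac ga)
  ultimately show "\<exists>i\<in>carrier ?W. i \<otimes>\<^bsub>?W\<^esub> a = \<one>\<^bsub>?W\<^esub>" by (rule bexI[rotated])
  fix b assume b: "b \<in> carrier ?W"
  have bc: "fst b u \<in> carrier P" if "u \<in> carrier G" for u
    using b that by (auto simp: wreath_simps)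
  have gb: "snd b \<in> carrier G" using b by (auto simp: wreath_simps)
  show "a \<otimes>\<^bsub>?W\<^esub> b \<in> carrier ?W" by (simp add: wreath_simps restrict_PiE_iff ac bc ga gb)
  fix c assume c: "c \<in> carrier ?W"
  have cc: "fst c u \<in> carrier P" if "u \<in> carrier G" for u
    using c that by (auto simp: wreath_simps)
  have gc: "snd c \<in> carrier G" using c by (auto simp: wreath_simps)
  show "a \<otimes>\<^bsub>?W\<^esub> b \<otimes>\<^bsub>?W\<^esub> c = a \<otimes>\<^bsub>?W\<^esub> (b \<otimes>\<^bsub>?W\<^esub> c)"
    by (simp add: wreath_simps ga gb gc G.m_assoc)
      (rule restrict_ext, simp add: ac bc cc ga gb gc G.m_assoc P.m_assoc)
qed

definition fz :: "('a, 'c) monoid_scheme \<Rightarrow> (('a \<times> bool) list \<times> 'a) monoid" where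
  "fz G = HNN G {\<one>\<^bsub>G\<^esub>} (\<lambda>x. x)"

definition tc :: "('a, 'c) monoid_scheme \<Rightarrow> 'a \<Rightarrow> ('a \<times> bool) list \<times> 'a" where
  "tc G g = ([], inv\<^bsub>G\<^esub> g) \<otimes>\<^bsub>fz G\<^esub> hnn_t G True \<otimes>\<^bsub>fz G\<^esub> ([], g)"

definition fall :: "('a, 'c) monoid_scheme \<Rightarrow> (('a \<times> bool) list \<times> 'a) set" where
  "fall G = generate (fz G) (tc G ` carrier G)"

text \<open>\<open>fz G\<close> is the free product of \<open>G\<close> with an infinite cyclic group; the conjugates \<open>tc G g\<close> of its
  generator form a basis of their span \<open>fall G\<close>.\<close>

locale fzgroup = group G for G (structure)
begin

lemma hnn_fz: "hnn G {\<one>} (\<lambda>x. x)"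
  by (rule hnn_id[OF is_group triv_subgroup])

interpretation z: hnn G "{\<one>}" "\<lambda>x. x" by (rule hnn_fz)

lemma group_fz: "group (fz G)" unfolding fz_def by (rule z.group_K)

sublocale Z: group "fz G" by (rule group_fz)

lemma incl_hom_fz: "hnn_incl \<in> hom G (fz G)" unfolding fz_def by (rule z.incl_hom)

lemma incl_fz [simp]: "g \<in> carrier G \<Longrightarrow> ([], g) \<in> carrier (fz G)"
  by (simp add: fz_def z.carrier_K)

lemma t_fz [simp]: "hnn_t G b \<in> carrier (fz G)"
  by (simp add: fz_def z.carrier_K z.t_Omega)

lemma incl_mult_fz: "([], g) \<otimes>\<^bsub>fz G\<^esub> ([], h) = ([], g \<otimes> h)"
  by (simp add: fz_def z.incl_mult)

lemma one_fz: "\<one>\<^bsub>fz G\<^esub> = ([], \<one>)" by (simp add: fz_def z.one_K)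

lemma incl_inv_fz: "g \<in> carrier G \<Longrightarrow> inv\<^bsub>fz G\<^esub> ([], g) = ([], inv g)"
  by (simp add: fz_def z.incl_inv)

lemma tc_closed [simp]: "g \<in> carrier G \<Longrightarrow> tc G g \<in> carrier (fz G)" by (simp add: tc_def)

lemma tc_one: "tc G \<one> = hnn_t G True"
proof -
  have "tc G \<one> = \<one>\<^bsub>fz G\<^esub> \<otimes>\<^bsub>fz G\<^esub> hnn_t G True \<otimes>\<^bsub>fz G\<^esub> \<one>\<^bsub>fz G\<^esub>" unfolding tc_def one_fz by simp
  then show ?thesis by simp
qed

lemma tc_image: "S \<subseteq> carrier G \<Longrightarrow> tc G ` S \<subseteq> carrier (fz G)" by auto

lemma fz_generated: "generate G S = carrier G \<Longrightarrow> S \<subseteq> carrier G \<Longrightarrow>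
    generate (fz G) (hnn_incl ` S \<union> {hnn_t G True}) = carrier (fz G)"
  unfolding fz_def by (rule z.K_generated_by)

lemma fz_universal:
  assumes "group M" "h \<in> hom G M" "\<tau> \<in> carrier M"
  shows "\<exists>k\<in>hom (fz G) M. (\<forall>g\<in>carrier G. k ([], g) = h g) \<and> k (hnn_t G True) = \<tau> \<and>
     (\<forall>g\<in>carrier G. k (tc G g) = inv\<^bsub>M\<^esub> (h g) \<otimes>\<^bsub>M\<^esub> \<tau> \<otimes>\<^bsub>M\<^esub> h g)"
proof -
  interpret h: group_hom G M h by (rule group_homI[OF is_group assms(1,2)])
  obtain k where k: "k \<in> hom (fz G) M" "\<And>g. g \<in> carrier G \<Longrightarrow> k ([], g) = h g" "k (hnn_t G True) = \<tau>"
    using z.universal[OF assms] assms(3) unfolding fz_def by auto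
  interpret k: group_hom "fz G" M k by (rule group_homI[OF group_fz assms(1) k(1)])
  have "k (tc G g) = inv\<^bsub>M\<^esub> (h g) \<otimes>\<^bsub>M\<^esub> \<tau> \<otimes>\<^bsub>M\<^esub> h g" if "g \<in> carrier G" for g
    using that k(2,3) by (simp add: tc_def)
  then show ?thesis using k by (intro bexI[OF _ k(1)]) auto
qed

lemma conj_tc: assumes "d \<in> carrier G" "s \<in> carrier G"
  shows "([], d) \<otimes>\<^bsub>fz G\<^esub> tc G s = tc G (s \<otimes> inv d) \<otimes>\<^bsub>fz G\<^esub> ([], d)"
proof -
  have "tc G (s \<otimes> inv d) \<otimes>\<^bsub>fz G\<^esub> ([], d) =
      ([], inv (s \<otimes> inv d)) \<otimes>\<^bsub>fz G\<^esub> hnn_t G True \<otimes>\<^bsub>fz G\<^esub> (([], s \<otimes> inv d) \<otimes>\<^bsub>fz G\<^esub> ([], d))"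
    using assms by (simp add: tc_def Z.m_assoc)
  also have "\<dots> = ([], d) \<otimes>\<^bsub>fz G\<^esub> ([], inv s) \<otimes>\<^bsub>fz G\<^esub> hnn_t G True \<otimes>\<^bsub>fz G\<^esub> ([], s)"
    using assms by (simp add: incl_mult_fz inv_mult_group m_assoc)
  finally show ?thesis using assms by (simp add: tc_def Z.m_assoc)
qed

lemma fall_subgroup: "subgroup (fall G) (fz G)"
  unfolding fall_def by (rule Z.generate_is_subgroup) auto

lemma fall_tc: "g \<in> carrier G \<Longrightarrow> tc G g \<in> fall G" unfolding fall_def by (auto intro: generate.incl)

lemma fall_mono: "S \<subseteq> carrier G \<Longrightarrow> generate (fz G) (tc G ` S) \<subseteq> fall G"
  unfolding fall_def by (rule Z.mono_generate) auto

lemma group_fall: "group (fz G\<lparr>carrier := fall G\<rparr>)"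
  by (rule Z.subgroup_imp_group[OF fall_subgroup])

text \<open>Freeness is seen in the wreath product: \<open>t\<close> is sent to the function
  \<open>A\<close>, so \<open>tc G g\<close> becomes \<open>A\<close> translated by
  \<open>g\<close>, with value \<open>A g\<close> at the identity. On \<open>fall G\<close> the
  component in \<open>G\<close> is trivial, and therefore evaluation at the identity is a
  homomorphism there.\<close>

lemma fz_basis:
  assumes P: "group P" and A: "\<And>g. g \<in> carrier G \<Longrightarrow> A g \<in> carrier P"
  shows "\<exists>\<rho>\<in>hom (fz G\<lparr>carrier := fall G\<rparr>) P. \<forall>g\<in>carrier G. \<rho> (tc G g) = A g"
proof -
  interpret P: group P by fact
  interpret W: group "wreath P G" by (rule group_wreath[OF P is_group])
  define h where "h g = (\<lambda>u\<in>carrier G. \<one>\<^bsub>P\<^esub>, g)" for g :: 'a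
  have h: "h \<in> hom G (wreath P G)"
    by (auto simp: hom_def h_def wreath_simps restrict_def fun_eq_iff)
  have AW: "(\<lambda>u\<in>carrier G. A u, \<one>) \<in> carrier (wreath P G)" using A by (auto simp: wreath_simps)
  obtain k where k: "k \<in> hom (fz G) (wreath P G)"
     "\<And>g. g \<in> carrier G \<Longrightarrow> k (tc G g) = inv\<^bsub>wreath P G\<^esub> (h g) \<otimes>\<^bsub>wreath P G\<^esub> (\<lambda>u\<in>carrier G. A u, \<one>) \<otimes>\<^bsub>wreath P G\<^esub> h g"
    using fz_universal[OF W.is_group h AW] by blast
  interpret h: group_hom G "wreath P G" h by (rule group_homI[OF is_group W.is_group h])
  interpret k: group_hom "fz G" "wreath P G" k by (rule group_homI[OF group_fz W.is_group k(1)])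
  have ktc: "k (tc G g) = (\<lambda>u\<in>carrier G. A (g \<otimes> u), \<one>)" if g: "g \<in> carrier G" for g
  proof -
    have "k (tc G g) = h (inv g) \<otimes>\<^bsub>wreath P G\<^esub> (\<lambda>u\<in>carrier G. A u, \<one>) \<otimes>\<^bsub>wreath P G\<^esub> h g"
      using k(2)[OF g] h.hom_inv[OF g] by simp
    then show ?thesis using g A by (auto simp: h_def wreath_simps fun_eq_iff restrict_def)
  qed
  have sub: "subgroup ({p \<in> carrier (wreath P G). snd p = \<one>}) (wreath P G)"
  proof (rule W.subgroupI)
    have "\<one>\<^bsub>wreath P G\<^esub> \<in> {p \<in> carrier (wreath P G). snd p = \<one>}" using W.one_closed by (simp add: wreath_simps(3))
    then show "{p \<in> carrier (wreath P G). snd p = \<one>} \<noteq> {}" by blast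
    fix a assume a: "a \<in> {p \<in> carrier (wreath P G). snd p = \<one>}"
    then have i: "inv\<^bsub>wreath P G\<^esub> a \<in> carrier (wreath P G)" by simp
    have "snd (inv\<^bsub>wreath P G\<^esub> a \<otimes>\<^bsub>wreath P G\<^esub> a) = \<one>" using a by (simp add: wreath_simps(3))
    then have "snd (inv\<^bsub>wreath P G\<^esub> a) \<otimes> \<one> = \<one>" using a by (simp add: wreath_simps(2))
    moreover have "snd (inv\<^bsub>wreath P G\<^esub> a) \<in> carrier G" using i by (auto simp: wreath_simps(1))
    ultimately show "inv\<^bsub>wreath P G\<^esub> a \<in> {p \<in> carrier (wreath P G). snd p = \<one>}" using i by simp
    fix b assume b: "b \<in> {p \<in> carrier (wreath P G). snd p = \<one>}"
    then have "a \<otimes>\<^bsub>wreath P G\<^esub> b \<in> carrier (wreath P G)" using a by simp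
    then show "a \<otimes>\<^bsub>wreath P G\<^esub> b \<in> {p \<in> carrier (wreath P G). snd p = \<one>}"
      using a b by (simp add: wreath_simps(2))
  qed blast
  have kf: "k x \<in> {p \<in> carrier (wreath P G). snd p = \<one>}" if "x \<in> fall G" for x
  proof -
    have "tc G ` carrier G \<subseteq> carrier (fz G)" by auto
    then have "k ` fall G = generate (wreath P G) (k ` tc G ` carrier G)"
      unfolding fall_def using k.generate_img by simp
    also have "\<dots> \<subseteq> {p \<in> carrier (wreath P G). snd p = \<one>}"
    proof (rule W.generate_subgroup_incl[OF _ sub], rule image_subsetI)
      fix y assume "y \<in> tc G ` carrier G"
      then obtain g where g: "g \<in> carrier G" "y = tc G g" by blast
      then have "k y \<in> carrier (wreath P G)" by simp
      moreover have "snd (k y) = \<one>" using g ktc by simp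
      ultimately show "k y \<in> {p \<in> carrier (wreath P G). snd p = \<one>}" by simp
    qed
    finally show ?thesis using that by blast
  qed
  have "(\<lambda>x. fst (k x) \<one>) \<in> hom (fz G\<lparr>carrier := fall G\<rparr>) P"
  proof (rule homI)
    fix x assume "x \<in> carrier (fz G\<lparr>carrier := fall G\<rparr>)"
    then show "fst (k x) \<one> \<in> carrier P" using kf[of x] by (auto simp: wreath_simps(1))
  next
    fix x y assume "x \<in> carrier (fz G\<lparr>carrier := fall G\<rparr>)" "y \<in> carrier (fz G\<lparr>carrier := fall G\<rparr>)"
    then have xy: "x \<in> fall G" "y \<in> fall G" by simp_all
    then have c: "x \<in> carrier (fz G)" "y \<in> carrier (fz G)" using subgroup.subset[OF fall_subgroup] by blast+
    have "k (x \<otimes>\<^bsub>fz G\<^esub> y) = k x \<otimes>\<^bsub>wreath P G\<^esub> k y" using c by simp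
    then show "fst (k (x \<otimes>\<^bsub>fz G\<lparr>carrier := fall G\<rparr>\<^esub> y)) \<one> = fst (k x) \<one> \<otimes>\<^bsub>P\<^esub> fst (k y) \<one>"
      using kf[OF xy(2)] by (simp add: wreath_simps(2))
  qed
  moreover have "\<forall>g\<in>carrier G. fst (k (tc G g)) \<one> = A g" by (simp add: ktc)
  ultimately show ?thesis by (intro bexI[of _ "\<lambda>x. fst (k x) \<one>"])
qed

text \<open>An element \<open>d\<close> of \<open>D\<close> passes \<open>tc G s\<close> from left
  to right while turning it into \<open>tc G (s d^-1)\<close>, so the factors from \<open>D\<close>
  can be collected on the right.\<close>

lemma fz_split:
  assumes S: "S \<subseteq> carrier G" and D: "subgroup D G" and x: "x \<in> generate (fz G) (tc G ` S \<union> hnn_incl ` D)"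
  shows "\<exists>f\<in>generate (fz G) (tc G ` {s \<otimes> d | s d. s \<in> S \<and> d \<in> D}). \<exists>d\<in>D. x = f \<otimes>\<^bsub>fz G\<^esub> ([], d)"
proof -
  interpret D: subgroup D G by fact
  let ?SD = "{s \<otimes> d | s d. s \<in> S \<and> d \<in> D}"
  let ?F = "generate (fz G) (tc G ` ?SD)"
  have SD: "?SD \<subseteq> carrier G" using S by auto
  have Fc: "?F \<subseteq> carrier (fz G)" by (rule Z.generate_incl[OF tc_image[OF SD]])
  have T: "tc G ` S \<union> hnn_incl ` D \<subseteq> carrier (fz G)" using S by auto
  show ?thesis
  proof (rule Z.generate_right_induct[OF T x])
    show "\<exists>f\<in>?F. \<exists>d\<in>D. \<one>\<^bsub>fz G\<^esub> = f \<otimes>\<^bsub>fz G\<^esub> ([], d)"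
      by (intro bexI[of _ "\<one>\<^bsub>fz G\<^esub>"] bexI[of _ \<one>]) (auto simp: one_fz incl_mult_fz generate.one[of "fz G", unfolded one_fz])
  next
    fix x y assume "\<exists>f\<in>?F. \<exists>d\<in>D. x = f \<otimes>\<^bsub>fz G\<^esub> ([], d)" and y: "y \<in> tc G ` S \<union> hnn_incl ` D"
    then obtain f d where fd: "f \<in> ?F" "d \<in> D" "x = f \<otimes>\<^bsub>fz G\<^esub> ([], d)" by blast
    have c: "f \<in> carrier (fz G)" "d \<in> carrier G" using fd Fc by auto
    show "(\<exists>f\<in>?F. \<exists>d\<in>D. x \<otimes>\<^bsub>fz G\<^esub> y = f \<otimes>\<^bsub>fz G\<^esub> ([], d)) \<and>
          (\<exists>f\<in>?F. \<exists>d\<in>D. x \<otimes>\<^bsub>fz G\<^esub> inv\<^bsub>fz G\<^esub> y = f \<otimes>\<^bsub>fz G\<^esub> ([], d))"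
    proof (cases "y \<in> hnn_incl ` D")
      case True
      then obtain k where k: "k \<in> D" "y = ([], k)" "k \<in> carrier G" by auto
      have "x \<otimes>\<^bsub>fz G\<^esub> y = f \<otimes>\<^bsub>fz G\<^esub> ([], d \<otimes> k)" "x \<otimes>\<^bsub>fz G\<^esub> inv\<^bsub>fz G\<^esub> y = f \<otimes>\<^bsub>fz G\<^esub> ([], d \<otimes> inv k)"
        using c k fd(3) by (simp_all add: Z.m_assoc incl_inv_fz incl_mult_fz)
      moreover have "d \<otimes> k \<in> D" "d \<otimes> inv k \<in> D" using fd k by auto
      ultimately show ?thesis using fd(1) by blast
    next
      case False
      then obtain s where s: "s \<in> S" "y = tc G s" "s \<in> carrier G" using y S by blast
      let ?q = "tc G (s \<otimes> inv d)"
      have q: "?q \<in> tc G ` ?SD" "?q \<in> carrier (fz G)" using s fd(2) c by (auto intro!: imageI)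
      have 1: "([], d) \<otimes>\<^bsub>fz G\<^esub> y = ?q \<otimes>\<^bsub>fz G\<^esub> ([], d)" using conj_tc c s by simp
      have yc: "y \<in> carrier (fz G)" "([], d) \<in> carrier (fz G)" using s c by auto
      have "([], d) = ?q \<otimes>\<^bsub>fz G\<^esub> ([], d) \<otimes>\<^bsub>fz G\<^esub> inv\<^bsub>fz G\<^esub> y" using yc by (simp add: 1[symmetric] Z.m_assoc)
      then have "inv\<^bsub>fz G\<^esub> ?q \<otimes>\<^bsub>fz G\<^esub> ([], d) = inv\<^bsub>fz G\<^esub> ?q \<otimes>\<^bsub>fz G\<^esub> (?q \<otimes>\<^bsub>fz G\<^esub> (([], d) \<otimes>\<^bsub>fz G\<^esub> inv\<^bsub>fz G\<^esub> y))"
        using yc q by (simp add: Z.m_assoc)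
      then have 2: "([], d) \<otimes>\<^bsub>fz G\<^esub> inv\<^bsub>fz G\<^esub> y = inv\<^bsub>fz G\<^esub> ?q \<otimes>\<^bsub>fz G\<^esub> ([], d)" using yc q by simp
      have "x \<otimes>\<^bsub>fz G\<^esub> y = (f \<otimes>\<^bsub>fz G\<^esub> ?q) \<otimes>\<^bsub>fz G\<^esub> ([], d)"
        using c yc q 1 fd(3) by (simp add: Z.m_assoc)
      moreover have "x \<otimes>\<^bsub>fz G\<^esub> inv\<^bsub>fz G\<^esub> y = (f \<otimes>\<^bsub>fz G\<^esub> inv\<^bsub>fz G\<^esub> ?q) \<otimes>\<^bsub>fz G\<^esub> ([], d)"
        using c yc q 2 fd(3) by (simp add: Z.m_assoc)
      moreover note generate.eng[OF fd(1) generate.incl[OF q(1)]] generate.eng[OF fd(1) generate.inv[OF q(1)]]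
      ultimately show ?thesis using fd(2) by blast
    qed
  qed
qed

lemma proj_ex: "\<exists>\<pi>\<in>hom (fz G) G. (\<forall>g\<in>carrier G. \<pi> ([], g) = g) \<and> (\<forall>f\<in>fall G. \<pi> f = \<one>)"
proof -
  have "(\<lambda>x. x) \<in> hom G G" by (simp add: hom_def)
  then obtain \<pi> where p: "\<pi> \<in> hom (fz G) G" "\<forall>g\<in>carrier G. \<pi> ([], g) = g"
      "\<And>g. g \<in> carrier G \<Longrightarrow> \<pi> (tc G g) = inv g \<otimes> \<one> \<otimes> g"
    using fz_universal[OF is_group, of "\<lambda>x. x" \<one>] by blast
  have "\<pi> f = \<one>" if "f \<in> fall G" for f
  proof (rule hom_eq_generate[OF group_fz is_group p(1), of "\<lambda>x. \<one>" "tc G ` carrier G"])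
    show "f \<in> generate (fz G) (tc G ` carrier G)" using that by (simp add: fall_def)
  qed (auto simp: hom_def p(3))
  then show ?thesis using p by blast
qed

text \<open>The projection to \<open>G\<close> that kills \<open>t\<close> is trivial on
  \<open>fall G\<close> and reads off the collected factor from \<open>D\<close>, which is therefore
  the identity.\<close>

lemma fall_int:
  assumes "S \<subseteq> carrier G" "subgroup D G"
  shows "generate (fz G) (tc G ` S \<union> hnn_incl ` D) \<inter> fall G = generate (fz G) (tc G ` {s \<otimes> d | s d. s \<in> S \<and> d \<in> D})"
    (is "?L \<inter> _ = ?R")
proof (intro equalityI subsetI)
  interpret D: subgroup D G by fact
  have SD: "{s \<otimes> d | s d. s \<in> S \<and> d \<in> D} \<subseteq> carrier G" using assms(1) by auto
  {
    fix x assume x: "x \<in> ?L \<inter> fall G"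
    then obtain f d where fd: "f \<in> ?R" "d \<in> D" "x = f \<otimes>\<^bsub>fz G\<^esub> ([], d)" using fz_split[OF assms] by blast
    obtain \<pi> where p: "\<pi> \<in> hom (fz G) G" "\<And>g. g \<in> carrier G \<Longrightarrow> \<pi> ([], g) = g" "\<And>f. f \<in> fall G \<Longrightarrow> \<pi> f = \<one>"
      using proj_ex by blast
    have f: "f \<in> fall G" "f \<in> carrier (fz G)" using fall_mono[OF SD] fd Z.generate_incl[OF tc_image[OF SD]] by blast+
    have "\<pi> x = \<one> \<otimes> d" using fd(2,3) f p(2)[of d] p(3)[of f] hom_mult[OF p(1), of f "([], d)"] by simp
    then have "d = \<one>" using p(3)[of x] x fd(2) by simp
    then have "x = f" using fd(3) f by (simp add: one_fz[symmetric])
    then show "x \<in> ?R" using fd by simp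
  next
    fix x assume x: "x \<in> ?R"
    have T: "tc G ` S \<union> hnn_incl ` D \<subseteq> carrier (fz G)" using assms(1) by auto
    have "?R \<subseteq> ?L"
    proof (rule Z.generate_subgroup_incl[OF _ Z.generate_is_subgroup[OF T]], rule image_subsetI)
      fix y assume "y \<in> {s \<otimes> d | s d. s \<in> S \<and> d \<in> D}"
      then obtain s d where sd: "y = s \<otimes> d" "s \<in> S" "d \<in> D" by blast
      have c: "s \<in> carrier G" "d \<in> carrier G" using sd assms(1) by auto
      have "([], inv d) \<otimes>\<^bsub>fz G\<^esub> tc G s \<otimes>\<^bsub>fz G\<^esub> ([], d) = tc G y \<otimes>\<^bsub>fz G\<^esub> (([], inv d) \<otimes>\<^bsub>fz G\<^esub> ([], d))"
        using conj_tc[of "inv d" s] c sd(1) by (simp add: Z.m_assoc)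
      also have "\<dots> = tc G y" using c sd(1) by (simp add: incl_mult_fz one_fz[symmetric])
      finally show "tc G y \<in> ?L" using sd
        by (metis (no_types, lifting) D.m_inv_closed UnI1 UnI2 generate.eng generate.incl imageI)
    qed
    then show "x \<in> ?L \<inter> fall G" using x fall_mono[OF SD] by blast
  }
qed

text \<open>Being a kernel makes \<open>fall G\<close> benign, as the preimage of the trivial
  subgroup.\<close>

lemma fall_kernel:
  assumes "\<pi> \<in> hom (fz G) G" "\<And>g. g \<in> carrier G \<Longrightarrow> \<pi> ([], g) = g" "\<And>f. f \<in> fall G \<Longrightarrow> \<pi> f = \<one>"
  shows "fall G = {x \<in> carrier (fz G). \<pi> x \<in> {\<one>}}"
proof (intro equalityI subsetI)
  fix x assume x: "x \<in> {x \<in> carrier (fz G). \<pi> x \<in> {\<one>}}"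
  have "generate (fz G) (hnn_incl ` carrier G \<union> {hnn_t G True}) = carrier (fz G)"
    by (rule fz_generated) (auto intro: generate.incl dest: generate_in_carrier[OF order_refl])
  then have "x \<in> generate (fz G) (tc G ` {\<one>} \<union> hnn_incl ` carrier G)" using x by (simp add: tc_one Un_commute)
  then obtain f d where fd: "f \<in> generate (fz G) (tc G ` {s \<otimes> d | s d. s \<in> {\<one>} \<and> d \<in> carrier G})"
     "d \<in> carrier G" "x = f \<otimes>\<^bsub>fz G\<^esub> ([], d)" using fz_split[OF _ subgroup_self, of "{\<one>}" x] by auto
  have f: "f \<in> fall G" using fall_mono[of "{s \<otimes> d | s d. s \<in> {\<one>} \<and> d \<in> carrier G}"] fd(1) by auto
  then have fc: "f \<in> carrier (fz G)" using subgroup.subset[OF fall_subgroup] by blast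
  have "\<pi> x = \<one> \<otimes> d" using fd(2,3) fc assms(2)[of d] assms(3)[OF f] hom_mult[OF assms(1), of f "([], d)"] by simp
  then have "d = \<one>" using x fd(2) by simp
  then show "x \<in> fall G" using fd(3) f fc by (simp add: one_fz[symmetric])
qed (use assms(3) subgroup.subset[OF fall_subgroup] in auto)

end

lemma fzgroupI: "group G \<Longrightarrow> fzgroup G" by (simp add: fzgroup_def)

lemma fpt_fz: assumes "fpt G" shows "fpt (fz G)"
proof -
  interpret group G by (rule fpt_group[OF assms])
  interpret hnn G "{\<one>\<^bsub>G\<^esub>}" "\<lambda>x. x" by (rule hnn_id[OF is_group triv_subgroup])
  show ?thesis unfolding fz_def by (rule fpt_K[OF assms, of "{}"]) (simp_all add: generate_empty)
qed

lemma fz_map: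
  assumes "group G" "group M" "f \<in> hom G M"
  shows "\<exists>k\<in>hom (fz G) (fz M). (\<forall>g\<in>carrier G. k ([], g) = ([], f g)) \<and> (\<forall>g\<in>carrier G. k (tc G g) = tc M (f g))"
proof -
  interpret G: fzgroup G by (rule fzgroupI[OF assms(1)])
  interpret M: fzgroup M by (rule fzgroupI[OF assms(2)])
  have h: "(\<lambda>g. ([], f g)) \<in> hom G (fz M)" using hom_compose[OF assms(3) M.incl_hom_fz] by (simp add: comp_def)
  from G.fz_universal[OF M.group_fz h M.t_fz, of True]
  obtain k where k: "k \<in> hom (fz G) (fz M)" "(\<forall>g\<in>carrier G. k ([], g) = ([], f g)) \<and> k (hnn_t G True) = hnn_t M True \<and>
     (\<forall>g\<in>carrier G. k (tc G g) = inv\<^bsub>fz M\<^esub> ([], f g) \<otimes>\<^bsub>fz M\<^esub> hnn_t M True \<otimes>\<^bsub>fz M\<^esub> ([], f g))"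
    by (rule bexE)
  have "k (tc G g) = tc M (f g)" if "g \<in> carrier G" for g
    using k(2) that hom_in_carrier[OF assms(3) that] by (simp add: tc_def M.incl_inv_fz)
  then show ?thesis using k by (intro bexI[OF _ k(1)]) simp
qed

section \<open>Closure properties of benign sets\<close>

definition bs :: "('a, 'c) monoid_scheme \<Rightarrow> ('a \<Rightarrow> bool) \<Rightarrow> bool" where
  "bs G P \<longleftrightarrow> benign (fz G) (generate (fz G) (tc G ` {x \<in> carrier G. P x}))"

lemma bs_cong: "(\<And>x. x \<in> carrier G \<Longrightarrow> P x = Q x) \<Longrightarrow> bs G P \<Longrightarrow> bs G Q"
  unfolding bs_def by (metis (no_types, lifting) Collect_cong)

lemma generate_generate:
  assumes "group G" "S \<subseteq> carrier G" "T \<subseteq> carrier G"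
  shows "generate G (generate G S \<union> generate G T) = generate G (S \<union> T)"
proof
  interpret group G by fact
  have ST: "S \<union> T \<subseteq> carrier G" using assms by blast
  have "generate G S \<subseteq> generate G (S \<union> T)" "generate G T \<subseteq> generate G (S \<union> T)" by (rule mono_generate; blast)+
  then show "generate G (generate G S \<union> generate G T) \<subseteq> generate G (S \<union> T)"
    by (intro generate_subgroup_incl generate_is_subgroup[OF ST]) blast
  show "generate G (S \<union> T) \<subseteq> generate G (generate G S \<union> generate G T)"
    by (rule mono_generate) (auto intro: generate.incl)
qed

lemma benign_fall: assumes "fpt G" shows "benign (fz G) (fall G)"
proof -
  interpret fzgroup G by (rule fzgroupI[OF fpt_group[OF assms]])
  from proj_ex obtain \<pi> where p: "\<pi> \<in> hom (fz G) G" "(\<forall>g\<in>carrier G. \<pi> ([], g) = g) \<and> (\<forall>f\<in>fall G. \<pi> f = \<one>\<^bsub>G\<^esub>)"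
    by (rule bexE)
  have "benign G {\<one>\<^bsub>G\<^esub>}" using benign_fg[OF assms, of "{}"] by (simp add: generate_empty)
  from benign_vimage[OF fpt_fz[OF assms] assms p(1) this] show ?thesis
    using fall_kernel[OF p(1)] p(2) by simp
qed

lemma bs_singleton: assumes "fpt G" "c \<in> carrier G" shows "bs G (\<lambda>x. x = c)"
proof -
  interpret fzgroup G by (rule fzgroupI[OF fpt_group[OF assms(1)]])
  have "{x \<in> carrier G. x = c} = {c}" using assms by auto
  then show ?thesis unfolding bs_def using assms by (simp add: benign_fg fpt_fz)
qed

text \<open>Joining the span of a set with \<open>D\<close> and cutting back to
  \<open>fall G\<close> multiplies the set by \<open>D\<close>, by \<open>fall_int\<close>.
  Subgroups, cylinders and the graph of the multiplication are obtained in this way.\<close>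

lemma bs_mulD:
  assumes "fpt G" "bs G P" "benign G D"
  shows "bs G (\<lambda>x. \<exists>s d. s \<in> carrier G \<and> P s \<and> d \<in> D \<and> x = s \<otimes>\<^bsub>G\<^esub> d)"
proof -
  interpret fzgroup G by (rule fzgroupI[OF fpt_group[OF assms(1)]])
  let ?S = "{x \<in> carrier G. P x}"
  have D: "subgroup D G" by (rule benign_subgroup[OF is_group assms(3)])
  have Dc: "D \<subseteq> carrier G" by (rule subgroup.subset[OF D])
  have S: "?S \<subseteq> carrier G" by blast
  have i: "benign (fz G) (hnn_incl ` D)" by (rule benign_image[OF assms(1) fpt_fz[OF assms(1)] incl_hom_fz assms(3)])
  have id: "generate (fz G) (hnn_incl ` D) = hnn_incl ` D"
    using Z.generate_subgroup_incl[OF order_refl benign_subgroup[OF group_fz i]] by (auto intro: generate.incl)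
  have c: "tc G ` ?S \<subseteq> carrier (fz G)" "hnn_incl ` D \<subseteq> carrier (fz G)" using Dc by auto
  have "benign (fz G) (generate (fz G) (generate (fz G) (tc G ` ?S) \<union> hnn_incl ` D))"
    by (rule benign_int_join(2)[OF fpt_fz[OF assms(1)] _ i]) (use assms(2) in \<open>simp add: bs_def\<close>)
  then have "benign (fz G) (generate (fz G) (tc G ` ?S \<union> hnn_incl ` D))"
    using generate_generate[OF group_fz c] id by simp
  then have "benign (fz G) (generate (fz G) (tc G ` ?S \<union> hnn_incl ` D) \<inter> fall G)"
    by (rule benign_int_join(1)[OF fpt_fz[OF assms(1)] _ benign_fall[OF assms(1)]])
  then have b: "benign (fz G) (generate (fz G) (tc G ` {s \<otimes>\<^bsub>G\<^esub> d | s d. s \<in> ?S \<and> d \<in> D}))"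
    unfolding fall_int[OF S D] .
  have "{s \<otimes>\<^bsub>G\<^esub> d | s d. s \<in> ?S \<and> d \<in> D} = {x \<in> carrier G. \<exists>s d. s \<in> carrier G \<and> P s \<and> d \<in> D \<and> x = s \<otimes>\<^bsub>G\<^esub> d}"
    using Dc by blast
  then show ?thesis using b unfolding bs_def by simp
qed

lemma bs_sub: assumes "fpt G" "benign G D" shows "bs G (\<lambda>x. x \<in> D)"
proof -
  interpret group G by (rule fpt_group[OF assms(1)])
  have D: "D \<subseteq> carrier G" using assms(2) by (simp add: benign_def)
  show ?thesis
    by (rule bs_cong[OF _ bs_mulD[OF assms(1) bs_singleton[OF assms(1) one_closed] assms(2)]]) (use D in auto)
qed

lemma bs_or: assumes "fpt G" "bs G P" "bs G Q" shows "bs G (\<lambda>x. P x \<or> Q x)"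
proof -
  interpret fzgroup G by (rule fzgroupI[OF fpt_group[OF assms(1)]])
  have "{x \<in> carrier G. P x \<or> Q x} = {x \<in> carrier G. P x} \<union> {x \<in> carrier G. Q x}" by blast
  moreover have "tc G ` {x \<in> carrier G. P x} \<subseteq> carrier (fz G)" "tc G ` {x \<in> carrier G. Q x} \<subseteq> carrier (fz G)" by auto
  note generate_generate[OF group_fz this]
  ultimately show ?thesis
    using benign_int_join(2)[OF fpt_fz[OF assms(1)] assms(2,3)[unfolded bs_def]] unfolding bs_def
    by (simp add: image_Un)
qed

text \<open>Sending the basis elements outside \<open>T\<close> to the identity is a retraction of \<open>fall G\<close> that maps the span of
  \<open>S\<close> onto the span of \<open>S \<inter> T\<close>.\<close>

lemma (in fzgroup) span_int:
  assumes "S \<subseteq> carrier G" "T \<subseteq> carrier G"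
  shows "generate (fz G) (tc G ` S) \<inter> generate (fz G) (tc G ` T) = generate (fz G) (tc G ` (S \<inter> T))"
proof
  let ?A = "\<lambda>g. if g \<in> T then tc G g else \<one>\<^bsub>fz G\<^esub>" and ?F = "fz G\<lparr>carrier := fall G\<rparr>"
  have A: "?A g \<in> carrier (fz G)" if "g \<in> carrier G" for g using that by simp
  from fz_basis[where A = ?A, OF group_fz A]
  obtain \<rho> where r: "\<rho> \<in> hom ?F (fz G)" "\<forall>g\<in>carrier G. \<rho> (tc G g) = ?A g" by (rule bexE)
  interpret F: group ?F by (rule group_fall)
  interpret r: group_hom ?F "fz G" \<rho> by (rule group_homI[OF group_fall group_fz r(1)])
  have cons: "generate ?F (tc G ` X) = generate (fz G) (tc G ` X)" "tc G ` X \<subseteq> carrier ?F" if "X \<subseteq> carrier G" for X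
  proof -
    show "tc G ` X \<subseteq> carrier ?F" using that fall_tc by auto
    then show "generate ?F (tc G ` X) = generate (fz G) (tc G ` X)"
      using Z.generate_consistent[OF _ fall_subgroup] by simp
  qed
  show "generate (fz G) (tc G ` S) \<inter> generate (fz G) (tc G ` T) \<subseteq> generate (fz G) (tc G ` (S \<inter> T))"
  proof
    fix x assume x: "x \<in> generate (fz G) (tc G ` S) \<inter> generate (fz G) (tc G ` T)"
    have xF: "x \<in> fall G" using x fall_mono[OF assms(1)] by blast
    have rx: "\<rho> x = x"
    proof (rule hom_eq_generate[OF group_fall group_fz r(1) _ cons(2)[OF assms(2)], of "\<lambda>x. x"])
      show "(\<lambda>x. x) \<in> hom ?F (fz G)" using subgroup.subset[OF fall_subgroup] by (auto simp: hom_def)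
      show "\<rho> y = y" if "y \<in> tc G ` T" for y using that assms(2) r(2) by auto
      show "x \<in> generate ?F (tc G ` T)" using x cons(1)[OF assms(2)] by simp
    qed
    have m1: "\<rho> x \<in> generate (fz G) (\<rho> ` tc G ` S)"
      unfolding r.generate_img[OF cons(2)[OF assms(1)]] using x cons(1)[OF assms(1)] by simp
    have m2: "generate (fz G) (\<rho> ` tc G ` S) \<subseteq> generate (fz G) (tc G ` (S \<inter> T))"
    proof (rule Z.generate_subgroup_incl)
      show "subgroup (generate (fz G) (tc G ` (S \<inter> T))) (fz G)"
        by (rule Z.generate_is_subgroup[OF tc_image]) (use assms in blast)
      show "\<rho> ` tc G ` S \<subseteq> generate (fz G) (tc G ` (S \<inter> T))"
        unfolding image_image
      proof (rule image_subsetI)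
        fix g assume g: "g \<in> S"
        then have "\<rho> (tc G g) = ?A g" using r(2) assms(1) by blast
        then show "\<rho> (tc G g) \<in> generate (fz G) (tc G ` (S \<inter> T))"
          using g by (cases "g \<in> T") (simp_all add: generate.one generate.incl)
      qed
    qed
    show "x \<in> generate (fz G) (tc G ` (S \<inter> T))" using subsetD[OF m2 m1] unfolding rx .
  qed
  show "generate (fz G) (tc G ` (S \<inter> T)) \<subseteq> generate (fz G) (tc G ` S) \<inter> generate (fz G) (tc G ` T)"
    by (intro Int_greatest Z.mono_generate image_mono) auto
qed

lemma bs_and: assumes "fpt G" "bs G P" "bs G Q" shows "bs G (\<lambda>x. P x \<and> Q x)"
proof -
  interpret fzgroup G by (rule fzgroupI[OF fpt_group[OF assms(1)]])
  have e: "{x \<in> carrier G. P x \<and> Q x} = {x \<in> carrier G. P x} \<inter> {x \<in> carrier G. Q x}" by blast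
  have "{x \<in> carrier G. P x} \<subseteq> carrier G" "{x \<in> carrier G. Q x} \<subseteq> carrier G" by blast+
  note span_int[OF this]
  then show ?thesis using benign_int_join(1)[OF fpt_fz[OF assms(1)] assms(2,3)[unfolded bs_def]]
    unfolding bs_def e by simp
qed

text \<open>A homomorphism extends to the free products and carries \<open>tc\<close> to
  \<open>tc\<close>, so the image of a span is the span of the image.\<close>

lemma bs_image:
  assumes "fpt G" "fpt M" "f \<in> hom G M" "bs G P"
  shows "bs M (\<lambda>y. \<exists>x. x \<in> carrier G \<and> P x \<and> y = f x)"
proof -
  interpret G: fzgroup G by (rule fzgroupI[OF fpt_group[OF assms(1)]])
  interpret M: fzgroup M by (rule fzgroupI[OF fpt_group[OF assms(2)]])
  from fz_map[OF G.is_group M.is_group assms(3)] obtain k where k: "k \<in> hom (fz G) (fz M)"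
     "(\<forall>g\<in>carrier G. k ([], g) = ([], f g)) \<and> (\<forall>g\<in>carrier G. k (tc G g) = tc M (f g))" by (rule bexE)
  interpret k: group_hom "fz G" "fz M" k by (rule group_homI[OF G.group_fz M.group_fz k(1)])
  let ?S = "{x \<in> carrier G. P x}"
  have c: "tc G ` ?S \<subseteq> carrier (fz G)" by auto
  have "k ` tc G ` ?S = tc M ` f ` ?S" using k(2) by (auto simp: image_image)
  moreover have "f ` ?S = {y \<in> carrier M. \<exists>x. x \<in> carrier G \<and> P x \<and> y = f x}" using hom_in_carrier[OF assms(3)] by blast
  ultimately show ?thesis
    using benign_image[OF fpt_fz[OF assms(1)] fpt_fz[OF assms(2)] k(1) assms(4)[unfolded bs_def]]
    unfolding k.generate_img[OF c, symmetric] bs_def by simp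
qed

lemma fst_hom: "fst \<in> hom (G \<times>\<times> M) G" and snd_hom: "snd \<in> hom (G \<times>\<times> M) M"
  by (auto simp: hom_def)

lemma pair_hom: "group G \<Longrightarrow> group M \<Longrightarrow> (\<lambda>x. (x, \<one>\<^bsub>M\<^esub>)) \<in> hom G (G \<times>\<times> M)"
   "group G \<Longrightarrow> group M \<Longrightarrow> (\<lambda>y. (\<one>\<^bsub>G\<^esub>, y)) \<in> hom M (G \<times>\<times> M)"
  by (auto simp: hom_def group.is_monoid)

text \<open>A cylinder is the copy of the set in the second factor multiplied by the first
  factor.\<close>

lemma bs_cylinder: assumes "fpt G" "fpt M" "bs M P" shows "bs (G \<times>\<times> M) (\<lambda>p. P (snd p))"
proof -
  interpret G: group G by (rule fpt_group[OF assms(1)])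
  interpret M: group M by (rule fpt_group[OF assms(2)])
  have GM: "fpt (G \<times>\<times> M)" by (rule fpt_prod[OF assms(1,2)])
  note b = bs_mulD[OF GM bs_image[OF assms(2) GM pair_hom(2)[OF G.is_group M.is_group] assms(3)]
      benign_hom_image[OF assms(1) GM pair_hom(1)[OF G.is_group M.is_group]]]
  show ?thesis
  proof (rule bs_cong[OF _ b])
    fix p assume p: "p \<in> carrier (G \<times>\<times> M)"
    show "(\<exists>s d. s \<in> carrier (G \<times>\<times> M) \<and> (\<exists>x. x \<in> carrier M \<and> P x \<and> s = (\<one>\<^bsub>G\<^esub>, x)) \<and>
       d \<in> (\<lambda>x. (x, \<one>\<^bsub>M\<^esub>)) ` carrier G \<and> p = s \<otimes>\<^bsub>G \<times>\<times> M\<^esub> d) = P (snd p)"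
    proof
      assume "P (snd p)"
      then show "\<exists>s d. s \<in> carrier (G \<times>\<times> M) \<and> (\<exists>x. x \<in> carrier M \<and> P x \<and> s = (\<one>\<^bsub>G\<^esub>, x)) \<and>
         d \<in> (\<lambda>x. (x, \<one>\<^bsub>M\<^esub>)) ` carrier G \<and> p = s \<otimes>\<^bsub>G \<times>\<times> M\<^esub> d"
        using p by (intro exI[of _ "(\<one>\<^bsub>G\<^esub>, snd p)"] exI[of _ "(fst p, \<one>\<^bsub>M\<^esub>)"]) (cases p, simp)
    qed (use p in auto)
  qed
qed

lemma bs_vimage:
  assumes "fpt G" "fpt M" "f \<in> hom G M" "bs M P" shows "bs G (\<lambda>x. P (f x))"
proof -
  interpret G: group G by (rule fpt_group[OF assms(1)])
  interpret M: group M by (rule fpt_group[OF assms(2)])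
  have GM: "fpt (G \<times>\<times> M)" by (rule fpt_prod[OF assms(1,2)])
  have g: "(\<lambda>x. (x, f x)) \<in> hom G (G \<times>\<times> M)" using assms(3) by (auto simp: hom_def)
  note b = bs_and[OF GM bs_cylinder[OF assms(1,2,4)] bs_sub[OF GM benign_hom_image[OF assms(1) GM g]]]
  show ?thesis
    by (rule bs_cong[OF _ bs_image[OF GM assms(1) fst_hom b]]) (use hom_in_carrier[OF assms(3)] in auto)
qed

lemma bs_ex:
  assumes "fpt G" "fpt M" "bs (G \<times>\<times> M) (\<lambda>p. P (fst p) (snd p))"
  shows "bs G (\<lambda>x. \<exists>y. y \<in> carrier M \<and> P x y)"
  by (rule bs_cong[OF _ bs_image[OF fpt_prod[OF assms(1,2)] assms(1) fst_hom assms(3)]]) auto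

section \<open>Functions with benign graph\<close>

definition bf :: "('a, 'c) monoid_scheme \<Rightarrow> ('b, 'd) monoid_scheme \<Rightarrow> ('a \<Rightarrow> 'b) \<Rightarrow> bool" where
  "bf G M f \<longleftrightarrow> fpt G \<and> fpt M \<and> f \<in> carrier G \<rightarrow> carrier M \<and> bs (G \<times>\<times> M) (\<lambda>p. snd p = f (fst p))"

lemma bf_fpt: "bf G M f \<Longrightarrow> fpt G" "bf G M f \<Longrightarrow> fpt M" by (auto simp: bf_def)

lemma bf_closed: "bf G M f \<Longrightarrow> x \<in> carrier G \<Longrightarrow> f x \<in> carrier M" by (auto simp: bf_def)

lemma bf_hom: assumes "fpt G" "fpt M" "f \<in> hom G M" shows "bf G M f"
proof -
  have GM: "fpt (G \<times>\<times> M)" by (rule fpt_prod[OF assms(1,2)])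
  have g: "(\<lambda>x. (x, f x)) \<in> hom G (G \<times>\<times> M)" using assms(3) by (auto simp: hom_def)
  have "bs (G \<times>\<times> M) (\<lambda>p. snd p = f (fst p))"
    by (rule bs_cong[OF _ bs_sub[OF GM benign_hom_image[OF assms(1) GM g]]]) auto
  then show ?thesis using assms by (auto simp: bf_def hom_def)
qed

text \<open>Substitution is a quantifier over the value, restricted to the graph. The function need
  not be a homomorphism.\<close>

lemma bs_subst: assumes "bs M P" "bf G M f" shows "bs G (\<lambda>x. P (f x))"
proof -
  have f: "fpt G" "fpt M" using assms(2) by (auto simp: bf_def)
  have GM: "fpt (G \<times>\<times> M)" by (rule fpt_prod[OF f])
  have "bs (G \<times>\<times> M) (\<lambda>p. snd p = f (fst p) \<and> P (snd p))"
    by (rule bs_and[OF GM _ bs_cylinder[OF f assms(1)]]) (use assms(2) in \<open>simp add: bf_def\<close>)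
  from bs_ex[OF f, of "\<lambda>x y. y = f x \<and> P y", OF this] show ?thesis
    by (rule bs_cong[rotated]) (use bf_closed[OF assms(2)] in auto)
qed

lemma bf_comp: assumes "bf G M f" "bf M N g" shows "bf G N (\<lambda>x. g (f x))"
proof -
  have fp: "fpt G" "fpt M" "fpt N" using assms by (auto simp: bf_def)
  have GN: "fpt (G \<times>\<times> N)" and E: "fpt ((G \<times>\<times> N) \<times>\<times> M)" and GM: "fpt (G \<times>\<times> M)" and MN: "fpt (M \<times>\<times> N)"
    using fp by (simp_all add: fpt_prod)
  have h1: "(\<lambda>q. (fst (fst q), snd q)) \<in> hom ((G \<times>\<times> N) \<times>\<times> M) (G \<times>\<times> M)" by (auto simp: hom_def)
  have h2: "(\<lambda>q. (snd q, snd (fst q))) \<in> hom ((G \<times>\<times> N) \<times>\<times> M) (M \<times>\<times> N)" by (auto simp: hom_def)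
  have f: "bs (G \<times>\<times> M) (\<lambda>p. snd p = f (fst p))" and g: "bs (M \<times>\<times> N) (\<lambda>p. snd p = g (fst p))"
    using assms by (auto simp: bf_def)
  have "bs ((G \<times>\<times> N) \<times>\<times> M) (\<lambda>q. snd q = f (fst (fst q)) \<and> snd (fst q) = g (snd q))"
    using bs_and[OF E bs_vimage[OF E GM h1 f] bs_vimage[OF E MN h2 g]] by simp
  from bs_ex[OF GN fp(2), of "\<lambda>p y. y = f (fst p) \<and> snd p = g y", OF this]
  have "bs (G \<times>\<times> N) (\<lambda>p. snd p = g (f (fst p)))"
    by (rule bs_cong[rotated]) (use bf_closed[OF assms(1)] in auto)
  then show ?thesis using fp bf_closed[OF assms(1)] bf_closed[OF assms(2)] by (auto simp: bf_def)
qed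

lemma bf_id: "fpt G \<Longrightarrow> bf G G (\<lambda>x. x)" by (rule bf_hom) (auto simp: hom_def)

lemma bf_fst: "bf E (G \<times>\<times> M) f \<Longrightarrow> fpt G \<Longrightarrow> fpt M \<Longrightarrow> bf E G (\<lambda>x. fst (f x))"
  by (rule bf_comp[of _ _ _ _ fst]) (auto intro: bf_hom fst_hom fpt_prod)

lemma bf_snd: "bf E (G \<times>\<times> M) f \<Longrightarrow> fpt G \<Longrightarrow> fpt M \<Longrightarrow> bf E M (\<lambda>x. snd (f x))"
  by (rule bf_comp[of _ _ _ _ snd]) (auto intro: bf_hom snd_hom fpt_prod)

lemma bf_homc: "h \<in> hom G M \<Longrightarrow> fpt M \<Longrightarrow> bf E G f \<Longrightarrow> bf E M (\<lambda>x. h (f x))"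
  by (rule bf_comp[of _ _ _ _ h]) (auto intro: bf_hom dest: bf_fpt)

lemma bf_pair: assumes "bf G M f" "bf G N g" shows "bf G (M \<times>\<times> N) (\<lambda>x. (f x, g x))"
proof -
  have fp: "fpt G" "fpt M" "fpt N" using assms by (auto simp: bf_def)
  have GN: "fpt (G \<times>\<times> N)" and E: "fpt (G \<times>\<times> (M \<times>\<times> N))" and GM: "fpt (G \<times>\<times> M)" and MN: "fpt (M \<times>\<times> N)"
    using fp by (simp_all add: fpt_prod)
  have h1: "(\<lambda>q. (fst q, fst (snd q))) \<in> hom (G \<times>\<times> (M \<times>\<times> N)) (G \<times>\<times> M)" by (auto simp: hom_def)
  have h2: "(\<lambda>q. (fst q, snd (snd q))) \<in> hom (G \<times>\<times> (M \<times>\<times> N)) (G \<times>\<times> N)" by (auto simp: hom_def)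
  have f: "bs (G \<times>\<times> M) (\<lambda>p. snd p = f (fst p))" and g: "bs (G \<times>\<times> N) (\<lambda>p. snd p = g (fst p))"
    using assms by (auto simp: bf_def)
  have "bs (G \<times>\<times> (M \<times>\<times> N)) (\<lambda>q. snd q = (f (fst q), g (fst q)))"
    by (rule bs_cong[OF _ bs_and[OF E bs_vimage[OF E GM h1 f] bs_vimage[OF E GN h2 g]]]) (auto simp: prod_eq_iff)
  then show ?thesis using fp MN bf_closed[OF assms(1)] bf_closed[OF assms(2)] by (auto simp: bf_def)
qed

lemma bs_eq: assumes "bf G M f" "bf G M g" shows "bs G (\<lambda>x. f x = g x)"
proof -
  have fp: "fpt G" "fpt M" using assms by (auto simp: bf_def)
  have MM: "fpt (M \<times>\<times> M)" by (rule fpt_prod[OF fp(2,2)])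
  have d: "(\<lambda>x. (x, x)) \<in> hom M (M \<times>\<times> M)" by (auto simp: hom_def)
  have "bs (M \<times>\<times> M) (\<lambda>p. fst p = snd p)"
    by (rule bs_cong[OF _ bs_sub[OF MM benign_hom_image[OF fp(2) MM d]]]) auto
  from bs_subst[OF this bf_pair[OF assms]] show ?thesis by simp
qed

lemma bf_const: assumes "fpt G" "fpt M" "c \<in> carrier M" shows "bf G M (\<lambda>_. c)"
  using bs_cylinder[OF assms(1,2) bs_singleton[OF assms(2,3)]] assms by (auto simp: bf_def)

text \<open>The graph of the multiplication is the product of the two subgroups of all \<open>((x, 1), x)\<close> and of
  all \<open>((1, y), y)\<close>.\<close>

lemma bf_mult_aux: assumes "fpt M" shows "bf (M \<times>\<times> M) M (\<lambda>p. fst p \<otimes>\<^bsub>M\<^esub> snd p)"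
proof -
  interpret M: group M by (rule fpt_group[OF assms])
  have MM: "fpt (M \<times>\<times> M)" and E: "fpt ((M \<times>\<times> M) \<times>\<times> M)" using assms by (simp_all add: fpt_prod)
  have h1: "(\<lambda>x. ((x, \<one>\<^bsub>M\<^esub>), x)) \<in> hom M ((M \<times>\<times> M) \<times>\<times> M)" and h2: "(\<lambda>x. ((\<one>\<^bsub>M\<^esub>, x), x)) \<in> hom M ((M \<times>\<times> M) \<times>\<times> M)"
    by (auto simp: hom_def)
  note b = bs_mulD[OF E bs_sub[OF E benign_hom_image[OF assms E h1]] benign_hom_image[OF assms E h2]]
  have "bs ((M \<times>\<times> M) \<times>\<times> M) (\<lambda>p. snd p = fst (fst p) \<otimes>\<^bsub>M\<^esub> snd (fst p))"
  proof (rule bs_cong[OF _ b])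
    fix p assume p: "p \<in> carrier ((M \<times>\<times> M) \<times>\<times> M)"
    obtain x y z where xyz: "p = ((x, y), z)" by (metis surj_pair)
    have c: "x \<in> carrier M" "y \<in> carrier M" "z \<in> carrier M" using p xyz by auto
    show "(\<exists>s d. s \<in> carrier ((M \<times>\<times> M) \<times>\<times> M) \<and> s \<in> (\<lambda>x. ((x, \<one>\<^bsub>M\<^esub>), x)) ` carrier M \<and>
       d \<in> (\<lambda>x. ((\<one>\<^bsub>M\<^esub>, x), x)) ` carrier M \<and> p = s \<otimes>\<^bsub>(M \<times>\<times> M) \<times>\<times> M\<^esub> d) = (snd p = fst (fst p) \<otimes>\<^bsub>M\<^esub> snd (fst p))"
    proof
      assume "snd p = fst (fst p) \<otimes>\<^bsub>M\<^esub> snd (fst p)"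
      then show "\<exists>s d. s \<in> carrier ((M \<times>\<times> M) \<times>\<times> M) \<and> s \<in> (\<lambda>x. ((x, \<one>\<^bsub>M\<^esub>), x)) ` carrier M \<and>
       d \<in> (\<lambda>x. ((\<one>\<^bsub>M\<^esub>, x), x)) ` carrier M \<and> p = s \<otimes>\<^bsub>(M \<times>\<times> M) \<times>\<times> M\<^esub> d"
        using c xyz by (intro exI[of _ "((x, \<one>\<^bsub>M\<^esub>), x)"] exI[of _ "((\<one>\<^bsub>M\<^esub>, y), y)"]) simp
    qed (use xyz c in auto)
  qed
  then show ?thesis using assms MM by (auto simp: bf_def)
qed

lemma bf_mult: assumes "bf G M f" "bf G M g" shows "bf G M (\<lambda>x. f x \<otimes>\<^bsub>M\<^esub> g x)"
  using bf_comp[OF bf_pair[OF assms] bf_mult_aux] assms by (simp add: bf_def)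

lemma bf_inv: assumes "bf G M f" shows "bf G M (\<lambda>x. inv\<^bsub>M\<^esub> (f x))"
proof -
  have fp: "fpt G" "fpt M" using assms by (auto simp: bf_def)
  interpret M: group M by (rule fpt_group[OF fp(2)])
  have "bs (M \<times>\<times> M) (\<lambda>p. fst p \<otimes>\<^bsub>M\<^esub> snd p = \<one>\<^bsub>M\<^esub>)"
    by (rule bs_eq[OF bf_mult_aux[OF fp(2)] bf_const[OF fpt_prod[OF fp(2,2)] fp(2) M.one_closed]])
  then have "bs (M \<times>\<times> M) (\<lambda>p. snd p = inv\<^bsub>M\<^esub> (fst p))"
  proof (rule bs_cong[rotated])
    fix p assume "p \<in> carrier (M \<times>\<times> M)"
    then have "fst p \<in> carrier M" "snd p \<in> carrier M" by auto
    then show "(fst p \<otimes>\<^bsub>M\<^esub> snd p = \<one>\<^bsub>M\<^esub>) = (snd p = inv\<^bsub>M\<^esub> (fst p))"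
      using M.inv_equality M.inv_inv M.r_inv by metis
  qed
  then have "bf M M (\<lambda>x. inv\<^bsub>M\<^esub> x)" using fp by (auto simp: bf_def)
  from bf_comp[OF assms this] show ?thesis .
qed

lemma bs_bex: assumes "bf G M f" "bs G P" shows "bs M (\<lambda>y. \<exists>x. x \<in> carrier G \<and> P x \<and> y = f x)"
proof -
  have fp: "fpt G" "fpt M" using assms by (auto simp: bf_def)
  have MG: "fpt (M \<times>\<times> G)" by (rule fpt_prod[OF fp(2,1)])
  have s: "bf (M \<times>\<times> G) G (\<lambda>p. snd p)" "bf (M \<times>\<times> G) M (\<lambda>p. fst p)"
    using bf_hom[OF MG fp(1) snd_hom] bf_hom[OF MG fp(2) fst_hom] by (simp_all add: eta_contract_eq)
  have "bs (M \<times>\<times> G) (\<lambda>p. P (snd p) \<and> fst p = f (snd p))"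
    by (rule bs_and[OF MG bs_subst[OF assms(2) s(1)] bs_eq[OF s(2) bf_comp[OF s(1) assms(1)]]])
  from bs_ex[OF fp(2,1), of "\<lambda>y x. P x \<and> y = f x", OF this] show ?thesis by simp
qed


lemma bf_tc: assumes "bf E G f" shows "bf E (fz G) (\<lambda>x. tc G (f x))"
proof -
  have fp: "fpt E" "fpt G" "fpt (fz G)" using assms fpt_fz by (auto simp: bf_def)
  interpret fzgroup G by (rule fzgroupI[OF fpt_group[OF fp(2)]])
  show ?thesis unfolding tc_def
    by (intro bf_mult bf_homc[OF incl_hom_fz fp(3)] bf_inv assms bf_const fp t_fz)
qed

text \<open>In the HNN extension with \<open>(g, g) z = z (1, g)\<close>, the conjugate of \<open>z\<close> by \<open>(1, g)\<close> is \<open>(g, 1) z\<close>.\<close>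

lemma benign_generate: assumes "fpt G" "bs G P" shows "benign G (generate G {x \<in> carrier G. P x})"
proof -
  interpret fzgroup G by (rule fzgroupI[OF fpt_group[OF assms(1)]])
  let ?S = "{x \<in> carrier G. P x}"
  let ?GG = "G \<times>\<times> G" and ?A = "(\<lambda>x. (x, x)) ` carrier G" and ?\<phi> = "\<lambda>p. (\<one>\<^bsub>G\<^esub>, snd p)"
  have GG: "fpt ?GG" by (rule fpt_prod[OF assms(1,1)])
  have d: "(\<lambda>x. (x, x)) \<in> hom G ?GG" by (auto simp: hom_def)
  interpret P: group ?GG by (rule fpt_group[OF GG])
  note d' = group_homI[OF is_group P.is_group d]
  interpret z: hnn ?GG ?A ?\<phi>
  proof (rule hnn.intro[OF P.is_group hnn_axioms.intro])
    show "subgroup ?A ?GG" by (rule group_hom.img_is_subgroup[OF d'])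
  qed (auto simp: inj_on_def)
  obtain C where C: "finite C" "C \<subseteq> carrier G" "generate G C = carrier G" by (rule fpt_gens[OF assms(1)])
  have K: "fpt z.K"
  proof (rule z.fpt_K[OF GG, of "(\<lambda>x. (x, x)) ` C"])
    show "?A = generate ?GG ((\<lambda>x. (x, x)) ` C)" by (simp only: group_hom.generate_img[OF d' C(2)] C(3))
  qed (use C(1,2) in auto)
  have h: "(\<lambda>g. hnn_incl (\<one>\<^bsub>G\<^esub>, g)) \<in> hom G z.K"
    using Group.hom_compose[OF pair_hom(2)[OF is_group is_group] z.incl_hom] by (simp add: comp_def)
  have t: "z.t b \<in> carrier z.K" for b using z.t_Omega by (simp add: z.carrier_K)
  from fz_universal[OF z.group_K h t, of True] obtain k where k: "k \<in> hom (fz G) z.K"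
    "(\<forall>g\<in>carrier G. k ([], g) = hnn_incl (\<one>\<^bsub>G\<^esub>, g)) \<and> k (hnn_t G True) = z.t True \<and>
     (\<forall>g\<in>carrier G. k (tc G g) = inv\<^bsub>z.K\<^esub> hnn_incl (\<one>\<^bsub>G\<^esub>, g) \<otimes>\<^bsub>z.K\<^esub> z.t True \<otimes>\<^bsub>z.K\<^esub> hnn_incl (\<one>\<^bsub>G\<^esub>, g))"
    by (rule bexE)
  interpret k: group_hom "fz G" z.K k by (rule group_homI[OF group_fz z.group_K k(1)])
  have ic: "hnn_incl (x, y) \<in> carrier z.K" if "x \<in> carrier G" "y \<in> carrier G" for x y
    using that by (simp add: z.carrier_K)
  have ktc: "k (tc G g) = hnn_incl (g, \<one>\<^bsub>G\<^esub>) \<otimes>\<^bsub>z.K\<^esub> z.t True" if g: "g \<in> carrier G" for g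
  proof -
    have sl: "hnn_incl (g, g) \<otimes>\<^bsub>z.K\<^esub> z.t True = z.t True \<otimes>\<^bsub>z.K\<^esub> hnn_incl (\<one>\<^bsub>G\<^esub>, g)"
      using z.t_slide[of "(g, g)" True] g by (simp add: hnn_dom_def hnn_map_def)
    have "k (tc G g) = hnn_incl (\<one>\<^bsub>G\<^esub>, inv\<^bsub>G\<^esub> g) \<otimes>\<^bsub>z.K\<^esub> (z.t True \<otimes>\<^bsub>z.K\<^esub> hnn_incl (\<one>\<^bsub>G\<^esub>, g))"
      using k(2) g ic t z.incl_inv[of "(\<one>\<^bsub>G\<^esub>, g)"] by (simp add: z.K.m_assoc inv_DirProd is_group)
    also have "\<dots> = hnn_incl (\<one>\<^bsub>G\<^esub>, inv\<^bsub>G\<^esub> g) \<otimes>\<^bsub>z.K\<^esub> hnn_incl (g, g) \<otimes>\<^bsub>z.K\<^esub> z.t True"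
      unfolding sl[symmetric] using g ic t by (simp add: z.K.m_assoc)
    finally show ?thesis using g by (simp add: z.incl_mult)
  qed
  have Sc: "tc G ` ?S \<subseteq> carrier (fz G)" by auto
  have b1: "benign z.K (generate z.K (k ` tc G ` ?S))"
    unfolding k.generate_img[OF Sc] by (rule benign_image[OF fpt_fz[OF assms(1)] K k(1)]) (use assms(2) in \<open>simp add: bs_def\<close>)
  have b2: "benign z.K (generate z.K {z.t True})" by (rule benign_fg[OF K]) (use t in auto)
  \<comment> \<open>Together with \<open>z\<close> itself the elements \<open>(g, 1) z\<close> yield
    the elements \<open>(g, 1)\<close>; restriction to the first factor then leaves the desired
    subgroup.\<close>
  let ?L = "generate z.K (k ` tc G ` ?S \<union> {z.t True})"
  have c: "k ` tc G ` ?S \<subseteq> carrier z.K" "{z.t True} \<subseteq> carrier z.K" using t by auto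
  have b: "benign z.K ?L"
    using benign_int_join(2)[OF K b1 b2] generate_generate[OF z.group_K c] by simp
  have l: "(\<lambda>g. hnn_incl (g, \<one>\<^bsub>G\<^esub>)) \<in> hom G z.K"
    using Group.hom_compose[OF pair_hom(1)[OF is_group is_group] z.incl_hom] by (simp add: comp_def)
  have b': "benign G {g \<in> carrier G. hnn_incl (g, \<one>\<^bsub>G\<^esub>) \<in> ?L}"
    by (rule benign_restrict[OF is_group z.group_K l _ b]) (simp add: inj_on_def)
  have S: "?S \<subseteq> carrier G" by blast
  have gS: "generate G ?S \<subseteq> carrier G" by (rule generate_incl[OF S])
  have cu: "k ` tc G ` ?S \<union> {z.t True} \<subseteq> carrier z.K" using c by blast
  have sL: "subgroup ?L z.K" by (rule z.K.generate_is_subgroup[OF cu])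
  have "{g \<in> carrier G. hnn_incl (g, \<one>\<^bsub>G\<^esub>) \<in> ?L} = generate G ?S"
  proof (intro equalityI subsetI)
    fix g assume "g \<in> {g \<in> carrier G. hnn_incl (g, \<one>\<^bsub>G\<^esub>) \<in> ?L}"
    then have g: "g \<in> carrier G" "hnn_incl (g, \<one>\<^bsub>G\<^esub>) \<in> ?L" by auto
    \<comment> \<open>This subgroup is invariant for a trivial reason: it meets the diagonal and the
      second factor, the two associated subgroups, in the identity only.\<close>
    let ?H = "generate G ?S \<times> {\<one>\<^bsub>G\<^esub>}"
    have H: "subgroup ?H ?GG" by (rule DirProd_subgroups[OF is_group generate_is_subgroup[OF S] is_group triv_subgroup])
    have Hc: "hnn_incl ` ?H \<union> {z.t True} \<subseteq> carrier z.K" using gS t ic by auto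
    have "?L \<subseteq> generate z.K (hnn_incl ` ?H \<union> {z.t True})"
    proof (rule z.K.generate_subgroup_incl[OF _ z.K.generate_is_subgroup[OF Hc]])
      have "k (tc G x) \<in> generate z.K (hnn_incl ` ?H \<union> {z.t True})" if "x \<in> ?S" for x
        unfolding ktc[OF subsetD[OF S that]] using that by (intro generate.eng generate.incl) (auto intro: generate.incl)
      then show "k ` tc G ` ?S \<union> {z.t True} \<subseteq> generate z.K (hnn_incl ` ?H \<union> {z.t True})" by (auto intro: generate.incl)
    qed
    then have "hnn_incl (g, \<one>\<^bsub>G\<^esub>) \<in> generate z.K (hnn_incl ` ?H \<union> {z.t True})" using g by blast
    then have "(g, \<one>\<^bsub>G\<^esub>) \<in> ?H"
    proof (rule z.invariance[OF H, rotated])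
      fix b a assume a: "a \<in> ?H" "a \<in> z.D b"
      then have "a = (\<one>\<^bsub>G\<^esub>, \<one>\<^bsub>G\<^esub>)" by (cases b) (auto simp: hnn_dom_def)
      then have "z.F b a = \<one>\<^bsub>?GG\<^esub>" using z.F_one[of b] by simp
      then show "z.F b a \<in> ?H" using subgroup.one_closed[OF H] by simp
    qed
    then show "g \<in> generate G ?S" by simp
  next
    fix g assume g: "g \<in> generate G ?S"
    have "hnn_incl (x, \<one>\<^bsub>G\<^esub>) \<in> ?L" if x: "x \<in> ?S" for x
    proof -
      have "k (tc G x) \<otimes>\<^bsub>z.K\<^esub> inv\<^bsub>z.K\<^esub> z.t True \<in> ?L" using x by (intro generate.eng generate.incl generate.inv) auto
      moreover have "k (tc G x) \<otimes>\<^bsub>z.K\<^esub> inv\<^bsub>z.K\<^esub> z.t True = hnn_incl (x, \<one>\<^bsub>G\<^esub>)"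
        using ktc[of x] x ic[of x "\<one>\<^bsub>G\<^esub>"] t by (simp add: z.K.m_assoc)
      ultimately show ?thesis by simp
    qed
    then have "(\<lambda>g. hnn_incl (g, \<one>\<^bsub>G\<^esub>)) ` ?S \<subseteq> ?L" by blast
    then have "generate z.K ((\<lambda>g. hnn_incl (g, \<one>\<^bsub>G\<^esub>)) ` ?S) \<subseteq> ?L" by (rule z.K.generate_subgroup_incl[OF _ sL])
    then show "g \<in> {g \<in> carrier G. hnn_incl (g, \<one>\<^bsub>G\<^esub>) \<in> ?L}" using group_hom.generate_img[OF group_homI[OF is_group z.group_K l] S] g gS by blast
  qed
  then show ?thesis using b' by simp
qed

text \<open>In the square of \<open>fz G\<close>, the pairs \<open>(tc x, tc y)\<close> with \<open>R x y\<close> or \<open>x = y\<close>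
  generate a subgroup that contains \<open>(tc x, tc y)\<close> exactly when \<open>x\<close> and \<open>y\<close> are equivalent.\<close>

lemma bs_equivclp:
  assumes "fpt G" "bs (G \<times>\<times> G) (\<lambda>p. R (fst p) (snd p))"
  shows "bs (G \<times>\<times> G) (\<lambda>p. equivclp (\<lambda>x y. x \<in> carrier G \<and> y \<in> carrier G \<and> R x y) (fst p) (snd p))"
proof -
  interpret fzgroup G by (rule fzgroupI[OF fpt_group[OF assms(1)]])
  let ?GG = "G \<times>\<times> G" and ?M = "fz G \<times>\<times> fz G"
  let ?R = "\<lambda>x y. x \<in> carrier G \<and> y \<in> carrier G \<and> R x y"
  define c where "c p = (tc G (fst p), tc G (snd p))" for p
  have GG: "fpt ?GG" and M: "fpt ?M" using assms(1) by (simp_all add: fpt_prod fpt_fz)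
  interpret M: group ?M by (rule fpt_group[OF M])
  have s: "bf ?GG G (\<lambda>p. fst p)" "bf ?GG G (\<lambda>p. snd p)"
    by (rule bf_fst[OF bf_id[OF GG] assms(1,1)], rule bf_snd[OF bf_id[OF GG] assms(1,1)])
  have c: "bf ?GG ?M c" unfolding c_def by (intro bf_pair bf_tc s)
  let ?T = "\<lambda>p. R (fst p) (snd p) \<or> fst p = snd p"
  have T: "bs ?GG ?T" by (rule bs_or[OF GG assms(2) bs_eq[OF s]])
  let ?X = "{y \<in> carrier ?M. \<exists>p. p \<in> carrier ?GG \<and> ?T p \<and> y = c p}"
  have D: "benign ?M (generate ?M ?X)" by (rule benign_generate[OF M bs_bex[OF c T]])
  have X: "?X \<subseteq> carrier ?M" by blast
  have "bs ?GG (\<lambda>p. c p \<in> generate ?M ?X)" by (rule bs_subst[OF bs_sub[OF M D] c])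
  then show ?thesis
  proof (rule bs_cong[rotated])
    fix p assume p: "p \<in> carrier ?GG"
    obtain x y where xy: "p = (x, y)" "x \<in> carrier G" "y \<in> carrier G" using p by auto
    have gX: "(tc G x, tc G y) \<in> generate ?M ?X" if "x \<in> carrier G" "y \<in> carrier G" "R x y \<or> x = y" for x y
      using that by (intro generate.incl) (auto simp: c_def)
    show "(c p \<in> generate ?M ?X) = equivclp ?R (fst p) (snd p)"
    proof
      assume "equivclp ?R (fst p) (snd p)"
      then have "equivclp ?R x y" using xy by simp
      then have "y \<in> carrier G \<and> (tc G x, tc G y) \<in> generate ?M ?X"
      proof (induct rule: equivclp_induct)
        case base then show ?case using gX xy by simp
      next
        case (step y z)
        then have c: "y \<in> carrier G" "z \<in> carrier G" by auto
        \<comment> \<open>Symmetry and transitivity come from products \<open>u v^-1 w\<close> in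
          which diagonal pairs cancel the unwanted coordinates.\<close>
        have e3: "(tc G y, tc G z) \<in> generate ?M ?X"
        proof (cases "?R y z")
          case True then show ?thesis using gX by simp
        next
          case False
          then have "R z y" using step(2) c by blast
          have g: "(tc G y, tc G y) \<in> generate ?M ?X" "(tc G z, tc G y) \<in> generate ?M ?X" "(tc G z, tc G z) \<in> generate ?M ?X"
            using c \<open>R z y\<close> by (blast intro: gX)+
          show ?thesis
            using generate.eng[OF generate.eng[OF g(1) M.generate_m_inv_closed[OF X g(2)]] g(3)] c
            by (simp add: inv_DirProd group_fz Z.m_assoc)
        qed
        have e1: "(tc G x, tc G y) \<in> generate ?M ?X" using step(3) by simp
        have e2: "(tc G y, tc G y) \<in> generate ?M ?X" using gX c by simp
        have "(tc G x, tc G y) \<otimes>\<^bsub>?M\<^esub> inv\<^bsub>?M\<^esub> (tc G y, tc G y) \<otimes>\<^bsub>?M\<^esub> (tc G y, tc G z)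
            = (tc G x, tc G z)" using c xy by (simp add: inv_DirProd group_fz Z.m_assoc)
        then show ?case
          using generate.eng[OF generate.eng[OF e1 M.generate_m_inv_closed[OF X e2]] e3] c(2) by simp
      qed
      then show "c p \<in> generate ?M ?X" using xy by (simp add: c_def)
    next
      assume cp: "c p \<in> generate ?M ?X"
      \<comment> \<open>The indicator of the class of \<open>x\<close> extends to a homomorphism
        into the integers. It takes equal values on the two coordinates of every generator, and it
        separates \<open>x\<close> from elements outside its class.\<close>
      define A where "A z = (if equivclp ?R x z then 1 else 0 :: int)" for z
      have "\<exists>\<rho>\<in>hom (fz G\<lparr>carrier := fall G\<rparr>) integer_group. \<forall>g\<in>carrier G. \<rho> (tc G g) = A g"
        by (rule fz_basis) auto
      then obtain \<rho> where r: "\<rho> \<in> hom (fz G\<lparr>carrier := fall G\<rparr>) integer_group"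
        "\<forall>g\<in>carrier G. \<rho> (tc G g) = A g" by (rule bexE)
      interpret r: group_hom "fz G\<lparr>carrier := fall G\<rparr>" integer_group \<rho>
        by (rule group_homI[OF group_fall group_integer_group r(1)])
      have A: "A u = A v" if "u \<in> carrier G" "v \<in> carrier G" "R u v \<or> u = v" for u v
      proof -
        have "equivclp ?R u v" using that by (auto simp: equivclp_def intro: r_into_rtranclp symclpI)
        then have "equivclp ?R x u \<longleftrightarrow> equivclp ?R x v" by (meson equivclp_sym equivclp_trans)
        then show ?thesis by (simp add: A_def)
      qed
      let ?Q = "{q \<in> fall G \<times> fall G. \<rho> (fst q) = \<rho> (snd q)}"
      have rm: "\<rho> (u \<otimes>\<^bsub>fz G\<^esub> v) = \<rho> u + \<rho> v" if "u \<in> fall G" "v \<in> fall G" for u v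
        using r.hom_mult[of u v] that by simp
      have ri: "\<rho> (inv\<^bsub>fz G\<^esub> u) = - \<rho> u" if "u \<in> fall G" for u
        using r.hom_inv[of u] that Z.m_inv_consistent[OF fall_subgroup that] by simp
      have "generate ?M ?X \<subseteq> ?Q"
      proof (rule M.generate_subgroup_incl)
        show "?X \<subseteq> ?Q"
        proof
          fix q assume "q \<in> ?X"
          then obtain u v where uv: "q = (tc G u, tc G v)" "u \<in> carrier G" "v \<in> carrier G" "R u v \<or> u = v"
            by (auto simp: c_def)
          then show "q \<in> ?Q" using A[OF uv(2-4)] r(2) fall_tc by simp
        qed
        have sc: "fall G \<subseteq> carrier (fz G)" by (rule subgroup.subset[OF fall_subgroup])
        show "subgroup ?Q ?M"
        proof (rule M.subgroupI)
          show "?Q \<subseteq> carrier ?M" using sc by auto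
          have "(\<one>\<^bsub>fz G\<^esub>, \<one>\<^bsub>fz G\<^esub>) \<in> ?Q" using subgroup.one_closed[OF fall_subgroup] by simp
          then show "?Q \<noteq> {}" by blast
          show "inv\<^bsub>?M\<^esub> a \<in> ?Q" if "a \<in> ?Q" for a
            using that sc ri subgroup.m_inv_closed[OF fall_subgroup] by (auto simp: inv_DirProd group_fz subset_iff)
          show "a \<otimes>\<^bsub>?M\<^esub> b \<in> ?Q" if "a \<in> ?Q" "b \<in> ?Q" for a b
            using that rm subgroup.m_closed[OF fall_subgroup] by auto
        qed
      qed
      then have "\<rho> (tc G x) = \<rho> (tc G y)" using cp xy by (auto simp: c_def)
      then have "A x = A y" using r(2) xy by simp
      then show "equivclp ?R (fst p) (snd p)" using xy by (auto simp: A_def split: if_splits)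
    qed
  qed
qed

section \<open>Recursively enumerable relations are benign\<close>

abbreviation Zg :: "int monoid" where "Zg \<equiv> integer_group"

lemma bf_add: "bf E Zg f \<Longrightarrow> bf E Zg g \<Longrightarrow> bf E Zg (\<lambda>x. f x + g x)"
  using bf_mult[of E Zg f g] by simp

lemma bf_minus: "bf E Zg f \<Longrightarrow> bf E Zg (\<lambda>x. - f x)"
  using bf_inv[of E Zg f] by simp

lemma bf_int_const: "fpt E \<Longrightarrow> bf E Zg (\<lambda>_. c)"
  by (rule bf_const) (simp_all add: fpt_int)

lemmas fpt_intros = fpt_prod fpt_int fpt_fz

lemmas bf_intros = bf_add bf_minus bf_int_const bf_pair bf_id bf_fst bf_snd

text \<open>From \<open>(0, 1)\<close> the steps \<open>(n, x) \<mapsto> (n + 1, 2 x)\<close> and their inverses reach exactly the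
  pairs \<open>(n, 2\<^sup>n)\<close> with \<open>n \<ge> 0\<close>, since 1 is odd.\<close>

lemma bs_nonneg: "bs Zg (\<lambda>z. 0 \<le> z)"
proof -
  let ?R = "\<lambda>p q. fst q = fst p + (1::int) \<and> snd q = snd p + (snd p :: int)"
  let ?R' = "\<lambda>x y. x \<in> carrier (Zg \<times>\<times> Zg) \<and> y \<in> carrier (Zg \<times>\<times> Zg) \<and> ?R x y"
  have "bs ((Zg \<times>\<times> Zg) \<times>\<times> (Zg \<times>\<times> Zg)) (\<lambda>p. ?R (fst p) (snd p))"
    by (rule bs_and bs_eq[where M = Zg] bf_intros fpt_intros)+
  note e = bs_equivclp[where R = ?R, OF fpt_prod[OF fpt_int fpt_int] this]
  have "bf (Zg \<times>\<times> Zg) ((Zg \<times>\<times> Zg) \<times>\<times> (Zg \<times>\<times> Zg)) (\<lambda>u. ((0, 1), u))" by (rule bf_intros fpt_intros)+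
  from bs_subst[OF e this]
  have "bs (Zg \<times>\<times> Zg) (\<lambda>u. equivclp ?R' (0, 1) (fst u, snd u))" by simp
  from bs_ex[OF fpt_int fpt_int, where P = "\<lambda>z y. equivclp ?R' (0, 1) (z, y)", OF this]
  show ?thesis
  proof (rule bs_cong[rotated])
    fix z :: int
    have 1: "\<exists>n. u = (int n, 2 ^ n)" if "equivclp ?R' (0, 1) u" for u
      using that
    proof (induct rule: equivclp_induct)
      case base then show ?case by (intro exI[of _ 0]) simp
    next
      case (step y w)
      then obtain n where n: "y = (int n, 2 ^ n)" by blast
      show ?case
      proof (cases "?R y w")
        case True then show ?thesis using n by (intro exI[of _ "Suc n"]) (auto simp: prod_eq_iff)
      next
        case False
        then have w: "int n = fst w + 1" "2 ^ n = snd w + snd w" using step(2) n by auto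
        then have "n \<noteq> 0" by (intro notI) (simp, presburger)
        then obtain m where "n = Suc m" using not0_implies_Suc by blast
        then show ?thesis using w by (intro exI[of _ m]) (auto simp: prod_eq_iff)
      qed
    qed
    have "equivclp ?R' (0, 1) (int n, 2 ^ n)" for n
    proof (induct n)
      case (Suc n)
      have "equivclp ?R' (int n, 2 ^ n) (int (Suc n), 2 ^ Suc n)"
        by (rule r_into_equivclp) simp
      with Suc show ?case by (rule equivclp_trans)
    qed simp
    note 2 = this
    show "(\<exists>y. y \<in> carrier Zg \<and> equivclp ?R' (0, 1) (z, y)) = (0 \<le> z)"
    proof
      assume "\<exists>y. y \<in> carrier Zg \<and> equivclp ?R' (0, 1) (z, y)"
      then show "0 \<le> z" using 1 by fastforce
    next
      assume "0 \<le> z"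
      then show "\<exists>y. y \<in> carrier Zg \<and> equivclp ?R' (0, 1) (z, y)"
        using 2[of "nat z"] by (intro exI[of _ "2 ^ nat z"]) simp
    qed
  qed
qed

section \<open>Arithmetic on natural numbers\<close>

definition nf :: "('e, 'c) monoid_scheme \<Rightarrow> ('e \<Rightarrow> nat) \<Rightarrow> bool" where
  "nf E f \<longleftrightarrow> bf E Zg (\<lambda>x. int (f x))"

text \<open>Since \<open>nat\<close> truncates, negative integers represent \<open>0\<close> here.\<close>

definition rn2 :: "(nat \<Rightarrow> nat \<Rightarrow> bool) \<Rightarrow> bool" where
  "rn2 R \<longleftrightarrow> bs (Zg \<times>\<times> Zg) (\<lambda>p. R (nat (fst p)) (nat (snd p)))"

lemma bs_graph: "fpt E \<Longrightarrow> bs (E \<times>\<times> Zg) (\<lambda>p. snd p = f (fst p)) \<Longrightarrow> bf E Zg f"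
  by (simp add: bf_def fpt_int)

text \<open>Truncation is defined by a case distinction on the sign, which \<open>bs_nonneg\<close>
  makes available.\<close>

lemma nf_nat: assumes "bf E Zg f" shows "nf E (\<lambda>x. nat (f x))"
proof -
  have "bs (Zg \<times>\<times> Zg) (\<lambda>p. (0 \<le> fst p \<and> snd p = fst p) \<or> (0 \<le> - fst p \<and> snd p = 0))"
    by (rule bs_or bs_and bs_eq[where M = Zg] bs_subst[OF bs_nonneg] bf_intros fpt_intros)+
  then have "bs (Zg \<times>\<times> Zg) (\<lambda>p. snd p = int (nat (fst p)))" by (rule bs_cong[rotated]) auto
  from bf_comp[OF assms bs_graph[OF fpt_int this]] show ?thesis by (simp add: nf_def)
qed

lemma nf_const: "fpt E \<Longrightarrow> nf E (\<lambda>_. c)" by (simp add: nf_def bf_int_const)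

lemma nf_add: "nf E f \<Longrightarrow> nf E g \<Longrightarrow> nf E (\<lambda>x. f x + g x)"
  using bf_add[of E "\<lambda>x. int (f x)" "\<lambda>x. int (g x)"] by (simp add: nf_def)

lemma nf_fpt: "nf E f \<Longrightarrow> fpt E" unfolding nf_def by (rule bf_fpt)

lemma nf_Suc: "nf E f \<Longrightarrow> nf E (\<lambda>x. Suc (f x))"
  using nf_add[of E f "\<lambda>_. 1"] nf_const[of E 1] nf_fpt[of E f] by simp

text \<open>The steps \<open>(n, s) \<mapsto> (n + 1, s + n + 1)\<close> trace out the graph of the triangular numbers.\<close>

lemma nf_triangle: assumes "nf E f" shows "nf E (\<lambda>x. triangle (f x))"
proof -
  let ?R = "\<lambda>p q. fst q = fst p + (1::int) \<and> snd q = snd p + (fst p + (1::int))"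
  let ?R' = "\<lambda>x y. x \<in> carrier (Zg \<times>\<times> Zg) \<and> y \<in> carrier (Zg \<times>\<times> Zg) \<and> ?R x y"
  have "bs ((Zg \<times>\<times> Zg) \<times>\<times> (Zg \<times>\<times> Zg)) (\<lambda>p. ?R (fst p) (snd p))"
    by (rule bs_and bs_eq[where M = Zg] bf_intros fpt_intros)+
  note e = bs_equivclp[where R = ?R, OF fpt_prod[OF fpt_int fpt_int] this]
  have "bf (Zg \<times>\<times> Zg) ((Zg \<times>\<times> Zg) \<times>\<times> (Zg \<times>\<times> Zg)) (\<lambda>u. ((0, 0), u))" by (rule bf_intros fpt_intros)+
  from bs_subst[OF e this]
  have "bs (Zg \<times>\<times> Zg) (\<lambda>u. equivclp ?R' (0, 0) u)" by simp
  then have "bs (Zg \<times>\<times> Zg) (\<lambda>u. snd u = fst u * (fst u + 1) div 2)"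
  proof (rule bs_cong[rotated])
    have st: "(n + 1) * (n + 2) div 2 = n * (n + 1) div 2 + (n + 1)" for n :: int
    proof -
      have "(n + 1) * (n + 2) = n * (n + 1) + (n + 1) * 2" by (simp add: algebra_simps)
      then show ?thesis by simp
    qed
    have 1: "snd u = fst u * (fst u + 1) div 2" if "equivclp ?R' (0, 0) u" for u
      using that
    proof (induct rule: equivclp_induct)
      case (step y w)
      then show ?case using st[of "fst y"] st[of "fst w"] by (auto simp: add.assoc)
    qed simp
    have s: "equivclp ?R' (n, n * (n + 1) div 2) (n + 1, (n + 1) * (n + 1 + 1) div 2)" for n :: int
      by (rule r_into_equivclp) (use st[of n] in \<open>simp add: add.assoc\<close>)
    have 2: "equivclp ?R' (0, 0) (n, n * (n + 1) div 2)" for n :: int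
    proof (induct n rule: int_induct[of _ 0])
      case (step1 n) then show ?case using equivclp_trans[OF step1(2) s[of n]] by blast
    next
      case (step2 n)
      have "equivclp ?R' (n - 1, (n - 1) * (n - 1 + 1) div 2) (n, n * (n + 1) div 2)"
        using s[of "n - 1"] by (simp only: diff_add_cancel)
      then show ?case by (rule equivclp_trans[OF step2(2) equivclp_sym])
    qed simp
    show "equivclp ?R' (0, 0) u = (snd u = fst u * (fst u + 1) div 2)" for u
    proof (cases u)
      case (Pair a b)
      show ?thesis unfolding Pair using 1[of "(a, b)"] 2[of a] by auto
    qed
  qed
  from bf_comp[OF assms[unfolded nf_def] bs_graph[OF fpt_int this]]
  have "bf E Zg (\<lambda>x. int (f x) * (int (f x) + 1) div 2)" .
  moreover have "int (triangle n) = int n * (int n + 1) div 2" for n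
    by (simp add: triangle_def zdiv_int algebra_simps)
  ultimately show ?thesis by (simp add: nf_def)
qed

text \<open>Cantor's pairing is a triangular number plus a summand; triangular numbers are treated
  for its sake.\<close>

lemma nf_pair: "nf E f \<Longrightarrow> nf E g \<Longrightarrow> nf E (\<lambda>x. prod_encode (f x, g x))"
  by (simp add: prod_encode_def nf_add nf_triangle)

lemma bs_eqn: "nf E f \<Longrightarrow> nf E g \<Longrightarrow> bs E (\<lambda>x. f x = g x)"
  using bs_eq[of E Zg "\<lambda>x. int (f x)" "\<lambda>x. int (g x)"] by (simp add: nf_def)

lemma bs_rn2: assumes "rn2 R" "nf E f" "nf E g" shows "bs E (\<lambda>x. R (f x) (g x))"
  using bs_subst[OF assms(1)[unfolded rn2_def] bf_pair[OF assms(2,3)[unfolded nf_def]]] by simp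

lemma bs_exn: assumes "fpt E" "bs (E \<times>\<times> Zg) (\<lambda>u. P (fst u) (nat (snd u)))" shows "bs E (\<lambda>x. \<exists>n. P x n)"
  by (rule bs_cong[OF _ bs_ex[OF assms(1) fpt_int, where P = "\<lambda>x z. P x (nat z)", OF assms(2)]])
    (metis UNIV_I carrier_integer_group nat_int)

text \<open>The closure over the integers is taken first. Between endpoints of the form
  \<open>int (nat _)\<close> its chains correspond to chains of natural numbers.\<close>

lemma rn2_equivclp: assumes "rn2 R" shows "rn2 (equivclp R)"
proof -
  let ?R = "\<lambda>x y. x \<in> carrier Zg \<and> y \<in> carrier Zg \<and> R (nat x) (nat y)"
  have b: "bs (Zg \<times>\<times> Zg) (\<lambda>p. equivclp ?R (fst p) (snd p))"
    by (rule bs_equivclp[OF fpt_int assms[unfolded rn2_def]])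
  have "bf (Zg \<times>\<times> Zg) (Zg \<times>\<times> Zg) (\<lambda>p. (int (nat (fst p)), int (nat (snd p))))"
    by (rule bf_pair nf_nat[unfolded nf_def] bf_intros fpt_intros)+
  from bs_subst[OF b this] have "bs (Zg \<times>\<times> Zg) (\<lambda>p. equivclp ?R (int (nat (fst p))) (int (nat (snd p))))" by simp
  moreover have e: "equivclp ?R (int a) (int b) = equivclp R a b" for a b
  proof
    have "equivclp ?R x y \<Longrightarrow> equivclp R (nat x) (nat y)" for x y
    proof (induct rule: equivclp_induct)
      case (step y z) then show ?case by (auto intro: equivclp_into_equivclp)
    qed simp
    from this[of "int a" "int b"] show "equivclp ?R (int a) (int b) \<Longrightarrow> equivclp R a b" by simp
    show "equivclp R a b \<Longrightarrow> equivclp ?R (int a) (int b)"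
    proof (induct rule: equivclp_induct)
      case (step y z)
      then have "?R (int y) (int z) \<or> ?R (int z) (int y)" by simp
      with step(3) show ?case by (rule equivclp_into_equivclp)
    qed simp
  qed
  ultimately show ?thesis unfolding rn2_def by (simp only: e)
qed

lemma det_terminal:
  assumes det: "\<And>a b c. R a b \<Longrightarrow> R a c \<Longrightarrow> b = c" and tm: "\<And>y. \<not> R d y" and e: "equivclp R c d"
  shows "R\<^sup>*\<^sup>* c d"
  using e
proof (induct rule: converse_equivclp_induct)
  case (step y z)
  show ?case
  proof (cases "R y z")
    case True then show ?thesis using step by simp
  next
    case False
    then have zy: "R z y" using step by blast
    from step(3) show ?thesis
    proof (cases rule: converse_rtranclpE)
      case base then show ?thesis using zy tm by blast
    next
      case (step w) then show ?thesis using det[OF zy] by blast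
    qed
  qed
qed simp

section \<open>Evaluation of recursive functions on coded lists\<close>

abbreviation cons :: "nat \<Rightarrow> nat \<Rightarrow> nat" where "cons x c \<equiv> Suc (prod_encode (x, c))"

lemma list_decode_eq_Cons: "list_decode c = x # xs \<longleftrightarrow> (\<exists>d. c = cons x d \<and> list_decode d = xs)"
  by (metis list_decode_inverse list_encode.simps(2) list_encode_inverse)

lemma list_decode_eq_Nil: "list_decode c = [] \<longleftrightarrow> c = 0"
  by (metis list_decode.simps(1) list_decode_inverse list_encode.simps(1))

lemmas nf_intros = nf_Suc nf_pair nf_add nf_nat nf_const bf_intros

lemmas bs_intros = bs_and bs_or bs_exn bs_eqn

lemma eval_det: "eval_recf f xs v \<Longrightarrow> eval_recf f xs w \<Longrightarrow> v = w"
proof (induct arbitrary: w rule: eval_recf.induct)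
  case (zero xs) then show ?case by (cases rule: eval_recf.cases) auto
next
  case (succ x xs) from succ show ?case by (cases rule: eval_recf.cases) auto
next
  case (proj i xs) from proj(2) show ?case by (cases rule: eval_recf.cases) auto
next
  case (comp xs gs ys f z)
  from comp(4) obtain ys' where y: "list_all2 (\<lambda>g. eval_recf g xs) gs ys'" "eval_recf f ys' w"
    by (cases rule: eval_recf.cases) auto
  have "ys = ys'"
  proof (rule nth_equalityI)
    show "length ys = length ys'" using list_all2_lengthD[OF comp(1)] list_all2_lengthD[OF y(1)] by simp
    show "ys ! i = ys' ! i" if "i < length ys" for i
    proof -
      have "i < length gs" using that list_all2_lengthD[OF comp(1)] by simp
      then show ?thesis using list_all2_nthD2[OF comp(1) that] list_all2_nthD[OF y(1), of i] by blast
    qed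
  qed
  then show ?case using comp(3) y(2) by simp
next
  case (pr0 f xs y g) from pr0(3) show ?case by (cases rule: eval_recf.cases) (auto intro: pr0(2))
next
  case (prS f g n xs y z) from prS(5) show ?case by (cases rule: eval_recf.cases) (auto dest: prS(2) prS(4))
next
  case (mn f n xs)
  have w: "eval_recf f (w # xs) 0" "\<forall>m<w. \<exists>v. eval_recf f (m # xs) v \<and> 0 < v"
    using mn(4) by (auto elim: eval_recf.cases)
  have "\<not> n < w" using w(2) mn(2) by force
  moreover have "\<not> w < n" using mn(3) w(1) by force
  ultimately show ?case by simp
qed

lemma rn2_nth: "rn2 (\<lambda>c v. i < length (list_decode c) \<and> v = list_decode c ! i)"
proof (induct i)
  case 0
  have "rn2 (\<lambda>c v. \<exists>d. c = cons v d)"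
    unfolding rn2_def by (rule bs_intros nf_intros fpt_intros)+
  moreover have "(0 < length (list_decode c) \<and> v = list_decode c ! 0) = (\<exists>d. c = cons v d)" for c v
    by (cases "list_decode c") (auto simp: list_decode_eq_Cons)
  ultimately show ?case by simp
next
  case (Suc i)
  have "rn2 (\<lambda>c v. \<exists>x d. c = cons x d \<and> (i < length (list_decode d) \<and> v = list_decode d ! i))"
    unfolding rn2_def by (rule bs_rn2[OF Suc] bs_intros nf_intros fpt_intros)+
  moreover have "(Suc i < length (list_decode c) \<and> v = list_decode c ! Suc i) =
     (\<exists>x d. c = cons x d \<and> (i < length (list_decode d) \<and> v = list_decode d ! i))" for c v
    by (cases "list_decode c") (auto simp: list_decode_eq_Cons)
  ultimately show ?case by simp
qed

lemma rn2_list_all2: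
  assumes "\<And>g. g \<in> set gs \<Longrightarrow> rn2 (\<lambda>c v. eval_recf g (list_decode c) v)"
  shows "rn2 (\<lambda>c d. list_all2 (\<lambda>g y. eval_recf g (list_decode c) y) gs (list_decode d))"
  using assms
proof (induct gs)
  case Nil
  have "rn2 (\<lambda>c d. d = 0)" unfolding rn2_def by (rule bs_intros nf_intros fpt_intros)+
  then show ?case by (simp add: list_decode_eq_Nil)
next
  case (Cons g gs)
  have IH: "rn2 (\<lambda>c d. list_all2 (\<lambda>g y. eval_recf g (list_decode c) y) gs (list_decode d))" using Cons by simp
  have g: "rn2 (\<lambda>c v. eval_recf g (list_decode c) v)" using Cons by simp
  have "rn2 (\<lambda>c d. \<exists>y e. d = cons y e \<and> eval_recf g (list_decode c) y \<and>
      list_all2 (\<lambda>g y. eval_recf g (list_decode c) y) gs (list_decode e))"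
    unfolding rn2_def by (rule bs_rn2[OF IH] bs_rn2[OF g] bs_intros nf_intros fpt_intros)+
  moreover have "list_all2 (\<lambda>g y. eval_recf g (list_decode c) y) (g # gs) (list_decode d) =
     (\<exists>y e. d = cons y e \<and> eval_recf g (list_decode c) y \<and>
      list_all2 (\<lambda>g y. eval_recf g (list_decode c) y) gs (list_decode e))" for c d
    by (auto simp: list_all2_Cons1 list_decode_eq_Cons)
  ultimately show ?case by simp
qed

text \<open>The basic functions, projections and compositions are existential formulas. Primitive
  recursion and minimisation are runs of a machine whose steps are deterministic because evaluation
  is.\<close>

lemma rn2_eval: "rn2 (\<lambda>c v. eval_recf f (list_decode c) v)"
proof (induct f)
  case Zero
  have "rn2 (\<lambda>c v. v = 0)" unfolding rn2_def by (rule bs_intros nf_intros fpt_intros)+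
  moreover have "eval_recf Zero xs v = (v = 0)" for xs v by (auto intro: eval_recf.zero elim: eval_recf.cases)
  ultimately show ?case by simp
next
  case Succ
  have "rn2 (\<lambda>c v. \<exists>x d. c = cons x d \<and> v = Suc x)" unfolding rn2_def by (rule bs_intros nf_intros fpt_intros)+
  moreover have "eval_recf Succ (list_decode c) v = (\<exists>x d. c = cons x d \<and> v = Suc x)" for c v
  proof
    assume "eval_recf Succ (list_decode c) v"
    then show "\<exists>x d. c = cons x d \<and> v = Suc x"
    proof (cases rule: eval_recf.cases)
      case (succ x xs) then show ?thesis using list_decode_eq_Cons[of c x xs] by auto
    qed
  qed (auto intro: eval_recf.succ)
  ultimately show ?case by simp
next
  case (Proj i)
  have "eval_recf (Proj i) xs v = (i < length xs \<and> v = xs ! i)" for xs v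
    by (auto intro: eval_recf.proj elim: eval_recf.cases)
  then show ?case using rn2_nth[of i] by simp
next
  case (Comp f gs)
  have gs: "rn2 (\<lambda>c d. list_all2 (\<lambda>g y. eval_recf g (list_decode c) y) gs (list_decode d))"
    by (rule rn2_list_all2) (rule Comp(2))
  have "rn2 (\<lambda>c v. \<exists>d. list_all2 (\<lambda>g y. eval_recf g (list_decode c) y) gs (list_decode d) \<and> eval_recf f (list_decode d) v)"
    unfolding rn2_def by (rule bs_rn2[OF gs] bs_rn2[OF Comp(1)] bs_intros nf_intros fpt_intros)+
  moreover have "eval_recf (Comp f gs) xs v =
      (\<exists>d. list_all2 (\<lambda>g y. eval_recf g xs y) gs (list_decode d) \<and> eval_recf f (list_decode d) v)" for xs v
  proof
    assume "eval_recf (Comp f gs) xs v"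
    then show "\<exists>d. list_all2 (\<lambda>g y. eval_recf g xs y) gs (list_decode d) \<and> eval_recf f (list_decode d) v"
    proof (cases rule: eval_recf.cases)
      case (comp ys) then show ?thesis by (intro exI[of _ "list_encode ys"]) simp
    qed
  qed (auto intro: eval_recf.comp)
  ultimately show ?case by simp
next
  case (PrimRec f g)
  \<comment> \<open>A state holds the counter \<open>i\<close>, the bound \<open>n\<close>, the
    coded arguments \<open>d\<close> and the current value \<open>y\<close>.\<close>
  define q where "q i n d y = prod_encode (i, prod_encode (n, prod_encode (d, y)))" for i n d y :: nat
  have q: "q i n d y = q i' n' d' y' \<longleftrightarrow> i = i' \<and> n = n' \<and> d = d' \<and> y = y'" for i n d y i' n' d' y'
    by (simp add: q_def)
  have nfq: "nf E (\<lambda>x. q (a x) (b x) (c x) (d x))" if "nf E a" "nf E b" "nf E c" "nf E d"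
    for E :: "('e, 'f) monoid_scheme" and a b c d
    unfolding q_def by (intro nf_pair that)
  \<comment> \<open>The equation with \<open>Suc k\<close> expresses \<open>i < n\<close>; it stops
    the machine at \<open>i = n\<close>, so that the final state is terminal.\<close>
  let ?S = "\<lambda>s s'. \<exists>i n d y z k. s = q i n d y \<and> s' = q (Suc i) n d z \<and> n = i + Suc k \<and>
     eval_recf g (list_decode (cons i (cons y d))) z"
  have "rn2 ?S" unfolding rn2_def by (rule bs_rn2[OF PrimRec(2)] bs_intros nfq nf_intros fpt_intros)+
  then have S: "rn2 (equivclp ?S)" by (rule rn2_equivclp)
  have "rn2 (\<lambda>c v. \<exists>n d y. c = cons n d \<and> eval_recf f (list_decode d) y \<and> equivclp ?S (q 0 n d y) (q n n d v))"
    unfolding rn2_def by (rule bs_rn2[OF PrimRec(1)] bs_rn2[OF S] bs_intros nfq nf_intros fpt_intros)+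
  moreover have "eval_recf (PrimRec f g) (list_decode c) v =
     (\<exists>n d y. c = cons n d \<and> eval_recf f (list_decode d) y \<and> equivclp ?S (q 0 n d y) (q n n d v))" for c v
  proof
    assume ev: "eval_recf (PrimRec f g) (list_decode c) v"
    then obtain n xs where nx: "list_decode c = n # xs" by (cases rule: eval_recf.cases) auto
    then obtain d where d: "c = cons n d" "list_decode d = xs" using list_decode_eq_Cons by blast
    have *: "\<exists>y. eval_recf f xs y \<and> equivclp ?S (q 0 n d y) (q i n d w)" if "i \<le> n" "eval_recf (PrimRec f g) (i # xs) w" for i w
      using that
    proof (induct i arbitrary: w)
      case 0
      from 0(2) show ?case by (cases rule: eval_recf.cases) auto
    next
      case (Suc i)
      from Suc(3) obtain u where u: "eval_recf (PrimRec f g) (i # xs) u" "eval_recf g (i # u # xs) w"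
        by (cases rule: eval_recf.cases) auto
      then obtain y where y: "eval_recf f xs y" "equivclp ?S (q 0 n d y) (q i n d u)" using Suc by auto
      obtain k where "n = i + Suc k" using Suc(2) by (metis Suc_le_eq add_Suc_right less_imp_Suc_add)
      then have "?S (q i n d u) (q (Suc i) n d w)" using u(2) d(2) by (auto intro!: exI)
      from y(1) equivclp_into_equivclp[where r = ?S, OF y(2) disjI1[OF this]] show ?case by blast
    qed
    then show "\<exists>n d y. c = cons n d \<and> eval_recf f (list_decode d) y \<and> equivclp ?S (q 0 n d y) (q n n d v)"
      using *[of n v] ev nx d by auto
  next
    assume "\<exists>n d y. c = cons n d \<and> eval_recf f (list_decode d) y \<and> equivclp ?S (q 0 n d y) (q n n d v)"
    then obtain n d y where a: "c = cons n d" "eval_recf f (list_decode d) y" "equivclp ?S (q 0 n d y) (q n n d v)" by blast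
    have "?S\<^sup>*\<^sup>* (q 0 n d y) (q n n d v)"
    proof (rule det_terminal[OF _ _ a(3)])
      show "b = c" if "?S a b" "?S a c" for a b c using that by (auto simp: q dest: eval_det)
    qed (auto simp: q)
    then have "\<exists>i w. q n n d v = q i n d w \<and> eval_recf (PrimRec f g) (i # list_decode d) w"
    proof (induct rule: rtranclp_induct)
      case base then show ?case using a(2) by (intro exI[of _ 0] exI[of _ y]) (auto intro: eval_recf.pr0)
    next
      case (step s s')
      then obtain i w where iw: "s = q i n d w" "eval_recf (PrimRec f g) (i # list_decode d) w" by blast
      then obtain z where "s' = q (Suc i) n d z" "eval_recf g (i # w # list_decode d) z" using step(2) by (auto simp: q)
      then show ?case using iw(2) by (blast intro: eval_recf.prS)
    qed
    then show "eval_recf (PrimRec f g) (list_decode c) v" using a(1) by (auto simp: q)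
  qed
  ultimately show ?case by simp
next
  case (Minimise f)
  \<comment> \<open>The search moves past \<open>i\<close> only if the value there is positive, so a
    zero of \<open>f\<close> is a terminal state.\<close>
  let ?S = "\<lambda>s s'. \<exists>i d v. s = prod_encode (i, d) \<and> s' = prod_encode (Suc i, d) \<and> eval_recf f (list_decode (cons i d)) (Suc v)"
  have "rn2 ?S" unfolding rn2_def by (rule bs_rn2[OF Minimise] bs_intros nf_intros fpt_intros)+
  then have S: "rn2 (equivclp ?S)" by (rule rn2_equivclp)
  have "rn2 (\<lambda>c v. eval_recf f (list_decode (cons v c)) 0 \<and> equivclp ?S (prod_encode (0, c)) (prod_encode (v, c)))"
    unfolding rn2_def by (rule bs_and bs_rn2[OF Minimise] bs_rn2[OF S] nf_intros fpt_intros)+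
  moreover have "eval_recf (Minimise f) (list_decode c) v =
     (eval_recf f (list_decode (cons v c)) 0 \<and> equivclp ?S (prod_encode (0, c)) (prod_encode (v, c)))" for c v
  proof
    assume "eval_recf (Minimise f) (list_decode c) v"
    then have ev: "eval_recf f (v # list_decode c) 0" "\<And>m. m < v \<Longrightarrow> \<exists>w. eval_recf f (m # list_decode c) w \<and> 0 < w"
      by (auto elim: eval_recf.cases)
    have "equivclp ?S (prod_encode (0, c)) (prod_encode (i, c))" if "i \<le> v" for i
      using that
    proof (induct i)
      case (Suc i)
      then obtain w where "eval_recf f (i # list_decode c) (Suc w)" using ev(2)[of i] by (metis Suc_le_eq gr0_implies_Suc)
      then have s: "?S (prod_encode (i, c)) (prod_encode (Suc i, c))" by auto
      have "equivclp ?S (prod_encode (0, c)) (prod_encode (i, c))" using Suc by simp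
      from equivclp_into_equivclp[where r = ?S, OF this disjI1[OF s]] show ?case .
    qed simp
    then show "eval_recf f (list_decode (cons v c)) 0 \<and> equivclp ?S (prod_encode (0, c)) (prod_encode (v, c))"
      using ev(1) by simp
  next
    assume a: "eval_recf f (list_decode (cons v c)) 0 \<and> equivclp ?S (prod_encode (0, c)) (prod_encode (v, c))"
    have "?S\<^sup>*\<^sup>* (prod_encode (0, c)) (prod_encode (v, c))"
    proof (rule det_terminal[OF _ _ conjunct2[OF a]])
      show "\<not> ?S (prod_encode (v, c)) y" for y using a by (auto dest: eval_det)
    qed auto
    then have "\<exists>i. prod_encode (v, c) = prod_encode (i, c) \<and> (\<forall>m<i. \<exists>w. eval_recf f (m # list_decode c) w \<and> 0 < w)"
    proof (induct rule: rtranclp_induct)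
      case (step s s')
      then obtain i where i: "s = prod_encode (i, c)" "\<forall>m<i. \<exists>w. eval_recf f (m # list_decode c) w \<and> 0 < w" by blast
      then have "s' = prod_encode (Suc i, c)" "\<exists>w. eval_recf f (i # list_decode c) w \<and> 0 < w"
        using step(2) by auto
      then show ?case using i(2) by (intro exI[of _ "Suc i"]) (auto simp: less_Suc_eq)
    qed auto
    then show "eval_recf (Minimise f) (list_decode c) v" using a by (auto intro: eval_recf.mn)
  qed
  ultimately show ?case by simp
qed

definition rn :: "(nat \<Rightarrow> bool) \<Rightarrow> bool" where "rn P \<longleftrightarrow> bs Zg (\<lambda>z. P (nat z))"

lemma bs_rn: assumes "rn P" "nf E f" shows "bs E (\<lambda>x. P (f x))"
  using bs_subst[OF assms(1)[unfolded rn_def] assms(2)[unfolded nf_def]] by simp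

lemma rn_re_nat: assumes "re_nat S" shows "rn (\<lambda>n. n \<in> S)"
proof -
  obtain f where f: "S = {n. \<exists>v. eval_recf f [n] v}" using assms by (auto simp: re_nat_def)
  have "rn (\<lambda>n. \<exists>v. eval_recf f (list_decode (cons n 0)) v)"
    unfolding rn_def by (rule bs_rn2[OF rn2_eval] bs_intros nf_intros fpt_intros)+
  then show ?thesis by (simp add: f)
qed

section \<open>Derivability with axioms and binary rules\<close>

inductive der :: "(nat \<Rightarrow> bool) \<Rightarrow> (nat \<Rightarrow> nat \<Rightarrow> bool) \<Rightarrow> nat \<Rightarrow> bool" for R0 R2 where
  "R0 g \<Longrightarrow> der R0 R2 g"
| "R2 g (prod_encode (p, q)) \<Longrightarrow> der R0 R2 p \<Longrightarrow> der R0 R2 q \<Longrightarrow> der R0 R2 g"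

text \<open>A derivation is checked by a machine whose state consists of the stack of open goals and
  of the list of rule instances still to be applied.  The rule instances make it deterministic.\<close>

lemma rn_der: assumes "rn R0" "rn2 R2" shows "rn (der R0 R2)"
proof -
  \<comment> \<open>A state is a pair of goal stack and instruction list. Instruction 0 closes the
    top goal as an axiom; the successor of the code of \<open>(p, q)\<close> replaces it by the
    goals \<open>p\<close> and \<open>q\<close>.\<close>
  let ?S = "\<lambda>x y. \<exists>g s c. (x = prod_encode (cons g s, cons 0 c) \<and> R0 g \<and> y = prod_encode (s, c)) \<or>
     (\<exists>p q. x = prod_encode (cons g s, cons (Suc (prod_encode (p, q))) c) \<and> R2 g (prod_encode (p, q)) \<and>
       y = prod_encode (cons p (cons q s), c))"
  have "rn2 ?S" unfolding rn2_def by (rule bs_rn[OF assms(1)] bs_rn2[OF assms(2)] bs_intros nf_intros fpt_intros)+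
  then have S: "rn2 (equivclp ?S)" by (rule rn2_equivclp)
  have "rn (\<lambda>g. \<exists>c. equivclp ?S (prod_encode (cons g 0, c)) (prod_encode (0, 0)))"
    unfolding rn_def by (rule bs_rn2[OF S] bs_exn nf_intros fpt_intros)+
  moreover have e: "der R0 R2 g = (\<exists>c. equivclp ?S (prod_encode (cons g 0, c)) (prod_encode (0, 0)))" for g
  proof
    assume "der R0 R2 g"
    then have "\<exists>c'. equivclp ?S (prod_encode (cons g s, c')) (prod_encode (s, c))" for s c
    proof (induct arbitrary: s c)
      case (1 g)
      then have "?S (prod_encode (cons g s, cons 0 c)) (prod_encode (s, c))" by blast
      from r_into_equivclp[where r = ?S, OF this] show ?case by (rule exI)
    next
      case (2 g p q)
      obtain c1 where c1: "equivclp ?S (prod_encode (cons q s, c1)) (prod_encode (s, c))" using 2(5) by blast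
      obtain c2 where c2: "equivclp ?S (prod_encode (cons p (cons q s), c2)) (prod_encode (cons q s, c1))" using 2(3) by blast
      have "?S (prod_encode (cons g s, cons (Suc (prod_encode (p, q))) c2)) (prod_encode (cons p (cons q s), c2))"
        using 2(1) by blast
      from equivclp_trans[OF equivclp_trans[OF r_into_equivclp[where r = ?S, OF this] c2] c1] show ?case by (rule exI)
    qed
    then show "\<exists>c. equivclp ?S (prod_encode (cons g 0, c)) (prod_encode (0, 0))" .
  next
    assume "\<exists>c. equivclp ?S (prod_encode (cons g 0, c)) (prod_encode (0, 0))"
    then obtain c where c: "equivclp ?S (prod_encode (cons g 0, c)) (prod_encode (0, 0))" by blast
    have "?S\<^sup>*\<^sup>* (prod_encode (cons g 0, c)) (prod_encode (0, 0))"
      by (rule det_terminal[OF _ _ c]) auto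
    \<comment> \<open>Read backwards from the empty stack, the invariant is that all goals on the
      stack are derivable.\<close>
    then have "\<exists>s c'. prod_encode (cons g 0, c) = prod_encode (s, c') \<and> (\<forall>x\<in>set (list_decode s). der R0 R2 x)"
    proof (induct rule: converse_rtranclp_induct)
      case base then show ?case by (intro exI[of _ 0]) simp
    next
      case (step x y)
      then show ?case by (fastforce intro: der.intros)
    qed
    then show "der R0 R2 g" by auto
  qed
  moreover have "der R0 R2 = (\<lambda>g. \<exists>c. equivclp ?S (prod_encode (cons g 0, c)) (prod_encode (0, 0)))"
    by (rule ext) (rule e)
  ultimately show ?thesis by (simp only:)
qed

section \<open>Words, powers, integers and finite sets\<close>

lemma word_code_simps:
  "word_code [] = 0"
  "word_code (l # w) = cons (prod_encode (fst l, if snd l then 1 else 0)) (word_code w)"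
  by (simp_all add: word_code_def split: prod.split)

lemma inj_word_code: "inj word_code"
proof (rule injI)
  fix v w :: word assume "word_code v = word_code w"
  then show "v = w"
  proof (induct v arbitrary: w)
    case Nil then show ?case by (cases w) (auto simp: word_code_simps)
  next
    case (Cons l v) then show ?case by (cases w) (auto simp: word_code_simps prod_eq_iff split: if_splits)
  qed
qed

text \<open>A machine reads the code letter by letter and multiplies the generator or its inverse
  onto an accumulator. Its steps are deterministic, and code 0 of the empty word is terminal, so
  \<open>det_terminal\<close> applies to chains that start with the accumulator at the
  identity.\<close>

lemma bs_weval:
  assumes "fpt M" "bf Zg M (\<lambda>z. f (nat z))" "nf E a" "bf E M b"
  shows "bs E (\<lambda>x. \<exists>w. a x = word_code w \<and> b x = weval M f w)"
proof -
  interpret group M by (rule fpt_group[OF assms(1)])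
  let ?E = "Zg \<times>\<times> M"
  have E: "fpt ?E" by (rule fpt_prod[OF fpt_int assms(1)])
  have f: "f n \<in> carrier M" for n using bf_closed[OF assms(2), of "int n"] by simp
  have nff: "bf E' M (\<lambda>x. f (k x))" if "nf E' k" for E' :: "('z, 'y) monoid_scheme" and k
    using bf_comp[OF that[unfolded nf_def] assms(2)] by simp
  let ?R = "\<lambda>u v. \<exists>n m. (nat (fst u) = cons (prod_encode (n, 0)) m \<and> fst v = int m \<and> snd v = snd u \<otimes>\<^bsub>M\<^esub> f n) \<or>
     (nat (fst u) = cons (prod_encode (n, 1)) m \<and> fst v = int m \<and> snd v = snd u \<otimes>\<^bsub>M\<^esub> inv\<^bsub>M\<^esub> (f n))"
  let ?R' = "\<lambda>u v. u \<in> carrier ?E \<and> v \<in> carrier ?E \<and> ?R u v"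
  have "bs (?E \<times>\<times> ?E) (\<lambda>p. ?R (fst p) (snd p))"
    by (rule bs_intros bs_eq[where M = M] bs_eq[where M = Zg] nff bf_mult bf_inv nf_intros[unfolded nf_def] nf_intros fpt_intros assms(1))+
  note e = bs_equivclp[where R = ?R, OF E this]
  have "bf E (?E \<times>\<times> ?E) (\<lambda>x. ((int (a x), \<one>\<^bsub>M\<^esub>), (0, b x)))"
    by (rule bf_pair bf_const bf_int_const assms(3)[unfolded nf_def] assms(4) bf_fpt(1)[OF assms(4)] assms(1) one_closed)+
  from bs_subst[OF e this] have "bs E (\<lambda>x. equivclp ?R' (int (a x), \<one>\<^bsub>M\<^esub>) (0, b x))" by simp
  then show ?thesis
  proof (rule bs_cong[rotated])
    fix x assume "x \<in> carrier E"
    then have bx: "b x \<in> carrier M" by (rule bf_closed[OF assms(4)])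
    have wc: "weval M f w \<in> carrier M" for w
      by (rule weval_closed[OF is_group, of f UNIV]) (use f in \<open>auto simp: words_on_def\<close>)
    show "equivclp ?R' (int (a x), \<one>\<^bsub>M\<^esub>) (0, b x) = (\<exists>w. a x = word_code w \<and> b x = weval M f w)"
    proof
      assume "equivclp ?R' (int (a x), \<one>\<^bsub>M\<^esub>) (0, b x)"
      then have "?R'\<^sup>*\<^sup>* (int (a x), \<one>\<^bsub>M\<^esub>) (0, b x)"
      proof (rule det_terminal[rotated 2])
        show "v = w" if "?R' u v" "?R' u w" for u v w using that by (auto simp: prod_eq_iff)
      qed auto
      then have "\<exists>w. nat (fst (int (a x), \<one>\<^bsub>M\<^esub>)) = word_code w \<and> b x = snd (int (a x), \<one>\<^bsub>M\<^esub>) \<otimes>\<^bsub>M\<^esub> weval M f w"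
      proof (induct rule: converse_rtranclp_induct)
        case base then show ?case using bx by (intro exI[of _ "[]"]) (simp add: word_code_simps)
      next
        case (step u v)
        then obtain w where w: "nat (fst v) = word_code w" "b x = snd v \<otimes>\<^bsub>M\<^esub> weval M f w" by blast
        have u: "snd u \<in> carrier M" using step(1) by auto
        obtain n m where "(nat (fst u) = cons (prod_encode (n, 0)) m \<and> fst v = int m \<and> snd v = snd u \<otimes>\<^bsub>M\<^esub> f n) \<or>
          (nat (fst u) = cons (prod_encode (n, 1)) m \<and> fst v = int m \<and> snd v = snd u \<otimes>\<^bsub>M\<^esub> inv\<^bsub>M\<^esub> (f n))"
          using step(1) by blast
        then show ?case
        proof
          assume "nat (fst u) = cons (prod_encode (n, 0)) m \<and> fst v = int m \<and> snd v = snd u \<otimes>\<^bsub>M\<^esub> f n"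
          then show ?thesis using w u f wc
            by (intro exI[of _ "(n, False) # w"]) (simp add: word_code_simps m_assoc)
        next
          assume "nat (fst u) = cons (prod_encode (n, 1)) m \<and> fst v = int m \<and> snd v = snd u \<otimes>\<^bsub>M\<^esub> inv\<^bsub>M\<^esub> (f n)"
          then show ?thesis using w u f wc
            by (intro exI[of _ "(n, True) # w"]) (simp add: word_code_simps m_assoc)
        qed
      qed
      then show "\<exists>w. a x = word_code w \<and> b x = weval M f w" using wc by auto
    next
      have st: "equivclp ?R' (int (word_code w), y) (0, y \<otimes>\<^bsub>M\<^esub> weval M f w)" if "y \<in> carrier M" for y w
        using that
      proof (induct w arbitrary: y)
        case Nil then show ?case by (simp add: word_code_simps)
      next
        case (Cons l w)
        let ?c = "if snd l then inv\<^bsub>M\<^esub> (f (fst l)) else f (fst l)"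
        have c: "?c \<in> carrier M" using f by simp
        have "?R (int (word_code (l # w)), y) (int (word_code w), y \<otimes>\<^bsub>M\<^esub> ?c)"
          by (rule exI[of _ "fst l"], rule exI[of _ "word_code w"], cases "snd l")
            (simp_all only: fst_conv snd_conv nat_int word_code_simps if_True if_False simp_thms)
        then have "?R' (int (word_code (l # w)), y) (int (word_code w), y \<otimes>\<^bsub>M\<^esub> ?c)"
          using Cons(2) c by simp
        note s = r_into_equivclp[where r = ?R', OF this]
        have "y \<otimes>\<^bsub>M\<^esub> weval M f (l # w) = (y \<otimes>\<^bsub>M\<^esub> ?c) \<otimes>\<^bsub>M\<^esub> weval M f w"
          using Cons(2) c wc unfolding weval_Cons by (simp only: m_assoc)
        then show ?case using equivclp_trans[OF s Cons(1)[OF m_closed[OF Cons(2) c]]] by (simp only:)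
      qed
      assume "\<exists>w. a x = word_code w \<and> b x = weval M f w"
      then obtain w where w: "a x = word_code w" "b x = weval M f w" by blast
      show "equivclp ?R' (int (a x), \<one>\<^bsub>M\<^esub>) (0, b x)" using st[of "\<one>\<^bsub>M\<^esub>" w] wc unfolding w by simp
    qed
  qed
qed

text \<open>The step multiplies an accumulator by \<open>x\<close> and increments a counter. Both
  directions preserve the equation between accumulator and power, so the equivalence class is the
  graph itself; backward steps reach the negative exponents.\<close>

lemma bf_pow: assumes "bf E M a" "bf E Zg b" shows "bf E M (\<lambda>x. a x [^]\<^bsub>M\<^esub> b x)"
proof -
  have M: "fpt M" by (rule bf_fpt(2)[OF assms(1)])
  interpret group M by (rule fpt_group[OF M])
  let ?E = "M \<times>\<times> (M \<times>\<times> Zg)"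
  have E: "fpt ?E" by (intro fpt_intros M)
  let ?R = "\<lambda>u v. fst v = fst u \<and> fst (snd v) = fst (snd u) \<otimes>\<^bsub>M\<^esub> fst u \<and> snd (snd v) = snd (snd u) + 1"
  let ?R' = "\<lambda>u v. u \<in> carrier ?E \<and> v \<in> carrier ?E \<and> ?R u v"
  have "bs (?E \<times>\<times> ?E) (\<lambda>p. ?R (fst p) (snd p))"
    by (rule bs_intros bs_eq[where M = M] bs_eq[where M = Zg] bf_mult bf_intros fpt_intros M)+
  note e = bs_equivclp[where R = ?R, OF E this]
  have "bf ((M \<times>\<times> Zg) \<times>\<times> M) (?E \<times>\<times> ?E) (\<lambda>p. ((fst (fst p), \<one>\<^bsub>M\<^esub>, 0), (fst (fst p), snd p, snd (fst p))))"
    by (rule bf_intros bf_const fpt_intros M one_closed)+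
  from bs_subst[OF e this]
  have "bs ((M \<times>\<times> Zg) \<times>\<times> M) (\<lambda>p. equivclp ?R' (fst (fst p), \<one>\<^bsub>M\<^esub>, 0) (fst (fst p), snd p, snd (fst p)))" by simp
  then have "bs ((M \<times>\<times> Zg) \<times>\<times> M) (\<lambda>p. snd p = fst (fst p) [^]\<^bsub>M\<^esub> (snd (fst p)))"
  proof (rule bs_cong[rotated])
    fix p assume "p \<in> carrier ((M \<times>\<times> Zg) \<times>\<times> M)"
    then obtain x n y where p: "p = ((x, n), y)" and x: "x \<in> carrier M" and y: "y \<in> carrier M" by auto
    have st: "x [^]\<^bsub>M\<^esub> (k + 1) = x [^]\<^bsub>M\<^esub> k \<otimes>\<^bsub>M\<^esub> x" for k :: int
      using int_pow_mult[OF x, of k 1] x by simp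
    have 1: "u = (x, x [^]\<^bsub>M\<^esub> snd (snd u), snd (snd u))" if "equivclp ?R' (x, \<one>\<^bsub>M\<^esub>, 0) u" for u
      using that
    proof (induct rule: equivclp_induct)
      case (step v w)
      obtain k where v: "v = (x, x [^]\<^bsub>M\<^esub> k, k)" using step(3) by blast
      from step(2) show ?case
      proof
        assume "?R' v w" then show ?thesis by (auto simp: v prod_eq_iff st)
      next
        assume a: "?R' w v"
        then have w: "fst w = x" "k = snd (snd w) + 1" "x [^]\<^bsub>M\<^esub> k = fst (snd w) \<otimes>\<^bsub>M\<^esub> x" "fst (snd w) \<in> carrier M"
          by (auto simp: v)
        then have "x [^]\<^bsub>M\<^esub> (snd (snd w)) \<otimes>\<^bsub>M\<^esub> x = fst (snd w) \<otimes>\<^bsub>M\<^esub> x" by (simp add: st)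
        then have "fst (snd w) = x [^]\<^bsub>M\<^esub> (snd (snd w))" using x w(4) by simp
        then show ?thesis using w(1) by (simp add: prod_eq_iff)
      qed
    qed simp
    have s: "equivclp ?R' (x, x [^]\<^bsub>M\<^esub> k, k) (x, x [^]\<^bsub>M\<^esub> (k + 1), k + 1)" for k :: int
      by (rule r_into_equivclp) (use x in \<open>simp add: st\<close>)
    have 2: "equivclp ?R' (x, \<one>\<^bsub>M\<^esub>, 0) (x, x [^]\<^bsub>M\<^esub> k, k)" for k :: int
    proof (induct k rule: int_induct[of _ 0])
      case (step1 k) show ?case by (rule equivclp_trans[OF step1(2) s])
    next
      case (step2 k)
      have "equivclp ?R' (x, x [^]\<^bsub>M\<^esub> (k - 1), k - 1) (x, x [^]\<^bsub>M\<^esub> k, k)"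
        using s[of "k - 1"] by (simp only: diff_add_cancel)
      then show ?case by (rule equivclp_trans[OF step2(2) equivclp_sym])
    qed simp
    show "equivclp ?R' (fst (fst p), \<one>\<^bsub>M\<^esub>, 0) (fst (fst p), snd p, snd (fst p)) = (snd p = fst (fst p) [^]\<^bsub>M\<^esub> (snd (fst p)))"
      using 1[of "(x, y, n)"] 2[of n] by (auto simp: p)
  qed
  then have "bf (M \<times>\<times> Zg) M (\<lambda>p. fst p [^]\<^bsub>M\<^esub> snd p)"
    unfolding bf_def using M by (auto intro: fpt_intros)
  from bf_comp[OF bf_pair[OF assms] this] show ?thesis by simp
qed

lemma bs_re_int: assumes "re_int A" shows "bs Zg (\<lambda>z. z \<in> A)"
proof -
  let ?S = "int_encode ` A"
  have S: "rn (\<lambda>n. n \<in> ?S)" by (rule rn_re_nat) (use assms in \<open>simp add: re_int_def\<close>)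
  \<comment> \<open>\<open>int_encode\<close> sends a nonnegative \<open>z\<close> to
    \<open>2 z\<close> and a negative one to \<open>2 (- z - 1) + 1\<close>; the formula spells this
    out in sums.\<close>
  have "bs Zg (\<lambda>z. (0 \<le> z \<and> nat z + nat z \<in> ?S) \<or> (0 \<le> - z + - 1 \<and> Suc (nat (- z + - 1) + nat (- z + - 1)) \<in> ?S))"
    by (rule bs_or bs_and bs_rn[OF S] bs_subst[OF bs_nonneg] nf_intros fpt_intros)+
  then show ?thesis
  proof (rule bs_cong[rotated])
    fix z :: int
    have "z \<in> A \<longleftrightarrow> int_encode z \<in> ?S" by (simp add: inj_image_mem_iff inj_int_encode)
    moreover have "int_encode z = (if 0 \<le> z then nat z + nat z else Suc (nat (- z + - 1) + nat (- z + - 1)))"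
      by (simp add: int_encode_def sum_encode_def)
    ultimately show "((0 \<le> z \<and> nat z + nat z \<in> ?S) \<or> (0 \<le> - z + - 1 \<and> Suc (nat (- z + - 1) + nat (- z + - 1)) \<in> ?S)) = (z \<in> A)"
      by (cases "0 \<le> z") auto
  qed
qed

text \<open>A step drops the lowest binary digit of \<open>e\<close> and lowers \<open>m\<close>.
  Whether digit \<open>m\<close> of \<open>e\<close> is set is preserved in both directions, so an
  invariant suffices here; at position 0 the digit is set exactly for odd numbers.\<close>

lemma rn2_set_decode: "rn2 (\<lambda>e m. m \<in> set_decode e)"
proof -
  let ?R = "\<lambda>x y. \<exists>e m b. (b = 0 \<or> b = 1) \<and> x = prod_encode (e + e + b, Suc m) \<and> y = prod_encode (e, m)"
  have "rn2 ?R" unfolding rn2_def by (rule bs_intros nf_intros fpt_intros)+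
  then have R: "rn2 (equivclp ?R)" by (rule rn2_equivclp)
  have "rn2 (\<lambda>e m. \<exists>d. equivclp ?R (prod_encode (e, m)) (prod_encode (Suc (d + d), 0)))"
    unfolding rn2_def by (rule bs_rn2[OF R] bs_intros nf_intros fpt_intros)+
  moreover have "(\<exists>d. equivclp ?R (prod_encode (e, m)) (prod_encode (Suc (d + d), 0))) = (m \<in> set_decode e)" for e m
  proof
    have i: "(snd (prod_decode x) \<in> set_decode (fst (prod_decode x))) = (snd (prod_decode y) \<in> set_decode (fst (prod_decode y)))"
      if "?R x y" for x y 
    proof -
      from that obtain e m b where b: "(b = 0 \<or> b = (1::nat)) \<and> x = prod_encode (e + e + b, Suc m) \<and> y = prod_encode (e, m)"
        by (elim exE)
      then have "(e + e + b) div 2 = e" by auto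
      then show ?thesis using b by simp
    qed
    have "(snd (prod_decode x) \<in> set_decode (fst (prod_decode x))) = (snd (prod_decode y) \<in> set_decode (fst (prod_decode y)))"
      if "equivclp ?R x y" for x y using that
    proof (induct rule: equivclp_induct)
      case (step y z) then show ?case using i[of y z] i[of z y] by blast
    qed simp
    from this[of "prod_encode (e, m)" "prod_encode (Suc (d + d), 0)" for d]
    show "\<exists>d. equivclp ?R (prod_encode (e, m)) (prod_encode (Suc (d + d), 0)) \<Longrightarrow> m \<in> set_decode e"
      by (elim exE) (simp add: set_decode_0)
    show "m \<in> set_decode e \<Longrightarrow> \<exists>d. equivclp ?R (prod_encode (e, m)) (prod_encode (Suc (d + d), 0))"
    proof (induct m arbitrary: e)
      case 0
      then have "\<exists>d. e = Suc (d + d)" by (simp add: set_decode_0) presburger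
      then obtain d where "e = Suc (d + d)" by (rule exE)
      then show ?case by (intro exI[of _ d]) simp
    next
      case (Suc m)
      have "?R (prod_encode (e, Suc m)) (prod_encode (e div 2, m))"
      proof (rule exI[of _ "e div 2"], rule exI[of _ m], rule exI[of _ "e mod 2"], intro conjI HOL.refl)
        show "e mod 2 = 0 \<or> e mod 2 = 1" by presburger
        have "e = e div 2 + e div 2 + e mod 2" by presburger
        then show "prod_encode (e, Suc m) = prod_encode (e div 2 + e div 2 + e mod 2, Suc m)" by (simp only: prod.inject prod_encode_eq)
      qed
      note s = r_into_equivclp[where r = ?R, OF this]
      from Suc obtain d where "equivclp ?R (prod_encode (e div 2, m)) (prod_encode (Suc (d + d), 0))" by auto
      from equivclp_trans[OF s this] show ?case by (rule exI)
    qed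
  qed
  ultimately show ?thesis by simp
qed

text \<open>For a subgroup \<open>U\<close> containing \<open>B\<close> this is the least normal
  subgroup of \<open>U\<close> containing \<open>B\<close> with an \<open>A\<close>-torsion-free
  quotient. The operations are those of \<open>M\<close>, the ambient group in which it has to be
  benign.\<close>

inductive_set ncl :: "('a, 'c) monoid_scheme \<Rightarrow> 'a set \<Rightarrow> 'a set \<Rightarrow> int set \<Rightarrow> 'a set" for M U B A where
  one: "\<one>\<^bsub>M\<^esub> \<in> ncl M U B A"
| base: "x \<in> B \<Longrightarrow> x \<in> ncl M U B A"
| mult: "x \<in> ncl M U B A \<Longrightarrow> y \<in> ncl M U B A \<Longrightarrow> x \<otimes>\<^bsub>M\<^esub> y \<in> ncl M U B A"
| inv: "x \<in> ncl M U B A \<Longrightarrow> inv\<^bsub>M\<^esub> x \<in> ncl M U B A"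
| conj: "x \<in> ncl M U B A \<Longrightarrow> u \<in> U \<Longrightarrow> u \<otimes>\<^bsub>M\<^esub> x \<otimes>\<^bsub>M\<^esub> inv\<^bsub>M\<^esub> u \<in> ncl M U B A"
| root: "x [^]\<^bsub>M\<^esub> n \<in> ncl M U B A \<Longrightarrow> x \<in> U \<Longrightarrow> n \<in> A \<Longrightarrow> x \<in> ncl M U B A"

lemma ncl_sub: assumes "group M" "subgroup U M" "B \<subseteq> U" shows "ncl M U B A \<subseteq> U"
proof
  fix x assume "x \<in> ncl M U B A"
  then show "x \<in> U"
    using assms by induct (auto simp: subgroup.one_closed subgroup.m_closed subgroup.m_inv_closed)
qed

lemma weval_generate:
  assumes "group M" "f \<in> UNIV \<rightarrow> carrier M" "x \<in> generate M (range f)" shows "\<exists>w. x = weval M f w"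
proof -
  interpret group M by fact
  have w: "w \<in> words_on UNIV" for w by (simp add: words_on_def)
  have S: "range f \<subseteq> carrier M" using assms(2) by auto
  show ?thesis
  proof (rule generate_right_induct[OF S assms(3)])
    show "\<exists>w. \<one>\<^bsub>M\<^esub> = weval M f w" by (rule exI[of _ "[]"]) simp
  next
    fix x s assume "\<exists>w. x = weval M f w" "s \<in> range f"
    then obtain w i where e: "x = weval M f w" "s = f i" by blast
    have i: "f i \<in> carrier M" using S by auto
    have "x \<otimes>\<^bsub>M\<^esub> s = weval M f (w @ [(i, False)])" "x \<otimes>\<^bsub>M\<^esub> inv\<^bsub>M\<^esub> s = weval M f (w @ [(i, True)])"
      using weval_append[OF assms(1,2) w w] i by (simp_all add: e)
    then show "(\<exists>w. x \<otimes>\<^bsub>M\<^esub> s = weval M f w) \<and> (\<exists>w. x \<otimes>\<^bsub>M\<^esub> inv\<^bsub>M\<^esub> s = weval M f w)" by blast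
  qed
qed

text \<open>Elements are represented by codes of words; membership in the closure is then derivability
  in a system of rules with at most two premises.\<close>

lemma bs_ncl:
  assumes M: "fpt M" and f: "bf Zg M (\<lambda>z. f (nat z))" and U: "subgroup U M" "U \<subseteq> generate M (range f)" "bs M (\<lambda>x. x \<in> U)"
    and B: "B \<subseteq> U" "bs M (\<lambda>x. x \<in> B)" and A: "bs Zg (\<lambda>z. z \<in> A)"
  shows "bs M (\<lambda>x. x \<in> ncl M U B A)"
proof -
  interpret group M by (rule fpt_group[OF M])
  have fc: "f n \<in> carrier M" for n using bf_closed[OF f, of "int n"] by simp
  define dec where "dec c x \<longleftrightarrow> (\<exists>w. c = word_code w \<and> x = weval M f w)" for c x
  have dec: "bs E (\<lambda>x. dec (a x) (b x))" if "nf E a" "bf E M b" for E :: "('z, 'y) monoid_scheme" and a b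
    unfolding dec_def by (rule bs_weval[OF M f that])
  have dec_ex: "\<exists>c. dec c x" if "x \<in> U" for x
    using weval_generate[OF is_group, of f x] U(2) that fc by (auto simp: dec_def)
  have dec_unique: "x = y" if "dec c x" "dec c y" for c x y
  proof -
    show ?thesis using that inj_word_code by (auto simp: dec_def dest: injD)
  qed
  let ?N = "ncl M U B A"
  have NU: "?N \<subseteq> U" by (rule ncl_sub[OF is_group U(1) B(1)])
  let ?R0 = "\<lambda>g. \<exists>x. x \<in> carrier M \<and> dec g x \<and> (x = \<one>\<^bsub>M\<^esub> \<or> x \<in> B)"
  \<comment> \<open>Multiplication uses both premises \<open>y\<close> and \<open>z\<close>.
    Inversion, conjugation and roots have one premise, which a derivation supplies twice.\<close>
  let ?Q = "\<lambda>x y z. x = y \<otimes>\<^bsub>M\<^esub> z \<or> x = inv\<^bsub>M\<^esub> y \<or>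
      (\<exists>u. u \<in> carrier M \<and> u \<in> U \<and> x = u \<otimes>\<^bsub>M\<^esub> y \<otimes>\<^bsub>M\<^esub> inv\<^bsub>M\<^esub> u) \<or> (\<exists>n. n \<in> carrier Zg \<and> n \<in> A \<and> y = x [^]\<^bsub>M\<^esub> n)"
  let ?W = "\<lambda>g p q. \<exists>x. x \<in> carrier M \<and> dec g x \<and> x \<in> U \<and>
     (\<exists>y. y \<in> carrier M \<and> dec p y \<and> (\<exists>z. z \<in> carrier M \<and> dec q z \<and> ?Q x y z))"
  let ?R2 = "\<lambda>g r. \<exists>p q. r = prod_encode (p, q) \<and> ?W g p q"
  note rls = bs_ex[where M = M] bs_ex[where M = Zg] bs_eq[where M = M] bs_subst[OF U(3)] bs_subst[OF B(2)] bs_subst[OF A] dec bf_pow bf_mult bf_inv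
  have "rn ?R0" unfolding rn_def
    by (rule bs_and bs_or bs_exn rls bf_const one_closed nf_intros fpt_intros M)+
  moreover have "rn2 ?R2" unfolding rn2_def
    by (rule bs_and bs_or bs_exn bs_eqn rls nf_intros fpt_intros M)+
  ultimately have d: "rn (der ?R0 ?R2)" by (rule rn_der)
  have "bs M (\<lambda>x. x \<in> U \<and> (\<exists>g. dec g x \<and> der ?R0 ?R2 g))"
    by (rule bs_and bs_exn bs_rn[OF d] rls nf_intros fpt_intros M)+
  then show ?thesis
  proof (rule bs_cong[rotated])
    have 1: "dec g x \<Longrightarrow> x \<in> ?N" if "der ?R0 ?R2 g" for g x
      using that
    proof (induct arbitrary: x)
      case (1 g)
      then obtain y where "dec g y" "y = \<one>\<^bsub>M\<^esub> \<or> y \<in> B" by blast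
      then show ?case using dec_unique[of g x y] 1(2) by (auto intro: ncl.intros)
    next
      case (2 g p q)
      from 2(1) obtain p' q' where e: "prod_encode (p, q) = prod_encode (p', q') \<and> ?W g p' q'" by (elim exE)
      then have "p' = p" "q' = q" by simp_all
      then have "?W g p q" using e by (simp only:)
      then obtain x' y z where w: "dec g x'" "x' \<in> U" "dec p y" "dec q z" and Q': "?Q x' y z" by (elim exE conjE)
      have x: "x' = x" by (rule dec_unique[OF w(1) 2(6)])
      have yz: "y \<in> ?N" "z \<in> ?N" "x \<in> U" using 2(3)[OF w(3)] 2(5)[OF w(4)] w(2) x by simp_all
      have Q: "?Q x y z" using Q' x by (simp only:)
      from Q show ?case
        using ncl.mult[OF yz(1,2)] ncl.inv[OF yz(1)] ncl.conj[OF yz(1)] yz(1) ncl.root[OF _ yz(3)] by blast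
    qed
    have ex: "\<exists>g. dec g x \<and> der ?R0 ?R2 g" if "x \<in> ?N" for x
      using that
    proof (induct x)
      have s: "\<exists>g. dec g x \<and> der ?R0 ?R2 g"
        if "\<exists>g. dec g y \<and> der ?R0 ?R2 g" "\<exists>g. dec g z \<and> der ?R0 ?R2 g" "x \<in> ?N" "y \<in> ?N" "z \<in> ?N" "?Q x y z" for x y z
      proof -
        note h = that
        obtain g where g: "dec g x" using dec_ex[OF subsetD[OF NU h(3)]] by (rule exE)
        from h(1) obtain p where p: "dec p y" "der ?R0 ?R2 p" by (elim exE conjE)
        from h(2) obtain q where q: "dec q z" "der ?R0 ?R2 q" by (elim exE conjE)
        have c: "x \<in> carrier M" "y \<in> carrier M" "z \<in> carrier M" "x \<in> U" using h(3-5) NU subgroup.subset[OF U(1)] by blast+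
        have "?W g p q"
          by (rule exI[of _ x], intro conjI c g, rule exI[of _ y], intro conjI c p, rule exI[of _ z], intro conjI c q h(6))
        then have "?R2 g (prod_encode (p, q))" by (intro exI[of _ p] exI[of _ q] conjI HOL.refl)
        from der.intros(2)[of ?R2, OF this p(2) q(2)] g show ?thesis by (intro exI[of _ g] conjI)
      qed
      have b: "\<exists>g. dec g x \<and> der ?R0 ?R2 g" if "x = \<one>\<^bsub>M\<^esub> \<or> x \<in> B" for x
      proof -
        have x: "x \<in> U" using that B(1) subgroup.one_closed[OF U(1)] by blast
        obtain g where g: "dec g x" using dec_ex[OF x] by (rule exE)
        have "x \<in> carrier M" using x subgroup.subset[OF U(1)] by blast
        then have "?R0 g" using g that by (intro exI[of _ x] conjI)
        from der.intros(1)[of ?R0, OF this] g show ?thesis by (intro exI[of _ g] conjI)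
      qed
      {
        case one show ?case by (rule b) simp
      next
        case (base x) then show ?case by (intro b disjI2)
      next
        case (mult x y)
        show ?case by (rule s[OF mult(2,4) ncl.mult[OF mult(1,3)] mult(1,3)]) simp
      next
        case (inv x)
        show ?case by (rule s[OF inv(2,2) ncl.inv[OF inv(1)] inv(1,1)]) simp
      next
        case (conj x u)
        show ?case by (rule s[OF conj(2,2) ncl.conj[OF conj(1,3)] conj(1,1)]) (use conj(3) subgroup.subset[OF U(1)] in blast)
      next
        case (root x n)
        show ?case by (rule s[OF root(2,2) ncl.root[OF root(1,3,4)] root(1,1)]) (use root(4) in auto)
      }
    qed
    show "(x \<in> U \<and> (\<exists>g. dec g x \<and> der ?R0 ?R2 g)) = (x \<in> ?N)" for x
      using 1 ex NU by blast
  qed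
qed

section \<open>The rope trick\<close>

text \<open>As \<open>A\<close> is the preimage of \<open>A'\<close>, a word has a pinch exactly
  when its image has one. A word representing an element of the kernel is shortened until it is
  reduced; Britton's lemma in the larger extension then leaves no letters, and
  \<open>\<iota>\<close> is injective.\<close>

lemma hnn_map_inj:
  assumes "group G" "group G'" "\<iota> \<in> hom G G'" "inj_on \<iota> (carrier G)" "subgroup A G" "subgroup A' G'"
    and AA: "\<And>g. g \<in> carrier G \<Longrightarrow> \<iota> g \<in> A' \<longleftrightarrow> g \<in> A"
  shows "\<exists>k\<in>hom (HNN G A (\<lambda>x. x)) (HNN G' A' (\<lambda>x. x)). inj_on k (carrier (HNN G A (\<lambda>x. x))) \<and>
     (\<forall>g\<in>carrier G. k ([], g) = ([], \<iota> g)) \<and> (\<forall>b. k (hnn_t G b) = hnn_t G' b)"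
proof -
  interpret X: hnn G A "\<lambda>x. x" by (rule hnn_id[OF assms(1,5)])
  interpret Y: hnn G' A' "\<lambda>x. x" by (rule hnn_id[OF assms(2,6)])
  have \<iota>: "\<iota> g \<in> carrier G'" if "g \<in> carrier G" for g using assms(3) that by (auto simp: hom_def)
  have h: "(\<lambda>g. ([], \<iota> g)) \<in> hom G Y.K" using Group.hom_compose[OF assms(3) Y.incl_hom] by (simp add: comp_def)
  have tY: "Y.t b \<in> carrier Y.K" for b using Y.t_Omega by (simp add: Y.carrier_K)
  have tX: "X.t b \<in> carrier X.K" for b using X.t_Omega by (simp add: X.carrier_K)
  have "([], \<iota> a) \<otimes>\<^bsub>Y.K\<^esub> Y.t True = Y.t True \<otimes>\<^bsub>Y.K\<^esub> ([], \<iota> a)" if "a \<in> A" for a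
    using Y.t_slide[of "\<iota> a" True] AA[of a] that subgroup.subset[OF assms(5)] by (auto simp: Y.F_id)
  from X.universal[OF Y.group_K h tY this] obtain k where k: "k \<in> hom X.K Y.K" "\<And>g. g \<in> carrier G \<Longrightarrow> k ([], g) = ([], \<iota> g)"
    "k (X.t True) = Y.t True" by blast
  interpret k: group_hom X.K Y.K k by (rule group_homI[OF X.group_K Y.group_K k(1)])
  have kt: "k (X.t b) = Y.t b" for b
  proof (cases b)
    case False
    have "k (inv\<^bsub>X.K\<^esub> (X.t True)) = inv\<^bsub>Y.K\<^esub> (Y.t True)" using k.hom_inv[OF tX] k(3) by simp
    then show ?thesis using False by (simp add: X.t_inv Y.t_inv)
  qed (simp add: k(3))
  have wfY: "Y.wfw (map (apsnd \<iota>) ws)" if "X.wfw ws" for ws using that \<iota> by (induct ws) auto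
  have kw: "k (X.wd g ws) = Y.wd (\<iota> g) (map (apsnd \<iota>) ws)" if "g \<in> carrier G" "X.wfw ws" for g ws
    using that(2)
  proof (induct ws rule: rev_induct)
    case Nil then show ?case using k(2) that(1) by simp
  next
    case (snoc x ws)
    have w: "X.wd g ws \<in> X.\<Omega>" "snd x \<in> carrier G" using X.wd_Omega[OF that(1)] snoc(2) by auto
    have "Y.wd (\<iota> g) (map (apsnd \<iota>) ws) \<in> Y.\<Omega>" by (rule Y.wd_Omega[OF \<iota>[OF that(1)] wfY]) (use snoc(2) in simp)
    moreover have "X.wstep (X.wd g ws) x = X.wd g ws \<otimes>\<^bsub>X.K\<^esub> X.t (fst x) \<otimes>\<^bsub>X.K\<^esub> ([], snd x)"
      using w by (simp add: X.wstep_def X.mult_t X.mult_incl)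
    moreover have "X.wd g ws \<in> carrier X.K" "([], snd x) \<in> carrier X.K" using w by (simp_all add: X.carrier_K)
    then have "k (X.wd g ws \<otimes>\<^bsub>X.K\<^esub> X.t (fst x) \<otimes>\<^bsub>X.K\<^esub> ([], snd x)) =
        k (X.wd g ws) \<otimes>\<^bsub>Y.K\<^esub> k (X.t (fst x)) \<otimes>\<^bsub>Y.K\<^esub> k ([], snd x)" using tX by simp
    ultimately show ?case using snoc w k(2) kt
      by (simp add: X.wd_snoc Y.wd_snoc Y.wstep_def Y.mult_t Y.mult_incl)
  qed
  have rd: "Y.red (map (apsnd \<iota>) ws) = X.red ws" if "X.wfw ws" for ws
    using that by (induct ws rule: X.red.induct) (auto simp: X.pinch_def Y.pinch_def X.F_id Y.F_id AA)
  have ker: "X.wd g ws = \<one>\<^bsub>X.K\<^esub>" if "g \<in> carrier G" "X.wfw ws" "k (X.wd g ws) = \<one>\<^bsub>Y.K\<^esub>" for g ws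
    using that
  proof (induct "length ws" arbitrary: g ws rule: less_induct)
    case less
    show ?case
    proof (cases "X.red ws")
      case True
      have e: "Y.wd (\<iota> g) (map (apsnd \<iota>) ws) = ([], \<one>\<^bsub>G'\<^esub>)" using less.prems kw by (simp add: Y.one_K)
      have "map (apsnd \<iota>) ws = []"
      proof (rule Y.britton[of "\<iota> g"])
        show "Y.wfw (map (apsnd \<iota>) ws)" by (rule wfY[OF less.prems(2)])
        show "Y.red (map (apsnd \<iota>) ws)" using True rd less.prems by simp
      qed (use e \<iota> less.prems in auto)
      then have n: "ws = []" by simp
      then have "\<iota> g = \<one>\<^bsub>G'\<^esub>" using e by simp
      then have "\<iota> g = \<iota> \<one>\<^bsub>G\<^esub>" using assms(1-3) by (simp add: hom_one)
      then have "g = \<one>\<^bsub>G\<^esub>" using assms(4) less.prems(1) by (auto dest: inj_onD)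
      then show ?thesis by (simp add: n X.one_K)
    next
      case False
      have "\<exists>g' ws'. g' \<in> carrier G \<and> X.wfw ws' \<and> length ws' < length ws \<and> X.wd g ws = X.wd g' ws'"
        by (rule X.wd_shorten[OF X.subgroup_self _ less.prems(1,2) False]) (rule X.F_carrier)
      then obtain g' ws' where w: "g' \<in> carrier G" "X.wfw ws'" "length ws' < length ws" "X.wd g ws = X.wd g' ws'" by blast
      show ?thesis using less.hyps[OF w(3,1,2)] less.prems(3) w(4) by simp
    qed
  qed
  have "inj_on k (carrier X.K)"
    unfolding k.inj_on_one_iff using X.carrier_wd ker by metis
  then show ?thesis using k kt by (intro bexI[OF _ k(1)]) auto
qed

text \<open>The subgroup generated by two copies of \<open>F\<close> in \<open>HNN K L id\<close> is their amalgam over the kernel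
  of \<open>\<delta>\<close>.  The wreath product gives a map on it that is \<open>\<delta>\<close> on one copy and trivial on the other.\<close>

lemma rope_char:
  assumes F: "group F" and D: "group D" and \<delta>: "\<delta> \<in> hom F D" and K: "group K" and \<iota>: "\<iota> \<in> hom F K" "inj_on \<iota> (carrier F)"
    and L: "subgroup L K" and ker: "\<And>f. f \<in> carrier F \<Longrightarrow> \<iota> f \<in> L \<longleftrightarrow> \<delta> f = \<one>\<^bsub>D\<^esub>"
    and P: "P = HNN K L (\<lambda>x. x)"
  defines "c \<equiv> \<lambda>f. hnn_t K False \<otimes>\<^bsub>P\<^esub> ([], \<iota> f) \<otimes>\<^bsub>P\<^esub> hnn_t K True"
  shows "\<exists>\<chi>\<in>hom (P\<lparr>carrier := generate P ((\<lambda>f. ([], \<iota> f)) ` carrier F \<union> c ` carrier F)\<rparr>) D.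
     \<forall>f\<in>carrier F. \<chi> ([], \<iota> f) = \<delta> f \<and> \<chi> (c f) = \<one>\<^bsub>D\<^esub>"
proof -
  interpret \<delta>: group_hom F D \<delta> by (rule group_homI[OF F D \<delta>])
  let ?N = "{f \<in> carrier F. \<delta> f = \<one>\<^bsub>D\<^esub>}"
  have N: "subgroup ?N F" using \<delta>.subgroup_kernel by (simp add: kernel_def)
  interpret X: hnn F ?N "\<lambda>x. x" by (rule hnn_id[OF F N])
  interpret Y: hnn K L "\<lambda>x. x" by (rule hnn_id[OF K L])
  interpret W: group "wreath D Zg" by (rule group_wreath[OF D group_integer_group])
  let ?W = "wreath D Zg"
  have "\<iota> g \<in> L \<longleftrightarrow> g \<in> ?N" if "g \<in> carrier F" for g using ker that by simp
  from hnn_map_inj[OF F K \<iota> N L this] obtain k where k: "k \<in> hom X.K P" "inj_on k (carrier X.K)"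
    "\<And>g. g \<in> carrier F \<Longrightarrow> k ([], g) = ([], \<iota> g)" "\<And>b. k (X.t b) = Y.t b" unfolding P by blast
  have gP: "group P" unfolding P by (rule Y.group_K)
  interpret k: group_hom X.K P k by (rule group_homI[OF X.group_K gP k(1)])
  \<comment> \<open>In the wreath product over the integers, \<open>f\<close> becomes the function
    with value \<open>\<delta> f\<close> at 0 and the stable letter becomes the shift. The conjugate
    of \<open>f\<close> then lives at another position and is trivial at 0.\<close>
  define h where "h f = (\<lambda>u::int. if u = 0 then \<delta> f else \<one>\<^bsub>D\<^esub>, 0 :: int)" for f
  have h: "h \<in> hom F ?W" by (auto simp: hom_def h_def wreath_simps fun_eq_iff PiE_UNIV_domain)
  have \<tau>: "(\<lambda>u::int. \<one>\<^bsub>D\<^esub>, 1 :: int) \<in> carrier ?W" by (auto simp: wreath_simps PiE_UNIV_domain)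
  have "h a \<otimes>\<^bsub>?W\<^esub> (\<lambda>u::int. \<one>\<^bsub>D\<^esub>, 1 :: int) = (\<lambda>u::int. \<one>\<^bsub>D\<^esub>, 1 :: int) \<otimes>\<^bsub>?W\<^esub> h a" if "a \<in> ?N" for a
    using that by (simp add: h_def wreath_simps fun_eq_iff)
  from X.universal[OF W.is_group h \<tau> this] obtain q where q: "q \<in> hom X.K ?W" "\<And>f. f \<in> carrier F \<Longrightarrow> q ([], f) = h f"
    "q (X.t True) = (\<lambda>u::int. \<one>\<^bsub>D\<^esub>, 1 :: int)" by blast
  interpret q: group_hom X.K ?W q by (rule group_homI[OF X.group_K W.is_group q(1)])
  have t: "X.t b \<in> carrier X.K" for b using X.t_Omega by (simp add: X.carrier_K)
  have i: "([], f) \<in> carrier X.K" if "f \<in> carrier F" for f using that by (simp add: X.carrier_K)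
  have cj: "X.cj f \<in> carrier X.K" if "f \<in> carrier F" for f using t i that by simp
  have tcj: "X.t True \<otimes>\<^bsub>X.K\<^esub> X.cj f = ([], f) \<otimes>\<^bsub>X.K\<^esub> X.t True" if "f \<in> carrier F" for f
    using t i that X.t_t[of True] by (simp add: X.K.m_assoc[symmetric])
  let ?S = "hnn_incl ` carrier F \<union> X.cj ` carrier F"
  have S: "?S \<subseteq> carrier X.K" using i cj by blast
  have sn: "(\<lambda>x. snd (q x)) \<in> hom X.K Zg" using q.hom_closed by (auto simp: hom_def wreath_simps)
  have scj: "snd (q (X.cj f)) = 0" if "f \<in> carrier F" for f
  proof -
    have "snd (q (X.t True \<otimes>\<^bsub>X.K\<^esub> X.cj f)) = snd (q (([], f) \<otimes>\<^bsub>X.K\<^esub> X.t True))" using tcj[OF that] by simp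
    then have "snd (q (X.t True) \<otimes>\<^bsub>?W\<^esub> q (X.cj f)) = snd (q ([], f) \<otimes>\<^bsub>?W\<^esub> q (X.t True))"
      using t i[OF that] cj[OF that] by (simp only: q.hom_mult)
    then show ?thesis using that by (simp add: wreath_simps q h_def)
  qed
  have s0: "snd (q x) = 0" if "x \<in> generate X.K ?S" for x
  proof (rule hom_eq_generate[OF X.group_K group_integer_group sn _ S _ that, of "\<lambda>_. 0"])
    show "snd (q x) = 0" if "x \<in> ?S" for x using that scj q(2) by (auto simp: h_def)
  qed (simp add: hom_def)
  have fcj: "fst (q (X.cj f)) 0 = \<one>\<^bsub>D\<^esub>" if "f \<in> carrier F" for f
  proof -
    have w: "q (X.cj f) \<in> carrier ?W" using cj[OF that] by simp
    then have "fst (q (X.cj f)) 0 \<in> carrier D" by (auto simp: wreath_simps)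
    moreover have "q (X.t True) \<otimes>\<^bsub>?W\<^esub> q (X.cj f) = q ([], f) \<otimes>\<^bsub>?W\<^esub> q (X.t True)"
      using t i[OF that] cj[OF that] tcj[OF that] by (simp only: q.hom_mult[symmetric])
    then have "fst (q (X.t True) \<otimes>\<^bsub>?W\<^esub> q (X.cj f)) 0 = fst (q ([], f) \<otimes>\<^bsub>?W\<^esub> q (X.t True)) 0" by simp
    ultimately show ?thesis using that by (simp add: wreath_simps q h_def)
  qed
  let ?c0 = "\<lambda>x. fst (q x) 0" and ?C = "generate X.K ?S"
  have Cc: "?C \<subseteq> carrier X.K" by (rule X.K.generate_incl[OF S])
  have c0: "?c0 x \<in> carrier D" if "x \<in> ?C" for x
  proof -
    have "q x \<in> carrier ?W" by (rule q.hom_closed[OF subsetD[OF Cc that]])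
    then have "fst (q x) \<in> UNIV \<rightarrow>\<^sub>E carrier D" by (simp add: wreath_simps mem_Times_iff)
    then show ?thesis by (rule PiE_mem) simp
  qed
  have cm: "?c0 (x \<otimes>\<^bsub>X.K\<^esub> y) = ?c0 x \<otimes>\<^bsub>D\<^esub> ?c0 y" if "x \<in> ?C" "y \<in> ?C" for x y
  proof -
    have "q (x \<otimes>\<^bsub>X.K\<^esub> y) = q x \<otimes>\<^bsub>?W\<^esub> q y" by (rule q.hom_mult[OF subsetD[OF Cc that(1)] subsetD[OF Cc that(2)]])
    then show ?thesis using s0[OF that(2)] by (simp add: wreath_simps)
  qed
  let ?T = "(\<lambda>f. ([], \<iota> f)) ` carrier F \<union> c ` carrier F"
  have kc: "k (X.cj f) = c f" if "f \<in> carrier F" for f using that t i k(3,4) by (simp add: c_def)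
  have "k ` ?S = ?T" using kc k(3) by (simp add: image_Un image_image)
  then have T: "generate P ?T = k ` ?C" using k.generate_img[OF S] by simp
  \<comment> \<open>The map is constructed on the extension of \<open>F\<close> over the kernel;
    injectivity of \<open>k\<close> carries it over to the subgroup of \<open>P\<close>.\<close>
  define r where "r = the_inv_into (carrier X.K) k"
  have r: "r (k x) = x" if "x \<in> carrier X.K" for x using the_inv_into_f_f[OF k(2) that] by (simp add: r_def)
  have "(\<lambda>y. ?c0 (r y)) \<in> hom (P\<lparr>carrier := generate P ?T\<rparr>) D"
  proof (rule homI)
    fix x y assume "x \<in> carrier (P\<lparr>carrier := generate P ?T\<rparr>)" "y \<in> carrier (P\<lparr>carrier := generate P ?T\<rparr>)"
    then obtain u v where uv: "u \<in> ?C" "v \<in> ?C" "x = k u" "y = k v" unfolding T by auto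
    have uc: "u \<in> carrier X.K" "v \<in> carrier X.K" using subsetD[OF Cc uv(1)] subsetD[OF Cc uv(2)] by simp_all
    show "?c0 (r x) \<in> carrier D" using c0[OF uv(1)] uc by (simp add: uv r)
    have "r (x \<otimes>\<^bsub>P\<^esub> y) = u \<otimes>\<^bsub>X.K\<^esub> v" using uc r[of "u \<otimes>\<^bsub>X.K\<^esub> v"] by (simp add: uv)
    then show "?c0 (r (x \<otimes>\<^bsub>P\<lparr>carrier := generate P ?T\<rparr>\<^esub> y)) = ?c0 (r x) \<otimes>\<^bsub>D\<^esub> ?c0 (r y)"
      using cm[OF uv(1,2)] uc by (simp add: uv r)
  qed
  moreover have "?c0 (r ([], \<iota> f)) = \<delta> f" if "f \<in> carrier F" for f
    using r[OF i[OF that]] k(3)[OF that] q(2)[OF that] by (simp add: h_def)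
  moreover have "?c0 (r (c f)) = \<one>\<^bsub>D\<^esub>" if "f \<in> carrier F" for f
    using r[OF cj[OF that]] kc[OF that] fcj[OF that] by simp
  ultimately show ?thesis by (intro bexI[of _ "\<lambda>y. ?c0 (r y)"]) auto
qed

lemma factor_hom:
  assumes "group F" "group D" "group M" "\<delta> \<in> hom F D" "\<delta> ` carrier F = carrier D" "\<eta> \<in> hom F M"
    "\<And>f. f \<in> carrier F \<Longrightarrow> \<delta> f = \<one>\<^bsub>D\<^esub> \<Longrightarrow> \<eta> f = \<one>\<^bsub>M\<^esub>"
  shows "\<exists>k\<in>hom D M. \<forall>f\<in>carrier F. k (\<delta> f) = \<eta> f"
proof -
  interpret \<delta>: group_hom F D \<delta> by (rule group_homI[OF assms(1,2,4)])
  interpret \<eta>: group_hom F M \<eta> by (rule group_homI[OF assms(1,3,6)])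
  have eq: "\<eta> f = \<eta> g" if "f \<in> carrier F" "g \<in> carrier F" "\<delta> f = \<delta> g" for f g
  proof -
    have "\<eta> (f \<otimes>\<^bsub>F\<^esub> inv\<^bsub>F\<^esub> g) = \<one>\<^bsub>M\<^esub>" by (rule assms(7)) (use that in simp_all)
    then have "\<eta> f \<otimes>\<^bsub>M\<^esub> inv\<^bsub>M\<^esub> (\<eta> g) = \<one>\<^bsub>M\<^esub>" using that by simp
    then show ?thesis using that \<eta>.H.inv_equality[of "\<eta> f" "inv\<^bsub>M\<^esub> (\<eta> g)"] by simp
  qed
  define k where "k d = \<eta> (SOME f. f \<in> carrier F \<and> \<delta> f = d)" for d
  have k: "k (\<delta> f) = \<eta> f" if "f \<in> carrier F" for f
  proof -
    have "(SOME g. g \<in> carrier F \<and> \<delta> g = \<delta> f) \<in> carrier F \<and> \<delta> (SOME g. g \<in> carrier F \<and> \<delta> g = \<delta> f) = \<delta> f"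
      by (rule someI[of _ f]) (use that in simp)
    then show ?thesis unfolding k_def by (intro eq that) simp_all
  qed
  have "k \<in> hom D M"
  proof (rule homI)
    fix x y assume "x \<in> carrier D" "y \<in> carrier D"
    then have "x \<in> \<delta> ` carrier F" "y \<in> \<delta> ` carrier F" by (simp_all only: assms(5))
    then obtain f g where fg: "f \<in> carrier F" "g \<in> carrier F" "x = \<delta> f" "y = \<delta> g" by (elim imageE)
    then show "k x \<in> carrier M" by (simp add: k)
    have "k (\<delta> (f \<otimes>\<^bsub>F\<^esub> g)) = \<eta> (f \<otimes>\<^bsub>F\<^esub> g)" by (rule k) (use fg in simp)
    then show "k (x \<otimes>\<^bsub>D\<^esub> y) = k x \<otimes>\<^bsub>M\<^esub> k y" using fg by (simp add: k)
  qed
  then show ?thesis using k by blast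
qed

text \<open>The relators of \<open>D\<close> are traded for conjugations. In \<open>P\<close> the
  group \<open>F\<close> and its conjugate agree on the kernel of \<open>\<delta>\<close>. A further
  stable letter \<open>w\<close> turns \<open>(x, 1)\<close> into \<open>(x, \<chi> x)\<close>,
  where \<open>\<chi>\<close> is \<open>\<delta>\<close> on \<open>F\<close> and trivial on the
  conjugate. For \<open>f\<close> in the kernel both prescriptions concern the same element, which
  forces \<open>\<delta> f\<close> to be trivial; so finitely many relations imply all relations of
  \<open>D\<close>. As \<open>P\<close> is torsion-free, torsion can only come from
  \<open>D\<close>.\<close>

lemma rope:
  assumes F: "fpt F" and D: "group D" and \<delta>: "\<delta> \<in> hom F D" "\<delta> ` carrier F = carrier D"
    and b: "benign F {f \<in> carrier F. \<delta> f = \<one>\<^bsub>D\<^esub>}"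
  shows "\<exists>X R h. fin_presentation X R \<and> (\<forall>r\<in>R. \<exists>i j k. r = [(i, False), (j, False), (k, True)]) \<and>
     h \<in> hom D (pres_group X R) \<and> inj_on h (carrier D) \<and> (\<forall>n>0. torfree n D \<longrightarrow> torfree n (pres_group X R))"
proof -
  have gF: "group F" by (rule fpt_group[OF F])
  interpret \<delta>: group_hom F D \<delta> by (rule group_homI[OF gF D \<delta>(1)])
  obtain K' :: "word set monoid" and \<iota> L0 where K': "fpt K'" "\<iota> \<in> hom F K'" "inj_on \<iota> (carrier F)" "finite L0" "L0 \<subseteq> carrier K'"
    "\<And>f. f \<in> carrier F \<Longrightarrow> f \<in> {f \<in> carrier F. \<delta> f = \<one>\<^bsub>D\<^esub>} \<longleftrightarrow> \<iota> f \<in> generate K' L0"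
    "{f \<in> carrier F. \<delta> f = \<one>\<^bsub>D\<^esub>} \<subseteq> carrier F"
    by (rule benignE[OF b]) blast
  have gK: "group K'" by (rule fpt_group[OF K'(1)])
  define L where "L = generate K' L0"
  have L: "subgroup L K'" unfolding L_def by (rule group.generate_is_subgroup[OF gK K'(5)])
  have kerL: "\<iota> f \<in> L \<longleftrightarrow> \<delta> f = \<one>\<^bsub>D\<^esub>" if "f \<in> carrier F" for f using K'(6)[OF that] that by (simp add: L_def)
  interpret Y: hnn K' L "\<lambda>x. x" by (rule hnn_id[OF gK L])
  let ?P = "HNN K' L (\<lambda>x. x)"
  have fP: "fpt ?P" by (rule Y.fpt_K[OF K'(1,4,5) L_def])
  have tP: "Y.t b \<in> carrier ?P" for b using Y.t_Omega by (simp add: Y.carrier_K)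
  let ?i = "\<lambda>f. ([], \<iota> f)" and ?c = "\<lambda>f. Y.cj (\<iota> f)"
  have i: "?i \<in> hom F ?P" using Group.hom_compose[OF K'(2) Y.incl_hom] by (simp add: comp_def)
  have c: "?c \<in> hom F ?P" using Group.hom_compose[OF K'(2) Y.cj_hom] by (simp add: comp_def)
  note iP = hom_in_carrier[OF i] and cP = hom_in_carrier[OF c]
  define B where "B = ?i ` carrier F \<union> ?c ` carrier F"
  define T where "T = generate ?P B"
  have B: "B \<subseteq> carrier ?P" unfolding B_def using iP cP by blast
  have T: "subgroup T ?P" unfolding T_def by (rule Y.K.generate_is_subgroup[OF B])
  obtain \<chi> where \<chi>: "\<chi> \<in> hom (?P\<lparr>carrier := T\<rparr>) D" "\<And>f. f \<in> carrier F \<Longrightarrow> \<chi> (?i f) = \<delta> f"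
      "\<And>f. f \<in> carrier F \<Longrightarrow> \<chi> (?c f) = \<one>\<^bsub>D\<^esub>"
    using rope_char[OF gF D \<delta>(1) gK K'(2,3) L kerL HOL.refl] unfolding T_def B_def by blast
  let ?E = "?P \<times>\<times> D" and ?A = "T \<times> {\<one>\<^bsub>D\<^esub>}" and ?\<phi> = "\<lambda>p. (fst p, \<chi> (fst p))"
  interpret E: group ?E by (rule DirProd_group[OF Y.K.is_group D])
  have Tc: "T \<subseteq> carrier ?P" by (rule subgroup.subset[OF T])
  have \<chi>c: "\<chi> x \<in> carrier D" if "x \<in> T" for x using hom_in_carrier[OF \<chi>(1)] that by simp
  have \<chi>m: "\<chi> (x \<otimes>\<^bsub>?P\<^esub> y) = \<chi> x \<otimes>\<^bsub>D\<^esub> \<chi> y" if "x \<in> T" "y \<in> T" for x y using hom_mult[OF \<chi>(1)] that by simp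
  interpret Z: hnn ?E ?A ?\<phi>
  proof (rule hnn.intro[OF E.is_group hnn_axioms.intro])
    show "subgroup ?A ?E" by (rule DirProd_subgroups[OF Y.K.is_group T D \<delta>.H.triv_subgroup])
    show "?\<phi> p \<in> carrier ?E" if "p \<in> ?A" for p using that \<chi>c Tc by auto
    show "?\<phi> (p \<otimes>\<^bsub>?E\<^esub> q) = ?\<phi> p \<otimes>\<^bsub>?E\<^esub> ?\<phi> q" if "p \<in> ?A" "q \<in> ?A" for p q using that by (auto simp: \<chi>m)
    show "inj_on ?\<phi> ?A" by (auto simp: inj_on_def)
  qed
  let ?K = "HNN ?E ?A ?\<phi>" and ?w = "Z.t True"
  have w: "?w \<in> carrier ?K" using Z.t_Omega by (simp add: Z.carrier_K)
  have e: "([], p) \<in> carrier ?K" if "p \<in> carrier ?E" for p using that by (simp add: Z.carrier_K)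
  have sl: "([], (x, \<one>\<^bsub>D\<^esub>)) \<otimes>\<^bsub>?K\<^esub> ?w = ?w \<otimes>\<^bsub>?K\<^esub> ([], (x, \<chi> x))" if "x \<in> T" for x
    using Z.t_slide[of "(x, \<one>\<^bsub>D\<^esub>)" True] that by (simp add: hnn_dom_def hnn_map_def)
  obtain S where S: "finite S" "S \<subseteq> carrier F" "generate F S = carrier F" "\<one>\<^bsub>F\<^esub> \<in> S" by (rule fpt_gens[OF F])
  let ?B = "?i ` S \<union> ?c ` S"
  have BB: "?B \<subseteq> B" using S(2) by (auto simp: B_def)
  obtain C where C: "?B \<subseteq> C" "\<one>\<^bsub>?P\<^esub> \<in> C" "fp_on ?P C"
    by (rule fp_obtain[OF fP _ subset_trans[OF BB B]]) (use S(1) in simp)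
  have Cc: "finite C" "C \<subseteq> carrier ?P" "generate ?P C = carrier ?P" using C(3) by (auto simp: fp_on_def)
  define U where "U = \<delta> ` S"
  have U: "finite U" "U \<subseteq> carrier D" "\<one>\<^bsub>D\<^esub> \<in> U" "generate D U = carrier D"
    using S(1,2,3) imageI[OF S(4), of \<delta>] \<delta>.generate_img[OF S(2)] \<delta>(2) by (auto simp: U_def)
  have BT: "x \<in> T" if "x \<in> B" for x using that by (simp add: T_def generate.incl)
  \<comment> \<open>Of \<open>D\<close> only the finite set \<open>U\<close> enters, as a factor of
    the pairs that make it commute with \<open>P\<close>; the remaining relations of
    \<open>D\<close> have to be derived from the products with \<open>w\<close>.\<close>
  define C' where "C' = hnn_incl ` (C \<times> U) \<union> {?w} \<union> (\<lambda>x. ([], (x, \<one>\<^bsub>D\<^esub>)) \<otimes>\<^bsub>?K\<^esub> ?w) ` ?B"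
  have mem: "([], (x, d)) \<in> C'" "?w \<in> C'" if "x \<in> C" "d \<in> U" for x d using that by (auto simp: C'_def)
  have mem2: "([], (x, \<one>\<^bsub>D\<^esub>)) \<otimes>\<^bsub>?K\<^esub> ?w \<in> C'" if "x \<in> ?B" for x using that by (auto simp: C'_def)
  have CU: "C \<times> U \<subseteq> carrier ?E" using Cc(2) U(2) by (simp add: Sigma_mono)
  have sub: "C' \<subseteq> carrier ?K"
  proof -
    have "([], (x, \<one>\<^bsub>D\<^esub>)) \<otimes>\<^bsub>?K\<^esub> ?w \<in> carrier ?K" if "x \<in> ?B" for x
      using e[of "(x, \<one>\<^bsub>D\<^esub>)"] w that BB B by auto
    then have "(\<lambda>x. ([], (x, \<one>\<^bsub>D\<^esub>)) \<otimes>\<^bsub>?K\<^esub> ?w) ` ?B \<subseteq> carrier ?K" by (rule image_subsetI)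
    moreover have "hnn_incl ` (C \<times> U) \<subseteq> carrier ?K"
      by (rule image_subsetI) (rule e[OF subsetD[OF CU]])
    ultimately show ?thesis unfolding C'_def using w by (intro Un_least) simp_all
  qed
  have gE: "generate ?E (C \<times> U) = carrier ?E"
    using generate_prod[OF Y.K.is_group D Cc(2) U(2) C(2) U(3)] Cc(3) U(4) by simp
  have gen: "generate ?K C' = carrier ?K"
  proof
    show "generate ?K C' \<subseteq> carrier ?K" by (rule Z.K.generate_incl[OF sub])
    have "generate ?K (hnn_incl ` (C \<times> U) \<union> {?w}) \<subseteq> generate ?K C'"
      by (rule Z.K.mono_generate) (auto simp: C'_def)
    then show "carrier ?K \<subseteq> generate ?K C'" using Z.K_generated_by[OF gE CU] by (simp only:)
  qed
  have ext: "\<exists>h\<in>hom ?K M. \<forall>p\<in>C'. h p = m p" if M: "group M" "part_hom ?K C' M m" for M :: "word set monoid" and m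
  proof -
    interpret M: group M by fact
    note mm = part_hom_mult[OF M(2)]
    define W where "W = m ?w"
    have W: "W \<in> carrier M" unfolding W_def by (rule part_hom_closed[OF M(2)]) (simp add: C'_def)
    have j: "(\<lambda>x. ([], (x, \<one>\<^bsub>D\<^esub>))) \<in> hom ?P ?K"
      using Group.hom_compose[OF pair_hom(1)[OF Y.K.is_group D] Z.incl_hom] by (simp add: comp_def)
    have "part_hom ?P C M (m \<circ> (\<lambda>x. ([], (x, \<one>\<^bsub>D\<^esub>))))"
      by (rule part_hom_comp[OF M(2) j Cc(2)]) (use mem(1) U(3) in blast)
    from fp_onD[OF C(3) M(1) this] obtain p where p: "p \<in> hom ?P M" "\<And>x. x \<in> C \<Longrightarrow> p x = m ([], (x, \<one>\<^bsub>D\<^esub>))" by auto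
    interpret p: group_hom ?P M p by (rule group_homI[OF Y.K.is_group M(1) p(1)])
    define q where "q d = m ([], (\<one>\<^bsub>?P\<^esub>, d))" for d
    have q: "q d \<in> carrier M" if "d \<in> U" for d unfolding q_def by (rule part_hom_closed[OF M(2)]) (rule mem(1)[OF C(2) that])
    have md: "m ([], (x, d)) = p x \<otimes>\<^bsub>M\<^esub> q d" "m ([], (x, d)) = q d \<otimes>\<^bsub>M\<^esub> p x" if "x \<in> C" "d \<in> U" for x d
    proof -
      have "x \<in> carrier ?P" "d \<in> carrier D" using that Cc(2) U(2) by blast+
      then have pr: "([], (x, \<one>\<^bsub>D\<^esub>)) \<otimes>\<^bsub>?K\<^esub> ([], (\<one>\<^bsub>?P\<^esub>, d)) = ([], (x, d))" "([], (\<one>\<^bsub>?P\<^esub>, d)) \<otimes>\<^bsub>?K\<^esub> ([], (x, \<one>\<^bsub>D\<^esub>)) = ([], (x, d))"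
        by (simp_all add: Z.incl_mult)
      show "m ([], (x, d)) = p x \<otimes>\<^bsub>M\<^esub> q d" "m ([], (x, d)) = q d \<otimes>\<^bsub>M\<^esub> p x"
        using mm[OF mem(1)[OF that(1) U(3)] mem(1)[OF C(2) that(2)]] mm[OF mem(1)[OF C(2) that(2)] mem(1)[OF that(1) U(3)]]
          mem(1)[OF that] p(2)[OF that(1)] unfolding pr q_def by simp_all
    qed
    have pq: "p x \<otimes>\<^bsub>M\<^esub> q d = q d \<otimes>\<^bsub>M\<^esub> p x" if "x \<in> carrier ?P" "d \<in> U" for x d
      by (rule comm_generate[OF M(1) q[OF that(2)] Y.K.is_group p(1) Cc(2)]) (use md that Cc(3) in auto)
    have sm: "m (([], (x, \<one>\<^bsub>D\<^esub>)) \<otimes>\<^bsub>?K\<^esub> ?w) = p x \<otimes>\<^bsub>M\<^esub> W" if "x \<in> ?B" for x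
      using mm[OF mem(1)[OF _ U(3)] mem(2)[OF C(2) U(3)] mem2[OF that]] that C(1) p(2)[of x] by (auto simp: W_def)
    have sm': "p x \<otimes>\<^bsub>M\<^esub> W = W \<otimes>\<^bsub>M\<^esub> (p x \<otimes>\<^bsub>M\<^esub> q (\<chi> x))" if "x \<in> ?B" "\<chi> x \<in> U" for x
    proof -
      have xC: "x \<in> C" "x \<in> T" using that C(1) BB BT by blast+
      have "m (?w \<otimes>\<^bsub>?K\<^esub> ([], (x, \<chi> x))) = W \<otimes>\<^bsub>M\<^esub> m ([], (x, \<chi> x))"
        unfolding W_def by (rule mm) (use mem[OF xC(1) that(2)] mem2[OF that(1)] sl[OF xC(2)] in simp_all)
      then show ?thesis using sm[OF that(1)] md(1)[OF xC(1) that(2)] unfolding sl[OF xC(2)] by simp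
    qed
    let ?a = "\<lambda>f. p (?i f)"
    \<comment> \<open>The relation for \<open>w\<close> forces this commutator to be the image of
      \<open>\<delta> f\<close>. For a homomorphism on \<open>D\<close> it has to be multiplicative
      in \<open>f\<close> and trivial on the kernel.\<close>
    define \<eta> where "\<eta> f = inv\<^bsub>M\<^esub> (?a f) \<otimes>\<^bsub>M\<^esub> (inv\<^bsub>M\<^esub> W \<otimes>\<^bsub>M\<^esub> ?a f \<otimes>\<^bsub>M\<^esub> W)" for f
    have a: "?a \<in> hom F M" using Group.hom_compose[OF i p(1)] by (simp add: comp_def)
    interpret a: group_hom F M ?a by (rule group_homI[OF gF M(1) a])
    have bh: "(\<lambda>f. inv\<^bsub>M\<^esub> W \<otimes>\<^bsub>M\<^esub> ?a f \<otimes>\<^bsub>M\<^esub> W) \<in> hom F M"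
      using W hom_in_carrier[OF a] hom_mult[OF a] by (auto simp: hom_def M.m_assoc)
    define b where "b f = inv\<^bsub>M\<^esub> W \<otimes>\<^bsub>M\<^esub> ?a f \<otimes>\<^bsub>M\<^esub> W" for f
    interpret b: group_hom F M b by (rule group_homI[OF gF M(1)]) (use bh in \<open>simp add: b_def[abs_def]\<close>)
    have \<eta>b: "\<eta> f = inv\<^bsub>M\<^esub> (?a f) \<otimes>\<^bsub>M\<^esub> b f" for f by (simp add: \<eta>_def b_def)
    have \<eta>c: "\<eta> f \<in> carrier M" if "f \<in> carrier F" for f unfolding \<eta>b using that a.hom_closed b.hom_closed by blast
    \<comment> \<open>A commutator is multiplicative once its values commute with the image of
      \<open>F\<close>. The centralizer of the image of \<open>P\<close> provides this, and
      membership spreads from the generators to all of \<open>F\<close>.\<close>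
    define Cn where "Cn = {y \<in> carrier M. \<forall>x\<in>carrier ?P. p x \<otimes>\<^bsub>M\<^esub> y = y \<otimes>\<^bsub>M\<^esub> p x}"
    have Cn_mult: "y \<otimes>\<^bsub>M\<^esub> z \<in> Cn" if "y \<in> Cn" "z \<in> Cn" for y z
    proof -
      have yz: "y \<in> carrier M" "z \<in> carrier M" using that by (auto simp: Cn_def)
      have "p x \<otimes>\<^bsub>M\<^esub> (y \<otimes>\<^bsub>M\<^esub> z) = (y \<otimes>\<^bsub>M\<^esub> z) \<otimes>\<^bsub>M\<^esub> p x" if x: "x \<in> carrier ?P" for x
      proof -
        have "p x \<otimes>\<^bsub>M\<^esub> (y \<otimes>\<^bsub>M\<^esub> z) = (p x \<otimes>\<^bsub>M\<^esub> y) \<otimes>\<^bsub>M\<^esub> z" using yz x by (simp add: M.m_assoc)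
        also have "\<dots> = y \<otimes>\<^bsub>M\<^esub> (p x \<otimes>\<^bsub>M\<^esub> z)" using \<open>y \<in> Cn\<close> yz x by (simp add: Cn_def M.m_assoc)
        also have "\<dots> = (y \<otimes>\<^bsub>M\<^esub> z) \<otimes>\<^bsub>M\<^esub> p x" using \<open>z \<in> Cn\<close> yz x by (simp add: Cn_def M.m_assoc)
        finally show ?thesis .
      qed
      then show ?thesis using yz by (simp add: Cn_def)
    qed
    have Cn_inv: "inv\<^bsub>M\<^esub> y \<in> Cn" if "y \<in> Cn" for y
    proof -
      have y: "y \<in> carrier M" using that by (simp add: Cn_def)
      have "p x \<otimes>\<^bsub>M\<^esub> inv\<^bsub>M\<^esub> y = inv\<^bsub>M\<^esub> y \<otimes>\<^bsub>M\<^esub> p x" if x: "x \<in> carrier ?P" for x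
      proof -
        have "y \<otimes>\<^bsub>M\<^esub> p x = p x \<otimes>\<^bsub>M\<^esub> y" using \<open>y \<in> Cn\<close> x by (simp add: Cn_def)
        then have "inv\<^bsub>M\<^esub> y \<otimes>\<^bsub>M\<^esub> (y \<otimes>\<^bsub>M\<^esub> p x) \<otimes>\<^bsub>M\<^esub> inv\<^bsub>M\<^esub> y = inv\<^bsub>M\<^esub> y \<otimes>\<^bsub>M\<^esub> (p x \<otimes>\<^bsub>M\<^esub> y) \<otimes>\<^bsub>M\<^esub> inv\<^bsub>M\<^esub> y" by simp
        then show ?thesis using y x by (simp add: M.m_assoc)
      qed
      then show ?thesis using y by (simp add: Cn_def)
    qed
    have ab: "?a f \<otimes>\<^bsub>M\<^esub> W = W \<otimes>\<^bsub>M\<^esub> (?a f \<otimes>\<^bsub>M\<^esub> \<eta> f)" if "f \<in> carrier F" for f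
      using a.hom_closed[OF that] W by (simp add: \<eta>_def M.m_assoc)
    have \<eta>S: "\<eta> s = q (\<delta> s)" if "s \<in> S" for s
    proof -
      have s: "s \<in> carrier F" "\<delta> s \<in> U" using that S(2) by (auto simp: U_def)
      have "?a s \<otimes>\<^bsub>M\<^esub> W = W \<otimes>\<^bsub>M\<^esub> (?a s \<otimes>\<^bsub>M\<^esub> q (\<delta> s))"
        using sm'[of "?i s"] that s \<chi>(2) by simp
      then have "W \<otimes>\<^bsub>M\<^esub> (?a s \<otimes>\<^bsub>M\<^esub> \<eta> s) = W \<otimes>\<^bsub>M\<^esub> (?a s \<otimes>\<^bsub>M\<^esub> q (\<delta> s))" using ab[OF s(1)] by simp
      then show ?thesis using W a.hom_closed[OF s(1)] \<eta>c[OF s(1)] q[OF s(2)] by simp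
    qed
    have \<eta>CS: "\<eta> s \<in> Cn" if "s \<in> S" for s
      unfolding Cn_def using \<eta>S[OF that] pq q that by (simp add: U_def)
    have \<eta>m: "\<eta> (f \<otimes>\<^bsub>F\<^esub> g) = \<eta> f \<otimes>\<^bsub>M\<^esub> \<eta> g" if f: "f \<in> carrier F" "\<eta> f \<in> Cn" and g: "g \<in> carrier F" for f g
    proof -
      note cl = a.hom_closed[OF f(1)] a.hom_closed[OF g] b.hom_closed[OF f(1)] b.hom_closed[OF g] \<eta>c[OF f(1)]
      have "\<eta> (f \<otimes>\<^bsub>F\<^esub> g) = inv\<^bsub>M\<^esub> (?a g) \<otimes>\<^bsub>M\<^esub> \<eta> f \<otimes>\<^bsub>M\<^esub> b g"
        using cl unfolding \<eta>b a.hom_mult[OF f(1) g] b.hom_mult[OF f(1) g] by (simp add: M.inv_mult_group M.m_assoc)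
      moreover have "p (inv\<^bsub>?P\<^esub> (?i g)) \<otimes>\<^bsub>M\<^esub> \<eta> f = \<eta> f \<otimes>\<^bsub>M\<^esub> p (inv\<^bsub>?P\<^esub> (?i g))"
        using f(2) Y.K.inv_closed[OF iP[OF g]] unfolding Cn_def by blast
      then have "inv\<^bsub>M\<^esub> (?a g) \<otimes>\<^bsub>M\<^esub> \<eta> f = \<eta> f \<otimes>\<^bsub>M\<^esub> inv\<^bsub>M\<^esub> (?a g)" using p.hom_inv[OF iP[OF g]] by simp
      ultimately have "\<eta> (f \<otimes>\<^bsub>F\<^esub> g) = \<eta> f \<otimes>\<^bsub>M\<^esub> inv\<^bsub>M\<^esub> (?a g) \<otimes>\<^bsub>M\<^esub> b g" by simp
      then show ?thesis unfolding \<eta>b[of g] using cl by (simp add: M.m_assoc)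
    qed
    have \<eta>inv: "\<eta> (inv\<^bsub>F\<^esub> s) = inv\<^bsub>M\<^esub> (\<eta> s)" if s: "s \<in> carrier F" "\<eta> s \<in> Cn" for s
    proof -
      have "\<eta> \<one>\<^bsub>F\<^esub> = \<one>\<^bsub>M\<^esub>" unfolding \<eta>b a.hom_one b.hom_one by simp
      then have "\<eta> s \<otimes>\<^bsub>M\<^esub> \<eta> (inv\<^bsub>F\<^esub> s) = \<one>\<^bsub>M\<^esub>" using \<eta>m[OF s, of "inv\<^bsub>F\<^esub> s"] s by simp
      then have "inv\<^bsub>M\<^esub> (\<eta> (inv\<^bsub>F\<^esub> s)) = \<eta> s"
        by (rule M.inv_equality) (simp_all add: \<eta>c s(1))
      then have "inv\<^bsub>M\<^esub> (inv\<^bsub>M\<^esub> (\<eta> (inv\<^bsub>F\<^esub> s))) = inv\<^bsub>M\<^esub> (\<eta> s)" by simp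
      then show ?thesis using \<eta>c s(1) by simp
    qed
    have \<eta>Cn: "\<eta> f \<in> Cn" if "f \<in> carrier F" for f
    proof (rule \<delta>.G.generate_right_induct[OF S(2), of f])
      show "f \<in> generate F S" using that S(3) by simp
      show "\<eta> \<one>\<^bsub>F\<^esub> \<in> Cn" by (rule \<eta>CS[OF S(4)])
      fix g s assume g: "g \<in> generate F S" "\<eta> g \<in> Cn" and s: "s \<in> S"
      have gs: "g \<in> carrier F" "s \<in> carrier F" using g S s by auto
      show "\<eta> (g \<otimes>\<^bsub>F\<^esub> s) \<in> Cn \<and> \<eta> (g \<otimes>\<^bsub>F\<^esub> inv\<^bsub>F\<^esub> s) \<in> Cn"
        using \<eta>m[OF gs(1) g(2)] gs(2) Cn_mult[OF g(2)] \<eta>CS[OF s] \<eta>inv[OF gs(2) \<eta>CS[OF s]] Cn_inv by simp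
    qed
    have \<eta>h: "\<eta> \<in> hom F M" by (rule homI) (use \<eta>c \<eta>m \<eta>Cn in auto)
    have cW: "p (?c f) \<otimes>\<^bsub>M\<^esub> W = W \<otimes>\<^bsub>M\<^esub> p (?c f)" if "f \<in> carrier F" for f
    proof (rule comm_generate[OF M(1) W gF _ S(2)])
      show "(\<lambda>f. p (?c f)) \<in> hom F M" using Group.hom_compose[OF c p(1)] by (simp add: comp_def)
      show "f \<in> generate F S" using that S(3) by simp
      fix s assume s: "s \<in> S"
      have "q \<one>\<^bsub>D\<^esub> = \<one>\<^bsub>M\<^esub>" using p(2)[OF C(2)] by (simp add: q_def)
      then show "p (?c s) \<otimes>\<^bsub>M\<^esub> W = W \<otimes>\<^bsub>M\<^esub> p (?c s)"
        using sm'[of "?c s"] s S(2) \<chi>(3)[of s] U(3) cP[of s] by auto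
    qed
    have \<eta>1: "\<eta> f = \<one>\<^bsub>M\<^esub>" if "f \<in> carrier F" "\<delta> f = \<one>\<^bsub>D\<^esub>" for f
    proof -
      \<comment> \<open>On the kernel the two copies of \<open>F\<close> coincide, and the image of
        the second one commutes with \<open>W\<close>.\<close>
      have "?c f = ?i f" by (rule Y.cj_A) (use kerL[OF that(1)] that in simp_all)
      then have "?a f \<otimes>\<^bsub>M\<^esub> W = W \<otimes>\<^bsub>M\<^esub> ?a f" using cW[OF that(1)] by simp
      then show ?thesis using W a.hom_closed[OF that(1)] by (simp add: \<eta>_def M.m_assoc)
    qed
    from factor_hom[OF gF D M(1) \<delta> \<eta>h \<eta>1] obtain k where k: "k \<in> hom D M" "\<And>f. f \<in> carrier F \<Longrightarrow> k (\<delta> f) = \<eta> f" by blast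
    have kU: "k d = q d" if "d \<in> U" for d using that k(2) \<eta>S S(2) by (auto simp: U_def)
    let ?h = "\<lambda>v. p (fst v) \<otimes>\<^bsub>M\<^esub> k (snd v)"
    have h: "?h \<in> hom ?E M"
      by (rule hom_prod_glue[OF Y.K.is_group D M(1) p(1) k(1) Cc(2) U(2) Cc(3) U(4)]) (use pq kU Cc(2) in auto)
    have k1: "k \<one>\<^bsub>D\<^esub> = \<one>\<^bsub>M\<^esub>" by (rule hom_one[OF k(1) D M(1)])
    have "?h v \<otimes>\<^bsub>M\<^esub> W = W \<otimes>\<^bsub>M\<^esub> ?h (?\<phi> v)" if "v \<in> ?A" for v
    proof -
      have v: "fst v \<in> T" "snd v = \<one>\<^bsub>D\<^esub>" using that by auto
      have kh: "(\<lambda>x. ?h (x, \<chi> x)) \<in> hom (?P\<lparr>carrier := generate ?P B\<rparr>) M"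
      proof (rule homI)
        fix x y assume "x \<in> carrier (?P\<lparr>carrier := generate ?P B\<rparr>)" "y \<in> carrier (?P\<lparr>carrier := generate ?P B\<rparr>)"
        then have xy: "x \<in> T" "y \<in> T" by (simp_all add: T_def)
        have xyE: "(x, \<chi> x) \<in> carrier ?E" "(y, \<chi> y) \<in> carrier ?E" using xy \<chi>c Tc by auto
        show "?h (x, \<chi> x) \<in> carrier M" by (rule hom_in_carrier[OF h xyE(1)])
        show "?h (x \<otimes>\<^bsub>?P\<lparr>carrier := generate ?P B\<rparr>\<^esub> y, \<chi> (x \<otimes>\<^bsub>?P\<lparr>carrier := generate ?P B\<rparr>\<^esub> y)) = ?h (x, \<chi> x) \<otimes>\<^bsub>M\<^esub> ?h (y, \<chi> y)"
          using hom_mult[OF h xyE] \<chi>m[OF xy] by simp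
      qed
      have "p (fst v) \<otimes>\<^bsub>M\<^esub> W = W \<otimes>\<^bsub>M\<^esub> ?h (fst v, \<chi> (fst v))"
      proof (rule slide_generate[OF M(1) Y.K.is_group p(1) W B _ kh])
        show "subgroup (generate ?P B) ?P" using T by (simp add: T_def)
        show "fst v \<in> generate ?P B" using v by (simp add: T_def)
        fix x assume "x \<in> B"
        then consider f where "f \<in> carrier F" "x = ?i f" | f where "f \<in> carrier F" "x = ?c f" unfolding B_def by blast
        then show "p x \<otimes>\<^bsub>M\<^esub> W = W \<otimes>\<^bsub>M\<^esub> ?h (x, \<chi> x)"
        proof cases
          case 1 then show ?thesis using ab[of f] \<chi>(2)[of f] k(2)[of f] by simp
        next
          case 2
          have "p x \<in> carrier M" using cP[OF 2(1)] 2(2) by simp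
          then show ?thesis using cW[OF 2(1)] \<chi>(3)[OF 2(1)] k1 unfolding 2(2) by simp
        qed
      qed
      then show ?thesis using v k1 Tc by auto
    qed
    from Z.universal[OF M(1) h W, OF this] obtain g where
      gh: "g \<in> hom ?K M" "(\<forall>v\<in>carrier ?E. g ([], v) = ?h v) \<and> g ?w = W" by (rule bexE)
    have g: "g \<in> hom ?K M" "\<And>v. v \<in> carrier ?E \<Longrightarrow> g ([], v) = ?h v" "g ?w = W"
      using gh(1) bspec[OF conjunct1[OF gh(2)]] conjunct2[OF gh(2)] by blast+
    have gC: "g ([], (x, d)) = m ([], (x, d))" if "x \<in> C" "d \<in> U" for x d
    proof -
      have "(x, d) \<in> carrier ?E" using subsetD[OF CU SigmaI[OF that]] .
      then show ?thesis using g(2) md(1)[OF that] kU[OF that(2)] by simp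
    qed
    have "g y = m y" if "y \<in> C'" for y
    proof -
      from that consider x d where "x \<in> C" "d \<in> U" "y = ([], (x, d))" | "y = ?w" | x where "x \<in> ?B" "y = ([], (x, \<one>\<^bsub>D\<^esub>)) \<otimes>\<^bsub>?K\<^esub> ?w"
        unfolding C'_def by blast
      then show ?thesis
      proof cases
        case 3
        have xc: "x \<in> C" "x \<in> carrier ?P" using 3(1) C(1) BB B by blast+
        then have "g y = g ([], (x, \<one>\<^bsub>D\<^esub>)) \<otimes>\<^bsub>M\<^esub> g ?w" unfolding 3(2) by (intro hom_mult[OF g(1)] e w) simp
        then show ?thesis using gC[OF xc(1) U(3)] p(2)[OF xc(1)] sm[OF 3(1)] g(3) unfolding 3(2) by simp
      qed (use gC g(3) in \<open>simp_all add: W_def\<close>)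
    qed
    then show ?thesis using g(1) by blast
  qed
  have "finite C'" using Cc(1) U(1) S(1) by (simp add: C'_def)
  then have fp: "fp_on ?K C'" using sub gen ext unfolding fp_on_def by blast
  from fp_on_presentation[OF Z.group_K fp] obtain X R cc g where X0: "fin_presentation X R \<and> cc ` X = C' \<and> g \<in> iso ?K (pres_group X R) \<and>
     (\<forall>x\<in>X. g (cc x) = pres_class X R [(x, False)]) \<and>
     (\<forall>r\<in>R. \<exists>i j k. r = [(i, False), (j, False), (k, True)] \<and> cc i \<otimes>\<^bsub>?K\<^esub> cc j = cc k)" by (elim exE)
  have XR: "fin_presentation X R" "g \<in> iso ?K (pres_group X R)" using X0 by (simp_all only:)
  have XR3: "\<forall>r\<in>R. \<exists>i j k. r = [(i, False), (j, False), (k, True)]"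
  proof
    fix r assume "r \<in> R"
    with X0 have "\<exists>i j k. r = [(i, False), (j, False), (k, True)] \<and> cc i \<otimes>\<^bsub>?K\<^esub> cc j = cc k" by (elim conjE) (rule bspec)
    then show "\<exists>i j k. r = [(i, False), (j, False), (k, True)]" by (elim exE conjE) (intro exI)
  qed
  interpret pr: presentation X R using XR(1) by unfold_locales (simp add: fin_presentation_def)
  have g: "g \<in> hom ?K (pres_group X R)" "inj_on g (carrier ?K)" "inv_into (carrier ?K) g \<in> iso (pres_group X R) ?K"
    using XR(2) Z.K.iso_set_sym[OF XR(2)] by (simp_all add: iso_def bij_betw_def)
  have j: "(\<lambda>d. ([], (\<one>\<^bsub>?P\<^esub>, d))) \<in> hom D ?K"
    using Group.hom_compose[OF pair_hom(2)[OF Y.K.is_group D] Z.incl_hom] by (simp add: comp_def)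
  have "(\<lambda>d. g ([], (\<one>\<^bsub>?P\<^esub>, d))) \<in> hom D (pres_group X R)" using Group.hom_compose[OF j g(1)] by (simp add: comp_def)
  moreover have "inj_on (\<lambda>d. g ([], (\<one>\<^bsub>?P\<^esub>, d))) (carrier D)"
  proof (rule inj_onI)
    fix a b assume ab: "a \<in> carrier D" "b \<in> carrier D" "g ([], (\<one>\<^bsub>?P\<^esub>, a)) = g ([], (\<one>\<^bsub>?P\<^esub>, b))"
    then have m: "(\<one>\<^bsub>?P\<^esub>, a) \<in> carrier ?E" "(\<one>\<^bsub>?P\<^esub>, b) \<in> carrier ?E" by simp_all
    from inj_onD[OF g(2) ab(3) e[OF m(1)] e[OF m(2)]] show "a = b" by simp
  qed
  moreover have "torfree n (pres_group X R)" if "n > 0" "torfree n D" for n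
  proof -
    have "torfree n ?P" using fP that(1) by (simp add: fpt_def)
    from Z.torfree_K[OF torfree_prod[OF this that(2)] that(1)] have "torfree n ?K" .
    then show ?thesis by (rule torfree_inj[of _ _ "inv_into (carrier ?K) g"]) (use g(3) in \<open>simp_all add: iso_def bij_betw_def pr.group_P Z.group_K\<close>)
  qed
  ultimately show ?thesis using XR(1) XR3
    by (intro exI[of _ X] exI[of _ R] exI[of _ "\<lambda>d. g ([], (\<one>\<^bsub>?P\<^esub>, d))"] conjI allI impI)
qed

section \<open>Embedding into finitely presented groups\<close>

type_synonym 'a hnn_elem = "('a \<times> bool) list \<times> 'a"

lemma torfree_fz: assumes "group G" "torfree n G" "n > 0" shows "torfree n (fz G)"
proof -
  interpret group G by fact
  interpret hnn G "{\<one>\<^bsub>G\<^esub>}" "\<lambda>x. x" by (rule hnn_id[OF is_group triv_subgroup])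
  show ?thesis unfolding fz_def by (rule torfree_K[OF assms(2,3)])
qed

text \<open>In the free group on \<open>x, t, s\<close> let \<open>t\<^sub>i\<close> be the conjugate of \<open>t\<close> by \<open>x\<^sup>i\<close>.  The elements
  \<open>s\<inverse> t\<^sub>i s t\<^sub>i\<inverse>\<close> become the given generators of \<open>G\<close> in the HNN extension of
  \<open>G * \<langle>x, t\<rangle>\<close> by \<open>t\<^sub>i \<mapsto> g\<^sub>i t\<^sub>i\<close>, which is therefore generated by three elements.\<close>

definition theta :: "int \<Rightarrow> int hnn_elem hnn_elem" where
  "theta i = inv\<^bsub>fz (fz Zg)\<^esub> (hnn_t (fz Zg) True) \<otimes>\<^bsub>fz (fz Zg)\<^esub> ([], tc Zg i) \<otimes>\<^bsub>fz (fz Zg)\<^esub> hnn_t (fz Zg) True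
      \<otimes>\<^bsub>fz (fz Zg)\<^esub> inv\<^bsub>fz (fz Zg)\<^esub> ([], tc Zg i)"

text \<open>The last clause expresses that \<open>D\<close> has no relations besides those of
  \<open>G\<close> written in the words \<open>theta i\<close>, which determines the kernel of
  \<open>\<delta>\<close>. Its groups \<open>P\<close> have the type of quotients of
  \<open>fz (fz Zg)\<close>, because it is applied to such a quotient.\<close>

lemma three_generators:
  fixes G :: "('a, 'c) monoid_scheme"
  assumes G: "group G" and gY: "g \<in> Y \<rightarrow> carrier G" and gen: "generate G (g ` Y) = carrier G"
  shows "\<exists>(D :: 'a hnn_elem hnn_elem hnn_elem monoid) \<delta> e. group D \<and> \<delta> \<in> hom (fz (fz Zg)) D \<and>
     \<delta> ` carrier (fz (fz Zg)) = carrier D \<and> e \<in> hom G D \<and> inj_on e (carrier G) \<and> (\<forall>i\<in>Y. \<delta> (theta i) = e (g i)) \<and>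
     (\<forall>n>0. torfree n G \<longrightarrow> torfree n D) \<and>
     (\<forall>(P :: int hnn_elem hnn_elem set monoid) j q. group P \<longrightarrow> j \<in> hom G P \<longrightarrow> q \<in> hom (fz (fz Zg)) P \<longrightarrow>
        (\<forall>i\<in>Y. q (theta i) = j (g i)) \<longrightarrow> (\<exists>\<zeta>\<in>hom D P. \<forall>f\<in>carrier (fz (fz Zg)). \<zeta> (\<delta> f) = q f))"
proof -
  have g: "g i \<in> carrier G" if "i \<in> Y" for i using gY that by blast
  interpret I: fzgroup Zg by (rule fzgroupI[OF group_integer_group])
  let ?Q = "fz Zg" and ?H = "fz G"
  interpret Q: fzgroup ?Q by (rule fzgroupI[OF I.group_fz])
  let ?F = "fz ?Q"
  interpret G: fzgroup G by (rule fzgroupI[OF G])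
  interpret H: fzgroup ?H by (rule fzgroupI[OF G.group_fz])
  let ?E = "fz ?H"
  have gQ: "group ?Q" and gF: "group ?F" and gH: "group ?H" and gE: "group ?E"
    by (rule I.group_fz Q.group_fz G.group_fz H.group_fz)+
  define x where "x = hnn_t G True"
  have x: "x \<in> carrier ?H" by (simp add: x_def)
  define xp where "xp i = x [^]\<^bsub>?H\<^esub> (i :: int)" for i
  have xp: "xp i \<in> carrier ?H" for i using group.int_pow_closed[OF gH x] by (simp add: xp_def)
  have xph: "xp \<in> hom Zg ?H" using xp group.int_pow_mult[OF gH x] by (simp add: hom_def xp_def)
  have x1: "xp 1 = x" using group.int_pow_1[OF gH x] by (simp add: xp_def)
  have hxp: "h (xp i) = h x [^]\<^bsub>M\<^esub> i" if "group M" "h \<in> hom ?H M" for M :: "('m, 'n) monoid_scheme" and h i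
    using hom_int_pow[OF that(2) x gH that(1)] by (simp add: xp_def)
  define tt where "tt i = tc ?H (xp i)" for i
  have tt: "tt i \<in> carrier ?E" for i using xp by (simp add: tt_def)
  let ?gg = "\<lambda>y. ([], ([], y))"
  have gg: "?gg \<in> hom G ?E" using Group.hom_compose[OF G.incl_hom_fz H.incl_hom_fz] by (simp add: comp_def)
  note ggc = hom_in_carrier[OF gg]
  define A where "A = generate ?E (tt ` Y)"
  have ttY: "tt ` Y \<subseteq> carrier ?E" using tt by blast
  have A: "subgroup A ?E" unfolding A_def by (rule H.Z.generate_is_subgroup[OF ttY])
  have Afall: "A \<subseteq> fall ?H"
  proof -
    have "tt ` Y = tc ?H ` (xp ` Y)" by (simp add: tt_def image_image)
    moreover have "xp ` Y \<subseteq> carrier ?H" using xp by blast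
    ultimately show ?thesis unfolding A_def using H.fall_mono by simp
  qed
  \<comment> \<open>The homomorphism \<open>\<kappa>\<close> recovers the exponent \<open>i\<close>
    from \<open>xp i\<close>, so that images of the basis elements \<open>tt i\<close> can be
    prescribed by their index.\<close>
  have "\<exists>\<kappa>\<in>hom ?H Zg. \<kappa> x = (1 :: int)"
  proof -
    have "(\<lambda>_. 0 :: int) \<in> hom G Zg" by (simp add: hom_def)
    from G.fz_universal[OF group_integer_group this, of 1] show ?thesis by (auto simp: x_def)
  qed
  then obtain \<kappa> where \<kappa>: "\<kappa> \<in> hom ?H Zg" "\<kappa> x = (1 :: int)" by (rule bexE)
  have \<kappa>xp: "\<kappa> (xp i) = i" for i using hxp[OF group_integer_group \<kappa>(1), of i] \<kappa>(2) by simp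
  \<comment> \<open>Basis elements whose exponent is outside \<open>Y\<close> receive the identity
    as a default value; the HNN extension uses the restriction to the span of the
    \<open>tt i\<close> with \<open>i\<close> in \<open>Y\<close>.\<close>
  let ?A = "\<lambda>u. if \<kappa> u \<in> Y then ?gg (g (\<kappa> u)) \<otimes>\<^bsub>?E\<^esub> tt (\<kappa> u) else \<one>\<^bsub>?E\<^esub>"
  have Ac: "?A u \<in> carrier ?E" for u using g tt ggc by simp
  from H.fz_basis[where A = ?A, OF gE Ac] obtain \<alpha> where
    a0: "\<alpha> \<in> hom (?E\<lparr>carrier := fall ?H\<rparr>) ?E" "\<forall>u\<in>carrier ?H. \<alpha> (tc ?H u) = ?A u" by (rule bexE)
  have \<alpha>tt: "\<alpha> (tt i) = ?gg (g i) \<otimes>\<^bsub>?E\<^esub> tt i" if "i \<in> Y" for i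
    using a0(2) xp[of i] that by (simp add: \<kappa>xp tt_def)
  have \<alpha>: "\<alpha> \<in> hom (?E\<lparr>carrier := A\<rparr>) ?E" using a0(1) Afall by (auto simp: hom_def)
  \<comment> \<open>The endomorphism \<open>\<rho>\<close> built on \<open>\<rho>0\<close> kills
    \<open>G\<close> and fixes \<open>x\<close> and the stable letter of \<open>?E\<close>. It
    undoes \<open>\<alpha>\<close> on \<open>A\<close>, which makes \<open>\<alpha>\<close>
    injective.\<close>
  have "\<exists>\<rho>0\<in>hom ?H ?E. (\<forall>y\<in>carrier G. \<rho>0 ([], y) = \<one>\<^bsub>?E\<^esub>) \<and> \<rho>0 x = ([], x)"
  proof -
    have "(\<lambda>_. \<one>\<^bsub>?E\<^esub>) \<in> hom G ?E" by (simp add: hom_def)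
    from G.fz_universal[OF gE this H.incl_fz[OF x]] show ?thesis by (auto simp: x_def)
  qed
  then obtain \<rho>0 where \<rho>0: "\<rho>0 \<in> hom ?H ?E" "(\<forall>y\<in>carrier G. \<rho>0 ([], y) = \<one>\<^bsub>?E\<^esub>) \<and> \<rho>0 x = ([], x)" by (rule bexE)
  have \<rho>xp: "\<rho>0 (xp i) = ([], xp i)" for i
    using hxp[OF gE \<rho>0(1), of i] hxp[OF gE H.incl_hom_fz, of i] \<rho>0(2) by simp
  from H.fz_universal[OF gE \<rho>0(1) H.t_fz[of True]] obtain \<rho> where \<rho>: "\<rho> \<in> hom ?E ?E"
    "(\<forall>u\<in>carrier ?H. \<rho> ([], u) = \<rho>0 u) \<and> \<rho> (hnn_t ?H True) = hnn_t ?H True \<and>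
     (\<forall>u\<in>carrier ?H. \<rho> (tc ?H u) = inv\<^bsub>?E\<^esub> (\<rho>0 u) \<otimes>\<^bsub>?E\<^esub> hnn_t ?H True \<otimes>\<^bsub>?E\<^esub> \<rho>0 u)" by (rule bexE)
  have tt_eq: "tt i = inv\<^bsub>?E\<^esub> ([], xp i) \<otimes>\<^bsub>?E\<^esub> hnn_t ?H True \<otimes>\<^bsub>?E\<^esub> ([], xp i)" for i
    using xp[of i] by (simp add: tt_def tc_def H.incl_inv_fz)
  have \<rho>tt: "\<rho> (tt i) = tt i" for i
  proof -
    have "\<rho> (tc ?H (xp i)) = inv\<^bsub>?E\<^esub> (\<rho>0 (xp i)) \<otimes>\<^bsub>?E\<^esub> hnn_t ?H True \<otimes>\<^bsub>?E\<^esub> \<rho>0 (xp i)" using \<rho>(2) xp[of i] by simp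
    then show ?thesis unfolding \<rho>xp tt_eq[symmetric] tt_def .
  qed
  have \<rho>\<alpha>: "\<rho> (\<alpha> a) = a" if "a \<in> A" for a
  proof -
    have gA: "group (?E\<lparr>carrier := A\<rparr>)" by (rule H.Z.subgroup_imp_group[OF A])
    have t: "tt ` Y \<subseteq> carrier (?E\<lparr>carrier := A\<rparr>)" by (auto simp: A_def generate.incl)
    show ?thesis
    proof (rule hom_eq_generate[OF gA gE _ _ t, of "\<lambda>a. \<rho> (\<alpha> a)" "\<lambda>a. a"])
      show "(\<lambda>a. \<rho> (\<alpha> a)) \<in> hom (?E\<lparr>carrier := A\<rparr>) ?E" using Group.hom_compose[OF \<alpha> \<rho>(1)] by (simp add: comp_def)
      show "(\<lambda>a. a) \<in> hom (?E\<lparr>carrier := A\<rparr>) ?E" using subgroup.subset[OF A] by (auto simp: hom_def)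
      show "a \<in> generate (?E\<lparr>carrier := A\<rparr>) (tt ` Y)"
        using H.Z.generate_consistent[OF _ A, of "tt ` Y"] t that by (simp add: A_def)
      fix a assume "a \<in> tt ` Y"
      then obtain i where i: "i \<in> Y" "a = tt i" by blast
      have "\<rho> (?gg (g i)) = \<one>\<^bsub>?E\<^esub>" using \<rho>(2) \<rho>0(2) g[OF i(1)] by simp
      then show "\<rho> (\<alpha> a) = a" using hom_mult[OF \<rho>(1) ggc[OF g[OF i(1)]] tt[of i]] tt[of i] by (simp add: i \<alpha>tt \<rho>tt)
    qed
  qed
  interpret Z: hnn ?E A \<alpha>
  proof (rule hnn.intro[OF gE hnn_axioms.intro])
    show "subgroup A ?E" by (rule A)
    show "\<alpha> a \<in> carrier ?E" if "a \<in> A" for a using hom_in_carrier[OF \<alpha>] that by simp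
    show "\<alpha> (a \<otimes>\<^bsub>?E\<^esub> b) = \<alpha> a \<otimes>\<^bsub>?E\<^esub> \<alpha> b" if "a \<in> A" "b \<in> A" for a b using hom_mult[OF \<alpha>] that by simp
    show "inj_on \<alpha> A" by (rule inj_onI) (metis \<rho>\<alpha>)
  qed
  let ?D = "HNN ?E A \<alpha>" and ?z = "Z.t True" and ?s = "hnn_t ?Q True"
  have gD: "group ?D" by (rule Z.group_K)
  have z: "?z \<in> carrier ?D" using Z.t_Omega by (simp add: Z.carrier_K)
  have inc: "([], p) \<in> carrier ?D" if "p \<in> carrier ?E" for p using that by (simp add: Z.carrier_K)
  have ttA: "tt i \<in> A" if "i \<in> Y" for i using that by (auto simp: A_def intro: generate.incl)
  have sl: "([], tt i) \<otimes>\<^bsub>?D\<^esub> ?z = ?z \<otimes>\<^bsub>?D\<^esub> ([], ?gg (g i) \<otimes>\<^bsub>?E\<^esub> tt i)" if "i \<in> Y" for i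
    using Z.t_slide[of "tt i" True] ttA[OF that] \<alpha>tt[OF that] by (simp add: hnn_dom_def hnn_map_def)
  let ?d0 = "\<lambda>i. ([], ([], xp i))"
  have d0: "?d0 \<in> hom Zg ?D"
    using Group.hom_compose[OF Group.hom_compose[OF xph H.incl_hom_fz] Z.incl_hom] by (simp add: comp_def)
  from I.fz_universal[OF gD d0 inc[OF H.t_fz[of True]]] obtain d1 where d1: "d1 \<in> hom ?Q ?D"
    "(\<forall>i\<in>carrier Zg. d1 ([], i) = ?d0 i) \<and> d1 (hnn_t Zg True) = ([], hnn_t ?H True) \<and>
     (\<forall>i\<in>carrier Zg. d1 (tc Zg i) = inv\<^bsub>?D\<^esub> (?d0 i) \<otimes>\<^bsub>?D\<^esub> ([], hnn_t ?H True) \<otimes>\<^bsub>?D\<^esub> ?d0 i)" by (rule bexE)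
  have d1tc: "d1 (tc Zg i) = ([], tt i)" for i
    using d1(2) xp[of i] by (simp add: Z.incl_inv Z.incl_mult tt_eq)
  from Q.fz_universal[OF gD d1(1) z] obtain \<delta> where \<delta>: "\<delta> \<in> hom ?F ?D"
    "(\<forall>u\<in>carrier ?Q. \<delta> ([], u) = d1 u) \<and> \<delta> ?s = ?z \<and>
     (\<forall>u\<in>carrier ?Q. \<delta> (tc ?Q u) = inv\<^bsub>?D\<^esub> (d1 u) \<otimes>\<^bsub>?D\<^esub> ?z \<otimes>\<^bsub>?D\<^esub> d1 u)" by (rule bexE)
  interpret \<delta>: group_hom ?F ?D \<delta> by (rule group_homI[OF gF gD \<delta>(1)])
  have \<delta>tc: "\<delta> ([], tc Zg i) = ([], tt i)" for i using \<delta>(2) d1tc by simp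
  have tcF: "([], tc Zg i) \<in> carrier ?F" for i by simp
  have thF: "theta i \<in> carrier ?F" for i using tcF[of i] by (simp add: theta_def)
  \<comment> \<open>In this form \<open>theta i\<close> satisfies the equation that
    \<open>sl\<close> gives for \<open>g i\<close>, so cancellation identifies the image of the
    former with the latter.\<close>
  have th_mult: "?s \<otimes>\<^bsub>?F\<^esub> (theta i \<otimes>\<^bsub>?F\<^esub> ([], tc Zg i)) = ([], tc Zg i) \<otimes>\<^bsub>?F\<^esub> ?s" for i
    using tcF[of i] by (simp add: theta_def Q.Z.m_assoc)
  let ?e = "\<lambda>y. ([], ?gg y)"
  have e: "?e \<in> hom G ?D" using Group.hom_compose[OF gg Z.incl_hom] by (simp add: comp_def)
  have \<delta>th: "\<delta> (theta i) = ?e (g i)" if i: "i \<in> Y" for i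
  proof -
    note c = inc[OF tt[of i]] inc[OF ggc[OF g[OF i]]] \<delta>.hom_closed[OF thF[of i]]
    have "\<delta> (?s \<otimes>\<^bsub>?F\<^esub> (theta i \<otimes>\<^bsub>?F\<^esub> ([], tc Zg i))) = \<delta> (([], tc Zg i) \<otimes>\<^bsub>?F\<^esub> ?s)" by (simp only: th_mult)
    then have "?z \<otimes>\<^bsub>?D\<^esub> (\<delta> (theta i) \<otimes>\<^bsub>?D\<^esub> ([], tt i)) = ([], tt i) \<otimes>\<^bsub>?D\<^esub> ?z"
      using thF[of i] tcF[of i] \<delta>(2) \<delta>tc by simp
    also have "\<dots> = ?z \<otimes>\<^bsub>?D\<^esub> (?e (g i) \<otimes>\<^bsub>?D\<^esub> ([], tt i))" by (simp add: sl[OF i] Z.incl_mult)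
    finally show ?thesis using c z by simp
  qed
  \<comment> \<open>The generators of \<open>G\<close> are reached as images of the
    \<open>theta i\<close>, so the three generators of \<open>?F\<close> cover
    \<open>?D\<close>.\<close>
  have surj: "\<delta> ` carrier ?F = carrier ?D"
  proof
    show "\<delta> ` carrier ?F \<subseteq> carrier ?D" using \<delta>.hom_closed by blast
    have sI: "subgroup (\<delta> ` carrier ?F) ?D" by (rule \<delta>.img_is_subgroup)
    let ?S1 = "hnn_incl ` g ` Y \<union> {x}"
    let ?S2 = "hnn_incl ` ?S1 \<union> {hnn_t ?H True}"
    have gY: "g ` Y \<subseteq> carrier G" using g by blast
    have S1: "generate ?H ?S1 = carrier ?H" using G.fz_generated[OF gen gY] by (simp add: x_def)
    have S1c: "?S1 \<subseteq> carrier ?H" using gY x G.incl_fz by blast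
    have S2: "generate ?E ?S2 = carrier ?E" by (rule H.fz_generated[OF S1 S1c])
    have S2c: "?S2 \<subseteq> carrier ?E" using S1c H.incl_fz H.t_fz by blast
    have "hnn_incl ` ?S2 \<union> {?z} \<subseteq> \<delta> ` carrier ?F"
    proof -
      have 1: "?e (g i) \<in> \<delta> ` carrier ?F" if "i \<in> Y" for i using \<delta>th[OF that] thF[of i] by (metis imageI)
      have 2: "([], ([], x)) \<in> \<delta> ` carrier ?F"
      proof -
        have "\<delta> ([], ([], 1)) = ([], ([], x))" using \<delta>(2) d1(2) x1 by simp
        then show ?thesis by (metis I.incl_fz Q.incl_fz UNIV_I carrier_integer_group imageI)
      qed
      have 3: "([], hnn_t ?H True) \<in> \<delta> ` carrier ?F"
      proof -
        have "\<delta> ([], hnn_t Zg True) = ([], hnn_t ?H True)" using \<delta>(2) d1(2) by simp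
        then show ?thesis by (metis I.t_fz Q.incl_fz imageI)
      qed
      have 4: "?z \<in> \<delta> ` carrier ?F" using \<delta>(2) by (metis Q.t_fz imageI)
      show ?thesis using 1 2 3 4 by (simp add: image_Un image_image image_subset_iff)
    qed
    from Z.K.generate_subgroup_incl[OF this sI] show "carrier ?D \<subseteq> \<delta> ` carrier ?F"
      using Z.K_generated_by[OF S2 S2c] by simp
  qed
  have univ: "\<exists>\<zeta>\<in>hom ?D P. \<forall>f\<in>carrier ?F. \<zeta> (\<delta> f) = q f"
    if P: "group P" and j: "j \<in> hom G P" and q: "q \<in> hom ?F P" and qj: "\<And>i. i \<in> Y \<Longrightarrow> q (theta i) = j (g i)"
    for P :: "int hnn_elem hnn_elem set monoid" and j q
  proof -
    interpret q: group_hom ?F P q by (rule group_homI[OF gF P q])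
    let ?x = "([], ([], 1 :: int))" and ?t = "([], hnn_t Zg True)"
    have xF: "?x \<in> carrier ?F" and tF: "?t \<in> carrier ?F" by simp_all
    have ih: "(\<lambda>i. ([], ([], i))) \<in> hom Zg ?F" using Group.hom_compose[OF I.incl_hom_fz Q.incl_hom_fz] by (simp add: comp_def)
    have xpw: "([], ([], i)) = ?x [^]\<^bsub>?F\<^esub> i" for i
      using hom_int_pow[OF ih _ group_integer_group gF, of 1 i] by simp
    from G.fz_universal[OF P j q.hom_closed[OF xF]] obtain \<zeta>0 where z0: "\<zeta>0 \<in> hom ?H P"
      "(\<forall>y\<in>carrier G. \<zeta>0 ([], y) = j y) \<and> \<zeta>0 (hnn_t G True) = q ?x \<and>
       (\<forall>y\<in>carrier G. \<zeta>0 (tc G y) = inv\<^bsub>P\<^esub> (j y) \<otimes>\<^bsub>P\<^esub> q ?x \<otimes>\<^bsub>P\<^esub> j y)" by (rule bexE)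
    have z0x: "\<zeta>0 (xp i) = q ([], ([], i))" for i
    proof -
      have "\<zeta>0 (xp i) = q ?x [^]\<^bsub>P\<^esub> i" using hxp[OF P z0(1), of i] z0(2) by (simp add: x_def[symmetric])
      then show ?thesis unfolding xpw[of i] hom_int_pow[OF q xF gF P] .
    qed
    from H.fz_universal[OF P z0(1) q.hom_closed[OF tF]] obtain \<zeta>1 where z1: "\<zeta>1 \<in> hom ?E P"
      "(\<forall>u\<in>carrier ?H. \<zeta>1 ([], u) = \<zeta>0 u) \<and> \<zeta>1 (hnn_t ?H True) = q ?t \<and>
       (\<forall>u\<in>carrier ?H. \<zeta>1 (tc ?H u) = inv\<^bsub>P\<^esub> (\<zeta>0 u) \<otimes>\<^bsub>P\<^esub> q ?t \<otimes>\<^bsub>P\<^esub> \<zeta>0 u)" by (rule bexE)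
    have tcF': "([], tc Zg i) = inv\<^bsub>?F\<^esub> ([], ([], i)) \<otimes>\<^bsub>?F\<^esub> ?t \<otimes>\<^bsub>?F\<^esub> ([], ([], i))" for i
      by (simp add: tc_def Q.incl_mult_fz Q.incl_inv_fz I.incl_inv_fz)
    have iF: "([], ([], i)) \<in> carrier ?F" for i :: int by simp
    have z1t: "\<zeta>1 (tt i) = q ([], tc Zg i)" for i
    proof -
      have "\<zeta>1 (tt i) = inv\<^bsub>P\<^esub> (\<zeta>0 (xp i)) \<otimes>\<^bsub>P\<^esub> q ?t \<otimes>\<^bsub>P\<^esub> \<zeta>0 (xp i)" using z1(2) xp[of i] by (simp add: tt_def)
      then show ?thesis unfolding z0x tcF' using iF[of i] tF by simp
    qed
    have z1a: "(\<lambda>a. \<zeta>1 (\<alpha> a)) \<in> hom (?E\<lparr>carrier := generate ?E (tt ` Y)\<rparr>) P"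
      using Group.hom_compose[OF \<alpha> z1(1)] by (simp add: comp_def A_def)
    have qs: "q ?s \<in> carrier P" by simp
    have slide: "\<zeta>1 a \<otimes>\<^bsub>P\<^esub> q ?s = q ?s \<otimes>\<^bsub>P\<^esub> \<zeta>1 (\<alpha> a)" if "a \<in> A" for a
    proof (rule slide_generate[OF P gE z1(1) qs ttY _ z1a])
      show "subgroup (generate ?E (tt ` Y)) ?E" using A by (simp add: A_def)
      show "a \<in> generate ?E (tt ` Y)" using that by (simp add: A_def)
      fix b assume "b \<in> tt ` Y"
      then obtain i where i: "i \<in> Y" "b = tt i" by blast
      have "\<zeta>1 (?gg (g i)) = q (theta i)" using z1(2) z0(2) g[OF i(1)] qj[OF i(1)] by simp
      then have "\<zeta>1 (\<alpha> b) = q (theta i \<otimes>\<^bsub>?F\<^esub> ([], tc Zg i))"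
        using hom_mult[OF z1(1) ggc[OF g[OF i(1)]] tt[of i]] thF[of i] tcF[of i] by (simp add: i \<alpha>tt z1t)
      moreover have "\<zeta>1 b \<otimes>\<^bsub>P\<^esub> q ?s = q (([], tc Zg i) \<otimes>\<^bsub>?F\<^esub> ?s)" using tcF[of i] by (simp add: i z1t)
      ultimately show "\<zeta>1 b \<otimes>\<^bsub>P\<^esub> q ?s = q ?s \<otimes>\<^bsub>P\<^esub> \<zeta>1 (\<alpha> b)"
        using thF[of i] tcF[of i] by (simp add: th_mult[symmetric])
    qed
    from Z.universal[OF P z1(1) qs, OF slide] obtain \<zeta> where \<zeta>: "\<zeta> \<in> hom ?D P"
      "(\<forall>p\<in>carrier ?E. \<zeta> ([], p) = \<zeta>1 p) \<and> \<zeta> ?z = q ?s" by (rule bexE)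
    let ?S1 = "hnn_incl ` carrier Zg \<union> {hnn_t Zg True}"
    let ?S2 = "hnn_incl ` ?S1 \<union> {?s}"
    have S0: "generate Zg (carrier Zg) = carrier Zg" using generate.incl[of _ "carrier Zg" Zg] by auto
    have S1: "generate ?Q ?S1 = carrier ?Q" by (rule I.fz_generated[OF S0]) simp
    have S1c: "?S1 \<subseteq> carrier ?Q" by auto
    have S2: "generate ?F ?S2 = carrier ?F" by (rule Q.fz_generated[OF S1 S1c])
    have S2c: "?S2 \<subseteq> carrier ?F" using S1c Q.incl_fz Q.t_fz by blast
    have "\<zeta> (\<delta> f) = q f" if "f \<in> carrier ?F" for f
    proof (rule hom_eq_generate[OF gF P _ q S2c, of "\<lambda>f. \<zeta> (\<delta> f)"])
      show "(\<lambda>f. \<zeta> (\<delta> f)) \<in> hom ?F P" using Group.hom_compose[OF \<delta>(1) \<zeta>(1)] by (simp add: comp_def)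
      show "f \<in> generate ?F ?S2" using that S2 by simp
      fix f assume "f \<in> ?S2"
      then consider i where "f = ([], ([], i))" | "f = ?t" | "f = ?s" by blast
      then show "\<zeta> (\<delta> f) = q f"
      proof cases
        case 1
        have "\<zeta> (\<delta> f) = \<zeta>1 ([], xp i)" using \<delta>(2) d1(2) \<zeta>(2) xp[of i] by (simp add: 1)
        then show ?thesis using z1(2) xp[of i] z0x by (simp add: 1)
      next
        case 2 then show ?thesis using \<delta>(2) d1(2) \<zeta>(2) z1(2) by simp
      next
        case 3 then show ?thesis using \<delta>(2) \<zeta>(2) by simp
      qed
    qed
    then show ?thesis using \<zeta>(1) by blast
  qed
  have tor: "torfree n ?D" if "n > 0" "torfree n G" for n
    by (rule Z.torfree_K[OF torfree_fz[OF gH torfree_fz[OF G that(2,1)] that(1)] that(1)])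
  have inj: "inj_on ?e (carrier G)" by (simp add: inj_on_def)
  show ?thesis
  proof (rule exI[of _ ?D], rule exI[of _ \<delta>], rule exI[of _ ?e], intro conjI)
    show "\<forall>i\<in>Y. \<delta> (theta i) = ?e (g i)" using \<delta>th by (rule ballI)
    show "\<forall>n>0. torfree n G \<longrightarrow> torfree n ?D" by (intro allI impI tor)
    show "\<forall>(P :: int hnn_elem hnn_elem set monoid) j q. group P \<longrightarrow> j \<in> hom G P \<longrightarrow> q \<in> hom ?F P \<longrightarrow>
        (\<forall>i\<in>Y. q (theta i) = j (g i)) \<longrightarrow> (\<exists>\<zeta>\<in>hom ?D P. \<forall>f\<in>carrier ?F. \<zeta> (\<delta> f) = q f)"
    proof (intro allI impI)
      fix P :: "int hnn_elem hnn_elem set monoid" and j q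
      assume a: "group P" "j \<in> hom G P" "q \<in> hom ?F P" "\<forall>i\<in>Y. q (theta i) = j (g i)"
      show "\<exists>\<zeta>\<in>hom ?D P. \<forall>f\<in>carrier ?F. \<zeta> (\<delta> f) = q f" by (rule univ[OF a(1-3) bspec[OF a(4)]])
    qed
  qed (rule gD \<delta>(1) surj e inj)+
qed

text \<open>The kernel of \<open>\<delta>\<close> is the normal closure of the relators of
  \<open>G\<close> with each basis element of index \<open>i\<close> replaced by
  \<open>theta i\<close>. The replacement is a relation, the subgroup \<open>\<Gamma>\<close>
  generated by a benign set of pairs, so projecting, conjugating and generating keep everything
  benign and the rope trick applies.\<close>

theorem higman_embed:
  fixes G :: "('a, 'c) monoid_scheme"
  defines "U Y \<equiv> generate (fz Zg) (tc Zg ` Y)"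
  assumes G: "group G" and Y: "bs Zg (\<lambda>i. i \<in> Y)" and \<pi>: "\<pi> \<in> hom (fz Zg\<lparr>carrier := U Y\<rparr>) G" "\<pi> ` U Y = carrier G"
    and N: "benign (fz Zg) {u \<in> U Y. \<pi> u = \<one>\<^bsub>G\<^esub>}"
  shows "\<exists>X R h. fin_presentation X R \<and> (\<forall>r\<in>R. \<exists>i j k. r = [(i, False), (j, False), (k, True)]) \<and>
     h \<in> hom G (pres_group X R) \<and> inj_on h (carrier G) \<and> (\<forall>n>0. torfree n G \<longrightarrow> torfree n (pres_group X R))"
proof -
  interpret I: fzgroup Zg by (rule fzgroupI[OF group_integer_group])
  let ?Q = "fz Zg"
  interpret Q: fzgroup ?Q by (rule fzgroupI[OF I.group_fz])
  let ?F = "fz ?Q" and ?QF = "?Q \<times>\<times> fz ?Q"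
  have gQ: "group ?Q" and gF: "group ?F" by (rule I.group_fz Q.group_fz)+
  have fQ: "fpt ?Q" and fF: "fpt ?F" and fQF: "fpt ?QF" by (intro fpt_intros)+
  interpret QF: group ?QF by (rule fpt_group[OF fQF])
  have tcY: "tc Zg ` Y \<subseteq> carrier ?Q" using I.tc_closed by auto
  have U: "subgroup (U Y) ?Q" unfolding U_def by (rule I.Z.generate_is_subgroup[OF tcY])
  let ?U = "?Q\<lparr>carrier := U Y\<rparr>"
  have gU: "group ?U" by (rule I.Z.subgroup_imp_group[OF U])
  interpret \<pi>: group_hom ?U G \<pi> by (rule group_homI[OF gU G \<pi>(1)])
  define g where "g i = \<pi> (tc Zg i)" for i
  have tcU: "tc Zg i \<in> U Y" if "i \<in> Y" for i using that by (auto simp: U_def intro: generate.incl)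
  have g: "g i \<in> carrier G" if "i \<in> Y" for i using \<pi>.hom_closed[of "tc Zg i"] tcU[OF that] by (simp add: g_def)
  have gen: "generate G (g ` Y) = carrier G"
  proof -
    have t: "tc Zg ` Y \<subseteq> carrier ?U" using tcU by auto
    have "generate ?U (tc Zg ` Y) = U Y" using I.Z.generate_consistent[OF _ U, of "tc Zg ` Y"] t by (simp add: U_def)
    then show ?thesis using \<pi>.generate_img[OF t] \<pi>(2) by (simp add: g_def[abs_def] image_image)
  qed
  have gP: "g \<in> Y \<rightarrow> carrier G" using g by blast
  obtain D :: "'a hnn_elem hnn_elem hnn_elem monoid" and \<delta> e where D: "group D" "\<delta> \<in> hom ?F D" "\<delta> ` carrier ?F = carrier D"
    "e \<in> hom G D" "inj_on e (carrier G)" "\<forall>i\<in>Y. \<delta> (theta i) = e (g i)" "\<forall>n>0. torfree n G \<longrightarrow> torfree n D"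
    and univ: "\<forall>(P :: int hnn_elem hnn_elem set monoid) j q. group P \<longrightarrow> j \<in> hom G P \<longrightarrow> q \<in> hom ?F P \<longrightarrow>
        (\<forall>i\<in>Y. q (theta i) = j (g i)) \<longrightarrow> (\<exists>\<zeta>\<in>hom D P. \<forall>f\<in>carrier ?F. \<zeta> (\<delta> f) = q f)"
    using three_generators[OF G gP gen] by (elim exE conjE) (rule that)
  interpret \<delta>: group_hom ?F D \<delta> by (rule group_homI[OF gF D(1,2)])
  interpret e: group_hom G D e by (rule group_homI[OF G D(1,4)])
  have bth: "bf Zg ?F theta" unfolding theta_def
    by (intro bf_mult bf_inv bf_const bf_homc[OF Q.incl_hom_fz] bf_tc bf_id fpt_intros Q.t_fz)
  have thF: "theta i \<in> carrier ?F" for i using bf_closed[OF bth] by simp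
  define S where "S = (\<lambda>i. (tc Zg i, theta i)) ` Y"
  define \<Gamma> where "\<Gamma> = generate ?QF S"
  have S: "S \<subseteq> carrier ?QF" using thF by (auto simp: S_def)
  have G\<Gamma>: "subgroup \<Gamma> ?QF" unfolding \<Gamma>_def by (rule QF.generate_is_subgroup[OF S])
  let ?G = "?QF\<lparr>carrier := \<Gamma>\<rparr>"
  have gG: "group ?G" by (rule QF.subgroup_imp_group[OF G\<Gamma>])
  have S': "S \<subseteq> carrier ?G" by (auto simp: \<Gamma>_def intro: generate.incl)
  have S\<Gamma>: "generate ?G S = \<Gamma>" using QF.generate_consistent[OF _ G\<Gamma>, of S] S' by (simp add: \<Gamma>_def)
  have \<Gamma>c: "\<Gamma> \<subseteq> carrier ?QF" by (rule subgroup.subset[OF G\<Gamma>])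
  have fstU: "fst p \<in> U Y" if "p \<in> \<Gamma>" for p
  proof -
    have "fst ` \<Gamma> = generate ?Q (fst ` S)"
      unfolding \<Gamma>_def by (rule group_hom.generate_img[OF group_homI[OF QF.is_group gQ fst_hom] S, symmetric])
    also have "fst ` S = tc Zg ` Y" by (simp add: S_def image_image)
    finally show ?thesis using that by (auto simp: U_def)
  qed
  have p1: "(\<lambda>p. \<pi> (fst p)) \<in> hom ?G G"
  proof (rule homI)
    fix x y assume "x \<in> carrier ?G" "y \<in> carrier ?G"
    then have xy: "fst x \<in> U Y" "fst y \<in> U Y" using fstU by simp_all
    show "\<pi> (fst x) \<in> carrier G" using \<pi>.hom_closed xy by simp
    show "\<pi> (fst (x \<otimes>\<^bsub>?G\<^esub> y)) = \<pi> (fst x) \<otimes>\<^bsub>G\<^esub> \<pi> (fst y)" using \<pi>.hom_mult xy by (simp add: DirProd_def split_beta)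
  qed
  interpret p1: group_hom ?G G "\<lambda>p. \<pi> (fst p)" by (rule group_homI[OF gG G p1])
  have p1S: "(\<lambda>p. \<pi> (fst p)) ` S = g ` Y" by (simp add: S_def g_def image_image)
  have p1surj: "(\<lambda>p. \<pi> (fst p)) ` carrier ?G = carrier G"
    using p1.generate_img[OF S'] unfolding p1S gen S\<Gamma> by simp
  have sndh: "snd \<in> hom ?G ?F" using snd_hom[of ?Q ?F] \<Gamma>c by (auto simp: hom_def)
  have \<delta>e: "\<delta> (snd p) = e (\<pi> (fst p))" if "p \<in> \<Gamma>" for p
  proof (rule hom_eq_generate[OF gG D(1) _ _ S', of "\<lambda>p. \<delta> (snd p)" "\<lambda>p. e (\<pi> (fst p))"])
    show "(\<lambda>p. \<delta> (snd p)) \<in> hom ?G D" using Group.hom_compose[OF sndh D(2)] by (simp add: comp_def)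
    show "(\<lambda>p. e (\<pi> (fst p))) \<in> hom ?G D" using Group.hom_compose[OF p1 D(4)] by (simp add: comp_def)
    show "p \<in> generate ?G S" using that S\<Gamma> by simp
    show "\<delta> (snd x) = e (\<pi> (fst x))" if "x \<in> S" for x using that D(6) by (auto simp: S_def g_def)
  qed
  let ?N = "{u \<in> U Y. \<pi> u = \<one>\<^bsub>G\<^esub>}"
  let ?T = "\<lambda>y. \<exists>u. u \<in> carrier ?Q \<and> u \<in> ?N \<and> (u, y) \<in> \<Gamma>"
  \<comment> \<open>Conjugates are adjoined as a benign set before generating, so that the generated
    subgroup is normal.\<close>
  let ?V = "\<lambda>v. \<exists>a. a \<in> carrier ?F \<and> (\<exists>y. y \<in> carrier ?F \<and> ?T y \<and> v = a \<otimes>\<^bsub>?F\<^esub> y \<otimes>\<^bsub>?F\<^esub> inv\<^bsub>?F\<^esub> a)"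
  have b\<Gamma>: "benign ?QF \<Gamma>"
  proof -
    have "bf Zg ?QF (\<lambda>i. (tc Zg i, theta i))" by (intro bf_pair bth bf_tc bf_id fpt_int)
    from benign_generate[OF fQF bs_bex[OF this Y]]
    have "benign ?QF (generate ?QF {x \<in> carrier ?QF. \<exists>i. i \<in> carrier Zg \<and> i \<in> Y \<and> x = (tc Zg i, theta i)})" .
    moreover have "{x \<in> carrier ?QF. \<exists>i. i \<in> carrier Zg \<and> i \<in> Y \<and> x = (tc Zg i, theta i)} = S"
      using S by (auto simp: S_def)
    ultimately show ?thesis by (simp only: \<Gamma>_def)
  qed
  have bT: "bs ?F ?T"
    by (rule bs_ex[where M = ?Q] bs_and bs_subst[OF bs_sub[OF fQ N]] bs_subst[OF bs_sub[OF fQF b\<Gamma>]] bf_pair bf_fst bf_snd bf_id fpt_intros)+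
  have "bs ?F ?V"
    by (rule bs_ex[where M = ?F] bs_and bs_subst[OF bT] bs_eq[where M = ?F] bf_mult bf_inv bf_fst bf_snd bf_id fpt_intros)+
  note bV = benign_generate[OF fF this]
  let ?VV = "{v \<in> carrier ?F. ?V v}"
  define NC where "NC = generate ?F ?VV"
  have VV: "?VV \<subseteq> carrier ?F" by blast
  have V1: "v \<in> carrier ?F \<and> \<delta> v = \<one>\<^bsub>D\<^esub>" if "v \<in> ?VV" for v
  proof -
    from that obtain a y u where a: "a \<in> carrier ?F" "y \<in> carrier ?F" "u \<in> ?N" "(u, y) \<in> \<Gamma>" "v = a \<otimes>\<^bsub>?F\<^esub> y \<otimes>\<^bsub>?F\<^esub> inv\<^bsub>?F\<^esub> a"
      by blast
    have "\<delta> y = \<one>\<^bsub>D\<^esub>" using \<delta>e[OF a(4)] a(3) by simp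
    then show ?thesis using a(1,2) by (simp add: a(5))
  qed
  have norm: "NC \<lhd> ?F" unfolding NC_def
  proof (rule Q.Z.normal_generateI[OF VV])
    fix v b assume v: "v \<in> ?VV" and b: "b \<in> carrier ?F"
    from v obtain a y where a: "a \<in> carrier ?F" "y \<in> carrier ?F" "?T y" "v = a \<otimes>\<^bsub>?F\<^esub> y \<otimes>\<^bsub>?F\<^esub> inv\<^bsub>?F\<^esub> a"
      by blast
    have "b \<otimes>\<^bsub>?F\<^esub> v \<otimes>\<^bsub>?F\<^esub> inv\<^bsub>?F\<^esub> b = (b \<otimes>\<^bsub>?F\<^esub> a) \<otimes>\<^bsub>?F\<^esub> y \<otimes>\<^bsub>?F\<^esub> inv\<^bsub>?F\<^esub> (b \<otimes>\<^bsub>?F\<^esub> a)"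
      using a(1,2) b by (simp add: a(4) Q.Z.inv_mult_group Q.Z.m_assoc)
    moreover have "b \<otimes>\<^bsub>?F\<^esub> a \<in> carrier ?F" using a b by simp
    moreover have "b \<otimes>\<^bsub>?F\<^esub> v \<otimes>\<^bsub>?F\<^esub> inv\<^bsub>?F\<^esub> b \<in> carrier ?F" using b VV v by blast
    ultimately show "b \<otimes>\<^bsub>?F\<^esub> v \<otimes>\<^bsub>?F\<^esub> inv\<^bsub>?F\<^esub> b \<in> ?VV"
      by (intro CollectI conjI exI[of _ "b \<otimes>\<^bsub>?F\<^esub> a"] exI[of _ y] a(2,3))
  qed
  have sN: "subgroup NC ?F" by (rule normal_imp_subgroup[OF norm])
  interpret NC: normal NC ?F by (rule norm)
  let ?P = "?F Mod NC"
  have gP: "group ?P" by (rule NC.factorgroup_is_group)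
  have q: "(\<lambda>a. NC #>\<^bsub>?F\<^esub> a) \<in> hom ?F ?P" by (rule NC.r_coset_hom_Mod)
  have q1: "(NC #>\<^bsub>?F\<^esub> a = \<one>\<^bsub>?P\<^esub>) = (a \<in> NC)" if "a \<in> carrier ?F" for a
    using Q.Z.coset_join1[OF _ that sN] Q.Z.coset_join2[OF that sN] by (auto simp: FactGroup_def)
  have q\<Gamma>: "NC #>\<^bsub>?F\<^esub> snd p = \<one>\<^bsub>?P\<^esub>" if "p \<in> carrier ?G" "\<pi> (fst p) = \<one>\<^bsub>G\<^esub>" for p
  proof -
    have p: "p \<in> \<Gamma>" using that by simp
    have pc: "fst p \<in> carrier ?Q" "snd p \<in> carrier ?F" using subsetD[OF \<Gamma>c p] by (auto simp: DirProd_def)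
    have "?T (snd p)" using p pc fstU[OF p] that(2) by (intro exI[of _ "fst p"]) simp
    then have "?V (snd p)"
      by (rule_tac exI[of _ "\<one>\<^bsub>?F\<^esub>"], intro conjI Q.Z.one_closed, rule_tac exI[of _ "snd p"], intro conjI pc(2)) (use pc(2) in simp_all)
    then have "snd p \<in> NC" unfolding NC_def using pc(2) by (intro generate.incl CollectI conjI)
    then show ?thesis using q1[OF pc(2)] by simp
  qed
  have qh: "(\<lambda>p. NC #>\<^bsub>?F\<^esub> snd p) \<in> hom ?G ?P" using Group.hom_compose[OF sndh q] by (simp add: comp_def)
  \<comment> \<open>Modulo \<open>NC\<close> the replacement is well defined on \<open>G\<close>, so
    \<open>G\<close> maps to the quotient. The last clause of \<open>three_generators\<close> then
    factors the quotient map through \<open>D\<close>, which shows that the kernel of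
    \<open>\<delta>\<close> is contained in \<open>NC\<close>.\<close>
  from factor_hom[OF gG G gP p1 p1surj qh, OF q\<Gamma>] obtain j where j: "j \<in> hom G ?P" "\<forall>p\<in>carrier ?G. j (\<pi> (fst p)) = NC #>\<^bsub>?F\<^esub> snd p"
    by (rule bexE)
  have jq: "NC #>\<^bsub>?F\<^esub> theta i = j (g i)" if "i \<in> Y" for i
  proof -
    have "(tc Zg i, theta i) \<in> carrier ?G" using that by (auto simp: \<Gamma>_def S_def intro: generate.incl)
    from bspec[OF j(2) this] show ?thesis by (simp add: g_def)
  qed
  have "\<forall>i\<in>Y. NC #>\<^bsub>?F\<^esub> theta i = j (g i)" using jq by (rule ballI)
  from univ[THEN spec, THEN spec, THEN spec, THEN mp, OF gP, THEN mp, OF j(1), THEN mp, OF q, THEN mp, OF this]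
  obtain \<zeta> where \<zeta>: "\<zeta> \<in> hom D ?P" "\<forall>f\<in>carrier ?F. \<zeta> (\<delta> f) = NC #>\<^bsub>?F\<^esub> f" by (rule bexE)
  have "{f \<in> carrier ?F. \<delta> f = \<one>\<^bsub>D\<^esub>} = NC"
  proof (intro equalityI subsetI)
    fix f assume "f \<in> {f \<in> carrier ?F. \<delta> f = \<one>\<^bsub>D\<^esub>}"
    then have f: "f \<in> carrier ?F" "\<delta> f = \<one>\<^bsub>D\<^esub>" by simp_all
    then have "NC #>\<^bsub>?F\<^esub> f = \<one>\<^bsub>?P\<^esub>" using bspec[OF \<zeta>(2) f(1)] hom_one[OF \<zeta>(1) D(1) gP] by simp
    then show "f \<in> NC" using q1[OF f(1)] by simp
  next
    fix f assume "f \<in> NC"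
    moreover have "subgroup (kernel ?F D \<delta>) ?F" by (rule \<delta>.subgroup_kernel)
    moreover have "?VV \<subseteq> kernel ?F D \<delta>" using V1 by (simp add: kernel_def subset_iff)
    ultimately show "f \<in> {f \<in> carrier ?F. \<delta> f = \<one>\<^bsub>D\<^esub>}"
      using Q.Z.generate_subgroup_incl[of ?VV "kernel ?F D \<delta>"] unfolding NC_def kernel_def by blast
  qed
  then have "benign ?F {f \<in> carrier ?F. \<delta> f = \<one>\<^bsub>D\<^esub>}" using bV by (simp only: NC_def)
  from rope[OF fF D(1-3) this] obtain X R h where h: "fin_presentation X R" "\<forall>r\<in>R. \<exists>i j k. r = [(i, False), (j, False), (k, True)]"
    "h \<in> hom D (pres_group X R)" "inj_on h (carrier D)" "\<forall>n>0. torfree n D \<longrightarrow> torfree n (pres_group X R)"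
    by (elim exE conjE) (rule that)
  have "(\<lambda>x. h (e x)) \<in> hom G (pres_group X R)" using Group.hom_compose[OF D(4) h(3)] by (simp add: comp_def)
  moreover have "inj_on (\<lambda>x. h (e x)) (carrier G)"
    using comp_inj_on[OF D(5) inj_on_subset[OF h(4) image_subsetI[OF e.hom_closed]]] by (simp add: comp_def)
  ultimately show ?thesis using h(1,2,5) D(7)
    by (intro exI[of _ X] exI[of _ R] exI[of _ "\<lambda>x. h (e x)"] conjI allI impI) simp_all
qed

section \<open>The universal torsion-free group\<close>

lemma weval_hom:
  assumes "group W" "group P" "h \<in> hom W P" "f \<in> X \<rightarrow> carrier W" "w \<in> words_on X"
  shows "h (weval W f w) = weval P (\<lambda>x. h (f x)) w"
proof -
  interpret h: group_hom W P h by (rule group_homI[OF assms(1-3)])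
  show ?thesis using assms(5)
  proof (induct w)
    case (Cons l w)
    then have "f (fst l) \<in> carrier W" "weval W f w \<in> carrier W"
      using assms(4) weval_closed[OF assms(1,4)] by auto
    then show ?case using Cons by simp
  qed simp
qed

lemma weval_cong: "w \<in> words_on X \<Longrightarrow> (\<And>x. x \<in> X \<Longrightarrow> f x = f' x) \<Longrightarrow> weval M f w = weval M f' w"
  by (induct w) auto

lemma (in presentation) rel_cls: assumes "r \<in> R" shows "cls r = \<one>\<^bsub>P\<^esub>"
  using pres_eq.rel[of "[]" X "[]" r R] assms R_words cls_eq[of r "[]"] by (auto simp: one_P)

text \<open>The homomorphism to \<open>W Mod N\<close> exists because the relators lie in
  \<open>N\<close>. It is injective because \<open>\<kappa>\<close> leads from words in
  \<open>W\<close> back to their classes and kills \<open>N\<close>. This allows \<open>W\<close> to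
  have more generators than the presentation.\<close>

lemma (in presentation) embed_quotient:
  assumes N: "N \<lhd> W" and f: "f \<in> X \<rightarrow> carrier W" and r: "\<And>r. r \<in> R \<Longrightarrow> weval W f r \<in> N"
    and \<kappa>: "\<kappa> \<in> hom W P" "\<And>x. x \<in> X \<Longrightarrow> \<kappa> (f x) = cls [(x, False)]" "\<And>n. n \<in> N \<Longrightarrow> \<kappa> n = \<one>\<^bsub>P\<^esub>"
  shows "\<exists>h\<in>hom P (W Mod N). inj_on h (carrier P)"
proof -
  interpret N: normal N W by (rule N)
  have gW: "group W" by (rule N.is_group)
  have gQ: "group (W Mod N)" by (rule N.factorgroup_is_group)
  have sN: "subgroup N W" by (rule normal_imp_subgroup[OF N])
  let ?q = "\<lambda>a. N #>\<^bsub>W\<^esub> a"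
  have q: "?q \<in> hom W (W Mod N)" by (rule N.r_coset_hom_Mod)
  have q1: "(?q a = \<one>\<^bsub>W Mod N\<^esub>) = (a \<in> N)" if "a \<in> carrier W" for a
    using N.coset_join1[OF _ that sN] N.coset_join2[OF that sN] by (auto simp: FactGroup_def)
  have wc: "weval W f w \<in> carrier W" if "w \<in> words_on X" for w by (rule weval_closed[OF gW f that])
  have qf: "(\<lambda>x. ?q (f x)) \<in> X \<rightarrow> carrier (W Mod N)"
  proof (rule Pi_I)
    fix x assume "x \<in> X"
    then show "?q (f x) \<in> carrier (W Mod N)" by (intro hom_in_carrier[OF q]) (use f in blast)
  qed
  have qw: "?q (weval W f w) = weval (W Mod N) (\<lambda>x. ?q (f x)) w" if "w \<in> words_on X" for w
    by (rule weval_hom[OF gW gQ q f that])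
  have "weval (W Mod N) (\<lambda>x. ?q (f x)) s = \<one>\<^bsub>W Mod N\<^esub>" if "s \<in> R" for s
  proof -
    have "s \<in> words_on X" using that R_words by blast
    then show ?thesis using qw q1[OF wc] r[OF that] by metis
  qed
  from P_universal[OF gQ qf, OF this] obtain h where h: "h \<in> hom P (W Mod N)"
    "\<forall>w\<in>words_on X. h (cls w) = weval (W Mod N) (\<lambda>x. ?q (f x)) w" by (rule bexE)
  interpret h: group_hom P "W Mod N" h by (rule group_homI[OF group_P gQ h(1)])
  have "a = \<one>\<^bsub>P\<^esub>" if "a \<in> carrier P" "h a = \<one>\<^bsub>W Mod N\<^esub>" for a
  proof -
    note a = that
    obtain w where w: "w \<in> words_on X" "a = cls w" using a(1) unfolding carrier_P by blast
    have "?q (weval W f w) = \<one>\<^bsub>W Mod N\<^esub>" using bspec[OF h(2) w(1)] a(2) qw[OF w(1)] w(2) by simp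
    then have "weval W f w \<in> N" using q1[OF wc[OF w(1)]] by simp
    then have "\<kappa> (weval W f w) = \<one>\<^bsub>P\<^esub>" by (rule \<kappa>(3))
    moreover have "\<kappa> (weval W f w) = weval P (\<lambda>x. \<kappa> (f x)) w" by (rule weval_hom[OF gW group_P \<kappa>(1) f w(1)])
    moreover have "weval P (\<lambda>x. \<kappa> (f x)) w = weval P (\<lambda>x. cls [(x, False)]) w" by (rule weval_cong[OF w(1) \<kappa>(2)])
    ultimately show ?thesis using weval_cls[OF w(1)] w(2) by simp
  qed
  then have "inj_on h (carrier P)" unfolding h.inj_on_one_iff by blast
  then show ?thesis using h(1) by blast
qed

lemma ncl_normal:
  assumes "group M" "subgroup U M" "B \<subseteq> U"
  shows "ncl M U B A \<lhd> (M\<lparr>carrier := U\<rparr>)"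
proof -
  interpret M: group M by fact
  let ?U = "M\<lparr>carrier := U\<rparr>"
  have gU: "group ?U" by (rule M.subgroup_imp_group[OF assms(2)])
  note NU = ncl_sub[OF assms]
  have iv: "inv\<^bsub>?U\<^esub> x = inv\<^bsub>M\<^esub> x" if "x \<in> U" for x using M.m_inv_consistent[OF assms(2) that] .
  have s: "subgroup (ncl M U B A) ?U"
  proof (rule group.subgroupI[OF gU])
    show "ncl M U B A \<subseteq> carrier ?U" using NU by simp
    show "ncl M U B A \<noteq> {}" using ncl.one by blast
    show "inv\<^bsub>?U\<^esub> a \<in> ncl M U B A" if "a \<in> ncl M U B A" for a
      using ncl.inv[OF that] iv[OF subsetD[OF NU that]] by simp
    show "a \<otimes>\<^bsub>?U\<^esub> b \<in> ncl M U B A" if "a \<in> ncl M U B A" "b \<in> ncl M U B A" for a b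
      using ncl.mult[OF that] by simp
  qed
  show ?thesis
    by (rule group.normal_invI[OF gU s]) (simp add: iv ncl.conj)
qed

text \<open>A root step is harmless: if the power of \<open>x\<close> goes to the identity, then so
  does \<open>x\<close>, as the target is \<open>A\<close>-torsion-free. Groups with this property
  are thus not damaged by the closure.\<close>

lemma ncl_kernel:
  assumes "group M" "subgroup U M" "B \<subseteq> U" "group P" and \<kappa>: "\<kappa> \<in> hom (M\<lparr>carrier := U\<rparr>) P"
    and "\<And>b. b \<in> B \<Longrightarrow> \<kappa> b = \<one>\<^bsub>P\<^esub>" and "torsion_free_wrt A P" and "x \<in> ncl M U B A"
  shows "\<kappa> x = \<one>\<^bsub>P\<^esub>"
proof -
  interpret M: group M by fact
  let ?U = "M\<lparr>carrier := U\<rparr>"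
  have gU: "group ?U" by (rule M.subgroup_imp_group[OF assms(2)])
  interpret \<kappa>: group_hom ?U P \<kappa> by (rule group_homI[OF gU assms(4) \<kappa>])
  note NU = subsetD[OF ncl_sub[OF assms(1-3)]]
  have iv: "\<kappa> (inv\<^bsub>M\<^esub> x) = inv\<^bsub>P\<^esub> (\<kappa> x)" if "x \<in> U" for x
    using M.m_inv_consistent[OF assms(2) that] \<kappa>.hom_inv[of x] that by simp
  have mu: "\<kappa> (x \<otimes>\<^bsub>M\<^esub> y) = \<kappa> x \<otimes>\<^bsub>P\<^esub> \<kappa> y" if "x \<in> U" "y \<in> U" for x y using \<kappa>.hom_mult[of x y] that by simp
  have cl: "\<kappa> x \<in> carrier P" if "x \<in> U" for x using \<kappa>.hom_closed[of x] that by simp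
  show ?thesis using assms(8)
  proof induct
    case one
    have "\<kappa> \<one>\<^bsub>?U\<^esub> = \<one>\<^bsub>P\<^esub>" by (rule \<kappa>.hom_one)
    then show ?case by simp
  next
    case (base x) then show ?case by (rule assms(6))
  next
    case (mult x y) then show ?case using mu[OF NU NU] by simp
  next
    case (inv x) then show ?case using iv[OF NU] by simp
  next
    case (conj x u)
    note xU = NU[OF conj(1)]
    have "u \<otimes>\<^bsub>M\<^esub> x \<in> U" "inv\<^bsub>M\<^esub> u \<in> U"
      using subgroup.m_closed[OF assms(2) conj(3) xU] subgroup.m_inv_closed[OF assms(2) conj(3)] by simp_all
    then show ?case using conj(2) cl[OF conj(3)] by (simp add: mu conj(3) xU iv)
  next
    case (root x n)
    have "\<kappa> (x [^]\<^bsub>?U\<^esub> n) = \<kappa> x [^]\<^bsub>P\<^esub> n" using \<kappa>.hom_int_pow[of x n] root(3) by simp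
    then have "\<kappa> x [^]\<^bsub>P\<^esub> n = \<one>\<^bsub>P\<^esub>" using M.int_pow_consistent[OF assms(2) root(3), of n] root(2) by simp
    then show ?case using assms(7) cl[OF root(3)] root(4) unfolding torsion_free_wrt_def by blast
  qed
qed

text \<open>A negative exponent inverts the power, so only the absolute value matters.\<close>

lemma torsion_free_iff_torfree:
  assumes "group G" shows "torsion_free_wrt A G \<longleftrightarrow> (\<forall>n\<in>A. torfree (nat \<bar>n\<bar>) G)"
proof -
  interpret group G by fact
  have "g [^]\<^bsub>G\<^esub> n = \<one>\<^bsub>G\<^esub> \<longleftrightarrow> g [^]\<^bsub>G\<^esub> nat \<bar>n\<bar> = \<one>\<^bsub>G\<^esub>" if "g \<in> carrier G" for g and n :: int
  proof (cases "0 \<le> n")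
    case True then show ?thesis using int_pow_int[of G g "nat n"] by simp
  next
    case False
    then have "nat \<bar>n\<bar> = nat (- n)" "n < 0" by simp_all
    then have "g [^]\<^bsub>G\<^esub> n = inv\<^bsub>G\<^esub> (g [^]\<^bsub>G\<^esub> (nat \<bar>n\<bar>))" by (simp only: int_pow_def2 if_True)
    then show ?thesis using that by (simp only: inv_eq_1_iff nat_pow_closed)
  qed
  then show ?thesis unfolding torsion_free_wrt_def torfree_def by blast
qed

text \<open>Indices are nonnegative because words are evaluated over generators numbered by natural
  numbers. The closure is benign by \<open>bs_ncl\<close>, its quotient is
  \<open>A\<close>-torsion-free by the root rule, and the exponents in \<open>A\<close> have
  positive absolute value, as \<open>higman_embed\<close> demands for the transfer of
  torsion-freeness.\<close>

lemma quotient_embed: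
  fixes V :: "int set"
  defines "U \<equiv> generate (fz Zg) (tc Zg ` V)"
  assumes V: "bs Zg (\<lambda>i. i \<in> V)" "V \<subseteq> {0..}" and B: "bs (fz Zg) (\<lambda>x. x \<in> B)" "B \<subseteq> U"
    and A: "re_int A" "0 \<notin> A"
  shows "\<exists>X R h. fin_presentation X R \<and> (\<forall>r\<in>R. \<exists>i j k. r = [(i, False), (j, False), (k, True)]) \<and>
     h \<in> hom (fz Zg\<lparr>carrier := U\<rparr> Mod ncl (fz Zg) U B A) (pres_group X R) \<and>
     inj_on h (carrier (fz Zg\<lparr>carrier := U\<rparr> Mod ncl (fz Zg) U B A)) \<and> torsion_free_wrt A (pres_group X R)"
proof -
  interpret I: fzgroup Zg by (rule fzgroupI[OF group_integer_group])
  let ?Q = "fz Zg"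
  have fQ: "fpt ?Q" by (intro fpt_intros)
  have gQ: "group ?Q" by (rule I.group_fz)
  let ?U = "?Q\<lparr>carrier := U\<rparr>" and ?N = "ncl ?Q U B A"
  have tcV: "tc Zg ` V \<subseteq> carrier ?Q" using I.tc_closed by auto
  have U: "subgroup U ?Q" unfolding U_def by (rule I.Z.generate_is_subgroup[OF tcV])
  have Uc: "U \<subseteq> carrier ?Q" by (rule subgroup.subset[OF U])
  have bU: "bs ?Q (\<lambda>x. x \<in> U)"
  proof -
    have "bs ?Q (\<lambda>x. x \<in> generate ?Q {x \<in> carrier ?Q. \<exists>i. i \<in> carrier Zg \<and> i \<in> V \<and> x = tc Zg i})"
      by (rule bs_sub[OF fQ benign_generate[OF fQ bs_bex[OF bf_tc[OF bf_id[OF fpt_int]] V(1)]]])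
    moreover have "{x \<in> carrier ?Q. \<exists>i. i \<in> carrier Zg \<and> i \<in> V \<and> x = tc Zg i} = tc Zg ` V" using tcV by auto
    ultimately show ?thesis by (simp only: U_def)
  qed
  have nf: "bf Zg ?Q (\<lambda>z. tc Zg (int (nat z)))" by (intro bf_tc nf_nat[unfolded nf_def] bf_id fpt_int)
  have UV: "U \<subseteq> generate ?Q (range (\<lambda>n. tc Zg (int n)))"
  proof -
    have "tc Zg ` V \<subseteq> range (\<lambda>n. tc Zg (int n))"
    proof (rule image_subsetI)
      fix v assume "v \<in> V"
      then have "tc Zg v = tc Zg (int (nat v))" using V(2) by auto
      then show "tc Zg v \<in> range (\<lambda>n. tc Zg (int n))" by (rule range_eqI)
    qed
    then show ?thesis unfolding U_def by (rule I.Z.mono_generate)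
  qed
  have bN: "bs ?Q (\<lambda>x. x \<in> ?N)" by (rule bs_ncl[OF fQ nf U UV bU B(2,1) bs_re_int[OF A(1)]])
  have NU: "?N \<subseteq> U" by (rule ncl_sub[OF gQ U B(2)])
  have norm: "?N \<lhd> ?U" by (rule ncl_normal[OF gQ U B(2)])
  interpret N: normal ?N ?U by (rule norm)
  let ?G = "?U Mod ?N" and ?q = "\<lambda>a. ?N #>\<^bsub>?U\<^esub> a"
  have gG: "group ?G" by (rule N.factorgroup_is_group)
  have q: "?q \<in> hom ?U ?G" by (rule N.r_coset_hom_Mod)
  interpret q: group_hom ?U ?G ?q by (rule group_homI[OF N.is_group gG q])
  have sN: "subgroup ?N ?U" by (rule normal_imp_subgroup[OF norm])
  have q1: "(?q a = \<one>\<^bsub>?G\<^esub>) = (a \<in> ?N)" if "a \<in> U" for a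
    using N.coset_join1[of ?N a] N.coset_join2[of a ?N] sN that by (auto simp: FactGroup_def)
  have qs: "?q ` U = carrier ?G" by (auto simp: FactGroup_def RCOSETS_def)
  have bnN: "benign ?Q {u \<in> U. ?q u = \<one>\<^bsub>?G\<^esub>}"
  proof -
    have "subgroup ?N ?Q" using I.Z.incl_subgroup[OF U sN] .
    then have "generate ?Q ?N = ?N" by (rule I.Z.generateI[symmetric]) simp_all
    moreover have "{x \<in> carrier ?Q. x \<in> ?N} = ?N" using NU Uc by blast
    moreover have "{u \<in> U. ?q u = \<one>\<^bsub>?G\<^esub>} = ?N" using q1 NU by blast
    ultimately show ?thesis using benign_generate[OF fQ bN] by (simp only:)
  qed
  have tG: "torsion_free_wrt A ?G" unfolding torsion_free_wrt_def
  proof (intro ballI impI)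
    fix x n assume x: "x \<in> carrier ?G" and n: "n \<in> A" and e: "x [^]\<^bsub>?G\<^esub> n = \<one>\<^bsub>?G\<^esub>"
    obtain u where u: "u \<in> U" "x = ?q u" using x unfolding qs[symmetric] by (rule imageE)
    have p: "u [^]\<^bsub>?Q\<^esub> n = u [^]\<^bsub>?U\<^esub> n" by (rule I.Z.int_pow_consistent[OF U u(1)])
    have pU: "u [^]\<^bsub>?U\<^esub> n \<in> U" using N.int_pow_closed[of u n] u(1) by simp
    have "?q (u [^]\<^bsub>?U\<^esub> n) = x [^]\<^bsub>?G\<^esub> n" using q.hom_int_pow[of u n] u by simp
    then have "u [^]\<^bsub>?Q\<^esub> n \<in> ?N" using e q1[OF pU] p by simp
    then have "u \<in> ?N" using u(1) n by (rule ncl.root)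
    then show "x = \<one>\<^bsub>?G\<^esub>" using q1[OF u(1)] u(2) by simp
  qed
  from higman_embed[of ?G V ?q, folded U_def, OF gG V(1) q qs bnN] obtain X R h where
    h: "fin_presentation X R" "\<forall>r\<in>R. \<exists>i j k. r = [(i, False), (j, False), (k, True)]" "h \<in> hom ?G (pres_group X R)"
      "inj_on h (carrier ?G)" "\<forall>n>0. torfree n ?G \<longrightarrow> torfree n (pres_group X R)" by (elim exE conjE) (rule that)
  interpret pr: presentation X R using h(1) by unfold_locales (simp add: fin_presentation_def)
  have "torsion_free_wrt A (pres_group X R)"
    unfolding torsion_free_iff_torfree[OF pr.group_P]
  proof
    fix n assume n: "n \<in> A"
    then have "nat \<bar>n\<bar> > 0" using A(2) by (cases "n = 0") auto
    then show "torfree (nat \<bar>n\<bar>) (pres_group X R)" using h(5) tG[unfolded torsion_free_iff_torfree[OF gG]] n by blast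
  qed
  then show ?thesis using h(1-4) by blast
qed

theorem theorem2p11:
  fixes A :: "int set"
  assumes "re_int A"
  shows "\<exists>X R. fin_presentation X R \<and>
           group (pres_group X R) \<and>
           torsion_free_wrt A (pres_group X R) \<and>
           (\<forall>Y S. rec_presentation Y S \<and> torsion_free_wrt A (pres_group Y S) \<longrightarrow>
              (\<exists>h. h \<in> hom (pres_group Y S) (pres_group X R) \<and>
                   inj_on h (carrier (pres_group Y S))))"
proof (cases "0 \<in> A")
  case True
  interpret pr: presentation "{}" "{}" by unfold_locales simp
  have c: "carrier (pres_group {} {}) = {\<one>\<^bsub>pres_group {} {}\<^esub>}"
  proof -
    have "w = []" if "w \<in> words_on {}" for w using that by (cases w) simp_all
    then have "words_on {} = {[]}" by auto
    then show ?thesis by (simp add: pr.carrier_P pr.one_P)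
  qed
  have triv: "\<exists>h. h \<in> hom (pres_group Y S) (pres_group {} {}) \<and> inj_on h (carrier (pres_group Y S))"
    if "torsion_free_wrt A (pres_group Y S)" for Y S
  proof -
    \<comment> \<open>The zeroth power of every element is the identity.\<close>
    have one: "g = \<one>\<^bsub>pres_group Y S\<^esub>" if g: "g \<in> carrier (pres_group Y S)" for g
    proof -
      have "g [^]\<^bsub>pres_group Y S\<^esub> (0 :: int) = \<one>\<^bsub>pres_group Y S\<^esub>" by (simp add: int_pow_def2)
      then show ?thesis using \<open>torsion_free_wrt A (pres_group Y S)\<close> g True unfolding torsion_free_wrt_def by blast
    qed
    have "inj_on (\<lambda>_. \<one>\<^bsub>pres_group {} {}\<^esub>) (carrier (pres_group Y S))"
    proof (rule inj_onI)
      fix x y assume "x \<in> carrier (pres_group Y S)" "y \<in> carrier (pres_group Y S)"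
      from one[OF this(1)] one[OF this(2)] show "x = y" by (rule HOL.trans[OF _ HOL.sym])
    qed
    moreover have "(\<lambda>_. \<one>\<^bsub>pres_group {} {}\<^esub>) \<in> hom (pres_group Y S) (pres_group {} {})" by (simp add: hom_def)
    ultimately show ?thesis by (intro exI[of _ "\<lambda>_. \<one>\<^bsub>pres_group {} {}\<^esub>"] conjI)
  qed
  have "torsion_free_wrt A (pres_group {} {})" using c by (simp add: torsion_free_wrt_def)
  then show ?thesis using triv pr.group_P
    by (intro exI[of _ "{}"] exI[of _ "{}"]) (simp add: fin_presentation_def)
next
  case False
  interpret I: fzgroup Zg by (rule fzgroupI[OF group_integer_group])
  let ?Q = "fz Zg"
  have fQ: "fpt ?Q" by (intro fpt_intros)
  have gQ: "group ?Q" by (rule I.group_fz)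
  have nat_tc: "bf Zg ?Q (\<lambda>z. tc Zg (int (nat z)))" by (intro bf_tc nf_nat[unfolded nf_def] bf_id fpt_int)
  have U: "subgroup (generate ?Q (tc Zg ` V)) ?Q" for V
    by (rule I.Z.generate_is_subgroup) (rule image_subsetI, simp)
  have gU: "group (?Q\<lparr>carrier := generate ?Q (tc Zg ` V)\<rparr>)" for V by (rule I.Z.subgroup_imp_group[OF U])
  have tU: "tc Zg i \<in> generate ?Q (tc Zg ` V)" if "i \<in> V" for i V using that by (auto intro: generate.incl)
  have map_ex: "\<exists>\<kappa>\<in>hom (?Q\<lparr>carrier := generate ?Q (tc Zg ` V)\<rparr>) P. \<forall>i\<in>V. \<kappa> (tc Zg i) = a i"
    if P: "group P" and a: "\<And>i. a i \<in> carrier P" for V and P :: "word set monoid" and a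
  proof -
    obtain \<rho> where r: "\<rho> \<in> hom (?Q\<lparr>carrier := fall Zg\<rparr>) P" "\<forall>g\<in>carrier Zg. \<rho> (tc Zg g) = a g"
      using I.fz_basis[OF P, of a] a by blast
    have f: "x \<in> fall Zg" if "x \<in> generate ?Q (tc Zg ` V)" for x by (rule subsetD[OF I.fall_mono that]) simp
    have "\<rho> \<in> hom (?Q\<lparr>carrier := generate ?Q (tc Zg ` V)\<rparr>) P"
      by (rule homI) (use hom_in_carrier[OF r(1)] hom_mult[OF r(1)] f in simp_all)
    then show ?thesis using r(2) by (intro bexI[of _ \<rho>]) simp_all
  qed
  \<comment> \<open>Recursive presentations are exchanged for finite ones, which are coded by single
    numbers.\<close>
  have fin: "\<exists>X R h. fin_presentation X R \<and> (\<forall>r\<in>R. \<exists>i j k. r = [(i, False), (j, False), (k, True)]) \<and>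
      h \<in> hom (pres_group Y S) (pres_group X R) \<and> inj_on h (carrier (pres_group Y S)) \<and> torsion_free_wrt A (pres_group X R)"
    if YS: "rec_presentation Y S" and tf: "torsion_free_wrt A (pres_group Y S)" for Y S
  proof -
    have re: "re_nat Y" "S \<subseteq> words_on Y" "re_words S" using YS by (simp_all add: rec_presentation_def)
    interpret pr: presentation Y S using re(2) by unfold_locales
    let ?V = "int ` Y" and ?f = "\<lambda>n. tc Zg (int n)"
    let ?U = "generate ?Q (tc Zg ` ?V)"
    let ?QU = "?Q\<lparr>carrier := ?U\<rparr>"
    let ?B = "weval ?Q ?f ` S"
    have "bs Zg (\<lambda>z. 0 \<le> z \<and> nat z \<in> Y)"
      by (rule bs_and[OF fpt_int bs_nonneg rn_re_nat[OF re(1), unfolded rn_def]])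
    then have V: "bs Zg (\<lambda>z. z \<in> ?V)" by (rule bs_cong[rotated]) (auto intro: image_eqI[of _ _ "nat _"])
    have fU: "?f \<in> Y \<rightarrow> carrier ?QU" using tU[of _ ?V] by auto
    have inclh: "(\<lambda>x. x) \<in> hom ?QU ?Q" using subgroup.subset[OF U[of ?V]] by (auto simp: hom_def)
    have we: "weval ?Q ?f w = weval ?QU ?f w" if "w \<in> words_on Y" for w
      using weval_hom[OF gU gQ inclh fU that] by simp
    have wU: "weval ?Q ?f w \<in> ?U" if "w \<in> words_on Y" for w
      using weval_closed[OF gU fU that] we[OF that] by simp
    have B: "?B \<subseteq> ?U" using wU re(2) by blast
    have "bs ?Q (\<lambda>x. \<exists>c. c \<in> word_code ` S \<and> (\<exists>w. c = word_code w \<and> x = weval ?Q ?f w))"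
      by (rule bs_exn bs_and bs_rn[OF rn_re_nat[OF re(3)[unfolded re_words_def]]] bs_weval[OF fQ nat_tc] nf_intros fpt_intros)+
    then have bB: "bs ?Q (\<lambda>x. x \<in> ?B)"
      by (rule bs_cong[rotated]) (auto dest: injD[OF inj_word_code])
    \<comment> \<open>\<open>map_ex\<close> expects a value in the group for every integer, hence
      the default.\<close>
    define a where "a i = (if nat i \<in> Y then pr.cls [(nat i, False)] else \<one>\<^bsub>pres_group Y S\<^esub>)" for i
    have ac: "a i \<in> carrier (pres_group Y S)" for i by (simp add: a_def) (simp add: pr.carrier_P)
    from map_ex[OF pr.group_P, of a ?V, OF ac] obtain \<kappa> where \<kappa>: "\<kappa> \<in> hom ?QU (pres_group Y S)"
      "\<forall>i\<in>?V. \<kappa> (tc Zg i) = a i" by (rule bexE)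
    have \<kappa>f: "\<kappa> (?f y) = pr.cls [(y, False)]" if "y \<in> Y" for y using \<kappa>(2) that by (simp add: a_def)
    have \<kappa>w: "\<kappa> (weval ?Q ?f w) = pr.cls w" if "w \<in> words_on Y" for w
    proof -
      have "\<kappa> (weval ?Q ?f w) = weval (pres_group Y S) (\<lambda>x. \<kappa> (?f x)) w"
        using weval_hom[OF gU pr.group_P \<kappa>(1) fU that] we[OF that] by (simp only:)
      also have "\<dots> = weval (pres_group Y S) (\<lambda>x. pr.cls [(x, False)]) w" by (rule weval_cong[OF that \<kappa>f])
      finally show ?thesis by (simp only: pr.weval_cls[OF that])
    qed
    have \<kappa>B: "\<kappa> b = \<one>\<^bsub>pres_group Y S\<^esub>" if "b \<in> ?B" for b
      using that \<kappa>w re(2) pr.rel_cls by auto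
    have "\<exists>h\<in>hom (pres_group Y S) (?QU Mod ncl ?Q ?U ?B A). inj_on h (carrier (pres_group Y S))"
    proof (rule pr.embed_quotient[OF ncl_normal[OF gQ U B] fU _ \<kappa>(1) \<kappa>f])
      show "weval ?QU ?f r \<in> ncl ?Q ?U ?B A" if "r \<in> S" for r
        by (rule ncl.base) (use that we[OF subsetD[OF re(2) that]] in \<open>simp add: image_eqI[where x = r]\<close>)
      show "\<kappa> n = \<one>\<^bsub>pres_group Y S\<^esub>" if "n \<in> ncl ?Q ?U ?B A" for n
        by (rule ncl_kernel[OF gQ U B pr.group_P \<kappa>(1) \<kappa>B tf that])
    qed
    then obtain h where h: "h \<in> hom (pres_group Y S) (?QU Mod ncl ?Q ?U ?B A)" "inj_on h (carrier (pres_group Y S))" by blast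
    have V0: "?V \<subseteq> {0..}" by auto
    from quotient_embed[OF V V0 bB B assms False] obtain X R k where k: "fin_presentation X R"
      "\<forall>r\<in>R. \<exists>i j k. r = [(i, False), (j, False), (k, True)]" "k \<in> hom (?QU Mod ncl ?Q ?U ?B A) (pres_group X R)"
      "inj_on k (carrier (?QU Mod ncl ?Q ?U ?B A))" "torsion_free_wrt A (pres_group X R)"
      by (elim exE conjE) (rule that)
    have "inj_on (\<lambda>x. k (h x)) (carrier (pres_group Y S))"
      using comp_inj_on[OF h(2) inj_on_subset[OF k(4) image_subsetI[OF hom_in_carrier[OF h(1)]]]] by (simp add: comp_def)
    moreover have "(\<lambda>x. k (h x)) \<in> hom (pres_group Y S) (pres_group X R)"
      using Group.hom_compose[OF h(1) k(3)] by (simp add: comp_def)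
    ultimately show ?thesis using k(1,2,5) by (intro exI[of _ X] exI[of _ R] exI[of _ "\<lambda>x. k (h x)"] conjI)
  qed
  \<comment> \<open>The element \<open>?f e n\<close> is the generator with number \<open>n\<close>
    of the presentation coded by \<open>e\<close>; pairing indexes all these blocks by natural
    numbers.\<close>
  let ?V = "{0..} :: int set" and ?f = "\<lambda>e n. tc Zg (int (prod_encode (e, n)))"
  let ?U = "generate ?Q (tc Zg ` ?V)"
  let ?QU = "?Q\<lparr>carrier := ?U\<rparr>"
  \<comment> \<open>Every number \<open>e\<close> counts as the code of a finite set of triples,
    whether or not the group so presented is \<open>A\<close>-torsion-free.\<close>
  let ?T = "\<lambda>x. \<exists>e i j k. prod_encode (i, prod_encode (j, k)) \<in> set_decode e \<and> x = ?f e i \<otimes>\<^bsub>?Q\<^esub> ?f e j \<otimes>\<^bsub>?Q\<^esub> inv\<^bsub>?Q\<^esub> (?f e k)"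
  let ?B = "{x. ?T x}"
  have V: "bs Zg (\<lambda>z. z \<in> ?V)" using bs_nonneg by simp
  have fU: "?f e n \<in> ?U" for e n by (rule tU) simp
  have B: "?B \<subseteq> ?U"
    using fU U[of ?V] by (auto intro!: subgroup.m_closed subgroup.m_inv_closed)
  have "bs ?Q ?T"
    by (rule bs_exn bs_and bs_rn2[OF rn2_set_decode] bs_eq[where M = ?Q] bf_mult bf_inv bf_tc nf_intros[unfolded nf_def] nf_intros fpt_intros)+
  then have bB: "bs ?Q (\<lambda>x. x \<in> ?B)" by simp
  let ?G = "?QU Mod ncl ?Q ?U ?B A"
  from quotient_embed[OF V subset_refl bB B assms False] obtain X R k where k: "fin_presentation X R"
    "k \<in> hom ?G (pres_group X R)" "inj_on k (carrier ?G)" "torsion_free_wrt A (pres_group X R)"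
    by (elim exE conjE) (rule that)
  interpret pX: presentation X R using k(1) by unfold_locales (simp add: fin_presentation_def)
  have "\<exists>h. h \<in> hom (pres_group Y S) (pres_group X R) \<and> inj_on h (carrier (pres_group Y S))"
    if YS: "rec_presentation Y S" "torsion_free_wrt A (pres_group Y S)" for Y S
  proof -
    from fin[OF YS] obtain X1 R1 h1 where X1: "fin_presentation X1 R1" "\<forall>r\<in>R1. \<exists>i j k. r = [(i, False), (j, False), (k, True)]"
      "h1 \<in> hom (pres_group Y S) (pres_group X1 R1)" "inj_on h1 (carrier (pres_group Y S))" "torsion_free_wrt A (pres_group X1 R1)"
      by (elim exE conjE) (rule that)
    interpret pr: presentation X1 R1 using X1(1) by unfold_locales (simp add: fin_presentation_def)
    let ?P = "pres_group X1 R1"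
    define c where "c r = prod_encode (fst (r ! 0), prod_encode (fst (r ! 1), fst (r ! 2)))" for r :: word
    define e where "e = set_encode (c ` R1)"
    have e: "set_decode e = c ` R1" using X1(1) by (simp add: e_def fin_presentation_def)
    have R1: "[(i, False), (j, False), (k, True)] \<in> R1" if "prod_encode (i, prod_encode (j, k)) \<in> set_decode e" for i j k
      using that X1(2) unfolding e by (auto simp: c_def dest!: bspec)
    \<comment> \<open>The homomorphism back to \<open>?P\<close> follows the presentation on the
      block of \<open>e\<close>, and is trivial on all other blocks and on indices outside
      \<open>X1\<close>; in this way the relators of every block are respected.\<close>
    define a where "a z = (if fst (prod_decode (nat z)) = e \<and> snd (prod_decode (nat z)) \<in> X1
       then pr.cls [(snd (prod_decode (nat z)), False)] else \<one>\<^bsub>?P\<^esub>)" for z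
    have ac: "a z \<in> carrier ?P" for z by (simp add: a_def) (simp add: pr.carrier_P)
    from map_ex[OF pr.group_P, of a ?V, OF ac] obtain \<kappa> where \<kappa>: "\<kappa> \<in> hom ?QU ?P" "\<forall>i\<in>?V. \<kappa> (tc Zg i) = a i" by (rule bexE)
    interpret \<kappa>: group_hom ?QU ?P \<kappa> by (rule group_homI[OF gU pr.group_P \<kappa>(1)])
    have \<kappa>f: "\<kappa> (?f d n) = (if d = e \<and> n \<in> X1 then pr.cls [(n, False)] else \<one>\<^bsub>?P\<^esub>)" for d n
      using \<kappa>(2) by (simp add: a_def)
    have fe: "?f e \<in> X1 \<rightarrow> carrier ?QU" using fU by simp
    have triple: "weval ?QU (?f d) [(i, False), (j, False), (k, True)] = ?f d i \<otimes>\<^bsub>?Q\<^esub> ?f d j \<otimes>\<^bsub>?Q\<^esub> inv\<^bsub>?Q\<^esub> (?f d k)" for d i j k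
      using I.Z.m_inv_consistent[OF U fU[of d k]] by (simp add: I.Z.m_assoc)
    have \<kappa>B: "\<kappa> b = \<one>\<^bsub>?P\<^esub>" if "b \<in> ?B" for b
    proof -
      from that obtain d i j k where b: "prod_encode (i, prod_encode (j, k)) \<in> set_decode d"
        "b = ?f d i \<otimes>\<^bsub>?Q\<^esub> ?f d j \<otimes>\<^bsub>?Q\<^esub> inv\<^bsub>?Q\<^esub> (?f d k)" by blast
      let ?r = "[(i, False), (j, False), (k, True)]"
      have fd: "?f d \<in> UNIV \<rightarrow> carrier ?QU" using fU by simp
      have "\<kappa> b = weval ?P (\<lambda>x. \<kappa> (?f d x)) ?r"
        unfolding b(2) triple[symmetric] by (rule weval_hom[OF gU pr.group_P \<kappa>(1) fd]) (simp add: words_on_def)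
      also have "\<dots> = \<one>\<^bsub>?P\<^esub>"
      proof (cases "d = e")
        case True
        then have r: "?r \<in> R1" using R1 b(1) by simp
        then have w: "?r \<in> words_on X1" using pr.R_words by blast
        have "weval ?P (\<lambda>x. \<kappa> (?f d x)) ?r = weval ?P (\<lambda>x. pr.cls [(x, False)]) ?r"
          by (rule weval_cong[OF w]) (simp add: \<kappa>f True)
        then show ?thesis using pr.weval_cls[OF w] pr.rel_cls[OF r] by simp
      qed (simp add: \<kappa>f)
      finally show ?thesis .
    qed
    have "\<exists>h\<in>hom ?P ?G. inj_on h (carrier ?P)"
    proof (rule pr.embed_quotient[OF ncl_normal[OF gQ U B] fe _ \<kappa>(1)])
      show "\<kappa> (?f e x) = pr.cls [(x, False)]" if "x \<in> X1" for x using that by (simp add: \<kappa>f)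
      show "\<kappa> n = \<one>\<^bsub>?P\<^esub>" if "n \<in> ncl ?Q ?U ?B A" for n
        by (rule ncl_kernel[OF gQ U B pr.group_P \<kappa>(1) \<kappa>B X1(5) that])
      fix r assume r: "r \<in> R1"
      then obtain i j k where ijk: "r = [(i, False), (j, False), (k, True)]" using X1(2) by blast
      have "c r \<in> set_decode e" using r by (simp add: e)
      then have "prod_encode (i, prod_encode (j, k)) \<in> set_decode e" by (simp add: c_def ijk)
      then have "weval ?QU (?f e) r \<in> ?B" unfolding ijk triple by blast
      then show "weval ?QU (?f e) r \<in> ncl ?Q ?U ?B A" by (rule ncl.base)
    qed
    then obtain h2 where h2: "h2 \<in> hom ?P ?G" "inj_on h2 (carrier ?P)" by blast
    note h12 = Group.hom_compose[OF X1(3) h2(1)]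
    have i12: "inj_on (h2 \<circ> h1) (carrier (pres_group Y S))"
      by (rule comp_inj_on[OF X1(4) inj_on_subset[OF h2(2) image_subsetI[OF hom_in_carrier[OF X1(3)]]]])
    have "inj_on (k \<circ> (h2 \<circ> h1)) (carrier (pres_group Y S))"
      by (rule comp_inj_on[OF i12 inj_on_subset[OF k(3) image_subsetI[OF hom_in_carrier[OF h12]]]])
    then show ?thesis using Group.hom_compose[OF h12 k(2)] by blast
  qed
  then show ?thesis using k(1,4) pX.group_P by blast
qed

end
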